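(* Let $K$ be a commutative semiring, let $pw\mathcal B$ be a set of parametric weighted components over $K$ with component types having port sets $P(1),\dots,P(n)$, and let $r:[n]\to\mathbb N$. Then for every wFOEIL sentence $\tilde\psi$ over $pw\mathcal B$ and $K$ one can effectively construct a weighted finite automaton $\mathcal A_{\tilde\psi,r}$ over the alphabet $I_r$ and $K$ such that $\|\tilde\psi\|(r,w)=\|\mathcal A_{\tilde\psi,r}\|(w)$ for every $w\in I_r^+$. The worst case running time of the translation algorithm is doubly exponential and the best case is exponential.
   Context: Fix $n\ge 1$ and pairwise disjoint finite sets of ports $P(1),\dots,P(n)$; $pw\mathcal B$ consists of weighted component types with these port sets and weight mappings $wt(i):P(i)\to K$ (instances of type $i$ carry the same weights), which play no role in the semantics below beyond the constants of formulas. For $i\in[n]$, $j\ge1$ the $j$-th instance of type $i$ has port set $P(i,j)=\{p(j)\mid p\in P(i)\}$, all pairwise disjoint. For $r:[n]\to\mathbb{N}$ let $P_r=\bigcup_{i\in[n],j\in[r(i)]}P(i,j)$ and $I_r$ the set of nonempty $a\subseteq P_r$ with $|a\cap P(i,j)|\le1$ for all $i,j$. $A^+$: nonempty finite words. Shuffle: $u\sqcup\!\sqcup v$ is the set of words $u_1v_1\cdots u_mv_m$ with $u=u_1\cdots u_m$, $v=v_1\cdots v_m$ ($u_k,v_k$ possibly empty), extended associatively. $I(P)$: nonempty subsets of $P$. PIL over $P$: $\phi::=\mathrm{true}\mid p\mid\neg\phi\mid\phi\vee\phi$, $a\models p$ iff $p\in a$. EPIL over $P$: $\zeta::=\phi\mid\zeta*\zeta$,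 $\varphi::=\zeta\mid\neg\zeta\mid\varphi\vee\varphi\mid\varphi\wedge\varphi\mid\varphi*\varphi\mid\varphi\sqcup\!\sqcup\varphi\mid\varphi^+$; for $w\in I(P)^+$: $w\models\phi$ iff $w$ is one letter $a$ with $a\models\phi$; $w\models\chi_1*\chi_2$ iff $w=w_1w_2$, $w_k\in I(P)^+$, $w_k\models\chi_k$; $w\models\neg\zeta$ iff not $w\models\zeta$; $\vee,\wedge$ usual; $w\models\varphi_1\sqcup\!\sqcup\varphi_2$ iff $w\in w_1\sqcup\!\sqcup w_2$, $w_k\in I(P)^+$, $w_k\models\varphi_k$; $w\models\varphi^+$ iff $w\models\varphi^\nu$ for some $\nu\ge1$ ($\varphi^1=\varphi$, $\varphi^{\nu+1}=\varphi^\nu*\varphi$). FOEIL: pairwise disjoint countably infinite variable sets $\mathcal X^{(1)},\dots,\mathcal X^{(n)}$, $\mathcal X=\bigcup_i\mathcal X^{(i)}$; variable ports $p(x^{(i)})$, $p\in P(i)$. $\psi::=\varphi\mid x^{(i)}=y^{(i)}\mid\neg(x^{(i)}=y^{(i)})\mid\psi\vee\psi\mid\psi\wedge\psi\mid\psi*\psi\mid\psi\sqcup\!\sqcup\psi\mid\psi^+\mid\exists x^{(i)}.\psi\mid\forall x^{(i)}.\psi\mid\exists^*x^{(i)}.\psi\mid\forall^*x^{(i)}.\psi\mid\exists^{\sqcup\!\sqcup}x^{(i)}.\psi\mid\forall^{\sqcup\!\sqcup}x^{(i)}.\psi$ ($\varphi$ EPIL over variable ports), with the restriction that in any subformula $\exists^*x^{(i)}.\psi'$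 or $\exists^{\sqcup\!\sqcup}x^{(i)}.\psi'$, negation in $\psi'$ occurs only inside PIL formulas and on $x^{(j)}=y^{(j)}$. A $(\mathcal V,r)$-assignment ($\mathcal V\subseteq\mathcal X$ finite) is $\sigma:\mathcal V\to\mathbb N$ with $\sigma(x^{(i)})\in[r(i)]$; $\sigma[x^{(i)}\to j]$ update; $\sigma(\varphi)$ replaces $p(x^{(i)})$ by $p(\sigma(x^{(i)}))$. For $w\in I_r^+$: $(r,\sigma,w)\models\varphi$ iff $w\models\sigma(\varphi)$; $x^{(i)}=y^{(i)}$ iff $\sigma(x^{(i)})=\sigma(y^{(i)})$; $\neg,\vee,\wedge$ usual; $*$, $\sqcup\!\sqcup$, $^+$ as in EPIL with subwords in $I_r^+$; $\exists x^{(i)}$/$\forall x^{(i)}$: for some/all $j\in[r(i)]$, $(r,\sigma[x^{(i)}\to j],w)\models\psi$; $\exists^*x^{(i)}.\psi$ iff there are $1\le k\le r(i)$, $1\le l_1<\dots<l_k\le r(i)$, $w_{l_1},\dots,w_{l_k}\in I_r^+$, $w=w_{l_1}\cdots w_{l_k}$, $(r,\sigma[x^{(i)}\to j],w_j)\models\psi$ for $j=l_1,\dots,l_k$; $\forall^*x^{(i)}.\psi$ iff $w=w_1\cdots w_{r(i)}$, $w_j\in I_r^+$, $(r,\sigma[x^{(i)}\to j],w_j)\models\psi$ for all $j\in[r(i)]$; $\exists^{\sqcup\!\sqcup},\forall^{\sqcup\!\sqcup}$ likewise with $w\in w_{l_1}\sqcup\!\sqcup\cdots\sqcup\!\sqcup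 w_{l_k}$, resp. $w\in w_1\sqcup\!\sqcup\cdots\sqcup\!\sqcup w_{r(i)}$. wFOEIL formulas over $pw\mathcal B$ and commutative semiring $(K,+,\cdot,0,1)$: $\tilde\psi::=k\mid\psi\mid\tilde\psi\oplus\tilde\psi\mid\tilde\psi\otimes\tilde\psi\mid\tilde\psi\odot\tilde\psi\mid\tilde\psi\varpi\tilde\psi\mid\tilde\psi^+\mid\sum x^{(i)}.\tilde\psi\mid\prod x^{(i)}.\tilde\psi\mid\sum^{\odot}x^{(i)}.\tilde\psi\mid\prod^{\odot}x^{(i)}.\tilde\psi\mid\sum^{\varpi}x^{(i)}.\tilde\psi\mid\prod^{\varpi}x^{(i)}.\tilde\psi$ with $k\in K$, $\psi$ FOEIL, and the restriction that if $\tilde\psi$ contains $\sum^{\odot}x^{(i)}.\tilde\psi'$ or $\sum^{\varpi}x^{(i)}.\tilde\psi'$, then in FOEIL subformulas of $\tilde\psi'$ negation occurs only inside PIL formulas and on $x^{(j)}=y^{(j)}$. Semantics for $w\in I_r^+$: $\|k\|(r,\sigma,w)=k$; $\|\psi\|(r,\sigma,w)=1$ if $(r,\sigma,w)\models\psi$, else $0$; $\|\tilde\psi_1\oplus\tilde\psi_2\|=\|\tilde\psi_1\|+\|\tilde\psi_2\|$ and $\|\tilde\psi_1\otimes\tilde\psi_2\|=\|\tilde\psi_1\|\cdot\|\tilde\psi_2\|$ pointwise; $\|\tilde\psi_1\odot\tilde\psi_2\|(r,\sigma,w)=\sum_{w=w_1w_2}\|\tilde\psi_1\|(r,\sigma,w_1)\cdot\|\tilde\psi_2\|(r,\sigma,w_2)$;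 $\|\tilde\psi_1\varpi\tilde\psi_2\|(r,\sigma,w)=\sum_{w\in w_1\sqcup\!\sqcup w_2}\|\tilde\psi_1\|(r,\sigma,w_1)\cdot\|\tilde\psi_2\|(r,\sigma,w_2)$ (sums over $w_1,w_2\in I_r^+$); $\|\tilde\psi^+\|(r,\sigma,w)=\sum_{\nu\ge1}\|\tilde\psi\|^\nu(r,\sigma,w)$ where $\|\tilde\psi\|^1=\|\tilde\psi\|$ and $\|\tilde\psi\|^{\nu+1}$ is the Cauchy product (as for $\odot$) of $\|\tilde\psi\|^\nu$ and $\|\tilde\psi\|$ (only finitely many nonzero terms); $\|\sum x^{(i)}.\tilde\psi\|(r,\sigma,w)=\sum_{j\in[r(i)]}\|\tilde\psi\|(r,\sigma[x^{(i)}\to j],w)$; $\|\prod x^{(i)}.\tilde\psi\|$ the same with product; $\|\sum^{\odot}x^{(i)}.\tilde\psi\|(r,\sigma,w)=\sum_{1\le t\le r(i)}\sum_{1\le l_1<\dots<l_t\le r(i)}\sum_{w=w_{l_1}\cdots w_{l_t}}\prod_{j=l_1,\dots,l_t}\|\tilde\psi\|(r,\sigma[x^{(i)}\to j],w_j)$; $\|\prod^{\odot}x^{(i)}.\tilde\psi\|(r,\sigma,w)=\sum_{w=w_1\cdots w_{r(i)}}\prod_{j\in[r(i)]}\|\tilde\psi\|(r,\sigma[x^{(i)}\to j],w_j)$; $\sum^{\varpi},\prod^{\varpi}$ likewise with $w\in w_{l_1}\sqcup\!\sqcup\cdots\sqcup\!\sqcup w_{l_t}$, resp. $w\in w_1\sqcup\!\sqcup\cdots\sqcup\!\sqcup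 w_{r(i)}$ (all subwords in $I_r^+$). For a sentence write $\|\tilde\psi\|(r,w)$. A weighted finite automaton (WFA) over alphabet $A$ and $K$ is $\mathcal A=(Q,in,wt,ter)$ with finite $Q$, $in,ter:Q\to K$, $wt:Q\times A\times Q\to K$; its behavior is $\|\mathcal A\|(a_1\cdots a_m)=\sum_{q_0,\dots,q_m\in Q}in(q_0)\cdot\prod_{k=1}^m wt(q_{k-1},a_k,q_k)\cdot ter(q_m)$.
   Formalization: In the weighted shuffle operators a tuple of words counts once per interleaving giving w, not once per tuple (then 1 ϖ 1 over the naturals is not recognizable); running time is measured in the size of the sentence with quantifiers unrolled for r, plus components and r. *)

theory Defs
  imports Complex_Main "HOL-Library.FuncSet"
begin

section \<open>Propositional and extended propositional interaction logic\<close>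

text \<open>An interaction is a set of ports. The two negations are kept apart: \<open>PNot\<close> is the negation of
  PIL (still a statement about a one-letter word), \<open>ENeg\<close> the negation of EPIL.\<close>

type_synonym 'v word = "'v set list"

datatype 'v pil =
    PTrue
  | PPort 'v
  | PNot "'v pil"
  | POr "'v pil" "'v pil"

datatype 'v zeta =
    ZPil "'v pil"
  | ZCat "'v zeta" "'v zeta"

datatype 'v epil =
    EPos "'v zeta"
  | ENeg "'v zeta"
  | EOr "'v epil" "'v epil"
  | EAnd "'v epil" "'v epil"
  | ECat "'v epil" "'v epil"
  | EShuf "'v epil" "'v epil"
  | EPlus "'v epil"

text \<open>Satisfaction is only used for words of \<open>I(P)\<^sup>+\<close>. A factor of such a word, or a word of which it
  is a shuffle, has all its letters in \<open>I(P)\<close>, so that membership in \<open>I(P)\<^sup>+\<close> amounts to being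
  nonempty; the same applies to \<open>I\<^sub>r\<close> below. The library function \<open>shuffles u v\<close> is the set of
  interleavings of two lists.\<close>

definition cat_sat :: "('a list \<Rightarrow> bool) \<Rightarrow> ('a list \<Rightarrow> bool) \<Rightarrow> 'a list \<Rightarrow> bool" where
  "cat_sat F G w \<longleftrightarrow> (\<exists>u v. u \<noteq> [] \<and> v \<noteq> [] \<and> w = u @ v \<and> F u \<and> G v)"

definition shuf_sat :: "('a list \<Rightarrow> bool) \<Rightarrow> ('a list \<Rightarrow> bool) \<Rightarrow> 'a list \<Rightarrow> bool" where
  "shuf_sat F G w \<longleftrightarrow> (\<exists>u v. u \<noteq> [] \<and> v \<noteq> [] \<and> w \<in> shuffles u v \<and> F u \<and> G v)"

text \<open>\<open>iter_sat F m\<close> is the power with exponent \<open>m + 1\<close>.\<close>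

primrec iter_sat :: "('a list \<Rightarrow> bool) \<Rightarrow> nat \<Rightarrow> 'a list \<Rightarrow> bool" where
  "iter_sat F 0 = F"
| "iter_sat F (Suc m) = cat_sat (iter_sat F m) F"

definition plus_sat :: "('a list \<Rightarrow> bool) \<Rightarrow> 'a list \<Rightarrow> bool" where
  "plus_sat F w \<longleftrightarrow> (\<exists>m. iter_sat F m w)"

primrec pil_sat :: "'v set \<Rightarrow> 'v pil \<Rightarrow> bool" where
  "pil_sat a PTrue \<longleftrightarrow> True"
| "pil_sat a (PPort p) \<longleftrightarrow> p \<in> a"
| "pil_sat a (PNot \<phi>) \<longleftrightarrow> \<not> pil_sat a \<phi>"
| "pil_sat a (POr \<phi> \<phi>') \<longleftrightarrow> pil_sat a \<phi> \<or> pil_sat a \<phi>'"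

primrec zeta_sat :: "'v zeta \<Rightarrow> 'v word \<Rightarrow> bool" where
  "zeta_sat (ZPil \<phi>) = (\<lambda>w. \<exists>a. w = [a] \<and> pil_sat a \<phi>)"
| "zeta_sat (ZCat \<zeta> \<zeta>') = cat_sat (zeta_sat \<zeta>) (zeta_sat \<zeta>')"

primrec epil_sat :: "'v epil \<Rightarrow> 'v word \<Rightarrow> bool" where
  "epil_sat (EPos \<zeta>) = zeta_sat \<zeta>"
| "epil_sat (ENeg \<zeta>) = (\<lambda>w. \<not> zeta_sat \<zeta> w)"
| "epil_sat (EOr \<phi> \<phi>') = (\<lambda>w. epil_sat \<phi> w \<or> epil_sat \<phi>' w)"
| "epil_sat (EAnd \<phi> \<phi>') = (\<lambda>w. epil_sat \<phi> w \<and> epil_sat \<phi>' w)"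
| "epil_sat (ECat \<phi> \<phi>') = cat_sat (epil_sat \<phi>) (epil_sat \<phi>')"
| "epil_sat (EShuf \<phi> \<phi>') = shuf_sat (epil_sat \<phi>) (epil_sat \<phi>')"
| "epil_sat (EPlus \<phi>) = plus_sat (epil_sat \<phi>)"


section \<open>Parametric weighted components\<close>

record ('p, 'k) pwcomp =
  ntypes :: nat
  ports :: "nat \<Rightarrow> 'p set"
  weight :: "nat \<Rightarrow> 'p \<Rightarrow> 'k"

definition is_pwcomp :: "('p, 'k) pwcomp \<Rightarrow> bool" where
  "is_pwcomp B \<longleftrightarrow> ntypes B \<ge> 1 \<and> (\<forall>i\<in>{1..ntypes B}. finite (ports B i)) \<and>
     (\<forall>i\<in>{1..ntypes B}. \<forall>i'\<in>{1..ntypes B}. i \<noteq> i' \<longrightarrow> ports B i \<inter> ports B i' = {})"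

text \<open>The port \<open>p(j)\<close> of the \<open>j\<close>-th instance is the pair \<open>(p, j)\<close>.\<close>

definition inst_ports :: "('p, 'k) pwcomp \<Rightarrow> nat \<Rightarrow> nat \<Rightarrow> ('p \<times> nat) set" where
  "inst_ports B i j = ports B i \<times> {j}"

definition all_ports :: "('p, 'k) pwcomp \<Rightarrow> (nat \<Rightarrow> nat) \<Rightarrow> ('p \<times> nat) set" where
  "all_ports B r = (\<Union>i\<in>{1..ntypes B}. \<Union>j\<in>{1..r i}. inst_ports B i j)"

definition interactions :: "('p, 'k) pwcomp \<Rightarrow> (nat \<Rightarrow> nat) \<Rightarrow> ('p \<times> nat) set set" where
  "interactions B r = {a. a \<noteq> {} \<and> a \<subseteq> all_ports B r \<and>
     (\<forall>i\<in>{1..ntypes B}. \<forall>j\<in>{1..r i}. card (a \<inter> inst_ports B i j) \<le> 1)}"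

definition nonempty_words :: "'a set \<Rightarrow> 'a list set" where
  "nonempty_words A = {w. w \<noteq> [] \<and> set w \<subseteq> A}"


section \<open>First-order extended interaction logic\<close>

text \<open>A variable \<open>(i, m)\<close> is the \<open>m\<close>-th variable of sort \<open>i\<close>; a variable port \<open>p(x)\<close> is \<open>(p, x)\<close>.\<close>

type_synonym var = "nat \<times> nat"

datatype 'p foeil =
    FEpil "('p \<times> var) epil"
  | FEq var var
  | FNeq var var
  | FOr "'p foeil" "'p foeil"
  | FAnd "'p foeil" "'p foeil"
  | FCat "'p foeil" "'p foeil"
  | FShuf "'p foeil" "'p foeil"
  | FPlus "'p foeil"
  | FEx var "'p foeil"
  | FAll var "'p foeil"
  | FExCat var "'p foeil"
  | FAllCat var "'p foeil"
  | FExShuf var "'p foeil"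
  | FAllShuf var "'p foeil"

definition subst_epil :: "(var \<rightharpoonup> nat) \<Rightarrow> ('p \<times> var) epil \<Rightarrow> ('p \<times> nat) epil" where
  "subst_epil \<sigma> = map_epil (\<lambda>(p, x). (p, the (\<sigma> x)))"

text \<open>For a finite index set \<open>L = {l\<^sub>1 < \<dots> < l\<^sub>k}\<close>: the families \<open>(w\<^sub>j)\<close>, \<open>j \<in> L\<close>, of nonempty words
  whose concatenation in increasing order of the index is \<open>w\<close>.\<close>

definition cat_families :: "nat set \<Rightarrow> 'a list \<Rightarrow> (nat \<Rightarrow> 'a list) set" where
  "cat_families L w =
     {ws \<in> L \<rightarrow>\<^sub>E (- {[]}). concat (map ws (sorted_list_of_set L)) = w}"

primrec shuffle_all :: "'a list list \<Rightarrow> 'a list set" where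
  "shuffle_all [] = {[]}"
| "shuffle_all (u # us) = (\<Union>v\<in>shuffle_all us. shuffles u v)"

definition shuf_families :: "nat set \<Rightarrow> 'a list \<Rightarrow> (nat \<Rightarrow> 'a list) set" where
  "shuf_families L w =
     {ws \<in> L \<rightarrow>\<^sub>E (- {[]}). w \<in> shuffle_all (map ws (sorted_list_of_set L))}"

primrec foeil_sat ::
  "(nat \<Rightarrow> nat) \<Rightarrow> 'p foeil \<Rightarrow> (var \<rightharpoonup> nat) \<Rightarrow> ('p \<times> nat) word \<Rightarrow> bool" where
  "foeil_sat r (FEpil \<phi>) = (\<lambda>\<sigma>. epil_sat (subst_epil \<sigma> \<phi>))"
| "foeil_sat r (FEq x y) = (\<lambda>\<sigma> w. \<sigma> x = \<sigma> y)"
| "foeil_sat r (FNeq x y) = (\<lambda>\<sigma> w. \<sigma> x \<noteq> \<sigma> y)"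
| "foeil_sat r (FOr \<psi> \<psi>') = (\<lambda>\<sigma> w. foeil_sat r \<psi> \<sigma> w \<or> foeil_sat r \<psi>' \<sigma> w)"
| "foeil_sat r (FAnd \<psi> \<psi>') = (\<lambda>\<sigma> w. foeil_sat r \<psi> \<sigma> w \<and> foeil_sat r \<psi>' \<sigma> w)"
| "foeil_sat r (FCat \<psi> \<psi>') = (\<lambda>\<sigma>. cat_sat (foeil_sat r \<psi> \<sigma>) (foeil_sat r \<psi>' \<sigma>))"
| "foeil_sat r (FShuf \<psi> \<psi>') = (\<lambda>\<sigma>. shuf_sat (foeil_sat r \<psi> \<sigma>) (foeil_sat r \<psi>' \<sigma>))"
| "foeil_sat r (FPlus \<psi>) = (\<lambda>\<sigma>. plus_sat (foeil_sat r \<psi> \<sigma>))"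
| "foeil_sat r (FEx x \<psi>) = (\<lambda>\<sigma> w. \<exists>j\<in>{1..r (fst x)}. foeil_sat r \<psi> (\<sigma>(x \<mapsto> j)) w)"
| "foeil_sat r (FAll x \<psi>) = (\<lambda>\<sigma> w. \<forall>j\<in>{1..r (fst x)}. foeil_sat r \<psi> (\<sigma>(x \<mapsto> j)) w)"
| "foeil_sat r (FExCat x \<psi>) = (\<lambda>\<sigma> w. \<exists>L. L \<noteq> {} \<and> L \<subseteq> {1..r (fst x)} \<and>
     (\<exists>ws\<in>cat_families L w. \<forall>j\<in>L. foeil_sat r \<psi> (\<sigma>(x \<mapsto> j)) (ws j)))"
| "foeil_sat r (FAllCat x \<psi>) = (\<lambda>\<sigma> w.
     \<exists>ws\<in>cat_families {1..r (fst x)} w. \<forall>j\<in>{1..r (fst x)}. foeil_sat r \<psi> (\<sigma>(x \<mapsto> j)) (ws j))"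
| "foeil_sat r (FExShuf x \<psi>) = (\<lambda>\<sigma> w. \<exists>L. L \<noteq> {} \<and> L \<subseteq> {1..r (fst x)} \<and>
     (\<exists>ws\<in>shuf_families L w. \<forall>j\<in>L. foeil_sat r \<psi> (\<sigma>(x \<mapsto> j)) (ws j)))"
| "foeil_sat r (FAllShuf x \<psi>) = (\<lambda>\<sigma> w.
     \<exists>ws\<in>shuf_families {1..r (fst x)} w. \<forall>j\<in>{1..r (fst x)}. foeil_sat r \<psi> (\<sigma>(x \<mapsto> j)) (ws j))"

text \<open>Negation only inside PIL formulas and on equalities:\<close>

primrec epil_negfree :: "'v epil \<Rightarrow> bool" where
  "epil_negfree (EPos \<zeta>) \<longleftrightarrow> True"
| "epil_negfree (ENeg \<zeta>) \<longleftrightarrow> False"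
| "epil_negfree (EOr \<phi> \<phi>') \<longleftrightarrow> epil_negfree \<phi> \<and> epil_negfree \<phi>'"
| "epil_negfree (EAnd \<phi> \<phi>') \<longleftrightarrow> epil_negfree \<phi> \<and> epil_negfree \<phi>'"
| "epil_negfree (ECat \<phi> \<phi>') \<longleftrightarrow> epil_negfree \<phi> \<and> epil_negfree \<phi>'"
| "epil_negfree (EShuf \<phi> \<phi>') \<longleftrightarrow> epil_negfree \<phi> \<and> epil_negfree \<phi>'"
| "epil_negfree (EPlus \<phi>) \<longleftrightarrow> epil_negfree \<phi>"

primrec foeil_negfree :: "'p foeil \<Rightarrow> bool" where
  "foeil_negfree (FEpil \<phi>) \<longleftrightarrow> epil_negfree \<phi>"
| "foeil_negfree (FEq x y) \<longleftrightarrow> True"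
| "foeil_negfree (FNeq x y) \<longleftrightarrow> True"
| "foeil_negfree (FOr \<psi> \<psi>') \<longleftrightarrow> foeil_negfree \<psi> \<and> foeil_negfree \<psi>'"
| "foeil_negfree (FAnd \<psi> \<psi>') \<longleftrightarrow> foeil_negfree \<psi> \<and> foeil_negfree \<psi>'"
| "foeil_negfree (FCat \<psi> \<psi>') \<longleftrightarrow> foeil_negfree \<psi> \<and> foeil_negfree \<psi>'"
| "foeil_negfree (FShuf \<psi> \<psi>') \<longleftrightarrow> foeil_negfree \<psi> \<and> foeil_negfree \<psi>'"
| "foeil_negfree (FPlus \<psi>) \<longleftrightarrow> foeil_negfree \<psi>"
| "foeil_negfree (FEx x \<psi>) \<longleftrightarrow> foeil_negfree \<psi>"
| "foeil_negfree (FAll x \<psi>) \<longleftrightarrow> foeil_negfree \<psi>"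
| "foeil_negfree (FExCat x \<psi>) \<longleftrightarrow> foeil_negfree \<psi>"
| "foeil_negfree (FAllCat x \<psi>) \<longleftrightarrow> foeil_negfree \<psi>"
| "foeil_negfree (FExShuf x \<psi>) \<longleftrightarrow> foeil_negfree \<psi>"
| "foeil_negfree (FAllShuf x \<psi>) \<longleftrightarrow> foeil_negfree \<psi>"

definition is_var :: "('p, 'k) pwcomp \<Rightarrow> var \<Rightarrow> bool" where
  "is_var B x \<longleftrightarrow> fst x \<in> {1..ntypes B}"

primrec is_foeil :: "('p, 'k) pwcomp \<Rightarrow> 'p foeil \<Rightarrow> bool" where
  "is_foeil B (FEpil \<phi>) \<longleftrightarrow> (\<forall>(p, x)\<in>set_epil \<phi>. is_var B x \<and> p \<in> ports B (fst x))"
| "is_foeil B (FEq x y) \<longleftrightarrow> is_var B x \<and> is_var B y \<and> fst x = fst y"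
| "is_foeil B (FNeq x y) \<longleftrightarrow> is_var B x \<and> is_var B y \<and> fst x = fst y"
| "is_foeil B (FOr \<psi> \<psi>') \<longleftrightarrow> is_foeil B \<psi> \<and> is_foeil B \<psi>'"
| "is_foeil B (FAnd \<psi> \<psi>') \<longleftrightarrow> is_foeil B \<psi> \<and> is_foeil B \<psi>'"
| "is_foeil B (FCat \<psi> \<psi>') \<longleftrightarrow> is_foeil B \<psi> \<and> is_foeil B \<psi>'"
| "is_foeil B (FShuf \<psi> \<psi>') \<longleftrightarrow> is_foeil B \<psi> \<and> is_foeil B \<psi>'"
| "is_foeil B (FPlus \<psi>) \<longleftrightarrow> is_foeil B \<psi>"
| "is_foeil B (FEx x \<psi>) \<longleftrightarrow> is_var B x \<and> is_foeil B \<psi>"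
| "is_foeil B (FAll x \<psi>) \<longleftrightarrow> is_var B x \<and> is_foeil B \<psi>"
| "is_foeil B (FExCat x \<psi>) \<longleftrightarrow> is_var B x \<and> is_foeil B \<psi> \<and> foeil_negfree \<psi>"
| "is_foeil B (FAllCat x \<psi>) \<longleftrightarrow> is_var B x \<and> is_foeil B \<psi>"
| "is_foeil B (FExShuf x \<psi>) \<longleftrightarrow> is_var B x \<and> is_foeil B \<psi> \<and> foeil_negfree \<psi>"
| "is_foeil B (FAllShuf x \<psi>) \<longleftrightarrow> is_var B x \<and> is_foeil B \<psi>"

primrec foeil_free :: "'p foeil \<Rightarrow> var set" where
  "foeil_free (FEpil \<phi>) = snd ` set_epil \<phi>"
| "foeil_free (FEq x y) = {x, y}"
| "foeil_free (FNeq x y) = {x, y}"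
| "foeil_free (FOr \<psi> \<psi>') = foeil_free \<psi> \<union> foeil_free \<psi>'"
| "foeil_free (FAnd \<psi> \<psi>') = foeil_free \<psi> \<union> foeil_free \<psi>'"
| "foeil_free (FCat \<psi> \<psi>') = foeil_free \<psi> \<union> foeil_free \<psi>'"
| "foeil_free (FShuf \<psi> \<psi>') = foeil_free \<psi> \<union> foeil_free \<psi>'"
| "foeil_free (FPlus \<psi>) = foeil_free \<psi>"
| "foeil_free (FEx x \<psi>) = foeil_free \<psi> - {x}"
| "foeil_free (FAll x \<psi>) = foeil_free \<psi> - {x}"
| "foeil_free (FExCat x \<psi>) = foeil_free \<psi> - {x}"
| "foeil_free (FAllCat x \<psi>) = foeil_free \<psi> - {x}"
| "foeil_free (FExShuf x \<psi>) = foeil_free \<psi> - {x}"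
| "foeil_free (FAllShuf x \<psi>) = foeil_free \<psi> - {x}"


section \<open>Weighted first-order extended interaction logic\<close>

text \<open>Semirings are taken in the sort \<open>{comm_semiring_0, comm_monoid_mult}\<close>, which is weaker than
  \<open>comm_semiring_1\<close> in that it does not require \<open>0 \<noteq> 1\<close>.\<close>

datatype ('p, 'k) wfoeil =
    WConst 'k
  | WBool "'p foeil"
  | WAdd "('p, 'k) wfoeil" "('p, 'k) wfoeil"
  | WMul "('p, 'k) wfoeil" "('p, 'k) wfoeil"
  | WCat "('p, 'k) wfoeil" "('p, 'k) wfoeil"
  | WShuf "('p, 'k) wfoeil" "('p, 'k) wfoeil"
  | WPlus "('p, 'k) wfoeil"
  | WSum var "('p, 'k) wfoeil"
  | WProd var "('p, 'k) wfoeil"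
  | WSumCat var "('p, 'k) wfoeil"
  | WProdCat var "('p, 'k) wfoeil"
  | WSumShuf var "('p, 'k) wfoeil"
  | WProdShuf var "('p, 'k) wfoeil"

definition cauchy ::
  "('a list \<Rightarrow> 'k) \<Rightarrow> ('a list \<Rightarrow> 'k) \<Rightarrow> 'a list \<Rightarrow> 'k :: {comm_semiring_0, comm_monoid_mult}" where
  "cauchy f g w = (\<Sum>(u, v)\<in>{(u, v). u \<noteq> [] \<and> v \<noteq> [] \<and> w = u @ v}. f u * g v)"

text \<open>The sums over all ways of writing \<open>w\<close> as a shuffle are taken as in the usual shuffle product of
  formal power series: a tuple of words counts as often as \<open>w\<close> occurs as an interleaving of it, an
  interleaving being given by the positions of \<open>w\<close> which belong to each of the words. (If every tuple
  were counted once only, then over the semiring of natural numbers and an alphabet with two letters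
  already the shuffle product of the constant series 1 with itself would not be recognizable. For
  idempotent semirings the two readings agree.)\<close>

definition shuffle_prod ::
  "('a list \<Rightarrow> 'k) \<Rightarrow> ('a list \<Rightarrow> 'k) \<Rightarrow> 'a list \<Rightarrow> 'k :: {comm_semiring_0, comm_monoid_mult}" where
  "shuffle_prod f g w =
     (\<Sum>S\<in>{S. S \<subseteq> {..<length w} \<and> S \<noteq> {} \<and> S \<noteq> {..<length w}}. f (nths w S) * g (nths w (- S)))"

definition cat_prod_family ::
  "nat set \<Rightarrow> (nat \<Rightarrow> 'a list \<Rightarrow> 'k) \<Rightarrow> 'a list \<Rightarrow> 'k :: {comm_semiring_0, comm_monoid_mult}" where
  "cat_prod_family L f w = (\<Sum>ws\<in>cat_families L w. \<Prod>j\<in>L. f j (ws j))"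

text \<open>Here \<open>g\<close> assigns to every position of \<open>w\<close> the index of the word it belongs to.\<close>

definition shuf_prod_family ::
  "nat set \<Rightarrow> (nat \<Rightarrow> 'a list \<Rightarrow> 'k) \<Rightarrow> 'a list \<Rightarrow> 'k :: {comm_semiring_0, comm_monoid_mult}" where
  "shuf_prod_family L f w =
     (\<Sum>g\<in>{g \<in> {..<length w} \<rightarrow>\<^sub>E L. g ` {..<length w} = L}.
        \<Prod>j\<in>L. f j (nths w {m. m < length w \<and> g m = j}))"

text \<open>\<open>cauchy_pow f m\<close> is the power with exponent \<open>m + 1\<close>. Powers with exponent larger than
  \<open>length w\<close> vanish on \<open>w\<close>, so that they are left out of the sum over all positive exponents.\<close>

primrec cauchy_pow ::
  "('a list \<Rightarrow> 'k) \<Rightarrow> nat \<Rightarrow> 'a list \<Rightarrow> 'k :: {comm_semiring_0, comm_monoid_mult}" where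
  "cauchy_pow f 0 = f"
| "cauchy_pow f (Suc m) = cauchy (cauchy_pow f m) f"

definition cauchy_plus ::
  "('a list \<Rightarrow> 'k) \<Rightarrow> 'a list \<Rightarrow> 'k :: {comm_semiring_0, comm_monoid_mult}" where
  "cauchy_plus f w = (\<Sum>m<length w. cauchy_pow f m w)"

primrec wsem ::
  "(nat \<Rightarrow> nat) \<Rightarrow> ('p, 'k :: {comm_semiring_0, comm_monoid_mult}) wfoeil \<Rightarrow> (var \<rightharpoonup> nat) \<Rightarrow>
   ('p \<times> nat) word \<Rightarrow> 'k" where
  "wsem r (WConst k) = (\<lambda>\<sigma> w. k)"
| "wsem r (WBool \<psi>) = (\<lambda>\<sigma> w. if foeil_sat r \<psi> \<sigma> w then 1 else 0)"
| "wsem r (WAdd \<psi> \<psi>') = (\<lambda>\<sigma> w. wsem r \<psi> \<sigma> w + wsem r \<psi>' \<sigma> w)"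
| "wsem r (WMul \<psi> \<psi>') = (\<lambda>\<sigma> w. wsem r \<psi> \<sigma> w * wsem r \<psi>' \<sigma> w)"
| "wsem r (WCat \<psi> \<psi>') = (\<lambda>\<sigma>. cauchy (wsem r \<psi> \<sigma>) (wsem r \<psi>' \<sigma>))"
| "wsem r (WShuf \<psi> \<psi>') = (\<lambda>\<sigma>. shuffle_prod (wsem r \<psi> \<sigma>) (wsem r \<psi>' \<sigma>))"
| "wsem r (WPlus \<psi>) = (\<lambda>\<sigma>. cauchy_plus (wsem r \<psi> \<sigma>))"
| "wsem r (WSum x \<psi>) = (\<lambda>\<sigma> w. \<Sum>j\<in>{1..r (fst x)}. wsem r \<psi> (\<sigma>(x \<mapsto> j)) w)"
| "wsem r (WProd x \<psi>) = (\<lambda>\<sigma> w. \<Prod>j\<in>{1..r (fst x)}. wsem r \<psi> (\<sigma>(x \<mapsto> j)) w)"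
| "wsem r (WSumCat x \<psi>) = (\<lambda>\<sigma> w. \<Sum>L\<in>{L. L \<noteq> {} \<and> L \<subseteq> {1..r (fst x)}}.
     cat_prod_family L (\<lambda>j. wsem r \<psi> (\<sigma>(x \<mapsto> j))) w)"
| "wsem r (WProdCat x \<psi>) = (\<lambda>\<sigma>. cat_prod_family {1..r (fst x)} (\<lambda>j. wsem r \<psi> (\<sigma>(x \<mapsto> j))))"
| "wsem r (WSumShuf x \<psi>) = (\<lambda>\<sigma> w. \<Sum>L\<in>{L. L \<noteq> {} \<and> L \<subseteq> {1..r (fst x)}}.
     shuf_prod_family L (\<lambda>j. wsem r \<psi> (\<sigma>(x \<mapsto> j))) w)"
| "wsem r (WProdShuf x \<psi>) = (\<lambda>\<sigma>. shuf_prod_family {1..r (fst x)} (\<lambda>j. wsem r \<psi> (\<sigma>(x \<mapsto> j))))"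

primrec wfoeil_negfree :: "('p, 'k) wfoeil \<Rightarrow> bool" where
  "wfoeil_negfree (WConst k) \<longleftrightarrow> True"
| "wfoeil_negfree (WBool \<psi>) \<longleftrightarrow> foeil_negfree \<psi>"
| "wfoeil_negfree (WAdd \<psi> \<psi>') \<longleftrightarrow> wfoeil_negfree \<psi> \<and> wfoeil_negfree \<psi>'"
| "wfoeil_negfree (WMul \<psi> \<psi>') \<longleftrightarrow> wfoeil_negfree \<psi> \<and> wfoeil_negfree \<psi>'"
| "wfoeil_negfree (WCat \<psi> \<psi>') \<longleftrightarrow> wfoeil_negfree \<psi> \<and> wfoeil_negfree \<psi>'"
| "wfoeil_negfree (WShuf \<psi> \<psi>') \<longleftrightarrow> wfoeil_negfree \<psi> \<and> wfoeil_negfree \<psi>'"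
| "wfoeil_negfree (WPlus \<psi>) \<longleftrightarrow> wfoeil_negfree \<psi>"
| "wfoeil_negfree (WSum x \<psi>) \<longleftrightarrow> wfoeil_negfree \<psi>"
| "wfoeil_negfree (WProd x \<psi>) \<longleftrightarrow> wfoeil_negfree \<psi>"
| "wfoeil_negfree (WSumCat x \<psi>) \<longleftrightarrow> wfoeil_negfree \<psi>"
| "wfoeil_negfree (WProdCat x \<psi>) \<longleftrightarrow> wfoeil_negfree \<psi>"
| "wfoeil_negfree (WSumShuf x \<psi>) \<longleftrightarrow> wfoeil_negfree \<psi>"
| "wfoeil_negfree (WProdShuf x \<psi>) \<longleftrightarrow> wfoeil_negfree \<psi>"

primrec is_wfoeil :: "('p, 'k) pwcomp \<Rightarrow> ('p, 'k) wfoeil \<Rightarrow> bool" where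
  "is_wfoeil B (WConst k) \<longleftrightarrow> True"
| "is_wfoeil B (WBool \<psi>) \<longleftrightarrow> is_foeil B \<psi>"
| "is_wfoeil B (WAdd \<psi> \<psi>') \<longleftrightarrow> is_wfoeil B \<psi> \<and> is_wfoeil B \<psi>'"
| "is_wfoeil B (WMul \<psi> \<psi>') \<longleftrightarrow> is_wfoeil B \<psi> \<and> is_wfoeil B \<psi>'"
| "is_wfoeil B (WCat \<psi> \<psi>') \<longleftrightarrow> is_wfoeil B \<psi> \<and> is_wfoeil B \<psi>'"
| "is_wfoeil B (WShuf \<psi> \<psi>') \<longleftrightarrow> is_wfoeil B \<psi> \<and> is_wfoeil B \<psi>'"
| "is_wfoeil B (WPlus \<psi>) \<longleftrightarrow> is_wfoeil B \<psi>"
| "is_wfoeil B (WSum x \<psi>) \<longleftrightarrow> is_var B x \<and> is_wfoeil B \<psi>"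
| "is_wfoeil B (WProd x \<psi>) \<longleftrightarrow> is_var B x \<and> is_wfoeil B \<psi>"
| "is_wfoeil B (WSumCat x \<psi>) \<longleftrightarrow> is_var B x \<and> is_wfoeil B \<psi> \<and> wfoeil_negfree \<psi>"
| "is_wfoeil B (WProdCat x \<psi>) \<longleftrightarrow> is_var B x \<and> is_wfoeil B \<psi>"
| "is_wfoeil B (WSumShuf x \<psi>) \<longleftrightarrow> is_var B x \<and> is_wfoeil B \<psi> \<and> wfoeil_negfree \<psi>"
| "is_wfoeil B (WProdShuf x \<psi>) \<longleftrightarrow> is_var B x \<and> is_wfoeil B \<psi>"

primrec wfoeil_free :: "('p, 'k) wfoeil \<Rightarrow> var set" where
  "wfoeil_free (WConst k) = {}"
| "wfoeil_free (WBool \<psi>) = foeil_free \<psi>"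
| "wfoeil_free (WAdd \<psi> \<psi>') = wfoeil_free \<psi> \<union> wfoeil_free \<psi>'"
| "wfoeil_free (WMul \<psi> \<psi>') = wfoeil_free \<psi> \<union> wfoeil_free \<psi>'"
| "wfoeil_free (WCat \<psi> \<psi>') = wfoeil_free \<psi> \<union> wfoeil_free \<psi>'"
| "wfoeil_free (WShuf \<psi> \<psi>') = wfoeil_free \<psi> \<union> wfoeil_free \<psi>'"
| "wfoeil_free (WPlus \<psi>) = wfoeil_free \<psi>"
| "wfoeil_free (WSum x \<psi>) = wfoeil_free \<psi> - {x}"
| "wfoeil_free (WProd x \<psi>) = wfoeil_free \<psi> - {x}"
| "wfoeil_free (WSumCat x \<psi>) = wfoeil_free \<psi> - {x}"
| "wfoeil_free (WProdCat x \<psi>) = wfoeil_free \<psi> - {x}"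
| "wfoeil_free (WSumShuf x \<psi>) = wfoeil_free \<psi> - {x}"
| "wfoeil_free (WProdShuf x \<psi>) = wfoeil_free \<psi> - {x}"

definition is_sentence :: "('p, 'k) pwcomp \<Rightarrow> ('p, 'k) wfoeil \<Rightarrow> bool" where
  "is_sentence B \<psi> \<longleftrightarrow> is_wfoeil B \<psi> \<and> wfoeil_free \<psi> = {}"

definition sentence_sem ::
  "(nat \<Rightarrow> nat) \<Rightarrow> ('p, 'k :: {comm_semiring_0, comm_monoid_mult}) wfoeil \<Rightarrow>
   ('p \<times> nat) word \<Rightarrow> 'k" where
  "sentence_sem r \<psi> w = wsem r \<psi> Map.empty w"


section \<open>Weighted finite automata\<close>

record ('q, 'a, 'k) wfa =
  states :: "'q set"
  initial :: "'q \<Rightarrow> 'k"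
  trans :: "'q \<Rightarrow> 'a \<Rightarrow> 'q \<Rightarrow> 'k"
  terminal :: "'q \<Rightarrow> 'k"

definition behavior ::
  "('q, 'a, 'k :: {comm_semiring_0, comm_monoid_mult}) wfa \<Rightarrow> 'a list \<Rightarrow> 'k" where
  "behavior A w = (\<Sum>q\<in>{q. set q \<subseteq> states A \<and> length q = Suc (length w)}.
     initial A (q ! 0) * (\<Prod>m<length w. trans A (q ! m) (w ! m) (q ! Suc m)) *
     terminal A (q ! length w))"


section \<open>A model of computation\<close>

text \<open>Algorithms are programs of a first-order functional language over trees. Weights can only be
  added and multiplied, neither inspected nor compared; the other leaves can be compared. The
  syntax of programs mentions neither ports nor weights.\<close>

datatype ('p, 'k) val =
    VNil
  | VNum nat
  | VPort 'p
  | VWt 'k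
  | VPair "('p, 'k) val" "('p, 'k) val"

datatype expr =
    Var nat
  | CNil
  | CNum nat
  | CZero
  | COne
  | MkPair expr expr
  | Fst expr
  | Snd expr
  | Plus expr expr
  | Times expr expr
  | IsPair expr
  | Eq expr expr
  | If expr expr expr
  | Let expr expr
  | Call nat expr

text \<open>The \<open>m\<close>-th expression is the body of the unary function \<open>m\<close>.\<close>

type_synonym program = "expr list"

primrec vsize :: "('p, 'k) val \<Rightarrow> nat" where
  "vsize VNil = 1"
| "vsize (VNum m) = 1"
| "vsize (VPort p) = 1"
| "vsize (VWt k) = 1"
| "vsize (VPair u v) = 1 + vsize u + vsize v"

definition truth :: "bool \<Rightarrow> ('p, 'k) val" where
  "truth b = (if b then VNum 1 else VNil)"

fun is_pair :: "('p, 'k) val \<Rightarrow> bool" where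
  "is_pair (VPair u v) = True"
| "is_pair v = False"

fun same_leaf :: "('p, 'k) val \<Rightarrow> ('p, 'k) val \<Rightarrow> bool" where
  "same_leaf VNil VNil = True"
| "same_leaf (VNum a) (VNum b) = (a = b)"
| "same_leaf (VPort p) (VPort q) = (p = q)"
| "same_leaf u v = False"

text \<open>\<open>eval prg env e v t\<close>: in the environment \<open>env\<close> the expression \<open>e\<close> evaluates to \<open>v\<close> in time \<open>t\<close>.
  Producing a value costs at least the size of the value, also when it is only copied or selected,
  so that sharing of subtrees gives no advantage. Semiring operations have unit cost.\<close>

inductive eval ::
  "program \<Rightarrow> ('p, 'k :: {comm_semiring_0, comm_monoid_mult}) val list \<Rightarrow> expr \<Rightarrow> ('p, 'k) val \<Rightarrow>
   nat \<Rightarrow> bool" for prg where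
  "m < length env \<Longrightarrow> eval prg env (Var m) (env ! m) (vsize (env ! m))"
| "eval prg env CNil VNil 1"
| "eval prg env (CNum m) (VNum m) 1"
| "eval prg env CZero (VWt 0) 1"
| "eval prg env COne (VWt 1) 1"
| "eval prg env e u t \<Longrightarrow> eval prg env e' u' t' \<Longrightarrow>
   eval prg env (MkPair e e') (VPair u u') (t + t' + vsize (VPair u u'))"
| "eval prg env e (VPair u u') t \<Longrightarrow> eval prg env (Fst e) u (t + vsize u)"
| "eval prg env e (VPair u u') t \<Longrightarrow> eval prg env (Snd e) u' (t + vsize u')"
| "eval prg env e (VWt k) t \<Longrightarrow> eval prg env e' (VWt k') t' \<Longrightarrow>
   eval prg env (Plus e e') (VWt (k + k')) (t + t' + 1)"
| "eval prg env e (VWt k) t \<Longrightarrow> eval prg env e' (VWt k') t' \<Longrightarrow>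
   eval prg env (Times e e') (VWt (k * k')) (t + t' + 1)"
| "eval prg env e u t \<Longrightarrow> eval prg env (IsPair e) (truth (is_pair u)) (t + 1)"
| "eval prg env e u t \<Longrightarrow> eval prg env e' u' t' \<Longrightarrow>
   eval prg env (Eq e e') (truth (same_leaf u u')) (t + t' + 1)"
| "eval prg env e u t \<Longrightarrow> u \<noteq> VNil \<Longrightarrow> eval prg env e\<^sub>1 v t' \<Longrightarrow>
   eval prg env (If e e\<^sub>1 e\<^sub>2) v (t + t' + 1)"
| "eval prg env e VNil t \<Longrightarrow> eval prg env e\<^sub>2 v t' \<Longrightarrow> eval prg env (If e e\<^sub>1 e\<^sub>2) v (t + t' + 1)"
| "eval prg env e u t \<Longrightarrow> eval prg (u # env) e' v t' \<Longrightarrow> eval prg env (Let e e') v (t + t' + 1)"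
| "eval prg env e u t \<Longrightarrow> m < length prg \<Longrightarrow> eval prg [u] (prg ! m) v t' \<Longrightarrow>
   eval prg env (Call m e) v (t + t' + 1)"

definition runs ::
  "program \<Rightarrow> ('p, 'k :: {comm_semiring_0, comm_monoid_mult}) val \<Rightarrow> ('p, 'k) val \<Rightarrow> nat \<Rightarrow> bool"
  where "runs prg x y t \<longleftrightarrow> eval prg [x] (Call 0 (Var 0)) y t"

inductive_cases eval_elims:
  "eval prg env (Var m) v t" "eval prg env CNil v t" "eval prg env (CNum m) v t"
  "eval prg env CZero v t" "eval prg env COne v t" "eval prg env (MkPair e e') v t"
  "eval prg env (Fst e) v t" "eval prg env (Snd e) v t" "eval prg env (Plus e e') v t"
  "eval prg env (Times e e') v t" "eval prg env (IsPair e) v t" "eval prg env (Eq e e') v t"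
  "eval prg env (If e e' e'') v t" "eval prg env (Let e e') v t" "eval prg env (Call m e) v t"

lemma eval_deterministic:
  "eval prg env e v t \<Longrightarrow> eval prg env e v' t' \<Longrightarrow> v' = v \<and> t' = t"
proof (induction arbitrary: v' t' rule: eval.induct)
  case (6 env e u t e' u' t1)
  from 6(5) show ?case by (rule eval_elims) (use 6(3,4) in simp)
next
  case (7 env e u u' t)
  from 7(3) show ?case by (rule eval_elims) (use 7(2) in fastforce)
next
  case (8 env e u u' t)
  from 8(3) show ?case by (rule eval_elims) (use 8(2) in fastforce)
next
  case (9 env e k t e' k' t1)
  from 9(5) show ?case by (rule eval_elims) (use 9(3,4) in fastforce)
next
  case (10 env e k t e' k' t1)
  from 10(5) show ?case by (rule eval_elims) (use 10(3,4) in fastforce)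
next
  case (11 env e u t)
  from 11(3) show ?case by (rule eval_elims) (use 11(2) in fastforce)
next
  case (12 env e u t e' u' t1)
  from 12(5) show ?case by (rule eval_elims) (use 12(3,4) in fastforce)
next
  case (13 env e u t e1 v t1 e2)
  from 13(6) show ?case by (rule eval_elims) (use 13(2,4,5) in fastforce)+
next
  case (14 env e t e2 v t1 e1)
  from 14(5) show ?case by (rule eval_elims) (use 14(3,4) in fastforce)+
next
  case (15 env e u t e' v t1)
  from 15(5) show ?case by (rule eval_elims) (use 15(3,4) in fastforce)
next
  case (16 env e u t m v t1)
  from 16(6) show ?case by (rule eval_elims) (use 16(4,5) in fastforce)
qed (erule eval_elims; simp)+

lemma runs_deterministic: "runs prg x y t \<Longrightarrow> runs prg x y' t' \<Longrightarrow> y' = y \<and> t' = t"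
  unfolding runs_def by (rule eval_deterministic)

lemma vsize_le_time: "eval prg env e v t \<Longrightarrow> vsize v \<le> t"
  by (induction rule: eval.induct) (auto simp: truth_def)


section \<open>Encoding of the input\<close>

definition vlist :: "('p, 'k) val list \<Rightarrow> ('p, 'k) val" where
  "vlist vs = foldr VPair vs VNil"

definition node :: "nat \<Rightarrow> ('p, 'k) val list \<Rightarrow> ('p, 'k) val" where
  "node c vs = VPair (VNum c) (vlist vs)"

definition enc_var :: "var \<Rightarrow> ('p, 'k) val" where
  "enc_var x = VPair (VNum (fst x)) (VNum (snd x))"

primrec enc_pil :: "('p \<times> var) pil \<Rightarrow> ('p, 'k) val" where
  "enc_pil PTrue = node 0 []"
| "enc_pil (PPort px) = node 1 [VPort (fst px), enc_var (snd px)]"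
| "enc_pil (PNot \<phi>) = node 2 [enc_pil \<phi>]"
| "enc_pil (POr \<phi> \<phi>') = node 3 [enc_pil \<phi>, enc_pil \<phi>']"

primrec enc_zeta :: "('p \<times> var) zeta \<Rightarrow> ('p, 'k) val" where
  "enc_zeta (ZPil \<phi>) = node 0 [enc_pil \<phi>]"
| "enc_zeta (ZCat \<zeta> \<zeta>') = node 1 [enc_zeta \<zeta>, enc_zeta \<zeta>']"

primrec enc_epil :: "('p \<times> var) epil \<Rightarrow> ('p, 'k) val" where
  "enc_epil (EPos \<zeta>) = node 0 [enc_zeta \<zeta>]"
| "enc_epil (ENeg \<zeta>) = node 1 [enc_zeta \<zeta>]"
| "enc_epil (EOr \<phi> \<phi>') = node 2 [enc_epil \<phi>, enc_epil \<phi>']"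
| "enc_epil (EAnd \<phi> \<phi>') = node 3 [enc_epil \<phi>, enc_epil \<phi>']"
| "enc_epil (ECat \<phi> \<phi>') = node 4 [enc_epil \<phi>, enc_epil \<phi>']"
| "enc_epil (EShuf \<phi> \<phi>') = node 5 [enc_epil \<phi>, enc_epil \<phi>']"
| "enc_epil (EPlus \<phi>) = node 6 [enc_epil \<phi>]"

primrec enc_foeil :: "'p foeil \<Rightarrow> ('p, 'k) val" where
  "enc_foeil (FEpil \<phi>) = node 0 [enc_epil \<phi>]"
| "enc_foeil (FEq x y) = node 1 [enc_var x, enc_var y]"
| "enc_foeil (FNeq x y) = node 2 [enc_var x, enc_var y]"
| "enc_foeil (FOr \<psi> \<psi>') = node 3 [enc_foeil \<psi>, enc_foeil \<psi>']"
| "enc_foeil (FAnd \<psi> \<psi>') = node 4 [enc_foeil \<psi>, enc_foeil \<psi>']"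
| "enc_foeil (FCat \<psi> \<psi>') = node 5 [enc_foeil \<psi>, enc_foeil \<psi>']"
| "enc_foeil (FShuf \<psi> \<psi>') = node 6 [enc_foeil \<psi>, enc_foeil \<psi>']"
| "enc_foeil (FPlus \<psi>) = node 7 [enc_foeil \<psi>]"
| "enc_foeil (FEx x \<psi>) = node 8 [enc_var x, enc_foeil \<psi>]"
| "enc_foeil (FAll x \<psi>) = node 9 [enc_var x, enc_foeil \<psi>]"
| "enc_foeil (FExCat x \<psi>) = node 10 [enc_var x, enc_foeil \<psi>]"
| "enc_foeil (FAllCat x \<psi>) = node 11 [enc_var x, enc_foeil \<psi>]"
| "enc_foeil (FExShuf x \<psi>) = node 12 [enc_var x, enc_foeil \<psi>]"
| "enc_foeil (FAllShuf x \<psi>) = node 13 [enc_var x, enc_foeil \<psi>]"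

primrec enc_wfoeil :: "('p, 'k) wfoeil \<Rightarrow> ('p, 'k) val" where
  "enc_wfoeil (WConst k) = node 0 [VWt k]"
| "enc_wfoeil (WBool \<psi>) = node 1 [enc_foeil \<psi>]"
| "enc_wfoeil (WAdd \<psi> \<psi>') = node 2 [enc_wfoeil \<psi>, enc_wfoeil \<psi>']"
| "enc_wfoeil (WMul \<psi> \<psi>') = node 3 [enc_wfoeil \<psi>, enc_wfoeil \<psi>']"
| "enc_wfoeil (WCat \<psi> \<psi>') = node 4 [enc_wfoeil \<psi>, enc_wfoeil \<psi>']"
| "enc_wfoeil (WShuf \<psi> \<psi>') = node 5 [enc_wfoeil \<psi>, enc_wfoeil \<psi>']"
| "enc_wfoeil (WPlus \<psi>) = node 6 [enc_wfoeil \<psi>]"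
| "enc_wfoeil (WSum x \<psi>) = node 7 [enc_var x, enc_wfoeil \<psi>]"
| "enc_wfoeil (WProd x \<psi>) = node 8 [enc_var x, enc_wfoeil \<psi>]"
| "enc_wfoeil (WSumCat x \<psi>) = node 9 [enc_var x, enc_wfoeil \<psi>]"
| "enc_wfoeil (WProdCat x \<psi>) = node 10 [enc_var x, enc_wfoeil \<psi>]"
| "enc_wfoeil (WSumShuf x \<psi>) = node 11 [enc_var x, enc_wfoeil \<psi>]"
| "enc_wfoeil (WProdShuf x \<psi>) = node 12 [enc_var x, enc_wfoeil \<psi>]"

text \<open>Component types are listed with their ports (in an order \<open>pl\<close>), the weights of the ports and
  the list \<open>1, \<dots>, r i\<close> of their instances, so that \<open>r i\<close> is given in unary.\<close>

definition lists_ports :: "('p, 'k) pwcomp \<Rightarrow> (nat \<Rightarrow> 'p list) \<Rightarrow> bool" where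
  "lists_ports B pl \<longleftrightarrow> (\<forall>i\<in>{1..ntypes B}. distinct (pl i) \<and> set (pl i) = ports B i)"

definition enc_type ::
  "('p, 'k) pwcomp \<Rightarrow> (nat \<Rightarrow> 'p list) \<Rightarrow> (nat \<Rightarrow> nat) \<Rightarrow> nat \<Rightarrow> ('p, 'k) val" where
  "enc_type B pl r i = vlist [VNum i,
     vlist (map (\<lambda>p. VPair (VPort p) (VWt (weight B i p))) (pl i)),
     vlist (map VNum [1..<Suc (r i)])]"

definition enc_input ::
  "('p, 'k) pwcomp \<Rightarrow> (nat \<Rightarrow> 'p list) \<Rightarrow> (nat \<Rightarrow> nat) \<Rightarrow> ('p, 'k) wfoeil \<Rightarrow> ('p, 'k) val" where
  "enc_input B pl r \<psi> =
     VPair (vlist (map (enc_type B pl r) [1..<Suc (ntypes B)])) (enc_wfoeil \<psi>)"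


section \<open>Encoding of the output\<close>

text \<open>The automaton has to be written out as a table: the vectors of the initial and of the terminal
  weights, and for every letter of the alphabet the matrix of its transition weights. The order of
  the letters, and of the ports in a letter, is left to the algorithm.\<close>

definition enc_letter :: "('p \<times> nat) list \<Rightarrow> ('p, 'k) val" where
  "enc_letter ps = vlist (map (\<lambda>(p, j). VPair (VPort p) (VNum j)) ps)"

definition wfa_code ::
  "('p \<times> nat) set set \<Rightarrow> (nat, ('p \<times> nat) set, 'k) wfa \<Rightarrow> ('p, 'k) val \<Rightarrow> bool" where
  "wfa_code I A y \<longleftrightarrow> (\<exists>N ls.
     states A = {..<N} \<and>
     distinct (map set ls) \<and> set ` set ls = I \<and> (\<forall>ps\<in>set ls. distinct ps) \<and>
     y = vlist [
       vlist (map (\<lambda>q. VWt (initial A q)) [0..<N]),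
       vlist (map (\<lambda>q. VWt (terminal A q)) [0..<N]),
       vlist (map (\<lambda>ps. VPair (enc_letter ps)
         (vlist (map (\<lambda>q. vlist (map (\<lambda>q'. VWt (trans A q (set ps) q')) [0..<N])) [0..<N]))) ls)])"


section \<open>Size of the input\<close>

text \<open>Running times are measured in the size of the instance for \<open>r\<close> of the sentence, in which the
  body of a quantifier over the instances of type \<open>i\<close> counts \<open>r i\<close> times (and at least once), plus
  the size of the component types and of \<open>r\<close>. In the number of symbols of the sentence alone the
  instance is exponential already, as quantifiers can be nested.\<close>

primrec pil_size :: "'v pil \<Rightarrow> nat" where
  "pil_size PTrue = 1"
| "pil_size (PPort p) = 1"
| "pil_size (PNot \<phi>) = 1 + pil_size \<phi>"
| "pil_size (POr \<phi> \<phi>') = 1 + pil_size \<phi> + pil_size \<phi>'"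

primrec zeta_size :: "'v zeta \<Rightarrow> nat" where
  "zeta_size (ZPil \<phi>) = pil_size \<phi>"
| "zeta_size (ZCat \<zeta> \<zeta>') = 1 + zeta_size \<zeta> + zeta_size \<zeta>'"

primrec epil_size :: "'v epil \<Rightarrow> nat" where
  "epil_size (EPos \<zeta>) = zeta_size \<zeta>"
| "epil_size (ENeg \<zeta>) = 1 + zeta_size \<zeta>"
| "epil_size (EOr \<phi> \<phi>') = 1 + epil_size \<phi> + epil_size \<phi>'"
| "epil_size (EAnd \<phi> \<phi>') = 1 + epil_size \<phi> + epil_size \<phi>'"
| "epil_size (ECat \<phi> \<phi>') = 1 + epil_size \<phi> + epil_size \<phi>'"
| "epil_size (EShuf \<phi> \<phi>') = 1 + epil_size \<phi> + epil_size \<phi>'"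
| "epil_size (EPlus \<phi>) = 1 + epil_size \<phi>"

definition copies :: "(nat \<Rightarrow> nat) \<Rightarrow> var \<Rightarrow> nat" where
  "copies r x = max 1 (r (fst x))"

primrec foeil_size :: "(nat \<Rightarrow> nat) \<Rightarrow> 'p foeil \<Rightarrow> nat" where
  "foeil_size r (FEpil \<phi>) = epil_size \<phi>"
| "foeil_size r (FEq x y) = 1"
| "foeil_size r (FNeq x y) = 1"
| "foeil_size r (FOr \<psi> \<psi>') = 1 + foeil_size r \<psi> + foeil_size r \<psi>'"
| "foeil_size r (FAnd \<psi> \<psi>') = 1 + foeil_size r \<psi> + foeil_size r \<psi>'"
| "foeil_size r (FCat \<psi> \<psi>') = 1 + foeil_size r \<psi> + foeil_size r \<psi>'"
| "foeil_size r (FShuf \<psi> \<psi>') = 1 + foeil_size r \<psi> + foeil_size r \<psi>'"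
| "foeil_size r (FPlus \<psi>) = 1 + foeil_size r \<psi>"
| "foeil_size r (FEx x \<psi>) = 1 + copies r x * foeil_size r \<psi>"
| "foeil_size r (FAll x \<psi>) = 1 + copies r x * foeil_size r \<psi>"
| "foeil_size r (FExCat x \<psi>) = 1 + copies r x * foeil_size r \<psi>"
| "foeil_size r (FAllCat x \<psi>) = 1 + copies r x * foeil_size r \<psi>"
| "foeil_size r (FExShuf x \<psi>) = 1 + copies r x * foeil_size r \<psi>"
| "foeil_size r (FAllShuf x \<psi>) = 1 + copies r x * foeil_size r \<psi>"

primrec wfoeil_size :: "(nat \<Rightarrow> nat) \<Rightarrow> ('p, 'k) wfoeil \<Rightarrow> nat" where
  "wfoeil_size r (WConst k) = 1"
| "wfoeil_size r (WBool \<psi>) = foeil_size r \<psi>"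
| "wfoeil_size r (WAdd \<psi> \<psi>') = 1 + wfoeil_size r \<psi> + wfoeil_size r \<psi>'"
| "wfoeil_size r (WMul \<psi> \<psi>') = 1 + wfoeil_size r \<psi> + wfoeil_size r \<psi>'"
| "wfoeil_size r (WCat \<psi> \<psi>') = 1 + wfoeil_size r \<psi> + wfoeil_size r \<psi>'"
| "wfoeil_size r (WShuf \<psi> \<psi>') = 1 + wfoeil_size r \<psi> + wfoeil_size r \<psi>'"
| "wfoeil_size r (WPlus \<psi>) = 1 + wfoeil_size r \<psi>"
| "wfoeil_size r (WSum x \<psi>) = 1 + copies r x * wfoeil_size r \<psi>"
| "wfoeil_size r (WProd x \<psi>) = 1 + copies r x * wfoeil_size r \<psi>"
| "wfoeil_size r (WSumCat x \<psi>) = 1 + copies r x * wfoeil_size r \<psi>"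
| "wfoeil_size r (WProdCat x \<psi>) = 1 + copies r x * wfoeil_size r \<psi>"
| "wfoeil_size r (WSumShuf x \<psi>) = 1 + copies r x * wfoeil_size r \<psi>"
| "wfoeil_size r (WProdShuf x \<psi>) = 1 + copies r x * wfoeil_size r \<psi>"

definition comp_size :: "('p, 'k) pwcomp \<Rightarrow> (nat \<Rightarrow> nat) \<Rightarrow> nat" where
  "comp_size B r = (\<Sum>i = 1..ntypes B. (1 + card (ports B i)) * (1 + r i))"

definition input_size ::
  "('p, 'k) pwcomp \<Rightarrow> (nat \<Rightarrow> nat) \<Rightarrow> ('p, 'k) wfoeil \<Rightarrow> nat" where
  "input_size B r \<psi> = comp_size B r + wfoeil_size r \<psi>"

end

theory Submission
  imports Defs
begin

text \<open>Quantifiers range over finitely many instances, so for a given \<open>r\<close> they can be unrolled. Grounding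
  turns a sentence into an expression that is built from weights and truth-valued expressions by sums,
  products, Cauchy products, shuffle products and iteration. The factors of these products have to be
  nonempty, while the neutral element of an iterated product is the series of the empty word; this is
  settled by nodes that reset the value of a series at the empty word. Every operation has its usual
  automaton. The truth-valued expressions are handled over the semiring of truth values and then
  determinized, since only the number of runs of a deterministic automaton is 0 or 1 in \<open>K\<close>; apart from
  this subset construction everything is exponential at most. Negations need no complementation of
  automata: \<open>\<zeta>\<close> is a concatenation of letter formulas, and its complement is a small expression.

  The program does not store automata. It computes start states, terminal weights and transition weights
  on demand, by recursion on the ground expression, and writes out the tables in the end. If \<open>U\<close> bounds
  the sizes of all lists involved, then a function on an expression of height \<open>k\<close> runs in time \<open>U\<close> to the
  power of \<open>O(k)\<close>. Here \<open>U\<close> is doubly exponential in general, and exponential for a sentence that is a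
  single letter formula.\<close>

section \<open>Evaluation as a function\<close>

text \<open>The logics give values to nonempty words only, so correctness is equality on nonempty
  words. A factor with value 1 at the empty word has a second use: it encodes the choice of a subset
  of instances, an index outside the subset contributing the empty word. A sum over exponentially
  many subsets thus becomes one iterated product of linear size. Every automaton has one start state
  of weight 1, and its states are themselves trees of the programming language, so that the program
  can compare and combine them. Sizes are controlled from above: the state list of an automaton
  inside a larger one is never larger than that of the whole, hence a bound on the final automaton
  covers all of them. With one base \<open>U\<close> above all sizes, a body without a loop adds 3
  to the exponent of the time and a loop adds 5; no polynomials are composed. \<open>U\<close> is
  chosen last, and the size of the state list enters as a parameter, so that the general case and
  the best case are two values of this parameter. The lower bound on the time comes from the output,
  which has one matrix per letter.\<close>

fun vfst :: "('p, 'k) val \<Rightarrow> ('p, 'k) val" where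
  "vfst (VPair u v) = u" | "vfst u = u"

fun vsnd :: "('p, 'k) val \<Rightarrow> ('p, 'k) val" where
  "vsnd (VPair u v) = v" | "vsnd u = u"

fun is_wt :: "('p, 'k) val \<Rightarrow> bool" where
  "is_wt (VWt k) = True" | "is_wt u = False"

fun the_wt :: "('p, 'k :: zero) val \<Rightarrow> 'k" where
  "the_wt (VWt k) = k" | "the_wt u = 0"

text \<open>Evaluation is deterministic, so a call of function \<open>m\<close> has at most one
  result and one running time; this turns both into functions. \<open>res\<close> and
  \<open>tm\<close> are meaningful only where \<open>halts\<close> holds.\<close>

definition halts ::
  "program \<Rightarrow> nat \<Rightarrow> ('p, 'k :: {comm_semiring_0, comm_monoid_mult}) val \<Rightarrow> bool" where
  "halts P m x \<longleftrightarrow> m < length P \<and> (\<exists>v t. eval P [x] (P ! m) v t)"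

definition res ::
  "program \<Rightarrow> nat \<Rightarrow> ('p, 'k :: {comm_semiring_0, comm_monoid_mult}) val \<Rightarrow> ('p, 'k) val" where
  "res P m x = (THE v. \<exists>t. eval P [x] (P ! m) v t)"

definition tm ::
  "program \<Rightarrow> nat \<Rightarrow> ('p, 'k :: {comm_semiring_0, comm_monoid_mult}) val \<Rightarrow> nat" where
  "tm P m x = (THE t. \<exists>v. eval P [x] (P ! m) v t)"

lemma halts_eval: "halts P m x \<Longrightarrow> eval P [x] (P ! m) (res P m x) (tm P m x)"
proof -
  assume "halts P m x"
  then obtain v t where e: "eval P [x] (P ! m) v t" by (auto simp: halts_def)
  have "res P m x = v" "tm P m x = t"
    unfolding res_def tm_def using e by (auto dest: eval_deterministic[OF e])
  then show ?thesis using e by simp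
qed

lemma vsize_res: "halts P m x \<Longrightarrow> vsize (res P m x) \<le> tm P m x"
  by (rule vsize_le_time[OF halts_eval])

lemma halts_eqI:
  assumes "m < length P" "eval P [x] (P ! m) v t"
  shows "halts P m x" "res P m x = v" "tm P m x = t"
proof -
  show h: "halts P m x" using assms by (auto simp: halts_def)
  show "res P m x = v" "tm P m x = t"
    using eval_deterministic[OF assms(2) halts_eval[OF h]] by auto
qed

text \<open>A functional reading of expressions: \<open>xv\<close> is the value, \<open>xok\<close> says that the evaluation does not
  get stuck, \<open>xc\<close> and \<open>xz\<close> add up the running times and the result sizes of the calls.\<close>

primrec xv ::
  "program \<Rightarrow> expr \<Rightarrow> ('p, 'k :: {comm_semiring_0, comm_monoid_mult}) val list \<Rightarrow> ('p, 'k) val" where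
  "xv P (Var m) = (\<lambda>env. env ! m)"
| "xv P CNil = (\<lambda>env. VNil)"
| "xv P (CNum m) = (\<lambda>env. VNum m)"
| "xv P CZero = (\<lambda>env. VWt 0)"
| "xv P COne = (\<lambda>env. VWt 1)"
| "xv P (MkPair e e') = (\<lambda>env. VPair (xv P e env) (xv P e' env))"
| "xv P (Fst e) = (\<lambda>env. vfst (xv P e env))"
| "xv P (Snd e) = (\<lambda>env. vsnd (xv P e env))"
| "xv P (Plus e e') = (\<lambda>env. VWt (the_wt (xv P e env) + the_wt (xv P e' env)))"
| "xv P (Times e e') = (\<lambda>env. VWt (the_wt (xv P e env) * the_wt (xv P e' env)))"
| "xv P (IsPair e) = (\<lambda>env. truth (is_pair (xv P e env)))"
| "xv P (Eq e e') = (\<lambda>env. truth (same_leaf (xv P e env) (xv P e' env)))"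
| "xv P (If e e1 e2) = (\<lambda>env. if xv P e env \<noteq> VNil then xv P e1 env else xv P e2 env)"
| "xv P (Let e e') = (\<lambda>env. xv P e' (xv P e env # env))"
| "xv P (Call m e) = (\<lambda>env. res P m (xv P e env))"

primrec xok ::
  "program \<Rightarrow> expr \<Rightarrow> ('p, 'k :: {comm_semiring_0, comm_monoid_mult}) val list \<Rightarrow> bool" where
  "xok P (Var m) = (\<lambda>env. m < length env)"
| "xok P CNil = (\<lambda>env. True)"
| "xok P (CNum m) = (\<lambda>env. True)"
| "xok P CZero = (\<lambda>env. True)"
| "xok P COne = (\<lambda>env. True)"
| "xok P (MkPair e e') = (\<lambda>env. xok P e env \<and> xok P e' env)"
| "xok P (Fst e) = (\<lambda>env. xok P e env \<and> is_pair (xv P e env))"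
| "xok P (Snd e) = (\<lambda>env. xok P e env \<and> is_pair (xv P e env))"
| "xok P (Plus e e') = (\<lambda>env. xok P e env \<and> xok P e' env \<and> is_wt (xv P e env) \<and> is_wt (xv P e' env))"
| "xok P (Times e e') = (\<lambda>env. xok P e env \<and> xok P e' env \<and> is_wt (xv P e env) \<and> is_wt (xv P e' env))"
| "xok P (IsPair e) = (\<lambda>env. xok P e env)"
| "xok P (Eq e e') = (\<lambda>env. xok P e env \<and> xok P e' env)"
| "xok P (If e e1 e2) =
     (\<lambda>env. xok P e env \<and> (if xv P e env \<noteq> VNil then xok P e1 env else xok P e2 env))"
| "xok P (Let e e') = (\<lambda>env. xok P e env \<and> xok P e' (xv P e env # env))"
| "xok P (Call m e) = (\<lambda>env. xok P e env \<and> halts P m (xv P e env))"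

primrec xc ::
  "program \<Rightarrow> expr \<Rightarrow> ('p, 'k :: {comm_semiring_0, comm_monoid_mult}) val list \<Rightarrow> nat" where
  "xc P (Var m) = (\<lambda>env. 0)"
| "xc P CNil = (\<lambda>env. 0)"
| "xc P (CNum m) = (\<lambda>env. 0)"
| "xc P CZero = (\<lambda>env. 0)"
| "xc P COne = (\<lambda>env. 0)"
| "xc P (MkPair e e') = (\<lambda>env. xc P e env + xc P e' env)"
| "xc P (Fst e) = (\<lambda>env. xc P e env)"
| "xc P (Snd e) = (\<lambda>env. xc P e env)"
| "xc P (Plus e e') = (\<lambda>env. xc P e env + xc P e' env)"
| "xc P (Times e e') = (\<lambda>env. xc P e env + xc P e' env)"
| "xc P (IsPair e) = (\<lambda>env. xc P e env)"
| "xc P (Eq e e') = (\<lambda>env. xc P e env + xc P e' env)"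
| "xc P (If e e1 e2) =
     (\<lambda>env. xc P e env + (if xv P e env \<noteq> VNil then xc P e1 env else xc P e2 env))"
| "xc P (Let e e') = (\<lambda>env. xc P e env + xc P e' (xv P e env # env))"
| "xc P (Call m e) = (\<lambda>env. xc P e env + tm P m (xv P e env))"

primrec xz ::
  "program \<Rightarrow> expr \<Rightarrow> ('p, 'k :: {comm_semiring_0, comm_monoid_mult}) val list \<Rightarrow> nat" where
  "xz P (Var m) = (\<lambda>env. 0)"
| "xz P CNil = (\<lambda>env. 0)"
| "xz P (CNum m) = (\<lambda>env. 0)"
| "xz P CZero = (\<lambda>env. 0)"
| "xz P COne = (\<lambda>env. 0)"
| "xz P (MkPair e e') = (\<lambda>env. xz P e env + xz P e' env)"
| "xz P (Fst e) = (\<lambda>env. xz P e env)"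
| "xz P (Snd e) = (\<lambda>env. xz P e env)"
| "xz P (Plus e e') = (\<lambda>env. xz P e env + xz P e' env)"
| "xz P (Times e e') = (\<lambda>env. xz P e env + xz P e' env)"
| "xz P (IsPair e) = (\<lambda>env. xz P e env)"
| "xz P (Eq e e') = (\<lambda>env. xz P e env + xz P e' env)"
| "xz P (If e e1 e2) =
     (\<lambda>env. xz P e env + (if xv P e env \<noteq> VNil then xz P e1 env else xz P e2 env))"
| "xz P (Let e e') = (\<lambda>env. xz P e env + xz P e' (xv P e env # env))"
| "xz P (Call m e) = (\<lambda>env. xz P e env + vsize (res P m (xv P e env)))"

text \<open>A constant of the expression that bounds its own work per unit of available data. For a
  pair the factor 2 pays for computing both parts and copying them again. In \<open>Let\<close> the
  body runs in an environment that has grown by a value of up to \<open>overhead e\<close> times the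
  data, whence the product.\<close>

primrec overhead :: "expr \<Rightarrow> nat" where
  "overhead (Var m) = 1"
| "overhead CNil = 1"
| "overhead (CNum m) = 1"
| "overhead CZero = 1"
| "overhead COne = 1"
| "overhead (MkPair e e') = 2 * (overhead e + overhead e') + 1"
| "overhead (Fst e) = 2 * overhead e"
| "overhead (Snd e) = 2 * overhead e"
| "overhead (Plus e e') = overhead e + overhead e' + 1"
| "overhead (Times e e') = overhead e + overhead e' + 1"
| "overhead (IsPair e) = overhead e + 1"
| "overhead (Eq e e') = overhead e + overhead e' + 1"
| "overhead (If e e1 e2) = overhead e + overhead e1 + overhead e2 + 1"
| "overhead (Let e e') = overhead e + overhead e' * (overhead e + 1) + 1"
| "overhead (Call m e) = overhead e + 1"

lemma is_pair_iff: "is_pair u \<longleftrightarrow> u = VPair (vfst u) (vsnd u)"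
  by (cases u) auto

lemma is_wt_iff: "is_wt u \<longleftrightarrow> u = VWt (the_wt u)"
  by (cases u) auto

lemma vsize_pos: "vsize u \<ge> 1"
  by (cases u) auto

lemma vsize_vfst: "vsize (vfst u) \<le> vsize u" and vsize_vsnd: "vsize (vsnd u) \<le> vsize u"
  by (cases u; simp)+

definition esz :: "('p, 'k) val list \<Rightarrow> nat" where "esz env = (\<Sum>v\<leftarrow>env. vsize v)"

lemma vsize_nth_esz: "m < length env \<Longrightarrow> vsize (env ! m) \<le> esz env"
  unfolding esz_def using elem_le_sum_list[of m "map vsize env"] by simp

lemma vsize_truth: "vsize (truth b) = 1"
  by (simp add: truth_def)

text \<open>The time of the called functions is kept apart and enters with factor 1; the work of the
  expression itself is linear in the environment and in the results of the calls. The factor 1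
  matters, since a larger constant would be multiplied again at each level of a recursion. The size
  bound is carried along because \<open>Let\<close> puts values into the environment.\<close>

lemma eval_xv:
  "xok P e env \<Longrightarrow> \<exists>t. eval P env e (xv P e env) t \<and>
     t \<le> xc P e env + overhead e * (esz env + xz P e env + 1) \<and>
     vsize (xv P e env) \<le> overhead e * (esz env + xz P e env + 1)"
proof (induction e arbitrary: env)
  case (Var m)
  have "eval P env (Var m) (env ! m) (vsize (env ! m))" using Var by (auto intro: eval.intros)
  moreover have "vsize (env ! m) \<le> esz env" using Var vsize_nth_esz by auto
  ultimately show ?case by (auto intro!: exI)
next
  case CNil
  have "eval P env CNil VNil 1" by (rule eval.intros)
  then show ?case by (auto intro!: exI)
next
  case (CNum m)
  have "eval P env (CNum m) (VNum m) 1" by (rule eval.intros)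
  then show ?case by (auto intro!: exI)
next
  case CZero
  have "eval P env CZero (VWt 0) 1" by (rule eval.intros)
  then show ?case by (auto intro!: exI)
next
  case COne
  have "eval P env COne (VWt 1) 1" by (rule eval.intros)
  then show ?case by (auto intro!: exI)
next
  case (MkPair e e')
  define X where "X = esz env + xz P (MkPair e e') env + 1"
  from MkPair.prems obtain t t' where
    t: "eval P env e (xv P e env) t" "t \<le> xc P e env + overhead e * (esz env + xz P e env + 1)"
      "vsize (xv P e env) \<le> overhead e * (esz env + xz P e env + 1)" and
    t': "eval P env e' (xv P e' env) t'" "t' \<le> xc P e' env + overhead e' * (esz env + xz P e' env + 1)"
      "vsize (xv P e' env) \<le> overhead e' * (esz env + xz P e' env + 1)"
    using MkPair.IH by fastforce
  have a: "overhead e * (esz env + xz P e env + 1) \<le> overhead e * X"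
    "overhead e' * (esz env + xz P e' env + 1) \<le> overhead e' * X" by (auto intro!: mult_le_mono2 simp: X_def)
  have b: "overhead (MkPair e e') * X = 2 * (overhead e * X) + 2 * (overhead e' * X) + X"
    by (simp add: algebra_simps)
  have c: "1 \<le> X" by (simp add: X_def)
  have "eval P env (MkPair e e') (xv P (MkPair e e') env)
      (t + t' + vsize (VPair (xv P e env) (xv P e' env)))"
    using eval.intros(6)[OF t(1) t'(1)] by simp
  moreover have "t + t' + vsize (VPair (xv P e env) (xv P e' env)) \<le>
      xc P (MkPair e e') env + overhead (MkPair e e') * X"
    using t(2,3) t'(2,3) a c unfolding b xc.simps vsize.simps by linarith
  moreover have "vsize (xv P (MkPair e e') env) \<le> overhead (MkPair e e') * X"
    using t(2,3) t'(2,3) a c unfolding b xv.simps vsize.simps by linarith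
  ultimately show ?case unfolding X_def by blast
next
  case (Fst e)
  then obtain t where
    t: "eval P env e (xv P e env) t" "t \<le> xc P e env + overhead e * (esz env + xz P e env + 1)"
      "vsize (xv P e env) \<le> overhead e * (esz env + xz P e env + 1)" by fastforce
  have "is_pair (xv P e env)" using Fst.prems by simp
  then have "eval P env (Fst e) (vfst (xv P e env)) (t + vsize (vfst (xv P e env)))"
    using t(1) is_pair_iff eval.intros(7) by metis
  then show ?case using t(2,3) vsize_vfst[of "xv P e env"] by (intro exI conjI) auto
next
  case (Snd e)
  then obtain t where
    t: "eval P env e (xv P e env) t" "t \<le> xc P e env + overhead e * (esz env + xz P e env + 1)"
      "vsize (xv P e env) \<le> overhead e * (esz env + xz P e env + 1)" by fastforce
  have "is_pair (xv P e env)" using Snd.prems by simp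
  then have "eval P env (Snd e) (vsnd (xv P e env)) (t + vsize (vsnd (xv P e env)))"
    using t(1) is_pair_iff eval.intros(8) by metis
  then show ?case using t(2,3) vsize_vsnd[of "xv P e env"] by (intro exI conjI) auto
next
  case (Plus e e')
  define X where "X = esz env + xz P (Plus e e') env + 1"
  from Plus.prems obtain t t' where
    t: "eval P env e (xv P e env) t" "t \<le> xc P e env + overhead e * (esz env + xz P e env + 1)" and
    t': "eval P env e' (xv P e' env) t'" "t' \<le> xc P e' env + overhead e' * (esz env + xz P e' env + 1)"
    using Plus.IH by fastforce
  have a: "overhead e * (esz env + xz P e env + 1) \<le> overhead e * X"
    "overhead e' * (esz env + xz P e' env + 1) \<le> overhead e' * X" by (auto intro!: mult_le_mono2 simp: X_def)
  have b: "overhead (Plus e e') * X = overhead e * X + overhead e' * X + X"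
    by (simp add: algebra_simps)
  have c: "1 \<le> X" by (simp add: X_def)
  have "eval P env (Plus e e') (xv P (Plus e e') env) (t + t' + 1)"
  proof -
    have "is_wt (xv P e env)" "is_wt (xv P e' env)" using Plus.prems by simp_all
    then obtain k k' where k: "xv P e env = VWt k" "xv P e' env = VWt k'" by (metis is_wt_iff)
    show ?thesis using eval.intros(9)[OF t(1)[unfolded k] t'(1)[unfolded k]] by (simp add: k)
  qed
  moreover have "t + t' + 1 \<le> xc P (Plus e e') env + overhead (Plus e e') * X"
    using t(2) t'(2) a c unfolding b xc.simps by linarith
  moreover have "vsize (xv P (Plus e e') env) \<le> overhead (Plus e e') * X"
    using c unfolding b by simp
  ultimately show ?case unfolding X_def by blast
next
  case (Times e e')
  define X where "X = esz env + xz P (Times e e') env + 1"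
  from Times.prems obtain t t' where
    t: "eval P env e (xv P e env) t" "t \<le> xc P e env + overhead e * (esz env + xz P e env + 1)" and
    t': "eval P env e' (xv P e' env) t'" "t' \<le> xc P e' env + overhead e' * (esz env + xz P e' env + 1)"
    using Times.IH by fastforce
  have a: "overhead e * (esz env + xz P e env + 1) \<le> overhead e * X"
    "overhead e' * (esz env + xz P e' env + 1) \<le> overhead e' * X" by (auto intro!: mult_le_mono2 simp: X_def)
  have b: "overhead (Times e e') * X = overhead e * X + overhead e' * X + X"
    by (simp add: algebra_simps)
  have c: "1 \<le> X" by (simp add: X_def)
  have "eval P env (Times e e') (xv P (Times e e') env) (t + t' + 1)"
  proof -
    have "is_wt (xv P e env)" "is_wt (xv P e' env)" using Times.prems by simp_all
    then obtain k k' where k: "xv P e env = VWt k" "xv P e' env = VWt k'" by (metis is_wt_iff)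
    show ?thesis using eval.intros(10)[OF t(1)[unfolded k] t'(1)[unfolded k]] by (simp add: k)
  qed
  moreover have "t + t' + 1 \<le> xc P (Times e e') env + overhead (Times e e') * X"
    using t(2) t'(2) a c unfolding b xc.simps by linarith
  moreover have "vsize (xv P (Times e e') env) \<le> overhead (Times e e') * X"
    using c unfolding b by simp
  ultimately show ?case unfolding X_def by blast
next
  case (IsPair e)
  then obtain t where
    t: "eval P env e (xv P e env) t" "t \<le> xc P e env + overhead e * (esz env + xz P e env + 1)"
    by fastforce
  show ?case using eval.intros(11)[OF t(1)] t(2) by (intro exI conjI) (auto simp: vsize_truth)
next
  case (Eq e e')
  define X where "X = esz env + xz P (Eq e e') env + 1"
  from Eq.prems obtain t t' where
    t: "eval P env e (xv P e env) t" "t \<le> xc P e env + overhead e * (esz env + xz P e env + 1)" and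
    t': "eval P env e' (xv P e' env) t'" "t' \<le> xc P e' env + overhead e' * (esz env + xz P e' env + 1)"
    using Eq.IH by fastforce
  have a: "overhead e * (esz env + xz P e env + 1) \<le> overhead e * X"
    "overhead e' * (esz env + xz P e' env + 1) \<le> overhead e' * X" by (auto intro!: mult_le_mono2 simp: X_def)
  have b: "overhead (Eq e e') * X = overhead e * X + overhead e' * X + X"
    by (simp add: algebra_simps)
  have c: "1 \<le> X" by (simp add: X_def)
  have "eval P env (Eq e e') (xv P (Eq e e') env) (t + t' + 1)"
    using eval.intros(12)[OF t(1) t'(1)] by simp
  moreover have "t + t' + 1 \<le> xc P (Eq e e') env + overhead (Eq e e') * X"
    using t(2) t'(2) a c unfolding b xc.simps by linarith
  moreover have "vsize (xv P (Eq e e') env) \<le> overhead (Eq e e') * X"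
    using c unfolding b by (simp add: vsize_truth)
  ultimately show ?case unfolding X_def by blast
next
  case (If e e1 e2)
  define X where "X = esz env + xz P (If e e1 e2) env + 1"
  let ?e = "if xv P e env \<noteq> VNil then e1 else e2"
  from If.prems If.IH(1)[of env] obtain t where
    t: "eval P env e (xv P e env) t" "t \<le> xc P e env + overhead e * (esz env + xz P e env + 1)"
    by auto
  from If.prems If.IH(2,3)[of env] obtain t' where
    t': "eval P env ?e (xv P ?e env) t'" "t' \<le> xc P ?e env + overhead ?e * (esz env + xz P ?e env + 1)"
    "vsize (xv P ?e env) \<le> overhead ?e * (esz env + xz P ?e env + 1)"
    by (auto split: if_splits)
  have x: "xz P (If e e1 e2) env = xz P e env + xz P ?e env"
    "xc P (If e e1 e2) env = xc P e env + xc P ?e env"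
    "xv P (If e e1 e2) env = xv P ?e env" by auto
  have a: "overhead e * (esz env + xz P e env + 1) \<le> overhead e * X"
    "overhead ?e * (esz env + xz P ?e env + 1) \<le> (overhead e1 + overhead e2) * X"
    by (rule mult_le_mono; simp add: x X_def)+
  have b: "overhead (If e e1 e2) * X = overhead e * X + (overhead e1 + overhead e2) * X + X"
    by (simp add: algebra_simps)
  have c: "1 \<le> X" by (simp add: X_def)
  have "eval P env (If e e1 e2) (xv P (If e e1 e2) env) (t + t' + 1)"
  proof (cases "xv P e env = VNil")
    case True
    then show ?thesis using t t' eval.intros(14)[of P env e t e2 "xv P e2 env" t' e1] by simp
  next
    case False
    then show ?thesis using eval.intros(13)[OF t(1) False, of e1 "xv P e1 env" t' e2] t' by simp
  qed
  moreover have "t + t' + 1 \<le> xc P (If e e1 e2) env + overhead (If e e1 e2) * X"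
    unfolding b x(2) using t(2) t'(2) a c by linarith
  moreover have "vsize (xv P (If e e1 e2) env) \<le> overhead (If e e1 e2) * X"
    unfolding b x(3) using t'(3) a c by linarith
  ultimately show ?case unfolding X_def by blast
next
  case (Let e e')
  define X where "X = esz env + xz P (Let e e') env + 1"
  let ?env = "xv P e env # env"
  from Let.prems Let.IH(1)[of env] obtain t where
    t: "eval P env e (xv P e env) t" "t \<le> xc P e env + overhead e * (esz env + xz P e env + 1)"
      "vsize (xv P e env) \<le> overhead e * (esz env + xz P e env + 1)" by auto
  from Let.prems Let.IH(2)[of ?env] obtain t' where
    t': "eval P ?env e' (xv P e' ?env) t'" "t' \<le> xc P e' ?env + overhead e' * (esz ?env + xz P e' ?env + 1)"
      "vsize (xv P e' ?env) \<le> overhead e' * (esz ?env + xz P e' ?env + 1)" by auto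
  have a: "overhead e * (esz env + xz P e env + 1) \<le> overhead e * X" by (auto intro!: mult_le_mono2 simp: X_def)
  have "esz ?env + xz P e' ?env + 1 \<le> (overhead e + 1) * X"
    using t(3) a by (simp add: esz_def X_def algebra_simps)
  then have a': "overhead e' * (esz ?env + xz P e' ?env + 1) \<le> overhead e' * (overhead e + 1) * X"
    by (metis mult.assoc mult_le_mono2)
  have b: "overhead (Let e e') * X = overhead e * X + overhead e' * (overhead e + 1) * X + X"
    by (simp add: algebra_simps)
  have c: "1 \<le> X" by (simp add: X_def)
  have "t + t' + 1 \<le> xc P (Let e e') env + overhead (Let e e') * X"
    unfolding b using t t' a a' c by simp
  moreover have "vsize (xv P (Let e e') env) \<le> overhead (Let e e') * X"
    unfolding b using t' a' c by simp
  moreover have "eval P env (Let e e') (xv P (Let e e') env) (t + t' + 1)"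
    using eval.intros(15)[OF t(1) t'(1)] by simp
  ultimately show ?case unfolding X_def by blast
next
  case (Call m e)
  then obtain t where
    t: "eval P env e (xv P e env) t" "t \<le> xc P e env + overhead e * (esz env + xz P e env + 1)"
    by fastforce
  define X where "X = esz env + xz P (Call m e) env + 1"
  have h: "halts P m (xv P e env)" using Call.prems by simp
  have "eval P env (Call m e) (xv P (Call m e) env) (t + tm P m (xv P e env) + 1)"
    using eval.intros(16)[OF t(1) _ halts_eval[OF h]] h by (simp add: halts_def)
  moreover have a: "overhead e * (esz env + xz P e env + 1) \<le> overhead e * X"
    by (auto intro!: mult_le_mono2 simp: X_def)
  moreover have b: "overhead (Call m e) * X = overhead e * X + X" by simp
  moreover have "vsize (xv P (Call m e) env) \<le> X" "1 \<le> X" by (simp_all add: X_def)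
  ultimately have "eval P env (Call m e) (xv P (Call m e) env) (t + tm P m (xv P e env) + 1)"
    "t + tm P m (xv P e env) + 1 \<le> xc P (Call m e) env + overhead (Call m e) * X"
    "vsize (xv P (Call m e) env) \<le> overhead (Call m e) * X"
    using t(2) unfolding xc.simps by linarith+
  then show ?case unfolding X_def by blast
qed

text \<open>Producing a value costs at least its size, so a time bound for the calls also bounds
  everything they return.\<close>

lemma xz_le_xc: "xok P e env \<Longrightarrow> xz P e env \<le> xc P e env"
proof (induction e arbitrary: env)
  case (Call m e)
  then show ?case using vsize_res[of P m "xv P e env"] by (fastforce simp: add_mono)
next
  case (If e e1 e2)
  then show ?case by (auto split: if_splits intro!: add_mono)
qed (auto intro!: add_mono)

text \<open>One constant for the whole program, above the overhead of each of its bodies.\<close>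

definition kappa :: "program \<Rightarrow> nat" where "kappa P = (\<Sum>e\<leftarrow>P. overhead e)"

lemma run_body:
  assumes "m < length P" "xok P (P ! m) [x]"
  shows "halts P m x \<and> res P m x = xv P (P ! m) [x] \<and>
    tm P m x \<le> xc P (P ! m) [x] + kappa P * (vsize x + xz P (P ! m) [x] + 1)"
proof -
  obtain t where t: "eval P [x] (P ! m) (xv P (P ! m) [x]) t"
    "t \<le> xc P (P ! m) [x] + overhead (P ! m) * (esz [x] + xz P (P ! m) [x] + 1)"
    using eval_xv[OF assms(2)] by blast
  have "overhead (P ! m) \<le> kappa P" unfolding kappa_def
    using assms(1) by (metis elem_le_sum_list length_map nth_map)
  then have "overhead (P ! m) * (esz [x] + xz P (P ! m) [x] + 1) \<le> kappa P * (vsize x + xz P (P ! m) [x] + 1)"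
    by (intro mult_le_mono) (auto simp: esz_def)
  then show ?thesis using halts_eqI[OF assms(1) t(1)] t(2) by auto
qed

section \<open>Running times as powers\<close>

text \<open>All times are powers of one base \<open>U\<close> that lies above the sizes of the data;
  composing functions then only adds to the exponent.\<close>

definition computes ::
  "program \<Rightarrow> nat \<Rightarrow> nat \<Rightarrow> ('p, 'k :: {comm_semiring_0, comm_monoid_mult}) val \<Rightarrow> ('p, 'k) val \<Rightarrow> nat \<Rightarrow> bool" where
  "computes P U m x y k \<longleftrightarrow> halts P m x \<and> res P m x = y \<and> tm P m x \<le> U ^ k"

lemma computesD:
  assumes "computes P U m x y k"
  shows "halts P m x" "res P m x = y" "tm P m x \<le> U ^ k"
  using assms by (auto simp: computes_def)

lemma computes_mono: "computes P U m x y k \<Longrightarrow> k \<le> k' \<Longrightarrow> 1 \<le> U \<Longrightarrow> computes P U m x y k'"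
  unfolding computes_def using power_increasing[of k k' U] by (meson le_trans)

text \<open>With 64 below \<open>U\<close>, the numerical constants of the estimates are absorbed by
  further factors \<open>U\<close>.\<close>

definition large :: "program \<Rightarrow> nat \<Rightarrow> bool" where
  "large P U \<longleftrightarrow> 64 \<le> U \<and> kappa P \<le> U"

text \<open>Three new factors \<open>U\<close>: one for \<open>kappa\<close>, one for the constant
  in front of the data size, one for adding up the terms.\<close>

lemma computes_body:
  assumes U: "large P U" and m: "m < length P" and ok: "xok P (P ! m) [x]"
    and x: "vsize x \<le> U ^ k" and c: "xc P (P ! m) [x] \<le> 16 * U ^ k" and k: "1 \<le> k" "k + 3 \<le> k'"
  shows "computes P U m x (xv P (P ! m) [x]) k'"
proof -
  have u: "64 \<le> U" "kappa P \<le> U" using U by (auto simp: large_def)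
  have u1: "1 \<le> U ^ k" using u by simp
  have "vsize x + xz P (P ! m) [x] + 1 \<le> 18 * U ^ k"
    using x c xz_le_xc[OF ok] u1 by linarith
  then have "kappa P * (vsize x + xz P (P ! m) [x] + 1) \<le> U * (18 * U ^ k)"
    using u by (intro mult_le_mono) auto
  then have "tm P m x \<le> 16 * U ^ k + U * (18 * U ^ k)"
    using run_body[OF m ok] c by linarith
  also have "\<dots> \<le> U * U ^ k + U * (U * U ^ k)"
    using u by (intro add_mono mult_le_mono) auto
  also have "\<dots> \<le> U * (U * U ^ k) + U * (U * U ^ k)"
    using u by (intro add_mono mult_le_mono) auto
  also have "\<dots> = 2 * (U * (U * U ^ k))" by simp
  also have "\<dots> \<le> U * (U * (U * U ^ k))" using u by (intro mult_le_mono) auto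
  also have "\<dots> = U ^ Suc (Suc (Suc k))" by simp
  also have "\<dots> \<le> U ^ k'" using u k by (intro power_increasing) auto
  finally show ?thesis using run_body[OF m ok] by (simp add: computes_def)
qed

lemma computesI:
  assumes U: "large P U" and m: "m < length P" and b: "P ! m = b" and ok: "xok P b [x]"
    and y: "xv P b [x] = y"
    and x: "vsize x \<le> U ^ k" and c: "xc P b [x] \<le> 16 * U ^ k" and k: "1 \<le> k" "k + 3 \<le> k'"
  shows "computes P U m x y k'"
  using computes_body[OF U m _ x _ k] ok c unfolding b y by blast

text \<open>A right fold over the second half of the argument, with the first half as a constant
  context. In \<open>base\<close> the argument is \<open>Var 0\<close>; in \<open>step\<close> the
  result for the tail is \<open>Var 0\<close> and the argument has moved to
  \<open>Var 1\<close>.\<close>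

definition fold_body :: "nat \<Rightarrow> expr \<Rightarrow> expr \<Rightarrow> expr" where
  "fold_body self base step =
     If (IsPair (Snd (Var 0)))
       (Let (Call self (MkPair (Fst (Var 0)) (Snd (Snd (Var 0))))) step) base"

lemma vlist_simps [simp]: "vlist [] = VNil" "vlist (v # vs) = VPair v (vlist vs)"
  by (simp_all add: vlist_def)

lemma is_pair_vlist [simp]: "is_pair (vlist vs) \<longleftrightarrow> vs \<noteq> []"
  by (cases vs) auto

lemma vlist_inject [simp]: "vlist vs = vlist vs' \<longleftrightarrow> vs = vs'"
proof (induction vs arbitrary: vs')
  case Nil
  then show ?case by (cases vs') auto
next
  case (Cons v vs)
  then show ?case by (cases vs') auto
qed

lemma vsize_vlist: "vsize (vlist vs) = 1 + (\<Sum>v\<leftarrow>vs. 1 + vsize v)"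
  by (induction vs) auto

lemma length_le_vsize_vlist: "length vs < vsize (vlist vs)"
  by (induction vs) auto

lemma truth_eq_VNil [simp]: "truth b = VNil \<longleftrightarrow> \<not> b"
  by (simp add: truth_def)

text \<open>A recursion along a list must not raise the exponent in each round, so the rounds are
  added up: there are at most \<open>U ^ 2\<close> of them, and each costs its own calls plus
  \<open>U\<close> times the data at hand. This makes five further factors in total. The hypotheses
  speak of suffixes of \<open>xs\<close>, the only lists that occur.\<close>

lemma computes_fold:
  assumes U: "large P U" and m: "m < length P" and body: "P ! m = fold_body m base step"
    and base: "xok P base [VPair c VNil]" "xv P base [VPair c VNil] = G []"
      "xc P base [VPair c VNil] \<le> 8 * U ^ k"
    and step: "\<And>x ys. \<exists>zs. xs = zs @ x # ys \<Longrightarrow>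
      xok P step [G ys, VPair c (VPair (ex x) (vlist (map ex ys)))] \<and>
      xv P step [G ys, VPair c (VPair (ex x) (vlist (map ex ys)))] = G (x # ys) \<and>
      xc P step [G ys, VPair c (VPair (ex x) (vlist (map ex ys)))] \<le> 8 * U ^ k"
    and size: "\<And>ys. \<exists>zs. xs = zs @ ys \<Longrightarrow> vsize (G ys) \<le> U ^ 2"
      "vsize (VPair c (vlist (map ex xs))) \<le> U ^ 2"
    and k: "2 \<le> k" "k + 5 \<le> k'"
  shows "computes P U m (VPair c (vlist (map ex xs))) (G xs) k'"
proof -
  have u: "64 \<le> U" "kappa P \<le> U" using U by (auto simp: large_def)
  have uk: "U ^ 2 \<le> U ^ k" "1 \<le> U ^ k" using u k by (auto intro: power_increasing)
  \<comment> \<open>The first summand pays for the calls in \<open>step\<close> or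
    \<open>base\<close>, the second for the work of the body itself, with \<open>kappa\<close>
    estimated by \<open>U\<close>.\<close>
  let ?B = "8 * U ^ k + U * (12 * U ^ k)"
  have gen: "(\<exists>zs. xs = zs @ ys) \<Longrightarrow> halts P m (VPair c (vlist (map ex ys))) \<and> res P m (VPair c (vlist (map ex ys))) = G ys \<and>
      tm P m (VPair c (vlist (map ex ys))) \<le> Suc (length ys) * ?B" for ys
  proof (induction ys)
    case Nil
    have ok: "xok P (P ! m) [VPair c (vlist [])]" using base by (simp add: body fold_body_def)
    have cc: "xc P (P ! m) [VPair c (vlist [])] \<le> 8 * U ^ k"
      and v: "xv P (P ! m) [VPair c (vlist [])] = G []"
      using base by (simp_all add: body fold_body_def)
    have "vsize (VPair c VNil) \<le> vsize (VPair c (vlist (map ex xs)))" using vsize_pos[of "vlist (map ex xs)"] by simp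
    then have "kappa P * (vsize (VPair c (vlist [])) + xz P (P ! m) [VPair c (vlist [])] + 1) \<le> U * (12 * U ^ k)"
      using u uk xz_le_xc[OF ok] cc size(2)
      unfolding vlist_simps by (intro mult_le_mono) linarith+
    then show ?case using run_body[OF m ok] cc v by simp
  next
    case (Cons y ys)
    from Cons.prems obtain zs where zs: "xs = zs @ y # ys" by blast
    then have "xs = (zs @ [y]) @ ys" by simp
    then have suf: "\<exists>zs. xs = zs @ ys" by blast
    note IH = Cons.IH[OF suf]
    have st: "xok P step [G ys, VPair c (VPair (ex y) (vlist (map ex ys)))]"
      "xv P step [G ys, VPair c (VPair (ex y) (vlist (map ex ys)))] = G (y # ys)"
      "xc P step [G ys, VPair c (VPair (ex y) (vlist (map ex ys)))] \<le> 8 * U ^ k" using step zs by blast+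
    let ?x = "VPair c (VPair (ex y) (vlist (map ex ys)))"
    have ok: "xok P (P ! m) [?x]" and v: "xv P (P ! m) [?x] = G (y # ys)"
      using st IH by (simp_all add: body fold_body_def)
    have cc: "xc P (P ! m) [?x] \<le> Suc (length ys) * ?B + 8 * U ^ k"
      and zz: "xz P (P ! m) [?x] \<le> U ^ 2 + 8 * U ^ k"
      using st IH xz_le_xc[OF st(1)] size(1)[OF suf] by (simp_all add: body fold_body_def)
    have "vsize (VPair c (vlist (map ex xs))) \<ge> vsize ?x"
      unfolding zs by (simp add: vsize_vlist)
    then have "kappa P * (vsize ?x + xz P (P ! m) [?x] + 1) \<le> U * (12 * U ^ k)"
      using u uk zz size(2) by (intro mult_le_mono) linarith+
    then have "tm P m ?x \<le> Suc (length ys) * ?B + 8 * U ^ k + U * (12 * U ^ k)"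
      using run_body[OF m ok] cc by linarith
    then show ?case using run_body[OF m ok] v by simp
  qed
  have "Suc (length xs) \<le> U ^ 2" using length_le_vsize_vlist[of "map ex xs"] size(2) by simp
  then have "Suc (length xs) * ?B \<le> U ^ 2 * (U * U ^ k + U * (U * U ^ k))"
    using u by (intro mult_le_mono add_mono) auto
  also have "\<dots> \<le> U ^ 2 * (U * (U * U ^ k) + U * (U * U ^ k))"
    using u by (intro mult_le_mono add_mono) auto
  also have "\<dots> = U ^ 2 * (2 * (U * (U * U ^ k)))" by simp
  also have "\<dots> \<le> U ^ 2 * (U * (U * (U * U ^ k)))" using u by (intro mult_le_mono) auto
  also have "\<dots> = U ^ Suc (Suc (Suc (Suc (Suc k))))" by (simp add: power2_eq_square)
  also have "\<dots> \<le> U ^ k'" using u k by (intro power_increasing) auto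
  finally have "Suc (length xs) * ?B \<le> U ^ k'" .
  then show ?thesis using gen[of xs] by (auto simp: computes_def)
qed

declare One_nat_def [simp del]

section \<open>The program\<close>

abbreviation "arg \<equiv> Var 0"
abbreviation "foldctx \<equiv> Fst (Var 1)"
abbreviation "foldelt \<equiv> Fst (Snd (Var 1))"

text \<open>Function 1, on \<open>((x, acc), ys)\<close>: pairs \<open>x\<close> with every element
  of \<open>ys\<close> and puts the list \<open>acc\<close> behind. Since consing is pairing, the
  same function serves tagged unions, products, subsequences and letters.\<close>

definition "pon_body = fold_body 1 (Snd (Fst arg))
   (MkPair (MkPair (Fst foldctx) foldelt) (Var 0))"

text \<open>Function 2, on \<open>(ys, xs)\<close>, yields \<open>pairl xs ys\<close>; the second
  list is the one that is folded over.\<close>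

definition "prodl_body = fold_body 2 CNil
   (Call 1 (MkPair (MkPair foldelt (Var 0)) foldctx))"

text \<open>Function 3: structural equality of trees, since \<open>Eq\<close> compares leaves
  only.\<close>

definition "teq_body =
   If (IsPair (Fst arg))
     (If (IsPair (Snd arg))
       (If (Call 3 (MkPair (Fst (Fst arg)) (Fst (Snd arg))))
         (Call 3 (MkPair (Snd (Fst arg)) (Snd (Snd arg)))) CNil)
       CNil)
     (Eq (Fst arg) (Snd arg))"

text \<open>\<open>Eq\<close> fails on weights, even on equal ones, so comparing an argument with itself tells truth values
  from weights.\<close>

definition "add_body = If (Eq (Fst arg) (Fst arg)) (If (Fst arg) (CNum 1) (Snd arg)) (Plus (Fst arg) (Snd arg))"

definition "mul_body = If (Eq (Fst arg) (Fst arg)) (If (Fst arg) (Snd arg) CNil) (Times (Fst arg) (Snd arg))"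

text \<open>Functions 6 and 7: membership of a key, and lookup in a list of pairs. Like
  \<open>map_of\<close>, lookup takes the first match, so that inner bindings hide outer ones; it
  returns \<open>VNil\<close> if there is none.\<close>

definition "mem_body = fold_body 6 CNil (If (Call 3 (MkPair foldctx foldelt)) (CNum 1) (Var 0))"

definition "look_body = fold_body 7 CNil
   (If (Call 3 (MkPair foldctx (Fst foldelt))) (Snd foldelt) (Var 0))"

section \<open>Program: letter formulas, the alphabet, and grounding\<close>

abbreviation "ctx \<equiv> Fst arg"
abbreviation "tag \<equiv> Fst (Snd arg)"
abbreviation "arg1 \<equiv> Fst (Snd (Snd arg))"
abbreviation "arg2 \<equiv> Fst (Snd (Snd (Snd arg)))"

text \<open>Function 8, on \<open>((letter, env), formula)\<close>. Formulas stay unsubstituted; a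
  port is instantiated by looking up its variable at the moment it is tested.\<close>

definition "psat_body =
   If (Eq tag (CNum 0)) (CNum 1)
   (If (Eq tag (CNum 1))
     (Call 6 (MkPair (MkPair arg1 (Call 7 (MkPair arg2 (Snd ctx)))) (Fst ctx)))
   (If (Eq tag (CNum 2)) (If (Call 8 (MkPair ctx arg1)) CNil (CNum 1))
     (If (Call 8 (MkPair ctx arg1)) (CNum 1) (Call 8 (MkPair ctx arg2)))))"

text \<open>Functions 9 to 11 build the letters by nested folds over ports, instances and types.
  Each port of an instance is put in front of all letters found so far, and these letters are kept
  as well, being those that avoid the instance. The innermost start value is the list that holds
  only the empty letter.\<close>

definition "lport_body = fold_body 9 (Snd (Fst arg))
   (Call 1 (MkPair (MkPair (MkPair (Fst foldelt) (Fst foldctx)) (Var 0)) (Snd foldctx)))"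

definition "linst_body = fold_body 10 (Snd (Fst arg))
   (Call 9 (MkPair (MkPair foldelt (Var 0)) (Fst foldctx)))"

definition "ltype_body = fold_body 11 (MkPair CNil CNil)
   (Call 10 (MkPair (MkPair (Fst (Snd foldelt)) (Var 0)) (Fst (Snd (Snd foldelt)))))"

text \<open>The tags of ground expressions are 0 for constants, 1 for letter formulas, 2 for truth-valued
  expressions that are to be read over \<open>K\<close>, 3 for resetting the value at the empty word, 4 for iteration,
  and 5 to 8 for sum, product, Cauchy product and shuffle product.\<close>

definition "mk_leaf t e = MkPair (CNum t) e" for t e
definition "mk_lit \<phi> env = MkPair (CNum 1) (MkPair \<phi> env)" for \<phi> env
definition "mk_wrap c e = MkPair (CNum 3) (MkPair c e)" for c e
definition "mk_bin t e e' = MkPair (CNum t) (MkPair e e')" for t e e'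

text \<open>Function 12, on \<open>(env, \<zeta>)\<close>; the environment is copied into every
  leaf.\<close>

definition "gz_body =
   If (Eq tag (CNum 0)) (mk_lit arg1 ctx)
     (mk_bin 7 (Call 12 (MkPair ctx arg1)) (Call 12 (MkPair ctx arg2)))"

text \<open>The argument is \<open>(env, \<zeta>, c)\<close>.\<close>

definition "gneg_body =
   If (Eq (Fst (Fst (Snd arg))) (CNum 0))
     (mk_wrap (CNum 1) (mk_bin 5
       (mk_bin 7 (mk_lit (MkPair (CNum 2) (MkPair (Fst (Snd (Fst (Snd arg)))) CNil)) ctx)
          (mk_leaf 0 (CNum 1)))
       (mk_bin 7 (mk_lit (MkPair (CNum 0) CNil) ctx) (Snd (Snd arg)))))
     (Call 13 (MkPair ctx (MkPair (Fst (Snd (Fst (Snd arg))))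
        (Call 13 (MkPair ctx (MkPair (Fst (Snd (Snd (Fst (Snd arg))))) (Snd (Snd arg))))))))"

text \<open>Wraps with flag \<open>CNil\<close> set the value at the empty word to 0, since the
  factors of a product have to be nonempty.\<close>

definition "ground_bin self t = mk_bin t (mk_wrap CNil (Call self (MkPair ctx arg1)))
   (mk_wrap CNil (Call self (MkPair ctx arg2)))" for self t

text \<open>The entry of a type is \<open>(i, ports, instances)\<close>. Lookup under
  \<open>i\<close> leaves the last two parts, from which the list of instances is taken as the range
  of the loop.\<close>

definition "ground_quant loop t c base =
   Call loop (MkPair (MkPair ctx (MkPair arg1 (MkPair arg2 (MkPair (CNum t) (MkPair c base)))))
     (Fst (Snd (Call 7 (MkPair (Fst arg1) (Fst ctx))))))" for loop t c base

text \<open>The argument is \<open>((types, env), \<psi>)\<close>. The constructors of the three logics that are common to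
  all of them have consecutive tags, which start at \<open>b\<close>.\<close>

definition "ground_body b z one self loop leaf =
   (let zero = mk_leaf 0 z; all = mk_leaf 0 one; unit = mk_wrap (CNum 1) zero in
    If (Eq tag (CNum b)) (ground_bin self 5)
   (If (Eq tag (CNum (b + 1))) (ground_bin self 6)
   (If (Eq tag (CNum (b + 2))) (ground_bin self 7)
   (If (Eq tag (CNum (b + 3))) (ground_bin self 8)
   (If (Eq tag (CNum (b + 4))) (MkPair (CNum 4) (Call self (MkPair ctx arg1)))
   (If (Eq tag (CNum (b + 5))) (ground_quant loop 5 CNil zero)
   (If (Eq tag (CNum (b + 6))) (ground_quant loop 6 CNil all)
   (If (Eq tag (CNum (b + 7))) (ground_quant loop 7 (CNum 1) unit)
   (If (Eq tag (CNum (b + 8))) (ground_quant loop 7 CNil unit)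
   (If (Eq tag (CNum (b + 9))) (ground_quant loop 8 (CNum 1) unit)
   (If (Eq tag (CNum (b + 10))) (ground_quant loop 8 CNil unit)
     leaf)))))))))))" for b z one self loop leaf

text \<open>The context is \<open>((types, env), x, \<psi>, t, c, base)\<close>.\<close>

definition "quant_body self loop = fold_body loop (Snd (Snd (Snd (Snd (Snd ctx)))))
   (MkPair (Fst (Snd (Snd (Snd foldctx))))
     (MkPair (mk_wrap (Fst (Snd (Snd (Snd (Snd foldctx)))))
        (Call self (MkPair
          (MkPair (Fst (Fst foldctx))
            (MkPair (MkPair (Fst (Snd foldctx)) foldelt) (Snd (Fst foldctx))))
          (Fst (Snd (Snd foldctx))))))
       (Var 0)))" for self loop

definition "epil_leaf =
   If (Eq tag (CNum 0)) (Call 12 (MkPair (Snd ctx) arg1))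
     (Call 13 (MkPair (Snd ctx) (MkPair arg1 (mk_wrap CNil (mk_leaf 0 (CNum 1))))))"

definition "foeil_leaf =
   If (Eq tag (CNum 0)) (Call 14 (MkPair ctx arg1))
   (If (Eq tag (CNum 1))
     (mk_leaf 0 (Eq (Call 7 (MkPair arg1 (Snd ctx))) (Call 7 (MkPair arg2 (Snd ctx)))))
     (mk_leaf 0 (If (Eq (Call 7 (MkPair arg1 (Snd ctx))) (Call 7 (MkPair arg2 (Snd ctx)))) CNil (CNum 1))))"

definition "wfoeil_leaf =
   If (Eq tag (CNum 0)) (mk_leaf 0 arg1) (mk_leaf 2 (Call 16 (MkPair ctx arg1)))"

text \<open>Function 20: the head is put in front of all subsequences of the tail, and those of the
  tail are kept behind; hence \<open>Var 0\<close> occurs twice.\<close>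

definition "subs_body = fold_body 20 (MkPair CNil CNil)
   (Call 1 (MkPair (MkPair foldelt (Var 0)) (Var 0)))"

section \<open>Program: automata of ground expressions, computed on demand\<close>

abbreviation "gtag \<equiv> Fst arg"
abbreviation "gpay \<equiv> Snd arg"

definition "tagged = Call 1 (MkPair (MkPair CNil
     (Call 1 (MkPair (MkPair (CNum 1) CNil) (Call 21 (Snd gpay))))) (Call 21 (Fst gpay)))"

text \<open>Function 21. The last case serves tags 6 and 8, since product and shuffle product both
  have pairs as states.\<close>

definition "states_body =
   If (Eq gtag (CNum 0)) (MkPair CNil CNil)
   (If (Eq gtag (CNum 1)) (MkPair CNil (MkPair (CNum 1) CNil))
   (If (Eq gtag (CNum 2)) (Call 20 (MkPair CNil (Call 21 gpay)))
   (If (Eq gtag (CNum 3)) (MkPair CNil (Call 1 (MkPair (MkPair CNil CNil) (Call 21 (Snd gpay)))))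
   (If (Eq gtag (CNum 4)) (MkPair CNil (Call 1 (MkPair (MkPair CNil CNil) (Call 21 gpay))))
   (If (Eq gtag (CNum 5)) (MkPair CNil tagged)
   (If (Eq gtag (CNum 7)) tagged
     (Call 2 (MkPair (Call 21 (Snd gpay)) (Call 21 (Fst gpay))))))))))"

text \<open>Function 22. The remaining tags 0, 1, 3, 4 and 5 share the start state
  \<open>VNil\<close>.\<close>

definition "start_body =
   If (Eq gtag (CNum 2)) (MkPair (Call 22 gpay) CNil)
   (If (Eq gtag (CNum 7)) (MkPair CNil (Call 22 (Fst gpay)))
   (If (Eq gtag (CNum 6)) (MkPair (Call 22 (Fst gpay)) (Call 22 (Snd gpay)))
   (If (Eq gtag (CNum 8)) (MkPair (Call 22 (Fst gpay)) (Call 22 (Snd gpay)))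
     CNil)))"

text \<open>Function 23, on \<open>(e, X)\<close>: whether the set \<open>X\<close> of states
  contains a final one. Function 24 is called in the mode \<open>CNil\<close> of truth
  values.\<close>

definition "anyter_body = fold_body 23 CNil
   (If (Call 24 (MkPair CNil (MkPair foldctx foldelt))) (CNum 1) (Var 0))"

text \<open>The argument is \<open>(mode, e, q)\<close>.\<close>

definition "mode_zero m = If m CZero CNil" for m
definition "mode_one m = If m COne (CNum 1)" for m

abbreviation "tmode \<equiv> Fst arg"
abbreviation "ttag \<equiv> Fst (Fst (Snd arg))"
abbreviation "tpay \<equiv> Snd (Fst (Snd arg))"
abbreviation "tq \<equiv> Snd (Snd arg)"
abbreviation "ter_call e q \<equiv> Call 24 (MkPair tmode (MkPair e q))"

definition "ter_body =
   If (Eq ttag (CNum 0)) tpay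
   (If (Eq ttag (CNum 1)) (If tq (mode_one tmode) (mode_zero tmode))
   (If (Eq ttag (CNum 2)) (If (Call 23 (MkPair tpay tq)) (mode_one tmode) (mode_zero tmode))
   (If (Eq ttag (CNum 3))
     (If (IsPair tq) (ter_call (Snd tpay) (Snd tq)) (If (Fst tpay) (mode_one tmode) (mode_zero tmode)))
   (If (Eq ttag (CNum 4)) (If (IsPair tq) (ter_call tpay (Snd tq)) (mode_zero tmode))
   (If (Eq ttag (CNum 5))
     (If (IsPair tq) (If (Fst tq) (ter_call (Snd tpay) (Snd tq)) (ter_call (Fst tpay) (Snd tq)))
        (mode_zero tmode))
   (If (Eq ttag (CNum 7))
     (If (Fst tq) (ter_call (Snd tpay) (Snd tq))
       (Call 5 (MkPair (ter_call (Fst tpay) (Snd tq)) (ter_call (Snd tpay) (Call 22 (Snd tpay))))))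
     (Call 5 (MkPair (ter_call (Fst tpay) (Fst tq)) (ter_call (Snd tpay) (Snd tq))))))))))"

text \<open>Function 25, on \<open>((a, e, p), X)\<close>, asks for a transition from
  \<open>X\<close> into \<open>p\<close>; function 26, on \<open>((a, e, X), states)\<close>,
  filters the states by this test. Together they make one step of the subset construction.\<close>

definition "anytr_body = fold_body 25 CNil
   (If (Call 27 (MkPair (MkPair CNil (Fst foldctx))
        (MkPair (Fst (Snd foldctx)) (MkPair foldelt (Snd (Snd foldctx))))))
     (CNum 1) (Var 0))"

definition "succ_body = fold_body 26 CNil
   (If (Call 25 (MkPair (MkPair (Fst foldctx) (MkPair (Fst (Snd foldctx)) foldelt)) (Snd (Snd foldctx))))
     (MkPair foldelt (Var 0)) (Var 0))"

text \<open>The argument is \<open>((mode, a), e, q, q')\<close>.\<close>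

abbreviation "rmode \<equiv> Fst (Fst arg)"
abbreviation "rtag \<equiv> Fst (Fst (Snd arg))"
abbreviation "rpay \<equiv> Snd (Fst (Snd arg))"
abbreviation "rq \<equiv> Fst (Snd (Snd arg))"
abbreviation "rq' \<equiv> Snd (Snd (Snd arg))"
abbreviation "tr_call e q q' \<equiv> Call 27 (MkPair (Fst arg) (MkPair e (MkPair q q')))"
abbreviation "rter_call e q \<equiv> Call 24 (MkPair rmode (MkPair e q))"

definition "tr_body =
   If (Eq rtag (CNum 0)) (mode_one rmode)
   (If (Eq rtag (CNum 1))
     (If rq (mode_zero rmode)
       (If rq' (If (Call 8 (MkPair (MkPair (Snd (Fst arg)) (Snd rpay)) (Fst rpay)))
            (mode_one rmode) (mode_zero rmode))
         (mode_zero rmode)))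
   (If (Eq rtag (CNum 2))
     (If (Call 3 (MkPair rq' (Call 26 (MkPair (MkPair (Snd (Fst arg)) (MkPair rpay rq)) (Call 21 rpay)))))
       (mode_one rmode) (mode_zero rmode))
   (If (Eq rtag (CNum 3))
     (If (IsPair rq')
       (If (IsPair rq) (tr_call (Snd rpay) (Snd rq) (Snd rq'))
          (tr_call (Snd rpay) (Call 22 (Snd rpay)) (Snd rq')))
       (mode_zero rmode))
   (If (Eq rtag (CNum 4))
     (If (IsPair rq')
       (If (IsPair rq)
          (Call 4 (MkPair (tr_call rpay (Snd rq) (Snd rq'))
             (Call 5 (MkPair (rter_call rpay (Snd rq)) (tr_call rpay (Call 22 rpay) (Snd rq'))))))
          (tr_call rpay (Call 22 rpay) (Snd rq')))
       (mode_zero rmode))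
   (If (Eq rtag (CNum 5))
     (If (IsPair rq')
       (If (IsPair rq)
         (If (Fst rq')
           (If (Fst rq) (tr_call (Snd rpay) (Snd rq) (Snd rq')) (mode_zero rmode))
           (If (Fst rq) (mode_zero rmode) (tr_call (Fst rpay) (Snd rq) (Snd rq'))))
         (If (Fst rq') (tr_call (Snd rpay) (Call 22 (Snd rpay)) (Snd rq'))
           (tr_call (Fst rpay) (Call 22 (Fst rpay)) (Snd rq'))))
       (mode_zero rmode))
   (If (Eq rtag (CNum 6))
     (Call 5 (MkPair (tr_call (Fst rpay) (Fst rq) (Fst rq')) (tr_call (Snd rpay) (Snd rq) (Snd rq'))))
   (If (Eq rtag (CNum 7))
     (If (Fst rq')
        (If (Fst rq) (tr_call (Snd rpay) (Snd rq) (Snd rq'))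
          (Call 5 (MkPair (rter_call (Fst rpay) (Snd rq))
             (tr_call (Snd rpay) (Call 22 (Snd rpay)) (Snd rq')))))
        (If (Fst rq) (mode_zero rmode) (tr_call (Fst rpay) (Snd rq) (Snd rq'))))
     (Call 4 (MkPair
        (If (Call 3 (MkPair (Snd rq) (Snd rq'))) (tr_call (Fst rpay) (Fst rq) (Fst rq')) (mode_zero rmode))
        (If (Call 3 (MkPair (Fst rq) (Fst rq'))) (tr_call (Snd rpay) (Snd rq) (Snd rq')) (mode_zero rmode)))))))))))"

section \<open>Program: output tables and the main function\<close>

definition "irow_body = fold_body 28 CNil
   (MkPair (If (Call 3 (MkPair foldctx foldelt)) COne CZero) (Var 0))"

definition "trow_body = fold_body 29 CNil
   (MkPair (Call 24 (MkPair (CNum 1) (MkPair foldctx foldelt))) (Var 0))"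

definition "row_body = fold_body 30 CNil
   (MkPair (Call 27 (MkPair (MkPair (CNum 1) (Fst foldctx))
      (MkPair (Fst (Snd foldctx)) (MkPair (Snd (Snd foldctx)) foldelt)))) (Var 0))"

text \<open>Function 31, on \<open>((a, e, states), states)\<close>. The state list occurs twice:
  one copy is run through for the rows, the other is handed to function 30 for the columns.\<close>

definition "mat_body = fold_body 31 CNil
   (MkPair (Call 30 (MkPair (MkPair (Fst foldctx) (MkPair (Fst (Snd foldctx)) foldelt))
      (Snd (Snd foldctx)))) (Var 0))"

text \<open>The context is \<open>(e, states)\<close>; the empty letter is dropped.\<close>

definition "tab_body = fold_body 32 CNil
   (If (IsPair foldelt)
     (MkPair (MkPair foldelt
        (Call 31 (MkPair (MkPair foldelt foldctx) (Snd foldctx)))) (Var 0))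
     (Var 0))"

text \<open>Inside both \<open>Let\<close>s, \<open>Var 0\<close> is the state list,
  \<open>Var 1\<close> the ground expression and \<open>Var 2\<close> the input.\<close>

definition "main_body =
   Let (Call 18 (MkPair (MkPair (Fst arg) CNil) (Snd arg)))
   (Let (Call 21 (Var 0))
     (MkPair (Call 28 (MkPair (Call 22 (Var 1)) (Var 0)))
     (MkPair (Call 29 (MkPair (Var 1) (Var 0)))
     (MkPair (Call 32 (MkPair (MkPair (Var 1) (Var 0)) (Call 11 (MkPair CNil (Fst (Var 2))))))
       CNil))))"

definition prg :: program where
  "prg = [main_body, pon_body, prodl_body, teq_body, add_body, mul_body, mem_body, look_body,
     psat_body, lport_body, linst_body, ltype_body, gz_body, gneg_body,
     ground_body 2 CNil (CNum 1) 14 15 epil_leaf, quant_body 14 15,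
     ground_body 3 CNil (CNum 1) 16 17 foeil_leaf, quant_body 16 17,
     ground_body 2 CZero COne 18 19 wfoeil_leaf, quant_body 18 19,
     subs_body, states_body, start_body, anyter_body, ter_body, anytr_body, succ_body, tr_body,
     irow_body, trow_body, row_body, mat_body, tab_body]"

lemma length_prg [simp]: "length prg = 33"
  by (simp add: prg_def)

lemma prg_nth:
  "prg ! 0 = main_body" "prg ! 1 = pon_body" "prg ! Suc 0 = pon_body" "prg ! 2 = prodl_body" "prg ! 3 = teq_body"
  "prg ! 4 = add_body" "prg ! 5 = mul_body" "prg ! 6 = mem_body" "prg ! 7 = look_body"
  "prg ! 8 = psat_body" "prg ! 9 = lport_body" "prg ! 10 = linst_body" "prg ! 11 = ltype_body"
  "prg ! 12 = gz_body" "prg ! 13 = gneg_body"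
  "prg ! 14 = ground_body 2 CNil (CNum 1) 14 15 epil_leaf" "prg ! 15 = quant_body 14 15"
  "prg ! 16 = ground_body 3 CNil (CNum 1) 16 17 foeil_leaf" "prg ! 17 = quant_body 16 17"
  "prg ! 18 = ground_body 2 CZero COne 18 19 wfoeil_leaf" "prg ! 19 = quant_body 18 19"
  "prg ! 20 = subs_body" "prg ! 21 = states_body" "prg ! 22 = start_body" "prg ! 23 = anyter_body"
  "prg ! 24 = ter_body" "prg ! 25 = anytr_body" "prg ! 26 = succ_body" "prg ! 27 = tr_body"
  "prg ! 28 = irow_body" "prg ! 29 = trow_body" "prg ! 30 = row_body" "prg ! 31 = mat_body"
  "prg ! 32 = tab_body"
  by (simp_all add: prg_def One_nat_def)

section \<open>Truth values as a semiring\<close>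

text \<open>Addition is idempotent, so sums over decompositions become existential statements and
  multiplicities disappear. The algebra below then serves satisfaction as well as weights.\<close>

instantiation bool :: "{comm_semiring_0, comm_monoid_mult}"
begin

definition "zero_bool = False"
definition "one_bool = True"
definition "plus_bool p q = (p \<or> q)"
definition "times_bool p q = (p \<and> q)"

instance
  by standard (auto simp: zero_bool_def one_bool_def plus_bool_def times_bool_def)

end

lemmas bool_semiring = zero_bool_def one_bool_def plus_bool_def times_bool_def

lemma sum_bool: "finite A \<Longrightarrow> (\<Sum>x\<in>A. f x) \<longleftrightarrow> (\<exists>x\<in>A. f x)"
  by (induction A rule: finite_induct) (auto simp: bool_semiring)

lemma prod_bool: "finite A \<Longrightarrow> (\<Prod>x\<in>A. f x) \<longleftrightarrow> (\<forall>x\<in>A. f x)"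
  by (induction A rule: finite_induct) (auto simp: bool_semiring)

lemma sum_list_bool: "(\<Sum>x\<leftarrow>xs. f x) \<longleftrightarrow> (\<exists>x\<in>set xs. f x)"
  by (induction xs) (auto simp: bool_semiring)


section \<open>Products of series\<close>

text \<open>Cauchy product with empty factors allowed, written with left derivatives: the first
  letter belongs to the first factor unless that factor is empty. An automaton reads a word in the
  same way.\<close>

primrec fcat ::
  "('a list \<Rightarrow> 's :: {comm_semiring_0, comm_monoid_mult}) \<Rightarrow> ('a list \<Rightarrow> 's) \<Rightarrow> 'a list \<Rightarrow> 's" where
  "fcat f g [] = f [] * g []"
| "fcat f g (a # w) = f [] * g (a # w) + fcat (\<lambda>u. f (a # u)) g w"

text \<open>The derivative by a letter acts on a shuffle product by the product rule, since the
  letter comes from one of the two factors. Adding both possibilities yields the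
  multiplicities.\<close>

primrec fshuf ::
  "('a list \<Rightarrow> 's :: {comm_semiring_0, comm_monoid_mult}) \<Rightarrow> ('a list \<Rightarrow> 's) \<Rightarrow> 'a list \<Rightarrow> 's" where
  "fshuf f g [] = f [] * g []"
| "fshuf f g (a # w) = fshuf (\<lambda>u. f (a # u)) g w + fshuf f (\<lambda>u. g (a # u)) w"

definition with_eps :: "bool \<Rightarrow> ('a list \<Rightarrow> 's :: {comm_semiring_0, comm_monoid_mult}) \<Rightarrow> 'a list \<Rightarrow> 's" where
  "with_eps c f w = (if w = [] then if c then 1 else 0 else f w)"

lemma with_eps_simps [simp]:
  "with_eps c f [] = (if c then 1 else 0)" "with_eps c f (a # w) = f (a # w)"
  by (simp_all add: with_eps_def)

lemma fcat_zero [simp]: "fcat (\<lambda>u. 0) g w = 0"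
  by (induction w) auto

lemma fcat_add: "fcat (\<lambda>u. f u + f' u) g w = fcat f g w + fcat f' g w"
  by (induction w arbitrary: f f') (auto simp: algebra_simps)

lemma fcat_scale: "fcat (\<lambda>u. c * f u) g w = c * fcat f g w"
  by (induction w arbitrary: f) (auto simp: algebra_simps)

lemma fcat_sum_list: "fcat (\<lambda>u. \<Sum>x\<leftarrow>xs. c x * f x u) g w = (\<Sum>x\<leftarrow>xs. c x * fcat (f x) g w)"
  by (induction xs) (auto simp: fcat_add fcat_scale)

lemma fshuf_commute: "fshuf f g w = fshuf g f w"
  by (induction w arbitrary: f g) (auto simp: mult.commute add.commute)

lemma fshuf_zero [simp]: "fshuf (\<lambda>u. 0) g w = 0"
  by (induction w arbitrary: g) auto

lemma fshuf_add: "fshuf (\<lambda>u. f u + f' u) g w = fshuf f g w + fshuf f' g w"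
  by (induction w arbitrary: f f' g) (auto simp: algebra_simps)

lemma fshuf_scale: "fshuf (\<lambda>u. c * f u) g w = c * fshuf f g w"
  by (induction w arbitrary: f g) (auto simp: algebra_simps)

lemma fshuf_sum_list: "fshuf (\<lambda>u. \<Sum>x\<leftarrow>xs. c x * f x u) g w = (\<Sum>x\<leftarrow>xs. c x * fshuf (f x) g w)"
  by (induction xs) (auto simp: fshuf_add fshuf_scale)

lemma fshuf_sum_list': "fshuf g (\<lambda>u. \<Sum>x\<leftarrow>xs. c x * f x u) w = (\<Sum>x\<leftarrow>xs. c x * fshuf g (f x) w)"
  using fshuf_sum_list[of c f xs g w] by (simp add: fshuf_commute)

lemma fcat_eq_sum: "fcat f g w = (\<Sum>i\<le>length w. f (take i w) * g (drop i w))"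
proof (induction w arbitrary: f)
  case (Cons a w)
  have "(\<Sum>i\<le>length (a # w). f (take i (a # w)) * g (drop i (a # w))) =
      f [] * g (a # w) + (\<Sum>i\<le>length w. f (a # take i w) * g (drop i w))"
    by (simp add: sum.atMost_Suc_shift del: sum.atMost_Suc)
  then show ?case using Cons.IH[of "\<lambda>u. f (a # u)"] by simp
qed simp

lemma splits_eq_image: "{(u, v). w = u @ v} = (\<lambda>i. (take i w, drop i w)) ` {..length w}"
proof (intro equalityI subsetI)
  fix z assume "z \<in> {(u, v). w = u @ v}"
  then obtain u v where "z = (u, v)" "w = u @ v" by auto
  then show "z \<in> (\<lambda>i. (take i w, drop i w)) ` {..length w}"
    by (intro image_eqI[where x = "length u"]) auto
qed auto

lemma inj_on_splits: "inj_on (\<lambda>i. (take i w, drop i w)) {..length w}"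
  by (rule inj_onI) (metis Pair_inject atMost_iff length_take min.absorb2)

lemma finite_splits: "finite {(u, v). w = u @ v}"
  unfolding splits_eq_image by simp

text \<open>Factors that vanish at the empty word remove exactly the decompositions excluded by
  \<open>cauchy\<close>.\<close>

lemma cauchy_eq_fcat: "cauchy f g w = fcat (with_eps False f) (with_eps False g) w"
proof -
  have "fcat (with_eps False f) (with_eps False g) w =
      (\<Sum>(u, v)\<in>{(u, v). w = u @ v}. with_eps False f u * with_eps False g v)"
    unfolding fcat_eq_sum splits_eq_image by (subst sum.reindex[OF inj_on_splits]) simp
  also have "\<dots> = (\<Sum>(u, v)\<in>{(u, v). u \<noteq> [] \<and> v \<noteq> [] \<and> w = u @ v}. f u * g v)"
    using finite_splits[of w]
    by (intro sum.mono_neutral_cong_right) (auto simp: with_eps_def)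
  finally show ?thesis by (simp add: cauchy_def)
qed

text \<open>Sets of positions are split by whether they contain 0, the position of the first letter,
  and the remaining positions are shifted.\<close>

lemma sum_subsets_Suc:
  "(\<Sum>S\<in>Pow {..<Suc n}. F S) = (\<Sum>S\<in>Pow {..<n}. F (insert 0 (Suc ` S)) + F (Suc ` S))"
    for F :: "nat set \<Rightarrow> 'b :: comm_monoid_add"
proof -
  have e: "Pow {..<Suc n} = (\<lambda>S. Suc ` S) ` Pow {..<n} \<union> (\<lambda>S. insert 0 (Suc ` S)) ` Pow {..<n}"
  proof (intro equalityI subsetI)
    fix S assume S: "S \<in> Pow {..<Suc n}"
    let ?T = "{m. Suc m \<in> S}"
    have T: "?T \<in> Pow {..<n}" using S by auto
    have "m \<in> S \<longleftrightarrow> m \<in> (if 0 \<in> S then insert 0 (Suc ` ?T) else Suc ` ?T)" for m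
      by (cases m) auto
    then have "S = (if 0 \<in> S then insert 0 (Suc ` ?T) else Suc ` ?T)" by blast
    then show "S \<in> (\<lambda>S. Suc ` S) ` Pow {..<n} \<union> (\<lambda>S. insert 0 (Suc ` S)) ` Pow {..<n}"
      using T by (cases "0 \<in> S") auto
  qed auto
  have i: "inj_on (\<lambda>S. Suc ` S) (Pow {..<n})" "inj_on (\<lambda>S. insert 0 (Suc ` S)) (Pow {..<n})"
    by (auto simp: inj_on_def set_eq_iff image_iff)
  show ?thesis unfolding e
    by (subst sum.union_disjoint) (auto simp: sum.reindex[OF i(1)] sum.reindex[OF i(2)] sum.distrib add.commute)
qed

text \<open>\<open>S\<close> is the set of positions whose letters go to the left factor.\<close>

lemma fshuf_eq_sum: "fshuf f g w = (\<Sum>S\<in>Pow {..<length w}. f (nths w S) * g (nths w (- S)))"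
proof (induction w arbitrary: f g)
  case (Cons a w)
  have e: "{j. Suc j \<in> insert 0 (Suc ` S)} = S" "{j. Suc j \<in> - insert 0 (Suc ` S)} = - S"
    "{j. Suc j \<in> Suc ` S} = S" "{j. Suc j \<notin> Suc ` S} = - S" for S by auto
  show ?case
    by (simp add: Cons.IH sum_subsets_Suc nths_Cons e sum.distrib del: Compl_insert Collect_mem_eq)
qed (simp add: Pow_def)

lemma nths_eq_Nil_iff: "S \<subseteq> {..<length w} \<Longrightarrow> nths w S = [] \<longleftrightarrow> S = {}"
proof -
  assume S: "S \<subseteq> {..<length w}"
  have "nths w S = [] \<longleftrightarrow> {i. i < length w \<and> i \<in> S} = {}"
    by (simp flip: length_0_conv add: length_nths)
  also have "\<dots> \<longleftrightarrow> S = {}" using S by auto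
  finally show ?thesis .
qed

lemma nths_Int_length: "nths w S = nths w (S \<inter> {..<length w})"
  unfolding nths_def by (rule arg_cong[where f = "map fst"], rule filter_cong) (auto dest: set_zip_rightD)

lemma shuffle_prod_eq_fshuf: "shuffle_prod f g w = fshuf (with_eps False f) (with_eps False g) w"
proof -
  have c: "nths w (- S) = [] \<longleftrightarrow> S = {..<length w}" if "S \<subseteq> {..<length w}" for S
    using that by (subst nths_Int_length, subst nths_eq_Nil_iff) auto
  show ?thesis unfolding fshuf_eq_sum shuffle_prod_def
    by (intro sum.mono_neutral_cong_left) (auto simp: with_eps_def nths_eq_Nil_iff c)
qed


section \<open>Iteration\<close>

lemma fcat_assoc: "fcat (fcat f g) h w = fcat f (fcat g h) w"
proof (induction w arbitrary: f)
  case (Cons a w)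
  have "fcat (\<lambda>u. fcat f g (a # u)) h w = f [] * fcat (\<lambda>u. g (a # u)) h w + fcat (fcat (\<lambda>u. f (a # u)) g) h w"
    by (simp add: fcat_add fcat_scale)
  then show ?case using Cons.IH by (simp add: algebra_simps)
qed (simp add: mult.assoc)

lemma with_eps_cauchy: "with_eps False (cauchy f g) = cauchy f g"
  by (rule ext) (simp add: with_eps_def cauchy_eq_fcat)

lemma cauchy_assoc: "cauchy (cauchy f g) h w = cauchy f (cauchy g h) w"
  for f :: "'a list \<Rightarrow> 'b :: {comm_semiring_0, comm_monoid_mult}"
proof -
  have e: "cauchy f g = fcat (with_eps False f) (with_eps False g)" for f g :: "'a list \<Rightarrow> 'b"
    by (rule ext) (rule cauchy_eq_fcat)
  show ?thesis
    by (simp add: cauchy_eq_fcat[of "cauchy f g"] cauchy_eq_fcat[of f "cauchy g h"] with_eps_cauchy)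
      (simp add: e fcat_assoc)
qed

text \<open>Powers are defined by new factors on the right, while reading a word splits off the
  first factor.\<close>

lemma cauchy_pow_Suc: "cauchy_pow f (Suc m) = cauchy f (cauchy_pow f m)"
proof (induction m)
  case (Suc m)
  have "cauchy_pow f (Suc (Suc m)) = cauchy (cauchy f (cauchy_pow f m)) f" using Suc by simp
  also have "\<dots> = cauchy f (cauchy (cauchy_pow f m) f)" by (rule ext) (rule cauchy_assoc)
  finally show ?case by simp
qed simp

lemma cauchy_pow_eq_0: "w \<noteq> [] \<Longrightarrow> length w \<le> m \<Longrightarrow> cauchy_pow f m w = 0"
proof (induction m arbitrary: w)
  case (Suc m)
  have "cauchy_pow f m u * f v = 0" if "u \<noteq> []" "v \<noteq> []" "w = u @ v" for u v
  proof -
    have "length u \<le> m" using that Suc.prems by (cases v) auto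
    then show ?thesis using Suc.IH[of u] that by simp
  qed
  then show ?case by (auto simp: cauchy_def intro!: sum.neutral)
qed simp

lemma cauchy_cong:
  assumes "\<And>u. u \<noteq> [] \<Longrightarrow> f u = f' u" "\<And>u. u \<noteq> [] \<Longrightarrow> g u = g' u"
  shows "cauchy f g w = cauchy f' g' w"
  unfolding cauchy_def using assms by (intro sum.cong) auto

text \<open>The sum for \<open>w\<close> runs over more powers than the sums for the shorter
  remainders \<open>v\<close>; the additional powers vanish on \<open>v\<close>.\<close>

lemma cauchy_plus_unfold:
  assumes "w \<noteq> []"
  shows "cauchy_plus f w = f w + cauchy f (cauchy_plus f) w"
proof -
  obtain n where n: "length w = Suc n" using assms by (cases w) auto
  have "cauchy_plus f w = f w + (\<Sum>m<n. cauchy f (cauchy_pow f m) w)"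
    unfolding cauchy_plus_def n by (simp add: sum.lessThan_Suc_shift cauchy_pow_Suc del: cauchy_pow.simps(2) sum.lessThan_Suc)
  also have "(\<Sum>m<n. cauchy f (cauchy_pow f m) w) =
      (\<Sum>(u, v)\<in>{(u, v). u \<noteq> [] \<and> v \<noteq> [] \<and> w = u @ v}. f u * (\<Sum>m<n. cauchy_pow f m v))"
    unfolding cauchy_def by (subst sum.swap) (auto simp: sum_distrib_left intro!: sum.cong)
  also have "\<dots> = cauchy f (cauchy_plus f) w"
    unfolding cauchy_def
  proof (intro sum.cong refl, clarify)
    fix u v assume uv: "u \<noteq> []" "v \<noteq> []" "w = u @ v"
    have l: "length v \<le> n" using n uv by (cases u) auto
    have "(\<Sum>m<n. cauchy_pow f m v) = (\<Sum>m<length v. cauchy_pow f m v)"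
      using uv l by (intro sum.mono_neutral_right) (auto intro!: cauchy_pow_eq_0)
    then show "f u * (\<Sum>m<n. cauchy_pow f m v) = f u * cauchy_plus f v" by (simp add: cauchy_plus_def)
  qed
  finally show ?thesis .
qed

lemma cauchy_plus_cong:
  assumes "\<And>u. u \<noteq> [] \<Longrightarrow> f u = f' u" "w \<noteq> []"
  shows "cauchy_plus f w = cauchy_plus f' w"
proof -
  have "u \<noteq> [] \<Longrightarrow> cauchy_pow f m u = cauchy_pow f' m u" for m u
  proof (induction m arbitrary: u)
    case (Suc m)
    show ?case unfolding cauchy_pow.simps by (rule cauchy_cong) (use assms(1) Suc.IH in auto)
  qed (use assms in simp)
  then show ?thesis using assms(2) by (simp add: cauchy_plus_def)
qed

text \<open>The equation determines \<open>S\<close> by induction on the length, as what remains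
  after the first factor is shorter. It is the equation that an automaton for iteration satisfies at
  its start state.\<close>

lemma cauchy_plus_unique:
  assumes "S [] = 0" "\<And>a w. S (a # w) = f (a # w) + fcat (\<lambda>u. f (a # u)) S w"
  shows "S w = with_eps False (cauchy_plus f) w"
proof (induction w rule: length_induct)
  case (1 w)
  show ?case
  proof (cases w)
    case (Cons a v)
    have "fcat (\<lambda>u. f (a # u)) S v = fcat (\<lambda>u. f (a # u)) (with_eps False (cauchy_plus f)) v"
      unfolding fcat_eq_sum using 1 Cons by (intro sum.cong) (auto simp: less_Suc_eq_le)
    also have "\<dots> = cauchy f (cauchy_plus f) (a # v)" by (simp add: cauchy_eq_fcat)
    finally show ?thesis using assms(2) cauchy_plus_unfold[of "a # v" f] Cons by simp
  qed (use assms in simp)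
qed


section \<open>Automata\<close>

text \<open>States form a list because their order fixes the numbering in the output and the
  representative of a set of states. The start state has initial weight 1, all others 0.\<close>

record ('q, 'a, 's) aut =
  astates :: "'q list"
  astart :: "'q"
  atrans :: "'q \<Rightarrow> 'a \<Rightarrow> 'q \<Rightarrow> 's"
  afinal :: "'q \<Rightarrow> 's"

primrec series ::
  "('q, 'a, 's :: {comm_semiring_0, comm_monoid_mult}) aut \<Rightarrow> 'q \<Rightarrow> 'a list \<Rightarrow> 's" where
  "series A q [] = afinal A q"
| "series A q (a # w) = (\<Sum>p\<leftarrow>astates A. atrans A q a p * series A p w)"

definition aut_ok :: "('q, 'a, 's) aut \<Rightarrow> bool" where
  "aut_ok A \<longleftrightarrow> distinct (astates A) \<and> astart A \<in> set (astates A)"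

type_synonym ('p, 'k, 'a, 's) vaut = "(('p, 'k) val, 'a, 's) aut"

abbreviation "tagL q \<equiv> VPair VNil q"
abbreviation "tagR q \<equiv> VPair (VNum 1) q"

definition pairl :: "('p, 'k) val list \<Rightarrow> ('p, 'k) val list \<Rightarrow> ('p, 'k) val list" where
  "pairl xs ys = concat (map (\<lambda>x. map (VPair x) ys) xs)"

text \<open>The new start state \<open>VNil\<close> imitates the old one but has no incoming
  transitions, so that its terminal weight concerns the empty word alone.\<close>

definition wrap_aut :: "bool \<Rightarrow> ('p, 'k, 'a, 's) vaut \<Rightarrow> ('p, 'k, 'a, 's :: {comm_semiring_0, comm_monoid_mult}) vaut" where
  "wrap_aut c A = \<lparr>astates = VNil # map tagL (astates A), astart = VNil,
     atrans = (\<lambda>q a q'. if is_pair q' then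
        atrans A (if is_pair q then vsnd q else astart A) a (vsnd q') else 0),
     afinal = (\<lambda>q. if is_pair q then afinal A (vsnd q) else if c then 1 else 0)\<rparr>"

text \<open>When a factor ends with its terminal weight, the next letter is read as if from the
  start. The separate start state gives 0 to the empty word even if \<open>A\<close> does
  not.\<close>

definition plus_aut :: "('p, 'k, 'a, 's) vaut \<Rightarrow> ('p, 'k, 'a, 's :: {comm_semiring_0, comm_monoid_mult}) vaut" where
  "plus_aut A = \<lparr>astates = VNil # map tagL (astates A), astart = VNil,
     atrans = (\<lambda>q a q'. if is_pair q' then
        if is_pair q then atrans A (vsnd q) a (vsnd q') +
          afinal A (vsnd q) * atrans A (astart A) a (vsnd q')
        else atrans A (astart A) a (vsnd q') else 0),
     afinal = (\<lambda>q. if is_pair q then afinal A (vsnd q) else 0)\<rparr>"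

definition add_aut :: "('p, 'k, 'a, 's) vaut \<Rightarrow> ('p, 'k, 'a, 's) vaut \<Rightarrow> ('p, 'k, 'a, 's :: {comm_semiring_0, comm_monoid_mult}) vaut" where
  "add_aut A B = \<lparr>astates = VNil # map tagL (astates A) @ map tagR (astates B), astart = VNil,
     atrans = (\<lambda>q a q'. if is_pair q' then
        if is_pair q then
          if vfst q' \<noteq> VNil then if vfst q \<noteq> VNil then atrans B (vsnd q) a (vsnd q') else 0
          else if vfst q \<noteq> VNil then 0 else atrans A (vsnd q) a (vsnd q')
        else if vfst q' \<noteq> VNil then atrans B (astart B) a (vsnd q') else atrans A (astart A) a (vsnd q')
      else 0),
     afinal = (\<lambda>q. if is_pair q then
       if vfst q \<noteq> VNil then afinal B (vsnd q) else afinal A (vsnd q) else 0)\<rparr>"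

definition mul_aut :: "('p, 'k, 'a, 's) vaut \<Rightarrow> ('p, 'k, 'a, 's) vaut \<Rightarrow> ('p, 'k, 'a, 's :: {comm_semiring_0, comm_monoid_mult}) vaut" where
  "mul_aut A B = \<lparr>astates = pairl (astates A) (astates B), astart = VPair (astart A) (astart B),
     atrans = (\<lambda>q a q'. atrans A (vfst q) a (vfst q') * atrans B (vsnd q) a (vsnd q')),
     afinal = (\<lambda>q. afinal A (vfst q) * afinal B (vsnd q))\<rparr>"

text \<open>The passage to \<open>B\<close> consumes a letter: a terminal weight of \<open>A\<close>
  times a transition from the start of \<open>B\<close>. The case of an empty second factor is
  therefore put into the terminal weights.\<close>

definition cat_aut :: "('p, 'k, 'a, 's) vaut \<Rightarrow> ('p, 'k, 'a, 's) vaut \<Rightarrow> ('p, 'k, 'a, 's :: {comm_semiring_0, comm_monoid_mult}) vaut" where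
  "cat_aut A B = \<lparr>astates = map tagL (astates A) @ map tagR (astates B), astart = tagL (astart A),
     atrans = (\<lambda>q a q'. if vfst q' \<noteq> VNil then
        if vfst q \<noteq> VNil then atrans B (vsnd q) a (vsnd q')
        else afinal A (vsnd q) * atrans B (astart B) a (vsnd q')
       else if vfst q \<noteq> VNil then 0 else atrans A (vsnd q) a (vsnd q')),
     afinal = (\<lambda>q. if vfst q \<noteq> VNil then afinal B (vsnd q) else afinal A (vsnd q) * afinal B (astart B))\<rparr>"

text \<open>One component moves at each letter and the other one rests. If both conditions hold,
  both moves lead to the same pair and their weights are added.\<close>

definition shuf_aut :: "('p, 'k, 'a, 's) vaut \<Rightarrow> ('p, 'k, 'a, 's) vaut \<Rightarrow> ('p, 'k, 'a, 's :: {comm_semiring_0, comm_monoid_mult}) vaut" where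
  "shuf_aut A B = \<lparr>astates = pairl (astates A) (astates B), astart = VPair (astart A) (astart B),
     atrans = (\<lambda>q a q'. (if vsnd q = vsnd q' then atrans A (vfst q) a (vfst q') else 0) +
        (if vfst q = vfst q' then atrans B (vsnd q) a (vsnd q') else 0)),
     afinal = (\<lambda>q. afinal A (vfst q) * afinal B (vsnd q))\<rparr>"

fun unvlist :: "('p, 'k) val \<Rightarrow> ('p, 'k) val list" where
  "unvlist (VPair x r) = x # unvlist r"
| "unvlist v = []"

lemma unvlist_vlist [simp]: "unvlist (vlist xs) = xs"
  by (induction xs) auto

text \<open>A set of states is represented by its members in the order of \<open>astates A\<close>;
  this makes the target of a transition a unique tree. The operands are truth-valued, the resulting
  weights are 0 and 1 of an arbitrary semiring.\<close>

definition det_aut :: "('p, 'k, 'a, bool) vaut \<Rightarrow> ('p, 'k, 'a, 's :: {comm_semiring_0, comm_monoid_mult}) vaut" where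
  "det_aut A = \<lparr>astates = map vlist (subseqs (astates A)), astart = VPair (astart A) VNil,
     atrans = (\<lambda>X a Y. if Y = vlist (filter (\<lambda>p. \<exists>q\<in>set (unvlist X). atrans A q a p) (astates A))
        then 1 else 0),
     afinal = (\<lambda>X. if \<exists>q\<in>set (unvlist X). afinal A q then 1 else 0)\<rparr>"

lemma wrap_aut_simps [simp]:
  "astates (wrap_aut c A) = VNil # map tagL (astates A)"
  "astart (wrap_aut c A) = VNil"
  "atrans (wrap_aut c A) q a q' = (if is_pair q' then
        atrans A (if is_pair q then vsnd q else astart A) a (vsnd q') else 0)"
  "afinal (wrap_aut c A) q = (if is_pair q then afinal A (vsnd q) else if c then 1 else 0)"
  by (simp_all add: wrap_aut_def)

lemma plus_aut_simps [simp]: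
  "astates (plus_aut A) = VNil # map tagL (astates A)"
  "astart (plus_aut A) = VNil"
  "atrans (plus_aut A) q a q' = (if is_pair q' then
        if is_pair q then atrans A (vsnd q) a (vsnd q') +
          afinal A (vsnd q) * atrans A (astart A) a (vsnd q')
        else atrans A (astart A) a (vsnd q') else 0)"
  "afinal (plus_aut A) q = (if is_pair q then afinal A (vsnd q) else 0)"
  by (simp_all add: plus_aut_def)

lemma add_aut_simps [simp]:
  "astates (add_aut A B) = VNil # map tagL (astates A) @ map tagR (astates B)"
  "astart (add_aut A B) = VNil"
  "atrans (add_aut A B) q a q' = (if is_pair q' then
        if is_pair q then
          if vfst q' \<noteq> VNil then if vfst q \<noteq> VNil then atrans B (vsnd q) a (vsnd q') else 0
          else if vfst q \<noteq> VNil then 0 else atrans A (vsnd q) a (vsnd q')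
        else if vfst q' \<noteq> VNil then atrans B (astart B) a (vsnd q') else atrans A (astart A) a (vsnd q')
      else 0)"
  "afinal (add_aut A B) q = (if is_pair q then
       if vfst q \<noteq> VNil then afinal B (vsnd q) else afinal A (vsnd q) else 0)"
  by (simp_all add: add_aut_def)

lemma mul_aut_simps [simp]:
  "astates (mul_aut A B) = pairl (astates A) (astates B)"
  "astart (mul_aut A B) = VPair (astart A) (astart B)"
  "atrans (mul_aut A B) q a q' = (atrans A (vfst q) a (vfst q') * atrans B (vsnd q) a (vsnd q'))"
  "afinal (mul_aut A B) q = (afinal A (vfst q) * afinal B (vsnd q))"
  by (simp_all add: mul_aut_def)

lemma cat_aut_simps [simp]:
  "astates (cat_aut A B) = map tagL (astates A) @ map tagR (astates B)"
  "astart (cat_aut A B) = tagL (astart A)"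
  "atrans (cat_aut A B) q a q' = (if vfst q' \<noteq> VNil then
        if vfst q \<noteq> VNil then atrans B (vsnd q) a (vsnd q')
        else afinal A (vsnd q) * atrans B (astart B) a (vsnd q')
       else if vfst q \<noteq> VNil then 0 else atrans A (vsnd q) a (vsnd q'))"
  "afinal (cat_aut A B) q = (if vfst q \<noteq> VNil then afinal B (vsnd q) else afinal A (vsnd q) * afinal B (astart B))"
  by (simp_all add: cat_aut_def)

lemma shuf_aut_simps [simp]:
  "astates (shuf_aut A B) = pairl (astates A) (astates B)"
  "astart (shuf_aut A B) = VPair (astart A) (astart B)"
  "atrans (shuf_aut A B) q a q' = ((if vsnd q = vsnd q' then atrans A (vfst q) a (vfst q') else 0) +
        (if vfst q = vfst q' then atrans B (vsnd q) a (vsnd q') else 0))"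
  "afinal (shuf_aut A B) q = (afinal A (vfst q) * afinal B (vsnd q))"
  by (simp_all add: shuf_aut_def)

lemma det_aut_simps [simp]:
  "astates (det_aut A) = map vlist (subseqs (astates A))"
  "astart (det_aut A) = VPair (astart A) VNil"
  "atrans (det_aut A) X a Y = (if Y = vlist (filter (\<lambda>p. \<exists>q\<in>set (unvlist X). atrans A q a p) (astates A))
        then 1 else 0)"
  "afinal (det_aut A) X = (if \<exists>q\<in>set (unvlist X). afinal A q then 1 else 0)"
  by (simp_all add: det_aut_def)

lemma distinct_pairl: "distinct xs \<Longrightarrow> distinct ys \<Longrightarrow> distinct (pairl xs ys)"
  by (induction xs) (auto simp: pairl_def distinct_map inj_on_def)

lemma set_pairl: "set (pairl xs ys) = (\<lambda>(x, y). VPair x y) ` (set xs \<times> set ys)"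
  by (auto simp: pairl_def)

lemma sum_list_pairl: "(\<Sum>z\<leftarrow>pairl xs ys. F z) = (\<Sum>x\<leftarrow>xs. \<Sum>y\<leftarrow>ys. F (VPair x y))"
  by (induction xs) (auto simp: pairl_def o_def)

lemma sum_list_single:
  "distinct xs \<Longrightarrow> x \<in> set xs \<Longrightarrow> (\<Sum>y\<leftarrow>xs. if x = y then F y else 0) = (F x :: 'b :: comm_monoid_add)"
proof (induction xs)
  case (Cons z xs)
  have "x \<notin> set xs \<Longrightarrow> (\<Sum>y\<leftarrow>xs. if x = y then F y else 0) = 0" by (induction xs) auto
  then show ?case using Cons by auto
qed simp

lemma sum_list_if:
  "(\<Sum>y\<leftarrow>ys. if b then F y else 0) = (if b then \<Sum>y\<leftarrow>ys. F y else (0 :: 'b :: comm_monoid_add))"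
  by simp

lemma series_wrap:
  "series (wrap_aut c A) (tagL q) w = series A q w"
  "series (wrap_aut c A) VNil w = with_eps c (series A (astart A)) w"
proof -
  show *: "series (wrap_aut c A) (tagL q) w = series A q w" for q w
    by (induction w arbitrary: q) (simp_all add: o_def)
  show "series (wrap_aut c A) VNil w = with_eps c (series A (astart A)) w"
    using * by (cases w) (simp_all add: o_def)
qed

lemma series_plus:
  "series (plus_aut A) VNil w = with_eps False (cauchy_plus (series A (astart A))) w"
proof (rule cauchy_plus_unique)
  let ?S = "series (plus_aut A) VNil"
  have St: "?S (a # w) = (\<Sum>p\<leftarrow>astates A. atrans A (astart A) a p * series (plus_aut A) (tagL p) w)" for a w
    by (simp add: o_def)
  \<comment> \<open>From a state inside a factor, either the word ends with this factor, or the
    factor is completed and further ones follow.\<close>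
  have *: "series (plus_aut A) (tagL q) w = series A q w + fcat (series A q) ?S w" for q w
  proof (induction w arbitrary: q)
    case (Cons a w)
    have "series (plus_aut A) (tagL q) (a # w) =
       (\<Sum>p\<leftarrow>astates A. (atrans A q a p + afinal A q * atrans A (astart A) a p) *
          series (plus_aut A) (tagL p) w)"
      by (simp add: o_def)
    also have "\<dots> = (\<Sum>p\<leftarrow>astates A. atrans A q a p * series (plus_aut A) (tagL p) w) + afinal A q * ?S (a # w)"
      unfolding St by (simp add: distrib_right sum_list_addf mult.assoc sum_list_const_mult)
    also have "(\<Sum>p\<leftarrow>astates A. atrans A q a p * series (plus_aut A) (tagL p) w) =
       series A q (a # w) + fcat (\<lambda>u. series A q (a # u)) ?S w"
      by (simp add: Cons.IH distrib_left sum_list_addf fcat_sum_list)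
    finally show ?case by (simp add: algebra_simps)
  qed (simp)
  show "?S [] = 0" by (simp)
  show "?S (a # w) = series A (astart A) (a # w) + fcat (\<lambda>u. series A (astart A) (a # u)) ?S w" for a w
    unfolding St by (simp add: * distrib_left sum_list_addf fcat_sum_list)
qed

lemma series_add:
  "series (add_aut A B) VNil w = with_eps False (\<lambda>w. series A (astart A) w + series B (astart B) w) w"
proof -
  have L: "series (add_aut A B) (tagL q) w = series A q w" for q w
    by (induction w arbitrary: q) (simp_all add: o_def)
  have R: "series (add_aut A B) (tagR q) w = series B q w" for q w
    by (induction w arbitrary: q) (simp_all add: o_def)
  show ?thesis using L R by (cases w) (simp_all add: o_def)
qed

lemma series_mul: "series (mul_aut A B) (VPair q p) w = series A q w * series B p w"
proof (induction w arbitrary: q p)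
  case (Cons a w)
  have "series (mul_aut A B) (VPair q p) (a # w) = (\<Sum>x\<leftarrow>astates A. \<Sum>y\<leftarrow>astates B.
      (atrans A q a x * series A x w) * (atrans B p a y * series B y w))"
    using Cons by (simp add: sum_list_pairl mult.assoc mult.left_commute)
  then show ?case by (simp add: sum_list_const_mult sum_list_mult_const)
qed (simp)

lemma series_cat: "series (cat_aut A B) (tagL q) w = fcat (series A q) (series B (astart B)) w"
proof -
  have R: "series (cat_aut A B) (tagR p) w = series B p w" for p w
    by (induction w arbitrary: p) (simp_all add: o_def)
  show ?thesis
  proof (induction w arbitrary: q)
    case (Cons a w)
    have "series (cat_aut A B) (tagL q) (a # w) =
       (\<Sum>p\<leftarrow>astates A. atrans A q a p * series (cat_aut A B) (tagL p) w) +
       (\<Sum>p\<leftarrow>astates B. afinal A q * atrans B (astart B) a p * series (cat_aut A B) (tagR p) w)"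
      by (simp add: o_def)
    also have "\<dots> = (\<Sum>p\<leftarrow>astates A. atrans A q a p * fcat (series A p) (series B (astart B)) w) +
       afinal A q * (\<Sum>p\<leftarrow>astates B. atrans B (astart B) a p * series B p w)"
      by (simp only: Cons.IH R mult.assoc sum_list_const_mult)
    finally show ?case by (simp add: fcat_sum_list add.commute)
  qed (simp)
qed

text \<open>In the sum over all target pairs, the resting component must match exactly one entry of
  its state list; here the distinctness of the states enters.\<close>

lemma series_shuf:
  assumes "aut_ok A" "aut_ok B" "q \<in> set (astates A)" "p \<in> set (astates B)"
  shows "series (shuf_aut A B) (VPair q p) w = fshuf (series A q) (series B p) w"
  using assms(3,4)
proof (induction w arbitrary: q p)
  case (Cons a w)
  have d: "distinct (astates A)" "distinct (astates B)" using assms by (auto simp: aut_ok_def)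
  have "series (shuf_aut A B) (VPair q p) (a # w) = (\<Sum>x\<leftarrow>astates A. \<Sum>y\<leftarrow>astates B.
      ((if p = y then atrans A q a x else 0) + (if q = x then atrans B p a y else 0)) *
        series (shuf_aut A B) (VPair x y) w)"
    by (simp add: sum_list_pairl cong: if_cong)
  also have "\<dots> = (\<Sum>x\<leftarrow>astates A. \<Sum>y\<leftarrow>astates B.
      ((if p = y then atrans A q a x else 0) + (if q = x then atrans B p a y else 0)) *
        fshuf (series A x) (series B y) w)"
    using Cons.IH by (intro arg_cong[where f = sum_list] map_cong refl) auto
  also have "\<dots> = (\<Sum>x\<leftarrow>astates A. (\<Sum>y\<leftarrow>astates B. if p = y then atrans A q a x * fshuf (series A x) (series B y) w else 0) +
      (\<Sum>y\<leftarrow>astates B. if q = x then atrans B p a y * fshuf (series A x) (series B y) w else 0))"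
    by (simp add: distrib_right sum_list_addf if_distrib[where f = "\<lambda>x. x * _"] cong: if_cong)
  also have "\<dots> = (\<Sum>x\<leftarrow>astates A. atrans A q a x * fshuf (series A x) (series B p) w +
      (if q = x then \<Sum>y\<leftarrow>astates B. atrans B p a y * fshuf (series A x) (series B y) w else 0))"
    by (simp add: sum_list_single[OF d(2) Cons.prems(2)] sum_list_if)
  also have "\<dots> = (\<Sum>x\<leftarrow>astates A. atrans A q a x * fshuf (series A x) (series B p) w) +
      (\<Sum>y\<leftarrow>astates B. atrans B p a y * fshuf (series A q) (series B y) w)"
    by (simp add: sum_list_addf sum_list_single[OF d(1) Cons.prems(1)])
  also have "\<dots> = fshuf (series A q) (series B p) (a # w)"
    by (simp add: fshuf_sum_list fshuf_sum_list')
  finally show ?case .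
qed (simp)

lemma filter_in_subseqs: "filter P xs \<in> set (subseqs xs)"
  by (induction xs) (auto simp: Let_def)

lemma distinct_subseqs: "distinct xs \<Longrightarrow> distinct (subseqs xs)"
  using distinct_set_subseqs distinct_map by blast

text \<open>The successor set occurs exactly once among the subsequences, so the sum over all
  targets collapses to one term and no multiplicities arise.\<close>

lemma series_det:
  assumes "aut_ok A"
  shows "series (det_aut A) (vlist X) w = (if \<exists>q\<in>set X. series A q w then 1 else 0)"
proof (induction w arbitrary: X)
  case (Cons a w)
  let ?Y = "filter (\<lambda>p. \<exists>q\<in>set X. atrans A q a p) (astates A)"
  have d: "distinct (map vlist (subseqs (astates A)) :: ('a, 'b) val list)"
    using assms by (simp add: aut_ok_def distinct_map distinct_subseqs inj_on_def)
  have "series (det_aut A) (vlist X) (a # w) =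
      (\<Sum>Y\<leftarrow>map vlist (subseqs (astates A)). if vlist ?Y = Y then series (det_aut A) Y w else (0 :: 'd))"
    unfolding series.simps by (intro arg_cong[where f = sum_list] map_cong) (auto)
  also have "\<dots> = series (det_aut A) (vlist ?Y) w"
    by (rule sum_list_single[OF d]) (auto simp: filter_in_subseqs)
  also have "\<dots> = (if \<exists>q\<in>set ?Y. series A q w then 1 else 0)" using Cons by simp
  finally show ?case by (auto simp: sum_list_bool times_bool_def)
qed (simp)

lemma aut_ok_wrap: "aut_ok A \<Longrightarrow> aut_ok (wrap_aut c A)"
  by (auto simp: aut_ok_def distinct_map inj_on_def)

lemma aut_ok_plus: "aut_ok A \<Longrightarrow> aut_ok (plus_aut A)"
  by (auto simp: aut_ok_def distinct_map inj_on_def)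

lemma aut_ok_bin:
  assumes "aut_ok A" "aut_ok B"
  shows "aut_ok (add_aut A B)" "aut_ok (mul_aut A B)" "aut_ok (cat_aut A B)" "aut_ok (shuf_aut A B)"
  using assms
  by (auto simp: aut_ok_def distinct_map inj_on_def
      distinct_pairl set_pairl)

lemma single_in_subseqs: "x \<in> set xs \<Longrightarrow> [x] \<in> set (subseqs xs)"
proof (induction xs)
  case (Cons y xs)
  have "[] \<in> set (subseqs xs)" by (induction xs) (auto simp: Let_def)
  then show ?case using Cons by (auto simp: Let_def)
qed simp

lemma aut_ok_det: "aut_ok A \<Longrightarrow> aut_ok (det_aut A)"
  by (auto simp: aut_ok_def distinct_map distinct_subseqs inj_on_def
      intro!: image_eqI[where x = "[_]"] single_in_subseqs)


section \<open>Ground expressions\<close>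

datatype bop = OAdd | OMul | OCat | OShuf

datatype 'd gexp = GLeaf 'd | GWrap bool "'d gexp" | GPlus "'d gexp" | GBin bop "'d gexp" "'d gexp"

primrec bin_aut :: "bop \<Rightarrow> ('p, 'k, 'a, 's) vaut \<Rightarrow> ('p, 'k, 'a, 's) vaut \<Rightarrow> ('p, 'k, 'a, 's :: {comm_semiring_0, comm_monoid_mult}) vaut" where
  "bin_aut OAdd = add_aut" | "bin_aut OMul = mul_aut" | "bin_aut OCat = cat_aut" | "bin_aut OShuf = shuf_aut"

primrec gaut :: "('d \<Rightarrow> ('p, 'k, 'a, 's) vaut) \<Rightarrow> 'd gexp \<Rightarrow> ('p, 'k, 'a, 's :: {comm_semiring_0, comm_monoid_mult}) vaut" where
  "gaut l (GLeaf d) = l d"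
| "gaut l (GWrap c e) = wrap_aut c (gaut l e)"
| "gaut l (GPlus e) = plus_aut (gaut l e)"
| "gaut l (GBin op e e') = bin_aut op (gaut l e) (gaut l e')"

text \<open>\<open>OAdd\<close> is 0 at the empty word because the fresh start state of
  \<open>add_aut\<close> is not terminal; the other operations obtain their value there from the
  operands.\<close>

primrec bin_series :: "bop \<Rightarrow> ('a list \<Rightarrow> 's) \<Rightarrow> ('a list \<Rightarrow> 's) \<Rightarrow> 'a list \<Rightarrow> 's :: {comm_semiring_0, comm_monoid_mult}" where
  "bin_series OAdd = (\<lambda>f g. with_eps False (\<lambda>w. f w + g w))"
| "bin_series OMul = (\<lambda>f g w. f w * g w)"
| "bin_series OCat = fcat"
| "bin_series OShuf = fshuf"

primrec gser :: "('d \<Rightarrow> 'a list \<Rightarrow> 's) \<Rightarrow> 'd gexp \<Rightarrow> 'a list \<Rightarrow> 's :: {comm_semiring_0, comm_monoid_mult}" where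
  "gser l (GLeaf d) = l d"
| "gser l (GWrap c e) = with_eps c (gser l e)"
| "gser l (GPlus e) = with_eps False (cauchy_plus (gser l e))"
| "gser l (GBin op e e') = bin_series op (gser l e) (gser l e')"

lemma gaut_correct:
  assumes "\<And>d. d \<in> set_gexp e \<Longrightarrow> aut_ok (la d) \<and> series (la d) (astart (la d)) = ls d"
  shows "aut_ok (gaut la e) \<and> series (gaut la e) (astart (gaut la e)) = gser ls e"
  using assms
proof (induction e)
  case (GWrap c e)
  then have IH: "aut_ok (gaut la e)" "series (gaut la e) (astart (gaut la e)) = gser ls e" by auto
  show ?case using series_wrap(2)[of c "gaut la e"] aut_ok_wrap[OF IH(1), of c] IH(2)
    by (auto intro!: ext)
next
  case (GPlus e)
  then have IH: "aut_ok (gaut la e)" "series (gaut la e) (astart (gaut la e)) = gser ls e" by auto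
  show ?case using series_plus[of "gaut la e"] aut_ok_plus[OF IH(1)] IH(2)
    by (auto intro!: ext)
next
  case (GBin op e e')
  then have IH: "aut_ok (gaut la e)" "series (gaut la e) (astart (gaut la e)) = gser ls e"
    "aut_ok (gaut la e')" "series (gaut la e') (astart (gaut la e')) = gser ls e'" by auto
  note ok = aut_ok_bin[OF IH(1,3)]
  have s: "astart (gaut la e) \<in> set (astates (gaut la e))" "astart (gaut la e') \<in> set (astates (gaut la e'))"
    using IH by (auto simp: aut_ok_def)
  show ?case
  proof (cases op)
    case OAdd
    have "astart (add_aut (gaut la e) (gaut la e')) = VNil" by (simp)
    then show ?thesis using OAdd ok(1) series_add[of "gaut la e" "gaut la e'"] IH by (auto intro!: ext)
  next
    case OMul
    have "astart (mul_aut (gaut la e) (gaut la e')) = VPair (astart (gaut la e)) (astart (gaut la e'))"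
      by (simp)
    then show ?thesis using OMul ok(2) series_mul[of "gaut la e" "gaut la e'"] IH by (auto intro!: ext)
  next
    case OCat
    have "astart (cat_aut (gaut la e) (gaut la e')) = tagL (astart (gaut la e))" by (simp)
    then show ?thesis using OCat ok(3) series_cat[of "gaut la e" "gaut la e'"] IH by (auto intro!: ext)
  next
    case OShuf
    have "astart (shuf_aut (gaut la e) (gaut la e')) = VPair (astart (gaut la e)) (astart (gaut la e'))"
      by (simp)
    then show ?thesis using OShuf ok(4) series_shuf[OF IH(1,3) s] IH by (auto intro!: ext)
  qed
qed auto

section \<open>Quantifiers as iterated products\<close>

lemma fcat_add_right: "fcat f (\<lambda>u. g u + g' u) w = fcat f g w + fcat f g' w"
  by (induction w arbitrary: f) (auto simp: algebra_simps)

lemma fcat_sum_right: "finite A \<Longrightarrow> fcat f (\<lambda>u. \<Sum>x\<in>A. g x u) w = (\<Sum>x\<in>A. fcat f (g x) w)"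
proof (induction A rule: finite_induct)
  case empty
  have "fcat f (\<lambda>u. 0) w = 0" by (induction w arbitrary: f) auto
  then show ?case by simp
qed (simp add: fcat_add_right)

lemma fcat_eps: "fcat (with_eps True (\<lambda>u. 0)) g w = g w"
proof (cases w)
  case (Cons a v)
  then show ?thesis by (simp add: with_eps_def)
qed simp

lemma with_eps_True: "with_eps True f w = with_eps True (\<lambda>u. 0) w + with_eps False f w"
  by (simp add: with_eps_def)

text \<open>A factor with value 1 at the empty word is either skipped or nonempty; this is the
  source of sums over subsets of indices.\<close>

lemma fcat_with_eps_True: "fcat (with_eps True f) g w = g w + fcat (with_eps False f) g w"
proof -
  have "with_eps True f = (\<lambda>w. with_eps True (\<lambda>u. 0) w + with_eps False f w)"
    by (rule ext) (rule with_eps_True)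
  then show ?thesis by (simp only: fcat_add fcat_eps)
qed

lemma sorted_list_of_set_insert_least:
  fixes j :: nat
  assumes "finite L" "\<forall>l\<in>L. j < l"
  shows "sorted_list_of_set (insert j L) = j # sorted_list_of_set L"
proof (rule sorted_distinct_set_unique)
  show "sorted (j # sorted_list_of_set L)" using assms by (auto simp: less_imp_le)
  show "distinct (j # sorted_list_of_set L)" using assms by auto
  show "set (sorted_list_of_set (insert j L)) = set (j # sorted_list_of_set L)"
    using assms by (simp only: set_sorted_list_of_set finite_insert list.set)
qed (simp_all only: sorted_sorted_list_of_set distinct_sorted_list_of_set)

lemma finite_cat_families: "finite L \<Longrightarrow> finite (cat_families L w)"
proof -
  assume L: "finite L"
  have "cat_families L w \<subseteq> L \<rightarrow>\<^sub>E {u. set u \<subseteq> set w \<and> length u \<le> length w}"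
  proof
    fix ws assume ws: "ws \<in> cat_families L w"
    have "set (ws j) \<subseteq> set w \<and> length (ws j) \<le> length w" if "j \<in> L" for j
    proof -
      have w: "w = concat (map ws (sorted_list_of_set L))" using ws by (simp add: cat_families_def)
      have j: "j \<in> set (sorted_list_of_set L)" using L that by simp
      have "length (ws j) \<le> sum_list (map (\<lambda>j. length (ws j)) (sorted_list_of_set L))"
        using j by (intro member_le_sum_list) auto
      then show ?thesis using j unfolding w by (auto simp: length_concat o_def)
    qed
    then show "ws \<in> L \<rightarrow>\<^sub>E {u. set u \<subseteq> set w \<and> length u \<le> length w}"
      using ws by (auto simp: cat_families_def PiE_def)
  qed
  then show ?thesis using L finite_lists_length_le[of "set w" "length w"]
    by (meson List.finite_set finite_PiE finite_subset)
qed

text \<open>The word of the least index is a prefix, determined by its length \<open>i\<close>, and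
  the other words split the rest. Lengths start at 1 as the words are nonempty; resetting the value
  at \<open>j\<close> to \<open>undefined\<close> leads back to extensional functions on
  \<open>L\<close>.\<close>

lemma cat_families_insert:
  assumes "finite L" "\<forall>l\<in>L. j < l"
  shows "bij_betw (\<lambda>(i, ws). ws(j := take i w))
    (SIGMA i:{1..length w}. cat_families L (drop i w)) (cat_families (insert j L) w)"
proof -
  have j: "j \<notin> L" using assms by auto
  have s: "sorted_list_of_set (insert j L) = j # sorted_list_of_set L"
    using assms by (rule sorted_list_of_set_insert_least)
  have m: "map (ws(j := u)) (sorted_list_of_set L) = map ws (sorted_list_of_set L)"
    for ws :: "nat \<Rightarrow> 'a list" and u using assms j by (intro map_cong) auto
  show ?thesis
  proof (rule bij_betwI[where g = "\<lambda>ws. (length (ws j), ws(j := undefined))"])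
    show "(\<lambda>(i, ws). ws(j := take i w)) \<in>
        (SIGMA i:{1..length w}. cat_families L (drop i w)) \<rightarrow> cat_families (insert j L) w"
      using assms j by (auto simp: cat_families_def s m PiE_def extensional_def Pi_def split: if_splits)
    show "(\<lambda>ws. (length (ws j), ws(j := undefined))) \<in>
        cat_families (insert j L) w \<rightarrow> (SIGMA i:{1..length w}. cat_families L (drop i w))"
    proof
      fix ws assume "ws \<in> cat_families (insert j L) w"
      then have ws: "ws \<in> insert j L \<rightarrow>\<^sub>E (- {[]})" and w: "w = ws j @ concat (map ws (sorted_list_of_set L))"
        by (auto simp: cat_families_def s)
      have "ws j \<noteq> []" using ws by (auto simp: PiE_def)
      then have "length (ws j) \<in> {1..length w}" using w by (cases "ws j") auto
      moreover have "ws(j := undefined) \<in> L \<rightarrow>\<^sub>E (- {[]})"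
        using ws j by (auto simp: PiE_def extensional_def Pi_def)
      moreover have "drop (length (ws j)) w = concat (map ws (sorted_list_of_set L))"
        by (subst w) simp
      ultimately show "(length (ws j), ws(j := undefined)) \<in> (SIGMA i:{1..length w}. cat_families L (drop i w))"
        by (simp add: cat_families_def m)
    qed
    show "(\<lambda>ws. (length (ws j), ws(j := undefined))) ((\<lambda>(i, ws). ws(j := take i w)) z) = z"
      if "z \<in> (SIGMA i:{1..length w}. cat_families L (drop i w))" for z
      using that j by (auto simp: cat_families_def PiE_def extensional_def fun_eq_iff)
    show "(\<lambda>(i, ws). ws(j := take i w)) (length (ws j), ws(j := undefined)) = ws"
      if "ws \<in> cat_families (insert j L) w" for ws
    proof -
      have "w = ws j @ concat (map ws (sorted_list_of_set L))" using that by (auto simp: cat_families_def s)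
      then have "take (length (ws j)) w = ws j" by (metis append_eq_conv_conj)
      then show ?thesis by simp
    qed
  qed
qed

lemma cat_prod_family_insert:
  assumes "finite L" "\<forall>l\<in>L. j < l"
  shows "cat_prod_family (insert j L) F w = fcat (with_eps False (F j)) (cat_prod_family L F) w"
proof -
  have j: "j \<notin> L" using assms by auto
  have p: "(\<Prod>l\<in>L. F l (if l = j then u else ws l)) = (\<Prod>l\<in>L. F l (ws l))" for ws u
    using j by (intro prod.cong) auto
  have "cat_prod_family (insert j L) F w =
      (\<Sum>(i, ws)\<in>(SIGMA i:{1..length w}. cat_families L (drop i w)). F j (take i w) * (\<Prod>l\<in>L. F l (ws l)))"
    unfolding cat_prod_family_def
    by (subst sum.reindex_bij_betw[OF cat_families_insert[OF assms], symmetric])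
      (intro sum.cong refl, auto simp: assms j p)
  also have "\<dots> = (\<Sum>i\<in>{1..length w}. F j (take i w) * cat_prod_family L F (drop i w))"
    unfolding cat_prod_family_def sum_distrib_left
    by (subst sum.Sigma) (auto simp: finite_cat_families assms)
  also have "\<dots> = (\<Sum>i\<le>length w. with_eps False (F j) (take i w) * cat_prod_family L F (drop i w))"
    by (rule sum.mono_neutral_cong_left) (auto simp: with_eps_def)
  finally show ?thesis by (simp add: fcat_eq_sum)
qed

lemma cat_prod_family_empty: "cat_prod_family {} F w = with_eps True (\<lambda>u. 0) w"
  by (auto simp: cat_prod_family_def cat_families_def with_eps_def)

lemma sum_Pow_insert:
  assumes "finite L" "j \<notin> L"
  shows "(\<Sum>S\<in>Pow (insert j L). F S) = (\<Sum>S\<in>Pow L. F S + F (insert j S))"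
proof -
  have "inj_on (insert j) (Pow L)" using assms by (auto simp: inj_on_def)
  moreover have "Pow L \<inter> insert j ` Pow L = {}" using assms by auto
  ultimately show ?thesis using assms
    by (simp add: Pow_insert sum.union_disjoint sum.reindex sum.distrib)
qed

lemma foldr_fcat_prod:
  assumes "sorted_wrt (<) js"
  shows "foldr (\<lambda>j. fcat (with_eps False (F j))) js (with_eps True (\<lambda>u. 0)) = cat_prod_family (set js) F"
  using assms
proof (induction js)
  case (Cons j js)
  then have "foldr (\<lambda>j. fcat (with_eps False (F j))) (j # js) (with_eps True (\<lambda>u. 0)) =
      fcat (with_eps False (F j)) (cat_prod_family (set js) F)" by simp
  also have "\<dots> = cat_prod_family (set (j # js)) F"
    using cat_prod_family_insert[of "set js" j F] Cons.prems by (auto intro!: ext)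
  finally show ?case .
qed (simp add: cat_prod_family_empty fun_eq_iff)

text \<open>Each index contributes the empty word, and then lies outside \<open>L\<close>, or a
  nonempty word. Expanding the product yields all subsets, the empty one included.\<close>

lemma foldr_fcat_sum:
  assumes "sorted_wrt (<) js"
  shows "foldr (\<lambda>j. fcat (with_eps True (F j))) js (with_eps True (\<lambda>u. 0)) =
    (\<lambda>w. \<Sum>L\<in>Pow (set js). cat_prod_family L F w)"
  using assms
proof (induction js)
  case (Cons j js)
  have j: "j \<notin> set js" "\<forall>l\<in>set js. j < l" "finite (set js)" using Cons.prems by auto
  have "foldr (\<lambda>j. fcat (with_eps True (F j))) (j # js) (with_eps True (\<lambda>u. 0)) w =
      (\<Sum>L\<in>Pow (set js). cat_prod_family L F w) +
      (\<Sum>L\<in>Pow (set js). fcat (with_eps False (F j)) (cat_prod_family L F) w)" for w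
  proof -
    have IH: "foldr (\<lambda>j. fcat (with_eps True (F j))) js (with_eps True (\<lambda>u. 0)) =
      (\<lambda>w. \<Sum>L\<in>Pow (set js). cat_prod_family L F w)" using Cons by simp
    show ?thesis
      by (simp only: foldr_Cons o_apply IH) (simp add: fcat_with_eps_True fcat_sum_right)
  qed
  also have "\<dots> w = (\<Sum>L\<in>Pow (set js). cat_prod_family L F w) +
      (\<Sum>L\<in>Pow (set js). cat_prod_family (insert j L) F w)" for w
    using j(2) finite_subset[OF _ j(3)]
    by (intro arg_cong2[where f = "(+)"] refl sum.cong) (subst cat_prod_family_insert, auto)
  also have "\<dots> w = (\<Sum>L\<in>Pow (set (j # js)). cat_prod_family L F w)" for w
    using sum_Pow_insert[OF j(3,1), of "\<lambda>L. cat_prod_family L F w"] by (simp add: sum.distrib)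
  finally show ?case by blast
qed (simp add: cat_prod_family_empty fun_eq_iff)

section \<open>Shuffle quantifiers: assignments of positions to instances\<close>

definition shuf_maps ::
  "nat set \<Rightarrow> (nat \<Rightarrow> 'a list \<Rightarrow> 'k) \<Rightarrow> 'a list \<Rightarrow> 'k :: {comm_semiring_0, comm_monoid_mult}" where
  "shuf_maps L F w = (\<Sum>g\<in>{..<length w} \<rightarrow>\<^sub>E L. \<Prod>j\<in>L. F j (nths w {m. m < length w \<and> g m = j}))"

lemma PiE_lessThan_Suc_bij:
  "bij_betw (\<lambda>(i, g). case_nat i g) (L \<times> ({..<n} \<rightarrow>\<^sub>E L)) ({..<Suc n} \<rightarrow>\<^sub>E L)"
proof (rule bij_betwI[where g = "\<lambda>g. (g 0, \<lambda>m. g (Suc m))"])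
  show "(\<lambda>(i, g). case_nat i g) \<in> L \<times> ({..<n} \<rightarrow>\<^sub>E L) \<rightarrow> ({..<Suc n} \<rightarrow>\<^sub>E L)"
    by (auto simp: PiE_def extensional_def Pi_def split: nat.splits)
  show "(\<lambda>g. (g 0, \<lambda>m. g (Suc m))) \<in> ({..<Suc n} \<rightarrow>\<^sub>E L) \<rightarrow> L \<times> ({..<n} \<rightarrow>\<^sub>E L)"
    by (auto simp: PiE_def extensional_def Pi_def)
  show "(\<lambda>(i, g). case_nat i g) (g 0, \<lambda>m. g (Suc m)) = g" for g
    unfolding case_prod_conv by (rule ext) (simp split: nat.split)
  show "((\<lambda>(i, g). case_nat i g) z 0, \<lambda>m. (\<lambda>(i, g). case_nat i g) z (Suc m)) = z" for z
    by (cases z) simp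
qed

text \<open>The first letter goes to one index \<open>i\<close>, whose series is replaced by its
  derivative: the product rule for many factors.\<close>

lemma shuf_maps_Cons:
  assumes "finite L"
  shows "shuf_maps L F (a # w) = (\<Sum>i\<in>L. shuf_maps L (F(i := \<lambda>u. F i (a # u))) w)"
proof -
  have n: "nths (a # w) {m. m < length (a # w) \<and> case_nat i g m = j} =
     (if i = j then [a] else []) @ nths w {m. m < length w \<and> g m = j}" for i g j
  proof -
    have e: "{m. Suc m \<in> {m. m < length (a # w) \<and> case_nat i g m = j}} = {m. m < length w \<and> g m = j}"
      by simp
    show ?thesis unfolding nths_Cons e by simp
  qed
  define H where "H g = (\<Prod>j\<in>L. F j (nths (a # w) {m. m < length (a # w) \<and> g m = j}))" for g
  have "shuf_maps L F (a # w) = sum H ({..<Suc (length w)} \<rightarrow>\<^sub>E L)"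
    unfolding shuf_maps_def H_def by (simp only: list.size(4) add_Suc_right add_0_right One_nat_def)
  also have "\<dots> = (\<Sum>z\<in>L \<times> ({..<length w} \<rightarrow>\<^sub>E L). H (case z of (i, g) \<Rightarrow> case_nat i g))"
    by (rule sum.reindex_bij_betw[OF PiE_lessThan_Suc_bij, symmetric])
  also have "\<dots> = (\<Sum>(i, g)\<in>L \<times> ({..<length w} \<rightarrow>\<^sub>E L).
      \<Prod>j\<in>L. F j ((if i = j then [a] else []) @ nths w {m. m < length w \<and> g m = j}))"
  proof (rule sum.cong[OF refl])
    fix z :: "nat \<times> (nat \<Rightarrow> nat)"
    obtain i g where z: "z = (i, g)" by (cases z)
    show "H (case z of (i, g) \<Rightarrow> case_nat i g) = (case z of (i, g) \<Rightarrow>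
        \<Prod>j\<in>L. F j ((if i = j then [a] else []) @ nths w {m. m < length w \<and> g m = j}))"
      unfolding z case_prod_conv H_def n ..
  qed
  also have "\<dots> = (\<Sum>(i, g)\<in>L \<times> ({..<length w} \<rightarrow>\<^sub>E L).
      \<Prod>j\<in>L. (F(i := \<lambda>u. F i (a # u))) j (nths w {m. m < length w \<and> g m = j}))"
  proof (rule sum.cong[OF refl])
    fix z :: "nat \<times> (nat \<Rightarrow> nat)"
    obtain i g where z: "z = (i, g)" by (cases z)
    have "F j ((if i = j then [a] else []) @ u) = (F(i := \<lambda>u. F i (a # u))) j u" for j u
      by (cases "i = j") simp_all
    then show "(case z of (i, g) \<Rightarrow>
        \<Prod>j\<in>L. F j ((if i = j then [a] else []) @ nths w {m. m < length w \<and> g m = j})) =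
       (case z of (i, g) \<Rightarrow>
        \<Prod>j\<in>L. (F(i := \<lambda>u. F i (a # u))) j (nths w {m. m < length w \<and> g m = j}))"
      unfolding z case_prod_conv by (simp only:)
  qed
  also have "\<dots> = (\<Sum>i\<in>L. shuf_maps L (F(i := \<lambda>u. F i (a # u))) w)"
    unfolding shuf_maps_def by (subst sum.cartesian_product) simp
  finally show ?thesis .
qed

definition fold_shuf ::
  "nat list \<Rightarrow> (nat \<Rightarrow> 'a list \<Rightarrow> 'k) \<Rightarrow> 'a list \<Rightarrow> 'k :: {comm_semiring_0, comm_monoid_mult}" where
  "fold_shuf js F = foldr (\<lambda>j. fshuf (F j)) js (with_eps True (\<lambda>u. 0))"

lemma fold_shuf_simps [simp]:
  "fold_shuf [] F = with_eps True (\<lambda>u. 0)" "fold_shuf (j # js) F = fshuf (F j) (fold_shuf js F)"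
  by (simp_all add: fold_shuf_def)

lemma fold_shuf_cong: "(\<And>j. j \<in> set js \<Longrightarrow> F j = G j) \<Longrightarrow> fold_shuf js F = fold_shuf js G"
  by (induction js) auto

lemma fshuf_sum_right: "finite A \<Longrightarrow> fshuf f (\<lambda>u. \<Sum>x\<in>A. g x u) w = (\<Sum>x\<in>A. fshuf f (g x) w)"
proof (induction A rule: finite_induct)
  case (insert x A)
  then show ?case by (simp add: fshuf_commute[of f] fshuf_add)
qed (simp add: fshuf_commute[of f])

lemma fold_shuf_Cons:
  "distinct js \<Longrightarrow> fold_shuf js F (a # w) = (\<Sum>i\<in>set js. fold_shuf js (F(i := \<lambda>u. F i (a # u))) w)"
proof (induction js arbitrary: w)
  case (Cons j js)
  have 1: "fold_shuf js (F(j := \<lambda>u. F j (a # u))) = fold_shuf js F"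
    using Cons.prems by (intro fold_shuf_cong) auto
  have "fold_shuf (j # js) F (a # w) = fshuf (\<lambda>u. F j (a # u)) (fold_shuf js F) w +
      fshuf (F j) (\<lambda>u. fold_shuf js F (a # u)) w" by simp
  also have "(\<lambda>u. fold_shuf js F (a # u)) = (\<lambda>u. \<Sum>i\<in>set js. fold_shuf js (F(i := \<lambda>u. F i (a # u))) u)"
    using Cons.IH Cons.prems by (intro ext) (simp del: fun_upd_apply)
  also have "fshuf (F j) \<dots> w = (\<Sum>i\<in>set js. fshuf (F j) (fold_shuf js (F(i := \<lambda>u. F i (a # u)))) w)"
    by (rule fshuf_sum_right) simp
  also have "\<dots> = (\<Sum>i\<in>set js. fold_shuf (j # js) (F(i := \<lambda>u. F i (a # u))) w)"
    using Cons.prems by (intro sum.cong) auto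
  finally show ?case using Cons.prems by (simp add: 1 fun_upd_same del: fun_upd_apply)
qed simp

text \<open>Nested binary shuffles obey the same product rule as assignments of positions, so both
  agree by recursion on the word.\<close>

lemma fold_shuf_eq_maps:
  "distinct js \<Longrightarrow> fold_shuf js F w = shuf_maps (set js) F w"
proof (induction w arbitrary: F)
  case Nil
  have "fold_shuf js F [] = (\<Prod>j\<in>set js. F j [])" using Nil
    by (induction js) auto
  then show ?case by (simp add: shuf_maps_def)
next
  case (Cons a w)
  then show ?case by (simp add: fold_shuf_Cons shuf_maps_Cons)
qed

lemma nths_fiber_Nil: "nths w {m. m < length w \<and> g m = j} = [] \<longleftrightarrow> j \<notin> g ` {..<length w}"
  by (subst nths_eq_Nil_iff) auto

text \<open>An index that receives no position contributes its value at the empty word, which is 0;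
  only surjective assignments survive.\<close>

lemma shuf_prod_family_eq_maps:
  assumes "finite L"
  shows "shuf_prod_family L F w = shuf_maps L (\<lambda>j. with_eps False (F j)) w"
  unfolding shuf_prod_family_def shuf_maps_def
proof (rule sum.mono_neutral_cong_left)
  show "finite ({..<length w} \<rightarrow>\<^sub>E L)" using assms by (intro finite_PiE) auto
  show "\<forall>g\<in>({..<length w} \<rightarrow>\<^sub>E L) - {g \<in> {..<length w} \<rightarrow>\<^sub>E L. g ` {..<length w} = L}.
     (\<Prod>j\<in>L. with_eps False (F j) (nths w {m. m < length w \<and> g m = j})) = 0"
  proof
    fix g assume g: "g \<in> ({..<length w} \<rightarrow>\<^sub>E L) - {g \<in> {..<length w} \<rightarrow>\<^sub>E L. g ` {..<length w} = L}"
    then have "g ` {..<length w} \<subseteq> L" "g ` {..<length w} \<noteq> L" by auto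
    then obtain j where j: "j \<in> L" "j \<notin> g ` {..<length w}" by blast
    then have "with_eps False (F j) (nths w {m. m < length w \<and> g m = j}) = 0"
      using nths_fiber_Nil[of w g j] by simp
    then show "(\<Prod>j\<in>L. with_eps False (F j) (nths w {m. m < length w \<and> g m = j})) = 0"
      using assms j(1) by (simp add: prod.remove)
  qed
  show "(\<Prod>j\<in>L. F j (nths w {m. m < length w \<and> g m = j})) =
      (\<Prod>j\<in>L. with_eps False (F j) (nths w {m. m < length w \<and> g m = j}))"
    if "g \<in> {g \<in> {..<length w} \<rightarrow>\<^sub>E L. g ` {..<length w} = L}" for g
    using that nths_fiber_Nil[of w g] by (intro prod.cong) (auto simp: with_eps_def)
qed auto

text \<open>If the value at the empty word is 1, an index without positions contributes the factor
  1, and the assignments can be grouped by their image.\<close>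

lemma sum_shuf_prod_family_eq_maps:
  assumes L: "finite L"
  shows "(\<Sum>L'\<in>Pow L. shuf_prod_family L' F w) = shuf_maps L (\<lambda>j. with_eps True (F j)) w"
proof -
  let ?h = "\<lambda>g. \<Prod>j\<in>L. with_eps True (F j) (nths w {m. m < length w \<and> g m = j})"
  have "shuf_prod_family L' F w =
      (\<Sum>g\<in>{g \<in> {..<length w} \<rightarrow>\<^sub>E L. g ` {..<length w} = L'}. ?h g)" if "L' \<in> Pow L" for L'
    unfolding shuf_prod_family_def
  proof (rule sum.cong)
    show "{g \<in> {..<length w} \<rightarrow>\<^sub>E L'. g ` {..<length w} = L'} = {g \<in> {..<length w} \<rightarrow>\<^sub>E L. g ` {..<length w} = L'}"
    proof (rule Collect_cong, rule iffI)
      fix g assume "g \<in> {..<length w} \<rightarrow>\<^sub>E L' \<and> g ` {..<length w} = L'"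
      then show "g \<in> {..<length w} \<rightarrow>\<^sub>E L \<and> g ` {..<length w} = L'"
        using that PiE_mono[of "{..<length w}" "\<lambda>_. L'" "\<lambda>_. L"] by blast
    next
      fix g assume "g \<in> {..<length w} \<rightarrow>\<^sub>E L \<and> g ` {..<length w} = L'"
      then show "g \<in> {..<length w} \<rightarrow>\<^sub>E L' \<and> g ` {..<length w} = L'"
        unfolding PiE_iff by blast
    qed
    fix g assume "g \<in> {g \<in> {..<length w} \<rightarrow>\<^sub>E L. g ` {..<length w} = L'}"
    then show "(\<Prod>j\<in>L'. F j (nths w {m. m < length w \<and> g m = j})) = ?h g"
      using that L nths_fiber_Nil[of w g] by (intro prod.mono_neutral_cong_left) (auto simp: with_eps_def)
  qed
  then have "(\<Sum>L'\<in>Pow L. shuf_prod_family L' F w) =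
      (\<Sum>L'\<in>Pow L. \<Sum>g\<in>{g \<in> {..<length w} \<rightarrow>\<^sub>E L. g ` {..<length w} = L'}. ?h g)" by simp
  also have "\<dots> = shuf_maps L (\<lambda>j. with_eps True (F j)) w"
    unfolding shuf_maps_def using L by (intro sum.group finite_PiE) auto
  finally show ?thesis .
qed

section \<open>Formulas of the three logics in a common form\<close>

datatype qk = KSum | KProd | KSumCat | KProdCat | KSumShuf | KProdShuf

primrec kop :: "qk \<Rightarrow> bop" where
  "kop KSum = OAdd" | "kop KProd = OMul" | "kop KSumCat = OCat" | "kop KProdCat = OCat"
| "kop KSumShuf = OShuf" | "kop KProdShuf = OShuf"

text \<open>True for the sums over subsets of instances, where an index may be left out.\<close>

primrec kflag :: "qk \<Rightarrow> bool" where
  "kflag KSum = False" | "kflag KProd = False" | "kflag KSumCat = True" | "kflag KProdCat = False"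
| "kflag KSumShuf = True" | "kflag KProdShuf = False"

text \<open>EPIL, FOEIL and wFOEIL share these connectives, as far as they have them, and differ in
  their leaves. Semantics, grounding and its complexity are treated once, with the leaf data as
  parameters.\<close>

datatype 'd qexp = QLeaf 'd | QBin bop "'d qexp" "'d qexp" | QPlus "'d qexp" | QQuant qk var "'d qexp"

primrec bop_sem ::
  "bop \<Rightarrow> ('a list \<Rightarrow> 's) \<Rightarrow> ('a list \<Rightarrow> 's) \<Rightarrow> 'a list \<Rightarrow> 's :: {comm_semiring_0, comm_monoid_mult}" where
  "bop_sem OAdd = (\<lambda>f g w. f w + g w)"
| "bop_sem OMul = (\<lambda>f g w. f w * g w)"
| "bop_sem OCat = cauchy"
| "bop_sem OShuf = shuffle_prod"

primrec quant_sem ::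
  "qk \<Rightarrow> nat set \<Rightarrow> (nat \<Rightarrow> 'a list \<Rightarrow> 's) \<Rightarrow> 'a list \<Rightarrow> 's :: {comm_semiring_0, comm_monoid_mult}" where
  "quant_sem KSum J F = (\<lambda>w. \<Sum>j\<in>J. F j w)"
| "quant_sem KProd J F = (\<lambda>w. \<Prod>j\<in>J. F j w)"
| "quant_sem KSumCat J F = (\<lambda>w. \<Sum>L\<in>{L. L \<noteq> {} \<and> L \<subseteq> J}. cat_prod_family L F w)"
| "quant_sem KProdCat J F = cat_prod_family J F"
| "quant_sem KSumShuf J F = (\<lambda>w. \<Sum>L\<in>{L. L \<noteq> {} \<and> L \<subseteq> J}. shuf_prod_family L F w)"
| "quant_sem KProdShuf J F = shuf_prod_family J F"

primrec qsem ::
  "('d \<Rightarrow> (var \<rightharpoonup> nat) \<Rightarrow> 'a list \<Rightarrow> 's) \<Rightarrow> (nat \<Rightarrow> nat) \<Rightarrow> 'd qexp \<Rightarrow> (var \<rightharpoonup> nat) \<Rightarrow> 'a list \<Rightarrow>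
   's :: {comm_semiring_0, comm_monoid_mult}" where
  "qsem l r (QLeaf d) = l d"
| "qsem l r (QBin op a b) = (\<lambda>\<sigma>. bop_sem op (qsem l r a \<sigma>) (qsem l r b \<sigma>))"
| "qsem l r (QPlus a) = (\<lambda>\<sigma>. cauchy_plus (qsem l r a \<sigma>))"
| "qsem l r (QQuant k x a) = (\<lambda>\<sigma>. quant_sem k {1..r (fst x)} (\<lambda>j. qsem l r a (\<sigma>(x \<mapsto> j))))"

type_synonym venv = "(var \<times> nat) list"

text \<open>Neutral elements of the iterated operations: \<open>z\<close> and \<open>i\<close> stand
  for 0 and 1, and wrapping 0 with flag \<open>True\<close> gives the series of the empty
  word.\<close>

primrec quant_base :: "'g \<Rightarrow> 'g \<Rightarrow> bop \<Rightarrow> 'g gexp" where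
  "quant_base z i OAdd = GLeaf z"
| "quant_base z i OMul = GLeaf i"
| "quant_base z i OCat = GWrap True (GLeaf z)"
| "quant_base z i OShuf = GWrap True (GLeaf z)"

primrec ground ::
  "'g \<Rightarrow> 'g \<Rightarrow> ('d \<Rightarrow> venv \<Rightarrow> 'g gexp) \<Rightarrow> (nat \<Rightarrow> nat) \<Rightarrow> 'd qexp \<Rightarrow> venv \<Rightarrow> 'g gexp" where
  "ground z i l r (QLeaf d) = l d"
| "ground z i l r (QBin op a b) =
     (\<lambda>env. GBin op (GWrap False (ground z i l r a env)) (GWrap False (ground z i l r b env)))"
| "ground z i l r (QPlus a) = (\<lambda>env. GPlus (ground z i l r a env))"
| "ground z i l r (QQuant k x a) = (\<lambda>env. foldr
     (\<lambda>j e. GBin (kop k) (GWrap (kflag k) (ground z i l r a ((x, j) # env))) e)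
     [1..<Suc (r (fst x))] (quant_base z i (kop k)))"

lemma with_eps_cong: "(\<And>w. w \<noteq> [] \<Longrightarrow> f w = g w) \<Longrightarrow> with_eps c f = with_eps c g"
  by (rule ext) (simp add: with_eps_def)

lemma bin_series_with_eps:
  "w \<noteq> [] \<Longrightarrow> bin_series op (with_eps False f) (with_eps False g) w = bop_sem op f g w"
  by (cases op) (simp_all add: cauchy_eq_fcat shuffle_prod_eq_fshuf, simp_all add: with_eps_def)

lemma sum_nonempty_subsets:
  assumes "finite J" "F {} = 0"
  shows "(\<Sum>L\<in>{L. L \<noteq> {} \<and> L \<subseteq> J}. F L) = (\<Sum>L\<in>Pow J. F L)"
  using assms by (intro sum.mono_neutral_left) auto

lemma quant_series:
  assumes w: "w \<noteq> []" and z: "ls z = (\<lambda>w. 0)" and i: "ls i = (\<lambda>w. 1)"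
  shows "gser ls (foldr (\<lambda>j e. GBin (kop k) (GWrap (kflag k) (e' j)) e) [1..<Suc n] (quant_base z i (kop k))) w
    = quant_sem k {1..n} (\<lambda>j. gser ls (e' j)) w"
proof -
  let ?F = "\<lambda>j. gser ls (e' j)" and ?js = "[1..<Suc n]"
  have fold: "gser ls (foldr (\<lambda>j e. GBin op (GWrap c (e' j)) e) js b) =
      foldr (\<lambda>j. bin_series op (with_eps c (?F j))) js (gser ls b)" for op c js b
    by (induction js) auto
  have js: "set ?js = {1..n}" "sorted_wrt (<) ?js" "distinct ?js" by (auto simp: sorted_wrt_upt simp del: upt_Suc)
  \<comment> \<open>On a nonempty word the empty index set contributes 0, so the sum over all
    subsets equals the required sum over the nonempty ones.\<close>
  have nil_cat: "cat_prod_family {} ?F w = 0" using w by (simp add: cat_prod_family_empty with_eps_def)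
  have nil_shuf: "shuf_prod_family {} ?F w = 0"
    using w by (cases w) (auto simp: shuf_prod_family_def intro!: sum.neutral)
  have sh: "foldr (\<lambda>j. fshuf (with_eps c (?F j))) ?js (with_eps True (\<lambda>u. 0)) w =
      shuf_maps {1..n} (\<lambda>j. with_eps c (?F j)) w" for c
    using fold_shuf_eq_maps[OF js(3), of "\<lambda>j. with_eps c (?F j)" w] by (simp only: fold_shuf_def js(1))
  show ?thesis
  proof (cases k)
    case KSum
    have "foldr (\<lambda>j. bin_series OAdd (with_eps False (?F j))) js (\<lambda>w. 0) w = (\<Sum>j\<leftarrow>js. ?F j w)" for js
      using w by (induction js) (simp_all add: with_eps_def)
    then show ?thesis unfolding KSum kop.simps kflag.simps fold quant_sem.simps
      by (simp only: quant_base.simps gser.simps z) (simp only: sum_list_distinct_conv_sum_set[OF js(3)] js(1))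
  next
    case KProd
    have "foldr (\<lambda>j. bin_series OMul (with_eps False (?F j))) js (\<lambda>w. 1) w = (\<Prod>j\<leftarrow>js. ?F j w)" for js
      using w by (induction js) (simp_all add: with_eps_def)
    then show ?thesis unfolding KProd kop.simps kflag.simps fold quant_sem.simps
      by (simp only: quant_base.simps gser.simps i) (simp only: prod.distinct_set_conv_list[OF js(3), symmetric] js(1))
  next
    case KSumCat
    show ?thesis unfolding KSumCat kop.simps kflag.simps fold quant_sem.simps
      by (simp only: quant_base.simps gser.simps bin_series.simps z foldr_fcat_sum[OF js(2)] js(1))
        (rule sum_nonempty_subsets[symmetric], simp_all add: nil_cat)
  next
    case KProdCat
    show ?thesis unfolding KProdCat kop.simps kflag.simps fold quant_sem.simps
      by (simp only: quant_base.simps gser.simps bin_series.simps z foldr_fcat_prod[OF js(2)] js(1))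
  next
    case KSumShuf
    show ?thesis unfolding KSumShuf kop.simps kflag.simps fold quant_sem.simps
      by (simp only: quant_base.simps gser.simps bin_series.simps z sh)
        (subst sum_nonempty_subsets, simp_all add: nil_shuf sum_shuf_prod_family_eq_maps)
  next
    case KProdShuf
    show ?thesis unfolding KProdShuf kop.simps kflag.simps fold quant_sem.simps
      by (simp only: quant_base.simps gser.simps bin_series.simps z sh)
        (simp add: shuf_prod_family_eq_maps)
  qed
qed

lemma quant_sem_cong:
  assumes FG: "\<And>j w. w \<noteq> [] \<Longrightarrow> F j w = G j w" and w: "w \<noteq> []"
  shows "quant_sem k J F w = quant_sem k J G w"
proof -
  have c: "cat_prod_family L F w = cat_prod_family L G w" for L
    unfolding cat_prod_family_def using FG
    by (intro sum.cong prod.cong refl) (auto simp: cat_families_def PiE_def Pi_def)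
  have "(\<Prod>j\<in>L. F j (nths w {m. m < length w \<and> g m = j})) = (\<Prod>j\<in>L. G j (nths w {m. m < length w \<and> g m = j}))"
    if "g ` {..<length w} = L" for g L
    using that FG nths_fiber_Nil[of w g] by (intro prod.cong) auto
  then have "shuf_prod_family L F w = shuf_prod_family L G w" for L
    unfolding shuf_prod_family_def by (intro sum.cong refl) blast
  then show ?thesis using c FG w by (cases k) auto
qed

lemma bop_sem_cong:
  assumes "\<And>w. w \<noteq> [] \<Longrightarrow> f w = f' w" "\<And>w. w \<noteq> [] \<Longrightarrow> g w = g' w" "w \<noteq> []"
  shows "bop_sem op f g w = bop_sem op f' g' w"
proof -
  have e: "with_eps False f = with_eps False f'" "with_eps False g = with_eps False g'"
    using assms by (auto intro!: with_eps_cong)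
  show ?thesis using assms by (cases op) (simp_all add: cauchy_eq_fcat shuffle_prod_eq_fshuf e)
qed

text \<open>Nothing is claimed for the empty word. This suffices for the induction, since operands
  of connectives and quantifiers are wrapped and iteration evaluates its body on nonempty factors
  only.\<close>

theorem ground_correct:
  assumes z: "ls z = (\<lambda>w. 0)" and i: "ls i = (\<lambda>w. 1)"
    and l: "\<And>d env w. w \<noteq> [] \<Longrightarrow> gser ls (l d env) w = lsem d (map_of env) w"
  shows "w \<noteq> [] \<Longrightarrow> gser ls (ground z i l r a env) w = qsem lsem r a (map_of env) w"
proof (induction a arbitrary: env w)
  case (QLeaf d)
  then show ?case using l by simp
next
  case (QBin op a b)
  show ?case using QBin.prems
    by (simp add: bin_series_with_eps) (intro bop_sem_cong QBin.IH; assumption)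
next
  case (QPlus a)
  show ?case using QPlus.prems
    by (simp add: with_eps_def) (intro cauchy_plus_cong QPlus.IH; assumption)
next
  case (QQuant k x a)
  have IH: "gser ls (ground z i l r a ((x, j) # env)) w = qsem lsem r a ((map_of env)(x \<mapsto> j)) w"
    if "w \<noteq> []" for j w
    using QQuant.IH[OF that, of "(x, j) # env"] by (simp only: map_of.simps fst_conv snd_conv)
  have "gser ls (ground z i l r (QQuant k x a) env) w =
     quant_sem k {1..r (fst x)} (\<lambda>j. gser ls (ground z i l r a ((x, j) # env))) w"
    unfolding ground.simps by (rule quant_series[OF QQuant.prems z i])
  also have "\<dots> = quant_sem k {1..r (fst x)} (\<lambda>j. qsem lsem r a ((map_of env)(x \<mapsto> j))) w"
    by (rule quant_sem_cong[OF IH QQuant.prems])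
  finally show ?case by simp
qed


section \<open>Satisfaction as a series of truth values\<close>

lemma cat_sat_eq: "cat_sat f g w = cauchy f g w"
proof -
  have "finite {(u, v). u \<noteq> [] \<and> v \<noteq> [] \<and> w = u @ v}"
    by (rule finite_subset[OF _ finite_splits[of w]]) auto
  then show ?thesis unfolding cat_sat_def cauchy_def by (subst sum_bool) (auto simp: times_bool_def)
qed

lemma Cons_in_shuffles:
  "a # w \<in> shuffles u v \<longleftrightarrow>
    (\<exists>u'. u = a # u' \<and> w \<in> shuffles u' v) \<or> (\<exists>v'. v = a # v' \<and> w \<in> shuffles u v')"
  unfolding Cons_in_shuffles_iff
  by (cases u; cases v) (simp_all only: list.sel list.distinct simp_thms list.inject, blast+)

lemma fshuf_bool: "fshuf f g w \<longleftrightarrow> (\<exists>u v. w \<in> shuffles u v \<and> f u \<and> g v)"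
proof (induction w arbitrary: f g)
  case (Cons a w)
  have "fshuf f g (a # w) \<longleftrightarrow> (\<exists>u v. w \<in> shuffles u v \<and> f (a # u) \<and> g v) \<or>
     (\<exists>u v. w \<in> shuffles u v \<and> f u \<and> g (a # v))"
    using Cons by (simp add: plus_bool_def)
  also have "\<dots> \<longleftrightarrow> (\<exists>u v. a # w \<in> shuffles u v \<and> f u \<and> g v)"
    unfolding Cons_in_shuffles by blast
  finally show ?case .
qed (auto simp: times_bool_def)

lemma shuf_sat_eq: "shuf_sat f g w = shuffle_prod f g w"
  unfolding shuffle_prod_eq_fshuf fshuf_bool shuf_sat_def
  by (auto simp: with_eps_def zero_bool_def)

lemma iter_sat_eq: "iter_sat f m w = cauchy_pow f m w"
proof (induction m arbitrary: w)
  case (Suc m)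
  have "iter_sat f m = cauchy_pow f m" using Suc by blast
  then show ?case by (simp add: cat_sat_eq)
qed simp

text \<open>On a nonempty word the powers of index \<open>length w\<close> or more are false, which
  makes the unbounded existential a finite sum.\<close>

lemma plus_sat_eq:
  assumes "w \<noteq> []"
  shows "plus_sat f w = cauchy_plus f w"
proof -
  have "plus_sat f w \<longleftrightarrow> (\<exists>m<length w. cauchy_pow f m w)"
    unfolding plus_sat_def iter_sat_eq
    using cauchy_pow_eq_0[OF assms, of _ f] by (metis linorder_not_less zero_bool_def)
  then show ?thesis by (auto simp: cauchy_plus_def sum_bool)
qed

lemma cat_prod_family_bool:
  "finite L \<Longrightarrow> cat_prod_family L F w \<longleftrightarrow> (\<exists>ws\<in>cat_families L w. \<forall>j\<in>L. F j (ws j))"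
  by (simp add: cat_prod_family_def sum_bool prod_bool finite_cat_families)

lemma fold_shuf_bool:
  "distinct js \<Longrightarrow> fold_shuf js (\<lambda>j. with_eps False (F j)) w \<longleftrightarrow>
    (\<exists>ws\<in>set js \<rightarrow>\<^sub>E (- {[]}). w \<in> shuffle_all (map ws js) \<and> (\<forall>j\<in>set js. F j (ws j)))"
proof (induction js arbitrary: w)
  case Nil
  then show ?case by (auto simp: with_eps_def bool_semiring)
next
  case (Cons j js)
  have j: "j \<notin> set js" and d: "distinct js" using Cons.prems by auto
  have "fold_shuf (j # js) (\<lambda>j. with_eps False (F j)) w \<longleftrightarrow>
      (\<exists>u v. w \<in> shuffles u v \<and> u \<noteq> [] \<and> F j u \<and>
        (\<exists>ws\<in>set js \<rightarrow>\<^sub>E (- {[]}). v \<in> shuffle_all (map ws js) \<and> (\<forall>j\<in>set js. F j (ws j))))"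
    unfolding fold_shuf_simps fshuf_bool Cons.IH[OF d] by (auto simp: with_eps_def zero_bool_def)
  also have "\<dots> \<longleftrightarrow> (\<exists>ws\<in>set (j # js) \<rightarrow>\<^sub>E (- {[]}). w \<in> shuffle_all (map ws (j # js)) \<and>
      (\<forall>j\<in>set (j # js). F j (ws j)))"
  proof (intro iffI; (elim exE conjE bexE)?)
    fix u v ws
    assume a: "w \<in> shuffles u v" "u \<noteq> []" "F j u" "ws \<in> set js \<rightarrow>\<^sub>E - {[]}"
      "v \<in> shuffle_all (map ws js)" "\<forall>j\<in>set js. F j (ws j)"
    have m: "map (ws(j := u)) js = map ws js" using j by (intro map_cong) auto
    have "ws(j := u) \<in> set (j # js) \<rightarrow>\<^sub>E - {[]}"
      using a j by (auto simp: PiE_def extensional_def Pi_def)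
    moreover have "w \<in> shuffle_all (map (ws(j := u)) (j # js))"
      using a by (auto simp: m)
    moreover have "\<forall>i\<in>set (j # js). F i ((ws(j := u)) i)" using a j by auto
    ultimately show "\<exists>ws\<in>set (j # js) \<rightarrow>\<^sub>E (- {[]}). w \<in> shuffle_all (map ws (j # js)) \<and>
      (\<forall>j\<in>set (j # js). F j (ws j))" by blast
  next
    fix ws
    assume a: "ws \<in> set (j # js) \<rightarrow>\<^sub>E - {[]}" "w \<in> shuffle_all (map ws (j # js))"
      "\<forall>j\<in>set (j # js). F j (ws j)"
    have m: "map (restrict ws (set js)) js = map ws js" by (intro map_cong) auto
    from a obtain v where v: "w \<in> shuffles (ws j) v" "v \<in> shuffle_all (map ws js)" by auto
    have "restrict ws (set js) \<in> set js \<rightarrow>\<^sub>E - {[]}" using a by (auto simp: PiE_def Pi_def)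
    moreover have "ws j \<noteq> []" using a by (auto simp: PiE_def)
    moreover have "\<forall>i\<in>set js. F i (restrict ws (set js) i)" using a by auto
    ultimately show "\<exists>u v. w \<in> shuffles u v \<and> u \<noteq> [] \<and> F j u \<and>
        (\<exists>ws\<in>set js \<rightarrow>\<^sub>E (- {[]}). v \<in> shuffle_all (map ws js) \<and> (\<forall>j\<in>set js. F j (ws j)))"
      using v a(3) by (intro exI[of _ "ws j"] exI[of _ v] conjI bexI[of _ "restrict ws (set js)"]) (auto simp: m)
  qed
  finally show ?case .
qed

lemma shuf_prod_family_bool:
  assumes "finite L"
  shows "shuf_prod_family L F w \<longleftrightarrow> (\<exists>ws\<in>shuf_families L w. \<forall>j\<in>L. F j (ws j))"
proof -
  have "shuf_prod_family L F w = fold_shuf (sorted_list_of_set L) (\<lambda>j. with_eps False (F j)) w"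
    using assms by (simp add: shuf_prod_family_eq_maps fold_shuf_eq_maps)
  also have "\<dots> \<longleftrightarrow> (\<exists>ws\<in>shuf_families L w. \<forall>j\<in>L. F j (ws j))"
    using assms by (auto simp: fold_shuf_bool shuf_families_def)
  finally show ?thesis .
qed

text \<open>The flag of a leaf distinguishes a formula \<zeta> from its negation.\<close>

primrec toqE :: "'v epil \<Rightarrow> (bool \<times> 'v zeta) qexp" where
  "toqE (EPos \<zeta>) = QLeaf (True, \<zeta>)"
| "toqE (ENeg \<zeta>) = QLeaf (False, \<zeta>)"
| "toqE (EOr \<phi> \<phi>') = QBin OAdd (toqE \<phi>) (toqE \<phi>')"
| "toqE (EAnd \<phi> \<phi>') = QBin OMul (toqE \<phi>) (toqE \<phi>')"
| "toqE (ECat \<phi> \<phi>') = QBin OCat (toqE \<phi>) (toqE \<phi>')"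
| "toqE (EShuf \<phi> \<phi>') = QBin OShuf (toqE \<phi>) (toqE \<phi>')"
| "toqE (EPlus \<phi>) = QPlus (toqE \<phi>)"

datatype 'p fleaf = LEpil "('p \<times> var) epil" | LEq bool var var

primrec toqF :: "'p foeil \<Rightarrow> 'p fleaf qexp" where
  "toqF (FEpil \<phi>) = QLeaf (LEpil \<phi>)"
| "toqF (FEq x y) = QLeaf (LEq True x y)"
| "toqF (FNeq x y) = QLeaf (LEq False x y)"
| "toqF (FOr \<psi> \<psi>') = QBin OAdd (toqF \<psi>) (toqF \<psi>')"
| "toqF (FAnd \<psi> \<psi>') = QBin OMul (toqF \<psi>) (toqF \<psi>')"
| "toqF (FCat \<psi> \<psi>') = QBin OCat (toqF \<psi>) (toqF \<psi>')"
| "toqF (FShuf \<psi> \<psi>') = QBin OShuf (toqF \<psi>) (toqF \<psi>')"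
| "toqF (FPlus \<psi>) = QPlus (toqF \<psi>)"
| "toqF (FEx x \<psi>) = QQuant KSum x (toqF \<psi>)"
| "toqF (FAll x \<psi>) = QQuant KProd x (toqF \<psi>)"
| "toqF (FExCat x \<psi>) = QQuant KSumCat x (toqF \<psi>)"
| "toqF (FAllCat x \<psi>) = QQuant KProdCat x (toqF \<psi>)"
| "toqF (FExShuf x \<psi>) = QQuant KSumShuf x (toqF \<psi>)"
| "toqF (FAllShuf x \<psi>) = QQuant KProdShuf x (toqF \<psi>)"

primrec toqW :: "('p, 'k) wfoeil \<Rightarrow> ('k + 'p foeil) qexp" where
  "toqW (WConst k) = QLeaf (Inl k)"
| "toqW (WBool \<psi>) = QLeaf (Inr \<psi>)"
| "toqW (WAdd \<psi> \<psi>') = QBin OAdd (toqW \<psi>) (toqW \<psi>')"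
| "toqW (WMul \<psi> \<psi>') = QBin OMul (toqW \<psi>) (toqW \<psi>')"
| "toqW (WCat \<psi> \<psi>') = QBin OCat (toqW \<psi>) (toqW \<psi>')"
| "toqW (WShuf \<psi> \<psi>') = QBin OShuf (toqW \<psi>) (toqW \<psi>')"
| "toqW (WPlus \<psi>) = QPlus (toqW \<psi>)"
| "toqW (WSum x \<psi>) = QQuant KSum x (toqW \<psi>)"
| "toqW (WProd x \<psi>) = QQuant KProd x (toqW \<psi>)"
| "toqW (WSumCat x \<psi>) = QQuant KSumCat x (toqW \<psi>)"
| "toqW (WProdCat x \<psi>) = QQuant KProdCat x (toqW \<psi>)"
| "toqW (WSumShuf x \<psi>) = QQuant KSumShuf x (toqW \<psi>)"
| "toqW (WProdShuf x \<psi>) = QQuant KProdShuf x (toqW \<psi>)"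

definition inst :: "(var \<rightharpoonup> nat) \<Rightarrow> 'p \<times> var \<Rightarrow> 'p \<times> nat" where
  "inst \<sigma> = (\<lambda>(p, x). (p, the (\<sigma> x)))"

definition semE :: "bool \<times> ('p \<times> var) zeta \<Rightarrow> (var \<rightharpoonup> nat) \<Rightarrow> ('p \<times> nat) word \<Rightarrow> bool" where
  "semE d \<sigma> w \<longleftrightarrow> zeta_sat (map_zeta (inst \<sigma>) (snd d)) w = fst d"

primrec semF :: "'p fleaf \<Rightarrow> (var \<rightharpoonup> nat) \<Rightarrow> ('p \<times> nat) word \<Rightarrow> bool" where
  "semF (LEpil \<phi>) = (\<lambda>\<sigma>. epil_sat (subst_epil \<sigma> \<phi>))"
| "semF (LEq b x y) = (\<lambda>\<sigma> w. (\<sigma> x = \<sigma> y) = b)"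

definition semW ::
  "(nat \<Rightarrow> nat) \<Rightarrow> 'k + 'p foeil \<Rightarrow> (var \<rightharpoonup> nat) \<Rightarrow> ('p \<times> nat) word \<Rightarrow>
    'k :: {comm_semiring_0, comm_monoid_mult}" where
  "semW r d \<sigma> w = (case d of Inl k \<Rightarrow> k | Inr \<psi> \<Rightarrow> if foeil_sat r \<psi> \<sigma> w then 1 else 0)"

lemma epil_sat_qsem: "w \<noteq> [] \<Longrightarrow> epil_sat (subst_epil \<sigma> \<phi>) w = qsem semE r (toqE \<phi>) \<sigma> w"
proof (induction \<phi> arbitrary: w)
  case (EShuf \<phi> \<phi>')
  then show ?case using bop_sem_cong[of _ _ _ _ w OShuf, OF EShuf.IH(1) EShuf.IH(2)]
    by (simp add: subst_epil_def shuf_sat_eq)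
next
  case (ECat \<phi> \<phi>')
  then show ?case using bop_sem_cong[of _ _ _ _ w OCat, OF ECat.IH(1) ECat.IH(2)]
    by (simp add: subst_epil_def cat_sat_eq)
next
  case (EPlus \<phi>)
  then show ?case using cauchy_plus_cong[OF EPlus.IH EPlus.prems]
    by (simp add: subst_epil_def plus_sat_eq)
qed (simp_all add: subst_epil_def semE_def inst_def bool_semiring)

lemma quant_sem_bool:
  assumes "finite J"
  shows "quant_sem KSum J F w \<longleftrightarrow> (\<exists>j\<in>J. F j w)"
    and "quant_sem KProd J F w \<longleftrightarrow> (\<forall>j\<in>J. F j w)"
    and "quant_sem KSumCat J F w \<longleftrightarrow>
      (\<exists>L. L \<noteq> {} \<and> L \<subseteq> J \<and> (\<exists>ws\<in>cat_families L w. \<forall>j\<in>L. F j (ws j)))"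
    and "quant_sem KProdCat J F w \<longleftrightarrow> (\<exists>ws\<in>cat_families J w. \<forall>j\<in>J. F j (ws j))"
    and "quant_sem KSumShuf J F w \<longleftrightarrow>
      (\<exists>L. L \<noteq> {} \<and> L \<subseteq> J \<and> (\<exists>ws\<in>shuf_families L w. \<forall>j\<in>L. F j (ws j)))"
    and "quant_sem KProdShuf J F w \<longleftrightarrow> (\<exists>ws\<in>shuf_families J w. \<forall>j\<in>J. F j (ws j))"
proof -
  have f: "finite {L. L \<noteq> {} \<and> L \<subseteq> J}" by (rule finite_subset[of _ "Pow J"]) (use assms in auto)
  have s: "(\<exists>L\<in>{L. L \<noteq> {} \<and> L \<subseteq> J}. P L) \<longleftrightarrow> (\<exists>L. L \<noteq> {} \<and> L \<subseteq> J \<and> P L)" for P by blast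
  have c: "L \<noteq> {} \<and> L \<subseteq> J \<and> cat_prod_family L F w \<longleftrightarrow>
      L \<noteq> {} \<and> L \<subseteq> J \<and> (\<exists>ws\<in>cat_families L w. \<forall>j\<in>L. F j (ws j))" for L
    using cat_prod_family_bool[of L F w] finite_subset[OF _ assms] by blast
  have h: "L \<noteq> {} \<and> L \<subseteq> J \<and> shuf_prod_family L F w \<longleftrightarrow>
      L \<noteq> {} \<and> L \<subseteq> J \<and> (\<exists>ws\<in>shuf_families L w. \<forall>j\<in>L. F j (ws j))" for L
    using shuf_prod_family_bool[of L F w] finite_subset[OF _ assms] by blast
  show "quant_sem KSum J F w \<longleftrightarrow> (\<exists>j\<in>J. F j w)" "quant_sem KProd J F w \<longleftrightarrow> (\<forall>j\<in>J. F j w)"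
    by (simp_all add: sum_bool prod_bool assms)
  show "quant_sem KSumCat J F w \<longleftrightarrow>
      (\<exists>L. L \<noteq> {} \<and> L \<subseteq> J \<and> (\<exists>ws\<in>cat_families L w. \<forall>j\<in>L. F j (ws j)))"
    by (simp only: quant_sem.simps sum_bool[OF f] s c)
  show "quant_sem KSumShuf J F w \<longleftrightarrow>
      (\<exists>L. L \<noteq> {} \<and> L \<subseteq> J \<and> (\<exists>ws\<in>shuf_families L w. \<forall>j\<in>L. F j (ws j)))"
    by (simp only: quant_sem.simps sum_bool[OF f] s h)
qed (simp_all add: cat_prod_family_bool shuf_prod_family_bool assms)

lemma foeil_sat_qsem: "w \<noteq> [] \<Longrightarrow> foeil_sat r \<psi> \<sigma> w = qsem semF r (toqF \<psi>) \<sigma> w"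
proof (induction \<psi> arbitrary: w \<sigma>)
  case (FCat \<psi> \<psi>')
  then show ?case using bop_sem_cong[of _ _ _ _ w OCat, OF FCat.IH(1) FCat.IH(2)]
    by (simp add: cat_sat_eq)
next
  case (FShuf \<psi> \<psi>')
  then show ?case using bop_sem_cong[of _ _ _ _ w OShuf, OF FShuf.IH(1) FShuf.IH(2)]
    by (simp add: shuf_sat_eq)
next
  case (FPlus \<psi>)
  then show ?case using cauchy_plus_cong[OF FPlus.IH FPlus.prems]
    by (simp add: plus_sat_eq)
next
  case (FEx x \<psi>)
  have "quant_sem KSum {1..r (fst x)} (\<lambda>j. foeil_sat r \<psi> (\<sigma>(x \<mapsto> j))) w =
      quant_sem KSum {1..r (fst x)} (\<lambda>j. qsem semF r (toqF \<psi>) (\<sigma>(x \<mapsto> j))) w"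
    by (rule quant_sem_cong[OF _ FEx.prems]) (rule FEx.IH)
  then show ?case
    by (simp only: foeil_sat.simps toqF.simps qsem.simps quant_sem_bool[OF finite_atLeastAtMost])
next
  case (FAll x \<psi>)
  have "quant_sem KProd {1..r (fst x)} (\<lambda>j. foeil_sat r \<psi> (\<sigma>(x \<mapsto> j))) w =
      quant_sem KProd {1..r (fst x)} (\<lambda>j. qsem semF r (toqF \<psi>) (\<sigma>(x \<mapsto> j))) w"
    by (rule quant_sem_cong[OF _ FAll.prems]) (rule FAll.IH)
  then show ?case
    by (simp only: foeil_sat.simps toqF.simps qsem.simps quant_sem_bool[OF finite_atLeastAtMost])
next
  case (FExCat x \<psi>)
  have "quant_sem KSumCat {1..r (fst x)} (\<lambda>j. foeil_sat r \<psi> (\<sigma>(x \<mapsto> j))) w =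
      quant_sem KSumCat {1..r (fst x)} (\<lambda>j. qsem semF r (toqF \<psi>) (\<sigma>(x \<mapsto> j))) w"
    by (rule quant_sem_cong[OF _ FExCat.prems]) (rule FExCat.IH)
  then show ?case
    by (simp only: foeil_sat.simps toqF.simps qsem.simps quant_sem_bool[OF finite_atLeastAtMost])
next
  case (FAllCat x \<psi>)
  have "quant_sem KProdCat {1..r (fst x)} (\<lambda>j. foeil_sat r \<psi> (\<sigma>(x \<mapsto> j))) w =
      quant_sem KProdCat {1..r (fst x)} (\<lambda>j. qsem semF r (toqF \<psi>) (\<sigma>(x \<mapsto> j))) w"
    by (rule quant_sem_cong[OF _ FAllCat.prems]) (rule FAllCat.IH)
  then show ?case
    by (simp only: foeil_sat.simps toqF.simps qsem.simps quant_sem_bool[OF finite_atLeastAtMost])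
next
  case (FExShuf x \<psi>)
  have "quant_sem KSumShuf {1..r (fst x)} (\<lambda>j. foeil_sat r \<psi> (\<sigma>(x \<mapsto> j))) w =
      quant_sem KSumShuf {1..r (fst x)} (\<lambda>j. qsem semF r (toqF \<psi>) (\<sigma>(x \<mapsto> j))) w"
    by (rule quant_sem_cong[OF _ FExShuf.prems]) (rule FExShuf.IH)
  then show ?case
    by (simp only: foeil_sat.simps toqF.simps qsem.simps quant_sem_bool[OF finite_atLeastAtMost])
next
  case (FAllShuf x \<psi>)
  have "quant_sem KProdShuf {1..r (fst x)} (\<lambda>j. foeil_sat r \<psi> (\<sigma>(x \<mapsto> j))) w =
      quant_sem KProdShuf {1..r (fst x)} (\<lambda>j. qsem semF r (toqF \<psi>) (\<sigma>(x \<mapsto> j))) w"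
    by (rule quant_sem_cong[OF _ FAllShuf.prems]) (rule FAllShuf.IH)
  then show ?case
    by (simp only: foeil_sat.simps toqF.simps qsem.simps quant_sem_bool[OF finite_atLeastAtMost])
qed (simp_all add: bool_semiring)

lemma wsem_qsem: "wsem r \<psi> = qsem (semW r) r (toqW \<psi>)"
  by (induction \<psi>) (auto intro!: ext simp: semW_def)


section \<open>Grounding\<close>

text \<open>A letter formula is kept with its environment instead of being instantiated, so that
  grounding copies formulas but never rewrites them.\<close>

datatype 'p bleaf = BConst bool | BLit "('p \<times> var) pil" venv

datatype ('p, 'k) wleaf = VConst 'k | VDet "'p bleaf gexp"

primrec bser :: "'p bleaf \<Rightarrow> ('p \<times> nat) word \<Rightarrow> bool" where
  "bser (BConst b) = (\<lambda>w. b)"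
| "bser (BLit \<phi> env) = (\<lambda>w. \<exists>a. w = [a] \<and> pil_sat a (map_pil (inst (map_of env)) \<phi>))"

primrec wser :: "('p, 'k) wleaf \<Rightarrow> ('p \<times> nat) word \<Rightarrow> 'k :: {comm_semiring_0, comm_monoid_mult}" where
  "wser (VConst k) = (\<lambda>w. k)"
| "wser (VDet e) = (\<lambda>w. if gser bser e w then 1 else 0)"

primrec gz :: "venv \<Rightarrow> ('p \<times> var) zeta \<Rightarrow> 'p bleaf gexp" where
  "gz env (ZPil \<phi>) = GLeaf (BLit \<phi> env)"
| "gz env (ZCat \<zeta> \<zeta>') = GBin OCat (gz env \<zeta>) (gz env \<zeta>')"

text \<open>If \<open>c\<close> describes the complement of \<open>R\<close>, then \<open>gneg env \<zeta> c\<close> describes the complement of the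
  product of the language of \<open>\<zeta>\<close> with \<open>R\<close>.\<close>

primrec gneg :: "venv \<Rightarrow> ('p \<times> var) zeta \<Rightarrow> 'p bleaf gexp \<Rightarrow> 'p bleaf gexp" where
  "gneg env (ZPil \<phi>) c = GWrap True (GBin OAdd
     (GBin OCat (GLeaf (BLit (PNot \<phi>) env)) (GLeaf (BConst True)))
     (GBin OCat (GLeaf (BLit PTrue env)) c))"
| "gneg env (ZCat \<zeta> \<zeta>') c = gneg env \<zeta> (gneg env \<zeta>' c)"

text \<open>The language of \<zeta> is its product with the language of the empty word. The
  complement of the latter consists of the nonempty words, and this is what \<open>gneg\<close>
  starts from.\<close>

definition groundE_leaf :: "bool \<times> ('p \<times> var) zeta \<Rightarrow> venv \<Rightarrow> 'p bleaf gexp" where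
  "groundE_leaf d env =
     (if fst d then gz env (snd d) else gneg env (snd d) (GWrap False (GLeaf (BConst True))))"

abbreviation "groundE r \<equiv> ground (BConst False) (BConst True) groundE_leaf r"

primrec groundF_leaf :: "(nat \<Rightarrow> nat) \<Rightarrow> 'p fleaf \<Rightarrow> venv \<Rightarrow> 'p bleaf gexp" where
  "groundF_leaf r (LEpil \<phi>) = groundE r (toqE \<phi>)"
| "groundF_leaf r (LEq b x y) = (\<lambda>env. GLeaf (BConst ((map_of env x = map_of env y) = b)))"

abbreviation "groundF r \<equiv> ground (BConst False) (BConst True) (groundF_leaf r) r"

definition groundW_leaf ::
  "(nat \<Rightarrow> nat) \<Rightarrow> 'k + 'p foeil \<Rightarrow> venv \<Rightarrow> ('p, 'k :: {comm_semiring_0, comm_monoid_mult}) wleaf gexp" where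
  "groundW_leaf r d env = (case d of Inl k \<Rightarrow> GLeaf (VConst k)
     | Inr \<psi> \<Rightarrow> GLeaf (VDet (groundF r (toqF \<psi>) env)))"

abbreviation "groundW r \<equiv> ground (VConst 0) (VConst 1) (groundW_leaf r) r"

text \<open>The reason why \<open>gz\<close> can concatenate its operands without wraps.\<close>

lemma not_zeta_sat_Nil [simp]: "\<not> zeta_sat \<zeta> []"
  by (cases \<zeta>) (auto simp: cat_sat_def)

lemma with_eps_zeta_sat: "with_eps False (zeta_sat \<zeta>) = zeta_sat \<zeta>"
  by (rule ext) (simp add: with_eps_def zero_bool_def)

lemma gz_correct: "gser bser (gz env \<zeta>) w = zeta_sat (map_zeta (inst (map_of env)) \<zeta>) w"
proof (induction \<zeta> arbitrary: w)
  case (ZCat \<zeta> \<zeta>')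
  then have "gser bser (gz env \<zeta>) = zeta_sat (map_zeta (inst (map_of env)) \<zeta>)"
    "gser bser (gz env \<zeta>') = zeta_sat (map_zeta (inst (map_of env)) \<zeta>')" by (auto intro!: ext)
  then show ?case by (simp add: cat_sat_eq cauchy_eq_fcat with_eps_zeta_sat)
qed auto

lemma fcat_letter: "fcat (\<lambda>u. \<exists>a. u = [a] \<and> P a) g w \<longleftrightarrow> (\<exists>a v. w = a # v \<and> P a \<and> g v)"
proof (cases w)
  case (Cons a v)
  have "fcat (\<lambda>u. u = [] \<and> P a) g v \<longleftrightarrow> P a \<and> g v"
    unfolding fcat_eq_sum by (auto simp: sum_bool times_bool_def)
  then show ?thesis using Cons by (simp add: bool_semiring)
qed (simp add: bool_semiring)

lemma fcat_Nil: "fcat (\<lambda>u. u = []) g w \<longleftrightarrow> g w"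
  unfolding fcat_eq_sum by (auto simp: sum_bool times_bool_def)

text \<open>A word is outside the product of a letter formula with \<open>R\<close> iff it is empty,
  starts with a letter that violates the formula, or goes on with a word outside \<open>R\<close>.
  For a concatenation, associativity lets the two factors be removed one after the other.\<close>

lemma gneg_correct:
  "gser bser (gneg env \<zeta> c) w \<longleftrightarrow>
     \<not> fcat (zeta_sat (map_zeta (inst (map_of env)) \<zeta>)) (\<lambda>v. \<not> gser bser c v) w"
proof (induction \<zeta> arbitrary: c w)
  case (ZPil \<phi>)
  show ?case
    by (cases w) (auto simp: fcat_letter fcat_Nil bool_semiring)
next
  case (ZCat \<zeta> \<zeta>')
  let ?z = "zeta_sat (map_zeta (inst (map_of env)) \<zeta>)" and ?z' = "zeta_sat (map_zeta (inst (map_of env)) \<zeta>')"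
  have "gser bser (gneg env (ZCat \<zeta> \<zeta>') c) w \<longleftrightarrow> \<not> fcat ?z (\<lambda>v. fcat ?z' (\<lambda>v. \<not> gser bser c v) v) w"
    by (simp add: ZCat)
  also have "\<dots> \<longleftrightarrow> \<not> fcat (fcat ?z ?z') (\<lambda>v. \<not> gser bser c v) w"
    by (simp add: fcat_assoc)
  also have "fcat ?z ?z' = zeta_sat (map_zeta (inst (map_of env)) (ZCat \<zeta> \<zeta>'))"
    by (rule ext) (simp add: cat_sat_eq cauchy_eq_fcat with_eps_zeta_sat)
  finally show ?case .
qed

lemma groundE_leaf_correct:
  "gser bser (groundE_leaf d env) w = semE d (map_of env) w"
proof -
  have "(\<lambda>v. \<not> with_eps False (\<lambda>w :: ('a \<times> nat) word. True) v) = with_eps True (\<lambda>u. 0)"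
    by (intro ext) (simp add: with_eps_def bool_semiring)
  then have "fcat f (\<lambda>v. \<not> with_eps False (\<lambda>w. True) v) w = f w" for f :: "('a \<times> nat) word \<Rightarrow> bool"
    by (induction w arbitrary: f) (simp_all add: bool_semiring with_eps_def)
  then show ?thesis by (auto simp: groundE_leaf_def semE_def gz_correct gneg_correct)
qed

lemma groundF_correct:
  assumes "w \<noteq> []"
  shows "gser bser (groundF r (toqF \<psi>) env) w = foeil_sat r \<psi> (map_of env) w"
proof -
  have E: "gser bser (groundE r (toqE \<phi>) env) w = epil_sat (subst_epil (map_of env) \<phi>) w"
    if "w \<noteq> []" for \<phi> :: "('a \<times> var) epil" and env w
  proof -
    have "gser bser (groundE r (toqE \<phi>) env) w = qsem semE r (toqE \<phi>) (map_of env) w"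
      by (rule ground_correct[OF _ _ _ that]) (simp_all add: groundE_leaf_correct bool_semiring)
    then show ?thesis using epil_sat_qsem[OF that] by metis
  qed
  have L: "gser bser (groundF_leaf r d env) w = semF d (map_of env) w" if "w \<noteq> []"
    for d :: "'a fleaf" and env w
    using that E by (cases d) auto
  have "gser bser (groundF r (toqF \<psi>) env) w = qsem semF r (toqF \<psi>) (map_of env) w"
    by (rule ground_correct[OF _ _ _ assms]) (simp_all add: L bool_semiring)
  then show ?thesis using foeil_sat_qsem[OF assms] by metis
qed

theorem groundW_correct:
  assumes "w \<noteq> []"
  shows "gser wser (groundW r (toqW \<psi>) env) w = wsem r \<psi> (map_of env) w"
proof -
  have "gser wser (groundW_leaf r d env) w = semW r d (map_of env) w" if "w \<noteq> []"
    for d :: "'b + 'a foeil" and env w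
    using that by (cases d) (auto simp: groundW_leaf_def semW_def groundF_correct)
  then have "gser wser (groundW r (toqW \<psi>) env) w = qsem (semW r) r (toqW \<psi>) (map_of env) w"
    by (intro ground_correct[OF _ _ _ assms]) simp_all
  then show ?thesis by (simp only: wsem_qsem)
qed

section \<open>Automata of ground expressions\<close>

definition const_aut :: "'s \<Rightarrow> ('p, 'k, 'a, 's :: {comm_semiring_0, comm_monoid_mult}) vaut" where
  "const_aut k = \<lparr>astates = [VNil], astart = VNil, atrans = (\<lambda>q a q'. 1), afinal = (\<lambda>q. k)\<rparr>"

lemma const_aut_simps [simp]:
  "astates (const_aut k) = [VNil]" "astart (const_aut k) = VNil"
  "atrans (const_aut k) q a q' = 1" "afinal (const_aut k) q = k"
  by (simp_all add: const_aut_def)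

lemma series_const: "series (const_aut k) q w = k"
  by (induction w arbitrary: q) simp_all

definition lit_aut :: "('a \<Rightarrow> bool) \<Rightarrow> ('p, 'k, 'a, bool) vaut" where
  "lit_aut P = \<lparr>astates = [VNil, VNum 1], astart = VNil,
     atrans = (\<lambda>q a q'. q = VNil \<and> q' \<noteq> VNil \<and> P a), afinal = (\<lambda>q. q \<noteq> VNil)\<rparr>"

lemma lit_aut_simps [simp]:
  "astates (lit_aut P) = [VNil, VNum 1]" "astart (lit_aut P) = VNil"
  "atrans (lit_aut P) q a q' = (q = VNil \<and> q' \<noteq> VNil \<and> P a)" "afinal (lit_aut P) q = (q \<noteq> VNil)"
  by (simp_all add: lit_aut_def)

lemma series_lit: "series (lit_aut P) VNil w \<longleftrightarrow> (\<exists>a. w = [a] \<and> P a)"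
proof -
  have "series (lit_aut P) (VNum 1) w \<longleftrightarrow> w = []" for w
    by (cases w) (simp_all add: bool_semiring)
  then show ?thesis by (cases w) (auto simp: bool_semiring)
qed

primrec bleaf_aut :: "'p bleaf \<Rightarrow> ('p, 'k, ('p \<times> nat) set, bool) vaut" where
  "bleaf_aut (BConst b) = const_aut b"
| "bleaf_aut (BLit \<phi> env) = lit_aut (\<lambda>a. pil_sat a (map_pil (inst (map_of env)) \<phi>))"

abbreviation "baut \<equiv> gaut bleaf_aut"

primrec wleaf_aut ::
  "('p, 'k) wleaf \<Rightarrow> ('p, 'k, ('p \<times> nat) set, 'k :: {comm_semiring_0, comm_monoid_mult}) vaut" where
  "wleaf_aut (VConst k) = const_aut k"
| "wleaf_aut (VDet e) = det_aut (baut e)"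

abbreviation "waut \<equiv> gaut wleaf_aut"

lemma baut_correct:
  "aut_ok (baut e :: ('p, 'k, ('p \<times> nat) set, bool) vaut) \<and>
    series (baut e :: ('p, 'k, ('p \<times> nat) set, bool) vaut) (astart (baut e)) = gser bser e"
proof (rule gaut_correct)
  fix d :: "'p bleaf"
  show "aut_ok (bleaf_aut d :: ('p, 'k, ('p \<times> nat) set, bool) vaut) \<and>
      series (bleaf_aut d) (astart (bleaf_aut d :: ('p, 'k, ('p \<times> nat) set, bool) vaut)) = bser d"
    by (cases d) (auto simp: aut_ok_def series_const series_lit fun_eq_iff)
qed

lemma waut_correct:
  fixes e :: "('p, 'k :: {comm_semiring_0, comm_monoid_mult}) wleaf gexp"
  shows "aut_ok (waut e) \<and> series (waut e) (astart (waut e)) = gser wser e"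
proof (rule gaut_correct)
  fix d :: "('p, 'k) wleaf"
  show "aut_ok (wleaf_aut d) \<and> series (wleaf_aut d) (astart (wleaf_aut d)) = wser d"
  proof (cases d)
    case (VConst k)
    then show ?thesis by (auto simp: aut_ok_def series_const fun_eq_iff)
  next
    case (VDet e)
    let ?A = "baut e :: ('p, 'k, ('p \<times> nat) set, bool) vaut"
    have "series (det_aut ?A) (astart (det_aut ?A :: ('p, 'k, ('p \<times> nat) set, 'k) vaut)) w = wser d w" for w
      using series_det[of ?A "[astart ?A]" w] baut_correct[of e, where 'k = 'k] VDet by simp
    then show ?thesis using VDet aut_ok_det[of ?A] baut_correct[of e, where 'k = 'k] by (auto intro!: ext)
  qed
qed

section \<open>Behaviour of an automaton as a sum over paths\<close>

primrec path_series ::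
  "'q set \<Rightarrow> ('q \<Rightarrow> 'a \<Rightarrow> 'q \<Rightarrow> 's) \<Rightarrow> ('q \<Rightarrow> 's) \<Rightarrow> 'a list \<Rightarrow> 'q \<Rightarrow> 's :: {comm_semiring_0, comm_monoid_mult}" where
  "path_series Q tr f [] = f"
| "path_series Q tr f (a # w) = (\<lambda>p. \<Sum>p'\<in>Q. tr p a p' * path_series Q tr f w p')"

text \<open>The induction needs arbitrary initial weights: the first transition is absorbed into
  them, and the rest of the path belongs to the shorter word.\<close>

lemma sum_paths:
  assumes "finite Q"
  shows "(\<Sum>q\<in>{q. set q \<subseteq> Q \<and> length q = Suc (length w)}.
      ini (q ! 0) * (\<Prod>m<length w. tr (q ! m) (w ! m) (q ! Suc m)) * f (q ! length w)) =
    (\<Sum>p\<in>Q. ini p * path_series Q tr f w p)"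
proof (induction w arbitrary: ini)
  case Nil
  have "{q. set q \<subseteq> Q \<and> length q = Suc 0} = (\<lambda>p. [p]) ` Q" by (auto simp: length_Suc_conv)
  then show ?case by (simp add: sum.reindex inj_on_def)
next
  case (Cons a w)
  let ?P = "\<lambda>n. {q. set q \<subseteq> Q \<and> length q = n}"
  have inj: "inj_on (\<lambda>(q, p). p # q) (?P (Suc (length w)) \<times> Q)" by (auto simp: inj_on_def)
  have l: "length (a # w) = Suc (length w)" by simp
  have "(\<Sum>q\<in>?P (Suc (length (a # w))). ini (q ! 0) *
        (\<Prod>m<length (a # w). tr (q ! m) ((a # w) ! m) (q ! Suc m)) * f (q ! length (a # w))) =
      (\<Sum>(q, p)\<in>?P (Suc (length w)) \<times> Q. (ini p * tr p a (q ! 0)) *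
        (\<Prod>m<length w. tr (q ! m) (w ! m) (q ! Suc m)) * f (q ! length w))"
    unfolding l lists_length_Suc_eq[of Q "Suc (length w)"] sum.reindex[OF inj]
    by (intro sum.cong refl) (auto simp: prod.lessThan_Suc_shift mult.assoc simp del: prod.lessThan_Suc)
  also have "\<dots> = (\<Sum>p\<in>Q. \<Sum>q\<in>?P (Suc (length w)). (ini p * tr p a (q ! 0)) *
        (\<Prod>m<length w. tr (q ! m) (w ! m) (q ! Suc m)) * f (q ! length w))"
    unfolding sum.cartesian_product[symmetric] by (rule sum.swap)
  also have "\<dots> = (\<Sum>p\<in>Q. \<Sum>p'\<in>Q. ini p * tr p a p' * path_series Q tr f w p')"
    by (subst Cons.IH) (rule refl)
  also have "\<dots> = (\<Sum>p\<in>Q. ini p * path_series Q tr f (a # w) p)"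
    by (simp add: sum_distrib_left mult.assoc)
  finally show ?case .
qed

definition wfa_of :: "('q, 'a, 's :: {comm_semiring_0, comm_monoid_mult}) aut \<Rightarrow> (nat, 'a, 's) wfa" where
  "wfa_of A = \<lparr>states = {..<length (astates A)},
     initial = (\<lambda>i. if astart A = astates A ! i then 1 else 0),
     trans = (\<lambda>i a j. atrans A (astates A ! i) a (astates A ! j)),
     terminal = (\<lambda>i. afinal A (astates A ! i))\<rparr>"

lemma sum_nth_eq: "(\<Sum>i<length xs. F (xs ! i)) = (\<Sum>x\<leftarrow>xs. F x)"
  by (simp add: sum_list_sum_nth atLeast0LessThan)

lemma behavior_wfa_of:
  assumes "aut_ok A"
  shows "behavior (wfa_of A) w = series A (astart A) w"
proof -
  let ?Q = "{..<length (astates A)}" and ?tr = "\<lambda>i a j. atrans A (astates A ! i) a (astates A ! j)"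
    and ?f = "\<lambda>i. afinal A (astates A ! i)"
  have s: "path_series ?Q ?tr ?f w i = series A (astates A ! i) w" for i w
  proof (induction w arbitrary: i)
    case (Cons a w)
    then show ?case
      using sum_nth_eq[of "\<lambda>p. atrans A (astates A ! i) a p * series A p w" "astates A"] by simp
  qed simp
  have "behavior (wfa_of A) w =
      (\<Sum>i\<in>?Q. (if astart A = astates A ! i then 1 else 0) * path_series ?Q ?tr ?f w i)"
    unfolding behavior_def wfa_of_def wfa.simps by (rule sum_paths) simp
  also have "\<dots> = (\<Sum>q\<leftarrow>astates A. if astart A = q then series A q w else 0)"
    unfolding s using sum_nth_eq[of "\<lambda>q. (if astart A = q then 1 else 0) * series A q w" "astates A"]
    by (simp add: if_distrib[where f = "\<lambda>x. x * _"] cong: if_cong)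
  also have "\<dots> = series A (astart A) w"
    using assms by (intro sum_list_single) (auto simp: aut_ok_def)
  finally show ?thesis .
qed


section \<open>Letters\<close>

definition add_ports :: "'p list \<Rightarrow> 'j \<Rightarrow> ('p \<times> 'j) list list \<Rightarrow> ('p \<times> 'j) list list" where
  "add_ports ps j ls = foldr (\<lambda>p ls'. map (Cons (p, j)) ls @ ls') ps ls"

definition add_insts :: "'p list \<Rightarrow> 'j list \<Rightarrow> ('p \<times> 'j) list list \<Rightarrow> ('p \<times> 'j) list list" where
  "add_insts ps js ls = foldr (add_ports ps) js ls"

definition all_letters :: "(nat \<Rightarrow> 'p list) \<Rightarrow> (nat \<Rightarrow> nat) \<Rightarrow> nat list \<Rightarrow> ('p \<times> nat) list list" where
  "all_letters pl r is = foldr (\<lambda>i. add_insts (pl i) [1..<Suc (r i)]) is [[]]"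

text \<open>A slot is one instance with the ports of its type; an interaction takes at most one port
  from each slot.\<close>

definition slots :: "(nat \<Rightarrow> 'p list) \<Rightarrow> (nat \<Rightarrow> nat) \<Rightarrow> nat list \<Rightarrow> ('p list \<times> nat) list" where
  "slots pl r is = concat (map (\<lambda>i. map (\<lambda>j. (pl i, j)) [1..<Suc (r i)]) is)"

definition slot_letters :: "('p list \<times> 'j) list \<Rightarrow> ('p \<times> 'j) list list" where
  "slot_letters ss = foldr (\<lambda>(ps, j). add_ports ps j) ss [[]]"

lemma all_letters_eq: "all_letters pl r is = slot_letters (slots pl r is)"
proof -
  have "foldr (\<lambda>(ps, j). add_ports ps j) (map (\<lambda>j. (ps, j)) js) ls = add_insts ps js ls"
    for ps :: "'a list" and js :: "nat list" and ls
    by (induction js) (simp_all add: add_insts_def)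
  then show ?thesis
    by (induction "is") (simp_all add: all_letters_def slot_letters_def slots_def del: upt_Suc)
qed

lemma set_add_ports: "set (add_ports ps j ls) = set ls \<union> (\<lambda>(p, l). (p, j) # l) ` (set ps \<times> set ls)"
  by (induction ps) (auto simp: add_ports_def)

lemma length_add_ports: "length (add_ports ps j ls) = Suc (length ps) * length ls"
  by (induction ps) (simp_all add: add_ports_def)

abbreviation slot_set :: "'p list \<times> 'j \<Rightarrow> ('p \<times> 'j) set" where
  "slot_set s \<equiv> set (fst s) \<times> {snd s}"

definition slots_ok :: "('p list \<times> 'j) list \<Rightarrow> bool" where
  "slots_ok ss \<longleftrightarrow> (\<forall>s\<in>set ss. distinct (fst s)) \<and> sorted_wrt (\<lambda>s t. slot_set s \<inter> slot_set t = {}) ss"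

lemma slot_letters_Cons: "slot_letters (s # ss) = add_ports (fst s) (snd s) (slot_letters ss)"
  by (simp add: slot_letters_def split: prod.split)

lemma card_le_1_iff: "finite A \<Longrightarrow> card A \<le> 1 \<longleftrightarrow> A = {} \<or> (\<exists>x. A = {x})"
  by (metis One_nat_def card_1_singleton_iff card_eq_0_iff le_SucE le_zero_eq nat_le_linear order_refl)

text \<open>A letter either avoids the first slot or has exactly one of its ports in front. As slots
  are disjoint, the two kinds of letters are different sets, and the bound 1 for the other slots is
  not affected.\<close>

lemma slot_letters_props:
  assumes "slots_ok ss"
  shows "\<forall>l\<in>set (slot_letters ss). distinct l \<and> set l \<subseteq> (\<Union>s\<in>set ss. slot_set s) \<and> length l \<le> length ss"
    and "set ` set (slot_letters ss) =
      {a. a \<subseteq> (\<Union>s\<in>set ss. slot_set s) \<and> (\<forall>s\<in>set ss. card (a \<inter> slot_set s) \<le> 1)}"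
    and "distinct (map set (slot_letters ss))"
  using assms
proof (induction ss)
  case Nil
  {
    case 1 show ?case by (simp add: slot_letters_def)
  next
    case 2 show ?case by (auto simp: slot_letters_def)
  next
    case 3 show ?case by (simp add: slot_letters_def)
  }
next
  case (Cons s ss)
  let ?L = "slot_letters ss" and ?U = "\<Union>s\<in>set ss. slot_set s"
  {
    case 1
    then have "slots_ok ss" by (simp add: slots_ok_def)
    note IH = Cons.IH[OF this]
    have d: "slot_set s \<inter> ?U = {}" using 1 by (auto simp: slots_ok_def)
    show ?case
    proof
      fix l assume "l \<in> set (slot_letters (s # ss))"
      then consider "l \<in> set ?L" | p l' where "l = (p, snd s) # l'" "p \<in> set (fst s)" "l' \<in> set ?L"
        by (auto simp: slot_letters_Cons set_add_ports)
      then show "distinct l \<and> set l \<subseteq> (\<Union>s\<in>set (s # ss). slot_set s) \<and> length l \<le> length (s # ss)"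
      proof cases
        case 1
        then show ?thesis using IH(1) by fastforce
      next
        case 2
        then have "(p, snd s) \<notin> set l'" using IH(1) d by fastforce
        then show ?thesis using 2 IH(1) by fastforce
      qed
    qed
  next
    case 2
    then have "slots_ok ss" by (simp add: slots_ok_def)
    note IH = Cons.IH[OF this]
    have d: "slot_set s \<inter> ?U = {}" using 2 by (auto simp: slots_ok_def)
    have fin: "finite (slot_set t)" for t :: "'a list \<times> 'b" by simp
    show ?case
    proof (intro equalityI subsetI)
      fix a assume "a \<in> set ` set (slot_letters (s # ss))"
      then consider "a \<in> set ` set ?L" | p a' where "a = insert (p, snd s) a'" "p \<in> set (fst s)" "a' \<in> set ` set ?L"
        by (auto simp: slot_letters_Cons set_add_ports)
      then show "a \<in> {a. a \<subseteq> (\<Union>s\<in>set (s # ss). slot_set s) \<and> (\<forall>s\<in>set (s # ss). card (a \<inter> slot_set s) \<le> 1)}"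
      proof cases
        case 1
        then have a: "a \<subseteq> ?U" "\<forall>s\<in>set ss. card (a \<inter> slot_set s) \<le> 1" using IH(2) by auto
        then have "a \<inter> slot_set s = {}" using d by blast
        then show ?thesis using a by auto
      next
        case (2 p a')
        then have a: "a' \<subseteq> ?U" "\<forall>s\<in>set ss. card (a' \<inter> slot_set s) \<le> 1" using IH(2) by auto
        have "a \<inter> slot_set s = {(p, snd s)}" using d a 2 by auto
        moreover have "a \<inter> slot_set t = a' \<inter> slot_set t" if "t \<in> set ss" for t using d 2 that by auto
        ultimately have "\<forall>t\<in>set (s # ss). card (a \<inter> slot_set t) \<le> 1"
          using a(2) by (metis One_nat_def card_1_singleton_iff order_refl set_ConsD)
        moreover have "a \<subseteq> (\<Union>s\<in>set (s # ss). slot_set s)" using a(1) 2 by auto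
        ultimately show ?thesis by blast
      qed
    next
      fix a assume "a \<in> {a. a \<subseteq> (\<Union>s\<in>set (s # ss). slot_set s) \<and> (\<forall>s\<in>set (s # ss). card (a \<inter> slot_set s) \<le> 1)}"
      then have a: "a \<subseteq> slot_set s \<union> ?U" "card (a \<inter> slot_set s) \<le> 1" "\<forall>s\<in>set ss. card (a \<inter> slot_set s) \<le> 1"
        by auto
      \<comment> \<open>The part of \<open>a\<close> outside the first slot is a letter of the
        remaining slots; at most one port is missing.\<close>
      let ?a = "a \<inter> ?U"
      have "?a \<inter> slot_set t = a \<inter> slot_set t" if "t \<in> set ss" for t using that by blast
      then have "?a \<in> set ` set ?L" using IH(2) a by auto
      moreover have "finite (a \<inter> slot_set s)" by simp
      then have "a \<inter> slot_set s = {} \<or> (\<exists>x. a \<inter> slot_set s = {x})" using a(2) card_le_1_iff by blast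
      then have "a = ?a \<or> (\<exists>p\<in>set (fst s). a = insert (p, snd s) ?a)"
      proof
        assume "a \<inter> slot_set s = {}"
        then show ?thesis using a(1) by blast
      next
        assume "\<exists>x. a \<inter> slot_set s = {x}"
        then obtain x where x: "a \<inter> slot_set s = {x}" by blast
        then have "x \<in> slot_set s" by blast
        then obtain p where p: "x = (p, snd s)" "p \<in> set (fst s)" by auto
        have "a = insert x ?a" using x a(1) by blast
        then show ?thesis using p by blast
      qed
      ultimately show "a \<in> set ` set (slot_letters (s # ss))"
        unfolding slot_letters_Cons set_add_ports
      proof (elim disjE bexE)
        assume "?a \<in> set ` set ?L" "a = ?a"
        then show "a \<in> set ` (set ?L \<union> (\<lambda>(p, l). (p, snd s) # l) ` (set (fst s) \<times> set ?L))" by auto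
      next
        fix p assume p: "?a \<in> set ` set ?L" "p \<in> set (fst s)" "a = insert (p, snd s) ?a"
        then obtain l where l: "l \<in> set ?L" "?a = set l" by blast
        have "a = set ((p, snd s) # l)" unfolding list.set(2) l(2)[symmetric] by (rule p(3))
        then show "a \<in> set ` (set ?L \<union> (\<lambda>(p, l). (p, snd s) # l) ` (set (fst s) \<times> set ?L))"
        proof (rule image_eqI)
          have "(p, l) \<in> set (fst s) \<times> set ?L" using p(2) l(1) by simp
          then show "(p, snd s) # l \<in> set ?L \<union> (\<lambda>(p, l). (p, snd s) # l) ` (set (fst s) \<times> set ?L)"
            by (intro UnI2 image_eqI[where x = "(p, l)"]) simp_all
        qed
      qed
    qed
  next
    case 3
    then have ok: "slots_ok ss" by (simp add: slots_ok_def)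
    note IH = Cons.IH[OF this]
    have d: "slot_set s \<inter> ?U = {}" using 3 by (auto simp: slots_ok_def)
    have sub: "set l \<subseteq> ?U" if "l \<in> set ?L" for l using IH(1) that by blast
    have "distinct ps \<Longrightarrow> set ps \<subseteq> set (fst s) \<Longrightarrow> distinct (map set (add_ports ps (snd s) ?L))" for ps
    proof (induction ps)
      case Nil
      then show ?case using IH(3) by (simp add: add_ports_def)
    next
      case (Cons p ps)
      have e: "add_ports (p # ps) (snd s) ?L = map (Cons (p, snd s)) ?L @ add_ports ps (snd s) ?L"
        by (simp add: add_ports_def)
      have n: "(q, snd s) \<notin> set l" if "q \<in> set (fst s)" "l \<in> set ?L" for q l
        using sub[OF that(2)] d that(1) by auto
      have i: "inj_on (insert (p, snd s)) (set ` set ?L)"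
        using n[of p] Cons.prems by (auto simp: inj_on_def) (metis insert_ident)+
      have "distinct (map (insert (p, snd s)) (map set ?L))"
        unfolding distinct_map[of "insert (p, snd s)"] set_map using IH(3) i by (rule conjI)
      then have "distinct (map set (map (Cons (p, snd s)) ?L))" by (simp add: o_def)
      moreover have "set (map set (map (Cons (p, snd s)) ?L)) \<inter> set (map set (add_ports ps (snd s) ?L)) = {}"
      proof -
        have "(p, snd s) \<notin> set l" if "l \<in> set (add_ports ps (snd s) ?L)" for l
          using that n[of p] Cons.prems by (auto simp: set_add_ports)
        then show ?thesis by auto
      qed
      ultimately show ?case using Cons unfolding e by simp
    qed
    then show ?case using 3 by (simp add: slot_letters_Cons slots_ok_def)
  }
qed

lemma length_slot_letters: "length (slot_letters ss) = (\<Prod>s\<leftarrow>ss. length (fst s) + 1)"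
proof (induction ss)
  case Nil
  show ?case by (simp add: slot_letters_def)
next
  case (Cons s ss)
  then show ?case by (simp add: slot_letters_Cons length_add_ports algebra_simps)
qed

lemma set_slots: "set (slots pl r is) = {(pl i, j) | i j. i \<in> set is \<and> 1 \<le> j \<and> j \<le> r i}"
  by (auto simp: slots_def less_Suc_eq_le image_iff simp del: upt_Suc)

text \<open>Instances of one type differ in their number, instances of different types in their
  ports.\<close>

lemma slots_ok_slots:
  assumes B: "is_pwcomp B" and pl: "lists_ports B pl"
  shows "slots_ok (slots pl r [1..<Suc (ntypes B)])"
proof -
  have gen: "slots_ok (slots pl r is)" if "distinct is" "set is \<subseteq> {1..ntypes B}" for "is"
    using that
  proof (induction "is")
    case Nil
    then show ?case by (simp add: slots_def slots_ok_def)
  next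
    case (Cons i "is")
    have i: "distinct (pl i)" "set (pl i) = ports B i" using Cons.prems pl by (auto simp: lists_ports_def)
    have "slot_set (pl i, j) \<inter> slot_set t = {}" if "t \<in> set (slots pl r is)" for j t
    proof -
      obtain i' j' where t: "t = (pl i', j')" "i' \<in> set is" using \<open>t \<in> _\<close> by (auto simp: set_slots)
      then have "i \<noteq> i'" "i \<in> {1..ntypes B}" "i' \<in> {1..ntypes B}" using Cons.prems by auto
      then have "ports B i \<inter> ports B i' = {}" using B by (simp add: is_pwcomp_def)
      moreover have "set (pl i') = ports B i'" using \<open>i' \<in> {1..ntypes B}\<close> pl by (auto simp: lists_ports_def)
      ultimately show ?thesis using t i by auto
    qed
    moreover have "sorted_wrt (\<lambda>s t. slot_set s \<inter> slot_set t = {}) (map (\<lambda>j. (pl i, j)) [1..<Suc (r i)])"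
      by (simp add: sorted_wrt_map del: upt_Suc) (rule sorted_wrt_mono_rel[OF _ sorted_wrt_upt], auto)
    moreover have e: "slots pl r (i # is) = map (\<lambda>j. (pl i, j)) [1..<Suc (r i)] @ slots pl r is"
      by (simp add: slots_def del: upt_Suc)
    moreover have "slots_ok (slots pl r is)" using Cons by simp
    ultimately show ?case
      using i(1) unfolding e slots_ok_def sorted_wrt_append set_append set_map by fastforce
  qed
  show ?thesis by (rule gen) (auto simp del: upt_Suc)
qed

lemma interactions_eq:
  assumes B: "is_pwcomp B" and pl: "lists_ports B pl"
  shows "interactions B r = set ` {l \<in> set (all_letters pl r [1..<Suc (ntypes B)]). l \<noteq> []}"
proof -
  let ?ss = "slots pl r [1..<Suc (ntypes B)]"
  have p: "set (pl i) = ports B i" if "i \<in> {1..ntypes B}" for i using pl that by (auto simp: lists_ports_def)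
  have ss: "set ?ss = {(pl i, j) | i j. i \<in> {1..ntypes B} \<and> j \<in> {1..r i}}"
    by (auto simp: set_slots less_Suc_eq_le simp del: upt_Suc)
  have "(\<Union>s\<in>set ?ss. slot_set s) = (\<Union>i\<in>{1..ntypes B}. \<Union>j\<in>{1..r i}. slot_set (pl i, j))"
    unfolding ss by blast
  also have "\<dots> = all_ports B r"
    unfolding all_ports_def inst_ports_def fst_conv snd_conv by (intro SUP_cong refl) (simp only: p)
  finally have U: "(\<Union>s\<in>set ?ss. slot_set s) = all_ports B r" .
  have C: "(\<forall>s\<in>set ?ss. card (a \<inter> slot_set s) \<le> 1) \<longleftrightarrow>
      (\<forall>i\<in>{1..ntypes B}. \<forall>j\<in>{1..r i}. card (a \<inter> inst_ports B i j) \<le> 1)" for a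
  proof -
    have "(\<forall>s\<in>set ?ss. card (a \<inter> slot_set s) \<le> 1) \<longleftrightarrow>
        (\<forall>i\<in>{1..ntypes B}. \<forall>j\<in>{1..r i}. card (a \<inter> slot_set (pl i, j)) \<le> 1)"
      unfolding ss by blast
    also have "\<dots> \<longleftrightarrow> (\<forall>i\<in>{1..ntypes B}. \<forall>j\<in>{1..r i}. card (a \<inter> inst_ports B i j) \<le> 1)"
      unfolding inst_ports_def fst_conv snd_conv by (intro ball_cong refl) (simp only: p)
    finally show ?thesis .
  qed
  have "set ` {l \<in> set (slot_letters ?ss). l \<noteq> []} = set ` set (slot_letters ?ss) - {{}}" by auto
  also have "\<dots> = interactions B r"
    unfolding slot_letters_props(2)[OF slots_ok_slots[OF B pl]] U C by (auto simp: interactions_def)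
  finally show ?thesis by (simp add: all_letters_eq)
qed

text \<open>The summand 1 is the choice of no port. With the empty letter included, this is the
  quantity that bounds the running time from below.\<close>

lemma length_all_letters:
  assumes "lists_ports B pl"
  shows "length (all_letters pl r [1..<Suc (ntypes B)]) = (\<Prod>i = 1..ntypes B. (card (ports B i) + 1) ^ r i)"
proof -
  have p: "length (pl i) = card (ports B i)" if "i \<in> {1..ntypes B}" for i
    using assms that by (metis distinct_card lists_ports_def)
  have "(\<Prod>s\<leftarrow>slots pl r is. length (fst s) + 1) = (\<Prod>i\<leftarrow>is. (length (pl i) + 1) ^ r i)" for "is"
  proof (induction "is")
    case (Cons i "is")
    have "(\<Prod>s\<leftarrow>map (\<lambda>j. (pl i, j)) js. length (fst s) + 1) = (length (pl i) + 1) ^ length js" for js :: "nat list"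
      by (induction js) simp_all
    from this[of "[1..<Suc (r i)]"] show ?case using Cons by (simp add: slots_def del: upt_Suc)
  qed (simp add: slots_def)
  then have "length (all_letters pl r [1..<Suc (ntypes B)]) = (\<Prod>i\<leftarrow>[1..<Suc (ntypes B)]. (length (pl i) + 1) ^ r i)"
    by (simp add: all_letters_eq length_slot_letters)
  also have "\<dots> = (\<Prod>i\<in>set [1..<Suc (ntypes B)]. (length (pl i) + 1) ^ r i)"
    by (rule prod.distinct_set_conv_list[symmetric]) (simp del: upt_Suc)
  also have "\<dots> = (\<Prod>i = 1..ntypes B. (card (ports B i) + 1) ^ r i)"
    by (rule prod.cong) (auto simp: p simp del: upt_Suc)
  finally show ?thesis .
qed

section \<open>Correctness of the auxiliary functions\<close>

declare vsize_truth [simp]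

text \<open>\<open>same_leaf\<close> is false on weights, so the equality test of the program is
  correct for trees without weights; states, letters and keys are such trees.\<close>

fun pure :: "('p, 'k) val \<Rightarrow> bool" where
  "pure (VWt k) \<longleftrightarrow> False"
| "pure (VPair u v) \<longleftrightarrow> pure u \<and> pure v"
| "pure v \<longleftrightarrow> True"

lemma pure_vlist [simp]: "pure (vlist vs) \<longleftrightarrow> (\<forall>v\<in>set vs. pure v)"
  by (induction vs) auto

lemma same_leaf_pure: "pure u \<Longrightarrow> pure v \<Longrightarrow> \<not> is_pair u \<Longrightarrow> same_leaf u v \<longleftrightarrow> u = v"
  by (cases u; cases v) auto

lemma vsize_mem_vlist: "v \<in> set vs \<Longrightarrow> vsize v < vsize (vlist vs)"
  by (induction vs) auto

lemma vsize_vlist_append: "vsize (vlist (us @ vs)) + 1 = vsize (vlist us) + vsize (vlist vs)"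
  by (induction us) auto

lemma vsize_vlist_suffix: "vsize (vlist vs) \<le> vsize (vlist (us @ vs))"
  using vsize_vlist_append[of us vs] vsize_pos[of "vlist us"] by linarith

lemma truth_simps [simp]: "truth True = VNum 1" "truth False = VNil"
  by (simp_all add: truth_def)

definition enc_env :: "venv \<Rightarrow> ('p, 'k) val" where
  "enc_env env = vlist (map (\<lambda>(x, j). VPair (enc_var x) (VNum j)) env)"

definition enc_letters :: "('p \<times> nat) list list \<Rightarrow> ('p, 'k) val" where
  "enc_letters ls = vlist (map enc_letter ls)"

lemma enc_letter_Nil [simp]: "enc_letter [] = VNil"
  by (simp add: enc_letter_def)

lemma enc_letter_Cons [simp]: "enc_letter ((p, j) # ps) = VPair (VPair (VPort p) (VNum j)) (enc_letter ps)"
  by (simp add: enc_letter_def)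

text \<open>Partial results of a fold are suffixes of its final result. A bound on the final list
  therefore covers the intermediate ones, as \<open>computes_fold\<close> demands; the suffix lemmas
  below serve the same purpose.\<close>

lemma add_ports_suffix: "\<exists>us. add_ports (qs @ ps) j ls = us @ add_ports ps j ls"
  by (induction qs) (auto simp: add_ports_def)

lemma add_ports_base: "\<exists>us. add_ports ps j ls = us @ ls"
  using add_ports_suffix[of ps "[]" j ls] by (simp add: add_ports_def)

lemma add_insts_suffix: "\<exists>us. add_insts ps (is @ js) ls = us @ add_insts ps js ls"
proof (induction "is")
  case (Cons i "is")
  then obtain us where "add_insts ps (is @ js) ls = us @ add_insts ps js ls" by blast
  then show ?case using add_ports_base[of ps i "us @ add_insts ps js ls"] by (auto simp: add_insts_def)
qed simp

lemma add_insts_base: "\<exists>us. add_insts ps js ls = us @ ls"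
  using add_insts_suffix[of ps js "[]" ls] by (simp add: add_insts_def)

lemma all_letters_suffix: "\<exists>us. all_letters pl r (is @ js) = us @ all_letters pl r js"
proof (induction "is")
  case (Cons i "is")
  then obtain us where "all_letters pl r (is @ js) = us @ all_letters pl r js" by blast
  then show ?case using add_insts_base[of "pl i" "[1..<Suc (r i)]" "us @ all_letters pl r js"]
    by (auto simp: all_letters_def simp del: upt_Suc)
qed simp

lemma vsize_enc_letters_suffix: "\<exists>us. ls = us @ ls' \<Longrightarrow>
    vsize (enc_letters ls' :: ('p, 'k) val) \<le> vsize (enc_letters ls :: ('p, 'k) val)"
  unfolding enc_letters_def by (elim exE) (simp add: vsize_vlist_suffix)

lemma vsize_subseqs_suffix:
  "vsize (vlist (map vlist (subseqs ys))) \<le> vsize (vlist (map vlist (subseqs (zs @ ys))))"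
proof (induction zs)
  case (Cons z zs)
  have "vsize (vlist (map vlist (subseqs (zs @ ys)))) \<le> vsize (vlist (map vlist (subseqs (z # zs @ ys))))"
    using vsize_vlist_suffix by (simp add: Let_def)
  then show ?case using Cons by simp
qed simp

lemmas pon_nth = prg_nth(2)[unfolded pon_body_def]
lemmas prodl_nth = prg_nth(4)[unfolded prodl_body_def]
lemmas mem_nth = prg_nth(8)[unfolded mem_body_def]
lemmas look_nth = prg_nth(9)[unfolded look_body_def]
lemmas lport_nth = prg_nth(11)[unfolded lport_body_def]
lemmas linst_nth = prg_nth(12)[unfolded linst_body_def]
lemmas ltype_nth = prg_nth(13)[unfolded ltype_body_def]
lemmas subs_nth = prg_nth(22)[unfolded subs_body_def]

lemma enc_var_inject [simp]: "enc_var x = enc_var y \<longleftrightarrow> x = y"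
  by (auto simp: enc_var_def prod_eq_iff)

lemma pure_enc_var [simp]: "pure (enc_var x)" and vsize_enc_var [simp]: "vsize (enc_var x) = 3"
  by (simp_all add: enc_var_def)

context
  fixes U :: nat
  assumes U: "large prg U"
begin

lemma U64: "64 \<le> U" and kappa_le: "kappa prg \<le> U"
  using U by (auto simp: large_def)

lemma pow_le: "j \<le> k \<Longrightarrow> U ^ j \<le> U ^ k"
  using U64 by (intro power_increasing) auto

lemma lin_le:
  assumes "n \<le> 64 * U" "2 \<le> k"
  shows "n \<le> U ^ k"
proof -
  have "n \<le> U * U" using assms(1) U64 by (meson le_trans mult_le_mono1)
  also have "\<dots> \<le> U ^ k" using pow_le[OF assms(2)] by (simp add: power2_eq_square)
  finally show ?thesis .
qed

lemma lin_le': "n \<le> 64 * U \<Longrightarrow> n \<le> U ^ 2"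
  by (rule lin_le) auto

lemma computes_le: "computes prg U m x y j \<Longrightarrow> j \<le> k \<Longrightarrow> computes prg U m x y k"
  using U64 by (auto intro: computes_mono)

lemma teq_run:
  assumes "xok prg teq_body [x]" "xv prg teq_body [x] = y" "xc prg teq_body [x] \<le> C"
    "xz prg teq_body [x] \<le> 2" "vsize x \<le> 2 * U + 1"
  shows "halts prg 3 x \<and> res prg 3 x = y \<and> tm prg 3 x \<le> C + 8 * U * U"
proof -
  have "kappa prg * (vsize x + xz prg teq_body [x] + 1) \<le> U * (8 * U)"
    using assms(4,5) U64 kappa_le by (intro mult_le_mono) auto
  then show ?thesis using run_body[of 3 prg x] assms by (simp add: prg_nth)
qed

text \<open>The recursion descends a tree and must not raise the exponent at each level, so the time
  is bounded by the size of the first tree times a fixed cost per node.\<close>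

lemma teq_time:
  "pure u \<Longrightarrow> pure v \<Longrightarrow> vsize u \<le> U \<Longrightarrow> vsize v \<le> U \<Longrightarrow>
   halts prg 3 (VPair u v) \<and> res prg 3 (VPair u v) = truth (u = v) \<and>
   tm prg 3 (VPair u v) \<le> vsize u * (8 * U * U)"
proof (induction u arbitrary: v)
  case (VPair u1 u2)
  show ?case
  proof (cases "is_pair v")
    case False
    then have "VPair u1 u2 \<noteq> v" by auto
    with False have "halts prg 3 (VPair (VPair u1 u2) v) \<and> res prg 3 (VPair (VPair u1 u2) v) = truth (VPair u1 u2 = v) \<and>
      tm prg 3 (VPair (VPair u1 u2) v) \<le> 0 + 8 * U * U"
      using VPair.prems by (intro teq_run) (auto simp: teq_body_def)
    then show ?thesis by (auto simp: add_mult_distrib)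
  next
    case True
    then obtain v1 v2 where v: "v = VPair v1 v2" by (cases v) auto
    have IH1: "halts prg 3 (VPair u1 v1)" "res prg 3 (VPair u1 v1) = truth (u1 = v1)"
        "tm prg 3 (VPair u1 v1) \<le> vsize u1 * (8 * U * U)"
      and IH2: "halts prg 3 (VPair u2 v2)" "res prg 3 (VPair u2 v2) = truth (u2 = v2)"
        "tm prg 3 (VPair u2 v2) \<le> vsize u2 * (8 * U * U)"
      using VPair.IH(1)[of v1] VPair.IH(2)[of v2] VPair.prems by (auto simp: v)
    have "halts prg 3 (VPair (VPair u1 u2) v) \<and> res prg 3 (VPair (VPair u1 u2) v) = truth (VPair u1 u2 = v) \<and>
      tm prg 3 (VPair (VPair u1 u2) v) \<le> (vsize u1 * (8 * U * U) + vsize u2 * (8 * U * U)) + 8 * U * U"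
      using VPair.prems IH1 IH2 by (intro teq_run) (auto simp: teq_body_def v)
    then show ?thesis by (auto simp: algebra_simps)
  qed
next
  case VNil
  have "halts prg 3 (VPair VNil v) \<and> res prg 3 (VPair VNil v) = truth (VNil = v) \<and>
      tm prg 3 (VPair VNil v) \<le> 0 + 8 * U * U"
    using VNil by (intro teq_run) (auto simp: teq_body_def same_leaf_pure)
  then show ?case by simp
next
  case (VNum m)
  have "halts prg 3 (VPair (VNum m) v) \<and> res prg 3 (VPair (VNum m) v) = truth (VNum m = v) \<and>
      tm prg 3 (VPair (VNum m) v) \<le> 0 + 8 * U * U"
    using VNum by (intro teq_run) (auto simp: teq_body_def same_leaf_pure)
  then show ?case by simp
next
  case (VPort p)
  have "halts prg 3 (VPair (VPort p) v) \<and> res prg 3 (VPair (VPort p) v) = truth (VPort p = v) \<and>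
      tm prg 3 (VPair (VPort p) v) \<le> 0 + 8 * U * U"
    using VPort by (intro teq_run) (auto simp: teq_body_def same_leaf_pure)
  then show ?case by simp
qed simp

lemma comp_teq:
  assumes "pure u" "pure v" "vsize u \<le> U" "vsize v \<le> U"
  shows "computes prg U 3 (VPair u v) (truth (u = v)) 4"
proof -
  have "vsize u * (8 * U * U) \<le> U * (U * U * U)" using assms U64 by (intro mult_le_mono) auto
  also have "\<dots> = U ^ 4" by (simp add: power4_eq_xxxx)
  finally have "tm prg 3 (VPair u v) \<le> U ^ 4" using teq_time[OF assms] by linarith
  then show ?thesis using teq_time[OF assms] by (simp add: computes_def)
qed

lemma comp_pon:
  assumes "vsize (vlist (map (VPair x) ys @ acc)) \<le> U" "vsize x \<le> U" "vsize (vlist ys) \<le> U"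
  shows "computes prg U 1 (VPair (VPair x (vlist acc)) (vlist ys)) (vlist (map (VPair x) ys @ acc)) 7"
proof -
  have "computes prg U 1 (VPair (VPair x (vlist acc)) (vlist (map (\<lambda>y. y) ys)))
      ((\<lambda>ys. vlist (map (VPair x) ys @ acc)) ys) 7"
  proof (rule computes_fold[OF U _ pon_nth, where k = 2])
    show "vsize (vlist (map (VPair x) ys' @ acc)) \<le> U ^ 2" if "\<exists>zs. ys = zs @ ys'" for ys'
    proof -
      from that obtain zs where "ys = zs @ ys'" by blast
      then show ?thesis using assms(1) vsize_vlist_suffix[of "map (VPair x) ys' @ acc" "map (VPair x) zs"]
        by (intro lin_le') simp
    qed
    show "vsize (VPair (VPair x (vlist acc)) (vlist (map (\<lambda>y. y) ys))) \<le> U ^ 2"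
      using assms U64 vsize_vlist_suffix[of acc "map (VPair x) ys"] by (intro lin_le') simp
  qed auto
  then show ?thesis by simp
qed

lemma comp_prodl:
  assumes "vsize (vlist (pairl xs ys)) \<le> U" "vsize (vlist xs) \<le> U" "vsize (vlist ys) \<le> U"
  shows "computes prg U 2 (VPair (vlist ys) (vlist xs)) (vlist (pairl xs ys)) 12"
proof -
  have suf: "vsize (vlist (pairl zs ys)) \<le> U" if "\<exists>us. xs = us @ zs" for zs
    using that assms(1) vsize_vlist_suffix[of "pairl zs ys" "pairl _ ys"] by (force simp: pairl_def intro: le_trans)
  have "computes prg U 2 (VPair (vlist ys) (vlist (map (\<lambda>y. y) xs))) ((\<lambda>xs. vlist (pairl xs ys)) xs) 12"
  proof (rule computes_fold[OF U _ prodl_nth, where k = 7])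
    show "vsize (vlist (pairl zs ys)) \<le> U ^ 2" if "\<exists>us. xs = us @ zs" for zs
      using suf[OF that] by (intro lin_le') simp
    show "vsize (VPair (vlist ys) (vlist (map (\<lambda>y. y) xs))) \<le> U ^ 2"
      using assms U64 by (intro lin_le') simp
    fix x zs assume "\<exists>us. xs = us @ x # zs"
    then obtain us where us: "xs = us @ x # zs" by blast
    then have "vsize x \<le> U" using vsize_mem_vlist[of x xs] assms by simp
    moreover have e: "map (VPair x) ys @ pairl zs ys = pairl (x # zs) ys" by (simp add: pairl_def)
    ultimately have "computes prg U 1 (VPair (VPair x (vlist (pairl zs ys))) (vlist ys)) (vlist (pairl (x # zs) ys)) 7"
      using comp_pon[of x ys "pairl zs ys"] suf[of "x # zs"] us assms by auto
    note h = computesD[OF this]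
    show "xok prg (Call 1 (MkPair (MkPair foldelt (Var 0)) foldctx))
        [vlist (pairl zs ys), VPair (vlist ys) (VPair x (vlist (map (\<lambda>y. y) zs)))] \<and>
      xv prg (Call 1 (MkPair (MkPair foldelt (Var 0)) foldctx))
        [vlist (pairl zs ys), VPair (vlist ys) (VPair x (vlist (map (\<lambda>y. y) zs)))] = vlist (pairl (x # zs) ys) \<and>
      xc prg (Call 1 (MkPair (MkPair foldelt (Var 0)) foldctx))
        [vlist (pairl zs ys), VPair (vlist ys) (VPair x (vlist (map (\<lambda>y. y) zs)))] \<le> 8 * U ^ 7"
      using h by simp
  qed (simp_all add: pairl_def)
  then show ?thesis by simp
qed

lemma comp_mem:
  assumes "pure key" "\<forall>x\<in>set xs. pure x" "vsize key \<le> U" "vsize (vlist xs) \<le> U"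
  shows "computes prg U 6 (VPair key (vlist xs)) (truth (key \<in> set xs)) 9"
proof -
  have "computes prg U 6 (VPair key (vlist (map (\<lambda>y. y) xs))) ((\<lambda>xs. truth (key \<in> set xs)) xs) 9"
  proof (rule computes_fold[OF U _ mem_nth, where k = 4])
    show "vsize (VPair key (vlist (map (\<lambda>y. y) xs))) \<le> U ^ 2"
      using assms U64 by (intro lin_le') simp
    show "vsize (truth (key \<in> set zs)) \<le> U ^ 2" for zs
      using U64 by (intro lin_le') (simp add: vsize_truth)
    fix x zs assume "\<exists>us. xs = us @ x # zs"
    then have x: "x \<in> set xs" by auto
    then have "vsize x \<le> U" using vsize_mem_vlist[of x xs] assms by simp
    then have "computes prg U 3 (VPair key x) (truth (key = x)) 4" using assms x by (intro comp_teq) auto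
    note h = computesD[OF this]
    show "xok prg (If (Call 3 (MkPair foldctx foldelt)) (CNum 1) (Var 0))
        [truth (key \<in> set zs), VPair key (VPair x (vlist (map (\<lambda>y. y) zs)))] \<and>
      xv prg (If (Call 3 (MkPair foldctx foldelt)) (CNum 1) (Var 0))
        [truth (key \<in> set zs), VPair key (VPair x (vlist (map (\<lambda>y. y) zs)))] = truth (key \<in> set (x # zs)) \<and>
      xc prg (If (Call 3 (MkPair foldctx foldelt)) (CNum 1) (Var 0))
        [truth (key \<in> set zs), VPair key (VPair x (vlist (map (\<lambda>y. y) zs)))] \<le> 8 * U ^ 4"
      using h by (cases "key = x") auto
  qed simp_all
  then show ?thesis by simp
qed

lemma comp_look:
  assumes "pure key" "\<forall>z\<in>set kvs. pure (fst z)" "vsize key \<le> U"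
    "vsize (vlist (map (\<lambda>(a, b). VPair a b) kvs)) \<le> U"
  shows "computes prg U 7 (VPair key (vlist (map (\<lambda>(a, b). VPair a b) kvs)))
    (case map_of kvs key of None \<Rightarrow> VNil | Some v \<Rightarrow> v) 9"
proof (rule computes_fold[OF U _ look_nth, where k = 4 and
      G = "\<lambda>kvs. case map_of kvs key of None \<Rightarrow> VNil | Some v \<Rightarrow> v"])
  let ?G = "\<lambda>kvs. case map_of kvs key of None \<Rightarrow> VNil | Some v \<Rightarrow> v" and ?ex = "\<lambda>(a, b). VPair a b"
  show "vsize (VPair key (vlist (map ?ex kvs))) \<le> U ^ 2"
    using assms U64 by (intro lin_le') simp
  have sz: "vsize (fst z) \<le> U \<and> vsize (snd z) \<le> U" if "z \<in> set kvs" for z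
  proof -
    have "?ex z \<in> set (map ?ex kvs)" using that by simp
    then have "vsize (?ex z) < vsize (vlist (map ?ex kvs))" by (rule vsize_mem_vlist)
    then show ?thesis using assms(4) by (cases z) simp
  qed
  show "vsize (?G zs) \<le> U ^ 2" if "\<exists>us. kvs = us @ zs" for zs
  proof (cases "map_of zs key")
    case (Some v)
    then have "(key, v) \<in> set kvs" using map_of_SomeD[OF Some] that by auto
    then have "vsize v \<le> U" using sz by force
    then show ?thesis using Some by (intro lin_le') simp
  qed (use U64 in simp)
  fix z zs assume "\<exists>us. kvs = us @ z # zs"
  then have z: "z \<in> set kvs" by auto
  obtain a b where ab: "z = (a, b)" by (cases z)
  have "computes prg U 3 (VPair key a) (truth (key = a)) 4"
    using assms z sz[OF z] by (intro comp_teq) (auto simp: ab)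
  note h = computesD[OF this]
  show "xok prg (If (Call 3 (MkPair foldctx (Fst foldelt))) (Snd foldelt) (Var 0))
        [?G zs, VPair key (VPair (?ex z) (vlist (map ?ex zs)))] \<and>
      xv prg (If (Call 3 (MkPair foldctx (Fst foldelt))) (Snd foldelt) (Var 0))
        [?G zs, VPair key (VPair (?ex z) (vlist (map ?ex zs)))] = ?G (z # zs) \<and>
      xc prg (If (Call 3 (MkPair foldctx (Fst foldelt))) (Snd foldelt) (Var 0))
        [?G zs, VPair key (VPair (?ex z) (vlist (map ?ex zs)))] \<le> 8 * U ^ 4"
    using h by (auto simp: ab)
qed simp_all

lemma comp_look_env:
  assumes "vsize (enc_env env :: ('p, 'k :: {comm_semiring_0, comm_monoid_mult}) val) \<le> U"
  shows "computes prg U 7 (VPair (enc_var x) (enc_env env :: ('p, 'k) val))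
    (case map_of env x of None \<Rightarrow> VNil | Some j \<Rightarrow> VNum j) 9"
proof -
  let ?kvs = "map (\<lambda>(x, j). (enc_var x, VNum j)) env :: (('p, 'k) val \<times> ('p, 'k) val) list"
  have e: "enc_env env = vlist (map (\<lambda>(a, b). VPair a b) ?kvs)"
    by (simp add: enc_env_def o_def case_prod_unfold)
  have m: "(case map_of ?kvs (enc_var x) of None \<Rightarrow> VNil | Some v \<Rightarrow> v) =
      (case map_of env x of None \<Rightarrow> VNil | Some j \<Rightarrow> VNum j)"
    by (induction env) auto
  have "computes prg U 7 (VPair (enc_var x) (vlist (map (\<lambda>(a, b). VPair a b) ?kvs)))
     (case map_of ?kvs (enc_var x) of None \<Rightarrow> VNil | Some v \<Rightarrow> v) 9"
  proof (rule comp_look)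
    show "vsize (vlist (map (\<lambda>(a, b). VPair a b) ?kvs)) \<le> U" using assms unfolding e .
  qed (use U64 in auto)
  then show ?thesis unfolding m e .
qed

text \<open>Here the recursion may raise the exponent, by 3 per connective, starting from the 9 of
  lookup and membership.\<close>

lemma comp_psat:
  assumes l: "vsize (enc_letter ps :: ('p, 'k :: {comm_semiring_0, comm_monoid_mult}) val) \<le> U"
    and e: "vsize (enc_env env :: ('p, 'k) val) \<le> U"
  shows "vsize (enc_pil \<phi> :: ('p, 'k) val) \<le> U \<Longrightarrow> snd ` set_pil \<phi> \<subseteq> fst ` set env \<Longrightarrow>
    computes prg U 8 (VPair (VPair (enc_letter ps) (enc_env env)) (enc_pil \<phi> :: ('p, 'k) val))
      (truth (pil_sat (set ps) (map_pil (inst (map_of env)) \<phi>))) (9 + 3 * pil_size \<phi>)"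
proof (induction \<phi>)
  case PTrue
  show ?case
    by (rule computesI[OF U _ prg_nth(10), where k = 9])
      (use PTrue l e U64 in \<open>auto simp: psat_body_def node_def intro!: lin_le\<close>)
next
  case (PPort px)
  obtain p x where px: "px = (p, x)" by (cases px)
  then have "x \<in> fst ` set env" using PPort by auto
  then obtain j where j: "map_of env x = Some j" by (meson map_of_eq_None_iff not_Some_eq)
  have h1: "computes prg U 7 (VPair (enc_var x) (enc_env env :: ('p, 'k) val)) (VNum j) 9"
    using comp_look_env[OF e, of x] j by simp
  have h2: "computes prg U 6 (VPair (VPair (VPort p) (VNum j)) (enc_letter ps :: ('p, 'k) val))
      (truth ((p, j) \<in> set ps)) 9"
  proof -
    have m: "VPair (VPort p) (VNum j) \<in> set (map (\<lambda>(p, j). VPair (VPort p) (VNum j)) ps :: ('p, 'k) val list) \<longleftrightarrow>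
      (p, j) \<in> set ps" by auto
    show ?thesis unfolding enc_letter_def m[symmetric]
      by (rule comp_mem) (use l U64 in \<open>auto simp: enc_letter_def\<close>)
  qed
  show ?case
    by (rule computesI[OF U _ prg_nth(10), where k = 9])
      (use PPort l e U64 computesD[OF h1] computesD[OF h2]
       in \<open>auto simp: psat_body_def node_def px j inst_def intro!: lin_le\<close>)
next
  case (PNot \<phi>)
  then have "computes prg U 8 (VPair (VPair (enc_letter ps) (enc_env env)) (enc_pil \<phi> :: ('p, 'k) val))
      (truth (pil_sat (set ps) (map_pil (inst (map_of env)) \<phi>))) (9 + 3 * pil_size \<phi>)"
    by (auto simp: node_def)
  note h = computesD[OF this]
  show ?case
    by (rule computesI[OF U _ prg_nth(10), where k = "9 + 3 * pil_size \<phi>"])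
      (use PNot.prems l e U64 h in \<open>auto simp: psat_body_def node_def intro!: lin_le\<close>)
next
  case (POr \<phi> \<phi>')
  let ?k = "9 + 3 * (pil_size \<phi> + pil_size \<phi>')"
  have "computes prg U 8 (VPair (VPair (enc_letter ps) (enc_env env)) (enc_pil \<phi> :: ('p, 'k) val))
      (truth (pil_sat (set ps) (map_pil (inst (map_of env)) \<phi>))) ?k"
    by (rule computes_le[OF POr.IH(1)]) (use POr.prems in \<open>auto simp: node_def\<close>)
  note h = computesD[OF this]
  have "computes prg U 8 (VPair (VPair (enc_letter ps) (enc_env env)) (enc_pil \<phi>' :: ('p, 'k) val))
      (truth (pil_sat (set ps) (map_pil (inst (map_of env)) \<phi>'))) ?k"
    by (rule computes_le[OF POr.IH(2)]) (use POr.prems in \<open>auto simp: node_def\<close>)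
  note h' = computesD[OF this]
  show ?case
    by (rule computesI[OF U _ prg_nth(10), where k = ?k])
      (use POr.prems l e U64 h h' in \<open>auto simp: psat_body_def node_def intro!: lin_le\<close>)
qed

lemma comp_subs:
  assumes "vsize (vlist (map vlist (subseqs xs))) \<le> U"
  shows "computes prg U 20 (VPair VNil (vlist xs)) (vlist (map vlist (subseqs xs))) 12"
proof -
  have suf: "vsize (vlist (map vlist (subseqs zs))) \<le> U" if "\<exists>us. xs = us @ zs" for zs
    using that assms vsize_subseqs_suffix[of zs] by (force intro: le_trans)
  \<comment> \<open>The list is one of its own subsequences, so the bound on the output also covers
    the input.\<close>
  have "xs \<in> set (subseqs xs)" using filter_in_subseqs[of "\<lambda>_. True" xs] by simp
  then have xs: "vsize (vlist xs) \<le> U"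
    using assms vsize_mem_vlist[of "vlist xs" "map vlist (subseqs xs)"] by auto
  have "computes prg U 20 (VPair VNil (vlist (map (\<lambda>y. y) xs))) ((\<lambda>xs. vlist (map vlist (subseqs xs))) xs) 12"
  proof (rule computes_fold[OF U _ subs_nth, where k = 7])
    show "vsize (vlist (map vlist (subseqs zs))) \<le> U ^ 2" if "\<exists>us. xs = us @ zs" for zs
      using suf[OF that] by (intro lin_le') simp
    show "vsize (VPair VNil (vlist (map (\<lambda>y. y) xs))) \<le> U ^ 2"
      using xs U64 by (intro lin_le') simp
    fix x zs assume a: "\<exists>us. xs = us @ x # zs"
    then have "\<exists>us. xs = us @ zs" by (metis append.assoc append_Cons append_Nil)
    note s = suf[OF this] suf[OF a]
    from a have "vsize x \<le> U" using vsize_mem_vlist[of x xs] xs by auto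
    moreover have e: "map (VPair x) (map vlist (subseqs zs)) @ map vlist (subseqs zs) = map vlist (subseqs (x # zs))"
      by (simp add: Let_def)
    ultimately have "computes prg U 1 (VPair (VPair x (vlist (map vlist (subseqs zs)))) (vlist (map vlist (subseqs zs))))
        (vlist (map vlist (subseqs (x # zs)))) 7"
      using comp_pon[of x "map vlist (subseqs zs)" "map vlist (subseqs zs)"] s unfolding e by blast
    note h = computesD[OF this]
    show "xok prg (Call 1 (MkPair (MkPair foldelt (Var 0)) (Var 0)))
        [vlist (map vlist (subseqs zs)), VPair VNil (VPair x (vlist (map (\<lambda>y. y) zs)))] \<and>
      xv prg (Call 1 (MkPair (MkPair foldelt (Var 0)) (Var 0)))
        [vlist (map vlist (subseqs zs)), VPair VNil (VPair x (vlist (map (\<lambda>y. y) zs)))] = vlist (map vlist (subseqs (x # zs))) \<and>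
      xc prg (Call 1 (MkPair (MkPair foldelt (Var 0)) (Var 0)))
        [vlist (map vlist (subseqs zs)), VPair VNil (VPair x (vlist (map (\<lambda>y. y) zs)))] \<le> 8 * U ^ 7"
      using h by (simp del: subseqs.simps)
  qed simp_all
  then show ?thesis by simp
qed

lemma comp_lport:
  fixes wt :: "'p \<Rightarrow> 'k :: {comm_semiring_0, comm_monoid_mult}"
  assumes "vsize (enc_letters (add_ports ps j ls) :: ('p, 'k) val) \<le> U"
    "vsize (vlist (map (\<lambda>p. VPair (VPort p) (VWt (wt p))) ps)) \<le> U"
  shows "computes prg U 9 (VPair (VPair (VNum j) (enc_letters ls)) (vlist (map (\<lambda>p. VPair (VPort p) (VWt (wt p))) ps)))
    (enc_letters (add_ports ps j ls)) 12"
proof (rule computes_fold[OF U _ lport_nth, where k = 7 and G = "\<lambda>ps. enc_letters (add_ports ps j ls)"])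
  have ls: "vsize (enc_letters ls :: ('p, 'k) val) \<le> U"
    using vsize_enc_letters_suffix[OF add_ports_base[of ps j ls]] assms(1) by (rule le_trans)
  have suf: "vsize (enc_letters (add_ports qs j ls) :: ('p, 'k) val) \<le> U" if "\<exists>us. ps = us @ qs" for qs
  proof -
    from that obtain us where "ps = us @ qs" by blast
    then show ?thesis
      using vsize_enc_letters_suffix[OF add_ports_suffix[of us qs j ls]] assms(1) by (auto intro: le_trans)
  qed
  then show "vsize (enc_letters (add_ports qs j ls) :: ('p, 'k) val) \<le> U ^ 2" if "\<exists>us. ps = us @ qs" for qs
    using that by (intro lin_le') fastforce
  show "vsize (VPair (VPair (VNum j) (enc_letters ls)) (vlist (map (\<lambda>p. VPair (VPort p) (VWt (wt p))) ps))) \<le> U ^ 2"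
    using ls assms(2) U64 by (intro lin_le') simp
  fix p qs assume a: "\<exists>us. ps = us @ p # qs"
  let ?x = "VPair (VPort p) (VNum j) :: ('p, 'k) val"
  have e: "map (VPair ?x) (map enc_letter ls) @ map enc_letter (add_ports qs j ls) =
      map enc_letter (add_ports (p # qs) j ls)"
    by (simp add: add_ports_def)
  have "computes prg U 1 (VPair (VPair ?x (enc_letters (add_ports qs j ls))) (enc_letters ls))
      (enc_letters (add_ports (p # qs) j ls)) 7"
    unfolding enc_letters_def e[symmetric]
    by (rule comp_pon) (use suf[OF a] ls U64 in \<open>auto simp: e enc_letters_def simp del: map_map\<close>)
  note h = computesD[OF this]
  show "xok prg (Call 1 (MkPair (MkPair (MkPair (Fst foldelt) (Fst foldctx)) (Var 0)) (Snd foldctx)))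
      [enc_letters (add_ports qs j ls), VPair (VPair (VNum j) (enc_letters ls))
        (VPair (VPair (VPort p) (VWt (wt p))) (vlist (map (\<lambda>p. VPair (VPort p) (VWt (wt p))) qs)))] \<and>
    xv prg (Call 1 (MkPair (MkPair (MkPair (Fst foldelt) (Fst foldctx)) (Var 0)) (Snd foldctx)))
      [enc_letters (add_ports qs j ls), VPair (VPair (VNum j) (enc_letters ls))
        (VPair (VPair (VPort p) (VWt (wt p))) (vlist (map (\<lambda>p. VPair (VPort p) (VWt (wt p))) qs)))] =
      enc_letters (add_ports (p # qs) j ls) \<and>
    xc prg (Call 1 (MkPair (MkPair (MkPair (Fst foldelt) (Fst foldctx)) (Var 0)) (Snd foldctx)))
      [enc_letters (add_ports qs j ls), VPair (VPair (VNum j) (enc_letters ls))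
        (VPair (VPair (VPort p) (VWt (wt p))) (vlist (map (\<lambda>p. VPair (VPort p) (VWt (wt p))) qs)))] \<le> 8 * U ^ 7"
    using h by simp
qed (simp_all add: add_ports_def)

lemma comp_linst:
  fixes wt :: "'p \<Rightarrow> 'k :: {comm_semiring_0, comm_monoid_mult}"
  assumes "vsize (enc_letters (add_insts ps js ls) :: ('p, 'k) val) \<le> U"
    "vsize (vlist (map (\<lambda>p. VPair (VPort p) (VWt (wt p))) ps)) \<le> U"
    "vsize (vlist (map VNum js) :: ('p, 'k) val) \<le> U"
  shows "computes prg U 10 (VPair (VPair (vlist (map (\<lambda>p. VPair (VPort p) (VWt (wt p))) ps)) (enc_letters ls)) (vlist (map VNum js)))
    (enc_letters (add_insts ps js ls)) 17"
proof (rule computes_fold[OF U _ linst_nth, where k = 12 and G = "\<lambda>js. enc_letters (add_insts ps js ls)"])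
  let ?ps = "vlist (map (\<lambda>p. VPair (VPort p) (VWt (wt p))) ps)"
  have ls: "vsize (enc_letters ls :: ('p, 'k) val) \<le> U"
    using vsize_enc_letters_suffix[OF add_insts_base[of ps js ls]] assms(1) by (rule le_trans)
  have suf: "vsize (enc_letters (add_insts ps is ls) :: ('p, 'k) val) \<le> U" if "\<exists>us. js = us @ is" for "is"
  proof -
    from that obtain us where "js = us @ is" by blast
    then show ?thesis
      using vsize_enc_letters_suffix[OF add_insts_suffix[of ps us "is" ls]] assms(1) by (auto intro: le_trans)
  qed
  then show "vsize (enc_letters (add_insts ps is ls) :: ('p, 'k) val) \<le> U ^ 2" if "\<exists>us. js = us @ is" for "is"
    using that by (intro lin_le') fastforce
  show "vsize (VPair (VPair ?ps (enc_letters ls)) (vlist (map VNum js))) \<le> U ^ 2"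
    using ls assms U64 by (intro lin_le') simp
  fix j "is" assume a: "\<exists>us. js = us @ j # is"
  have "computes prg U 9 (VPair (VPair (VNum j) (enc_letters (add_insts ps is ls))) ?ps)
      (enc_letters (add_insts ps (j # is) ls)) 12"
    using comp_lport[of ps j "add_insts ps is ls" wt] suf[OF a] assms(2) by (simp add: add_insts_def)
  note h = computesD[OF this]
  show "xok prg (Call 9 (MkPair (MkPair foldelt (Var 0)) (Fst foldctx)))
      [enc_letters (add_insts ps is ls), VPair (VPair ?ps (enc_letters ls)) (VPair (VNum j) (vlist (map VNum is)))] \<and>
    xv prg (Call 9 (MkPair (MkPair foldelt (Var 0)) (Fst foldctx)))
      [enc_letters (add_insts ps is ls), VPair (VPair ?ps (enc_letters ls)) (VPair (VNum j) (vlist (map VNum is)))] =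
      enc_letters (add_insts ps (j # is) ls) \<and>
    xc prg (Call 9 (MkPair (MkPair foldelt (Var 0)) (Fst foldctx)))
      [enc_letters (add_insts ps is ls), VPair (VPair ?ps (enc_letters ls)) (VPair (VNum j) (vlist (map VNum is)))] \<le> 8 * U ^ 12"
    using h by simp
qed (simp_all add: add_insts_def)

lemma comp_ltype:
  fixes B :: "('p, 'k :: {comm_semiring_0, comm_monoid_mult}) pwcomp"
  assumes "vsize (enc_letters (all_letters pl r is) :: ('p, 'k) val) \<le> U"
    "vsize (vlist (map (enc_type B pl r) is)) \<le> U"
  shows "computes prg U 11 (VPair VNil (vlist (map (enc_type B pl r) is))) (enc_letters (all_letters pl r is)) 22"
proof (rule computes_fold[OF U _ ltype_nth, where k = 17 and G = "\<lambda>is. enc_letters (all_letters pl r is)"])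
  have suf: "vsize (enc_letters (all_letters pl r js) :: ('p, 'k) val) \<le> U" if "\<exists>us. is = us @ js" for js
  proof -
    from that obtain us where "is = us @ js" by blast
    then show ?thesis
      using vsize_enc_letters_suffix[OF all_letters_suffix[of pl r us js]] assms(1) by (auto intro: le_trans)
  qed
  then show "vsize (enc_letters (all_letters pl r js) :: ('p, 'k) val) \<le> U ^ 2" if "\<exists>us. is = us @ js" for js
    using that by (intro lin_le') fastforce
  show "vsize (VPair VNil (vlist (map (enc_type B pl r) is))) \<le> U ^ 2"
    using assms U64 by (intro lin_le') simp
  fix i js assume a: "\<exists>us. is = us @ i # js"
  let ?ps = "vlist (map (\<lambda>p. VPair (VPort p) (VWt (weight B i p))) (pl i))"
  have "i \<in> set is" using a by auto
  then have "vsize (enc_type B pl r i) \<le> U"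
    using vsize_mem_vlist[of "enc_type B pl r i" "map (enc_type B pl r) is"] assms(2) by auto
  then have "computes prg U 10 (VPair (VPair ?ps (enc_letters (all_letters pl r js))) (vlist (map VNum [1..<Suc (r i)])))
      (enc_letters (all_letters pl r (i # js))) 17"
    using comp_linst[of "pl i" "[1..<Suc (r i)]" "all_letters pl r js" "weight B i"] suf[OF a]
    by (simp add: all_letters_def enc_type_def del: upt_Suc)
  note h = computesD[OF this]
  show "xok prg (Call 10 (MkPair (MkPair (Fst (Snd foldelt)) (Var 0)) (Fst (Snd (Snd foldelt)))))
      [enc_letters (all_letters pl r js), VPair VNil (VPair (enc_type B pl r i) (vlist (map (enc_type B pl r) js)))] \<and>
    xv prg (Call 10 (MkPair (MkPair (Fst (Snd foldelt)) (Var 0)) (Fst (Snd (Snd foldelt)))))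
      [enc_letters (all_letters pl r js), VPair VNil (VPair (enc_type B pl r i) (vlist (map (enc_type B pl r) js)))] =
      enc_letters (all_letters pl r (i # js)) \<and>
    xc prg (Call 10 (MkPair (MkPair (Fst (Snd foldelt)) (Var 0)) (Fst (Snd (Snd foldelt)))))
      [enc_letters (all_letters pl r js), VPair VNil (VPair (enc_type B pl r i) (vlist (map (enc_type B pl r) js)))] \<le> 8 * U ^ 17"
    using h by (simp add: enc_type_def del: upt_Suc)
qed (simp_all add: all_letters_def enc_letters_def)

end

section \<open>Bodies whose calls obey a common time bound\<close>

primrec xgood ::
  "program \<Rightarrow> nat \<Rightarrow> expr \<Rightarrow> ('p, 'k :: {comm_semiring_0, comm_monoid_mult}) val list \<Rightarrow> bool" where
  "xgood P T (Var m) = (\<lambda>env. m < length env)"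
| "xgood P T CNil = (\<lambda>env. True)"
| "xgood P T (CNum m) = (\<lambda>env. True)"
| "xgood P T CZero = (\<lambda>env. True)"
| "xgood P T COne = (\<lambda>env. True)"
| "xgood P T (MkPair e e') = (\<lambda>env. xgood P T e env \<and> xgood P T e' env)"
| "xgood P T (Fst e) = (\<lambda>env. xgood P T e env \<and> is_pair (xv P e env))"
| "xgood P T (Snd e) = (\<lambda>env. xgood P T e env \<and> is_pair (xv P e env))"
| "xgood P T (Plus e e') =
     (\<lambda>env. xgood P T e env \<and> xgood P T e' env \<and> is_wt (xv P e env) \<and> is_wt (xv P e' env))"
| "xgood P T (Times e e') =
     (\<lambda>env. xgood P T e env \<and> xgood P T e' env \<and> is_wt (xv P e env) \<and> is_wt (xv P e' env))"
| "xgood P T (IsPair e) = (\<lambda>env. xgood P T e env)"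
| "xgood P T (Eq e e') = (\<lambda>env. xgood P T e env \<and> xgood P T e' env)"
| "xgood P T (If e e1 e2) =
     (\<lambda>env. xgood P T e env \<and> (if xv P e env \<noteq> VNil then xgood P T e1 env else xgood P T e2 env))"
| "xgood P T (Let e e') = (\<lambda>env. xgood P T e env \<and> xgood P T e' (xv P e env # env))"
| "xgood P T (Call m e) = (\<lambda>env. xgood P T e env \<and> halts P m (xv P e env) \<and> tm P m (xv P e env) \<le> T)"

primrec ncalls :: "expr \<Rightarrow> nat" where
  "ncalls (Var m) = 0"
| "ncalls CNil = 0"
| "ncalls (CNum m) = 0"
| "ncalls CZero = 0"
| "ncalls COne = 0"
| "ncalls (MkPair e e') = ncalls e + ncalls e'"
| "ncalls (Fst e) = ncalls e"
| "ncalls (Snd e) = ncalls e"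
| "ncalls (Plus e e') = ncalls e + ncalls e'"
| "ncalls (Times e e') = ncalls e + ncalls e'"
| "ncalls (IsPair e) = ncalls e"
| "ncalls (Eq e e') = ncalls e + ncalls e'"
| "ncalls (If e e1 e2) = ncalls e + ncalls e1 + ncalls e2"
| "ncalls (Let e e') = ncalls e + ncalls e'"
| "ncalls (Call m e) = Suc (ncalls e)"

text \<open>With one bound \<open>T\<close> for each call, the total depends on the number of calls
  in the body only, and the conditions on a body can be left to simplification.\<close>

lemma xgood_xok: "xgood P T e env \<Longrightarrow> xok P e env \<and> xc P e env \<le> ncalls e * T"
proof (induction e arbitrary: env)
  case (If e e1 e2)
  show ?case
  proof (cases "xv P e env = VNil")
    case True
    then show ?thesis using If.IH(1)[of env] If.IH(3)[of env] If.prems by (simp add: add_mult_distrib)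
  next
    case False
    then show ?thesis using If.IH(1)[of env] If.IH(2)[of env] If.prems by (simp add: add_mult_distrib)
  qed
next
  case (Let e e')
  then show ?case using Let.IH(1)[of env] Let.IH(2)[of "xv P e env # env"]
    by (simp add: add_mult_distrib add_mono)
next
  case (Call m e)
  then show ?case by fastforce
qed (auto simp: add_mult_distrib intro!: add_mono)

lemma computesG:
  assumes U: "large P U" and m: "m < length P" and b: "P ! m = b" and good: "xgood P (U ^ k) b [x]"
    and y: "xv P b [x] = y" and x: "vsize x \<le> U ^ k" and n: "ncalls b \<le> 64" and k: "k + 3 \<le> k'"
  shows "computes P U m x y k'"
proof -
  have u: "64 \<le> U" "kappa P \<le> U" using U by (auto simp: large_def)
  have ok: "xok P b [x]" and c: "xc P b [x] \<le> ncalls b * U ^ k" using xgood_xok[OF good] by auto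
  have c': "xc P b [x] \<le> U * U ^ k" using c mult_le_mono1[of "ncalls b" U "U ^ k"] n u by linarith
  have u1: "1 \<le> U ^ k" "U ^ k \<le> U * U ^ k" using u by auto
  have "vsize x + xz P b [x] + 1 \<le> 3 * (U * U ^ k)"
    using x c' xz_le_xc[OF ok] u1 by linarith
  then have "kappa P * (vsize x + xz P b [x] + 1) \<le> U * (3 * (U * U ^ k))"
    using u by (intro mult_le_mono) auto
  then have "tm P m x \<le> U * U ^ k + U * (3 * (U * U ^ k))"
    using run_body[OF m, of x] ok c' unfolding b by linarith
  also have "\<dots> \<le> U * (U * U ^ k) + U * (3 * (U * U ^ k))"
    using u by (intro add_mono mult_le_mono) auto
  also have "\<dots> = 4 * (U * (U * U ^ k))" by simp
  also have "\<dots> \<le> U * (U * (U * U ^ k))" using u by (intro mult_le_mono) auto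
  also have "\<dots> = U ^ Suc (Suc (Suc k))" by simp
  also have "\<dots> \<le> U ^ k'" using u k by (intro power_increasing) auto
  finally show ?thesis using run_body[OF m, of x] ok y unfolding b by (simp add: computes_def)
qed

section \<open>Correctness of the automaton functions\<close>

context
  fixes U :: nat
  assumes U: "large prg U"
begin

lemma computesU:
  assumes "m < length prg" "prg ! m = b" "xgood prg (U ^ k) b [x]" "xv prg b [x] = y" "vsize x \<le> 64 * U"
    "ncalls b \<le> 64" "2 \<le> k" "k + 3 \<le> k'"
  shows "computes prg U m x y k'"
  using computesG[OF U assms(1-4) lin_le[OF U assms(5,7)] assms(6,8)] .

text \<open>The representation \<open>es\<close> of the semiring elements is \<open>truth\<close> for the truth values and \<open>VWt\<close>
  for the weights; \<open>md\<close> tells the program which of the two is in use.\<close>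

definition mode_ok ::
  "('p, 'k :: {comm_semiring_0, comm_monoid_mult}) val \<Rightarrow> ('s :: {comm_semiring_0, comm_monoid_mult} \<Rightarrow> ('p, 'k) val) \<Rightarrow> bool" where
  "mode_ok md es \<longleftrightarrow> vsize md = 1 \<and> (\<forall>s. vsize (es s) = 1) \<and>
     es 0 = (if md = VNil then VNil else VWt 0) \<and> es 1 = (if md = VNil then VNum 1 else VWt 1) \<and>
     (\<forall>a b. computes prg U 4 (VPair (es a) (es b)) (es (a + b)) 5) \<and>
     (\<forall>a b. computes prg U 5 (VPair (es a) (es b)) (es (a * b)) 5)"

text \<open>Functions 21, 22, 24 and 27 realize the automaton \<open>A\<close> on the code
  \<open>E\<close> within exponent \<open>k\<close>. The 12 is the exponent of the list product, and
  purity makes states comparable.\<close>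

definition implements ::
  "('p, 'k :: {comm_semiring_0, comm_monoid_mult}) val \<Rightarrow> ('s :: {comm_semiring_0, comm_monoid_mult} \<Rightarrow> ('p, 'k) val) \<Rightarrow>
   ('p, 'k) val \<Rightarrow> ('p, 'k, ('p \<times> nat) set, 's) vaut \<Rightarrow> nat \<Rightarrow> bool" where
  "implements md es E A k \<longleftrightarrow> 12 \<le> k \<and> aut_ok A \<and> (\<forall>q\<in>set (astates A). pure q) \<and>
     vsize (vlist (astates A)) \<le> U \<and> vsize E \<le> U \<and>
     computes prg U 21 E (vlist (astates A)) k \<and> computes prg U 22 E (astart A) k \<and>
     (\<forall>q\<in>set (astates A). computes prg U 24 (VPair md (VPair E q)) (es (afinal A q)) k) \<and>
     (\<forall>ps q q'. vsize (enc_letter ps :: ('p, 'k) val) \<le> U \<longrightarrow> q \<in> set (astates A) \<longrightarrow> q' \<in> set (astates A) \<longrightarrow>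
        computes prg U 27 (VPair (VPair md (enc_letter ps)) (VPair E (VPair q q'))) (es (atrans A q (set ps) q')) k)"

lemma mode_ok_truth: "mode_ok VNil (truth :: bool \<Rightarrow> ('p, 'k :: {comm_semiring_0, comm_monoid_mult}) val)"
proof -
  have "computes prg U 4 (VPair (truth a) (truth b)) (truth (a + b) :: ('p, 'k) val) 5"
    "computes prg U 5 (VPair (truth a) (truth b)) (truth (a * b) :: ('p, 'k) val) 5" for a b :: bool
    using U64[OF U]
    by (intro computesI[OF U _ prg_nth(6), where k = 2] computesI[OF U _ prg_nth(7), where k = 2];
        cases a; cases b; auto simp: add_body_def mul_body_def bool_semiring intro!: lin_le[OF U])+
  then show ?thesis by (auto simp: mode_ok_def zero_bool_def one_bool_def)
qed

lemma mode_ok_VWt: "mode_ok (VNum 1) (VWt :: 'k :: {comm_semiring_0, comm_monoid_mult} \<Rightarrow> ('p, 'k) val)"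
proof -
  have "computes prg U 4 (VPair (VWt a) (VWt b)) (VWt (a + b) :: ('p, 'k) val) 5"
    "computes prg U 5 (VPair (VWt a) (VWt b)) (VWt (a * b) :: ('p, 'k) val) 5" for a b :: 'k
    using U64[OF U]
    by (intro computesI[OF U _ prg_nth(6), where k = 2] computesI[OF U _ prg_nth(7), where k = 2];
        auto simp: add_body_def mul_body_def intro!: lin_le[OF U])+
  then show ?thesis by (simp add: mode_ok_def)
qed

lemma mode_okD:
  assumes "mode_ok md es"
  shows "vsize md = 1" "vsize (es s) = 1"
    "es 0 = (if md = VNil then VNil else VWt 0)" "es 1 = (if md = VNil then VNum 1 else VWt 1)"
  using assms by (auto simp: mode_ok_def)

lemma mode_ok_add:
  assumes "mode_ok md es" "5 \<le> k"
  shows "halts prg 4 (VPair (es a) (es b))" "res prg 4 (VPair (es a) (es b)) = es (a + b)"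
    "tm prg 4 (VPair (es a) (es b)) \<le> U ^ k"
proof -
  have "computes prg U 4 (VPair (es a) (es b)) (es (a + b)) 5" using assms by (simp add: mode_ok_def)
  note h = computesD[OF computes_le[OF U this assms(2)]]
  show "halts prg 4 (VPair (es a) (es b))" "res prg 4 (VPair (es a) (es b)) = es (a + b)"
    "tm prg 4 (VPair (es a) (es b)) \<le> U ^ k" using h by auto
qed

lemma mode_ok_mul:
  assumes "mode_ok md es" "5 \<le> k"
  shows "halts prg 5 (VPair (es a) (es b))" "res prg 5 (VPair (es a) (es b)) = es (a * b)"
    "tm prg 5 (VPair (es a) (es b)) \<le> U ^ k"
proof -
  have "computes prg U 5 (VPair (es a) (es b)) (es (a * b)) 5" using assms by (simp add: mode_ok_def)
  note h = computesD[OF computes_le[OF U this assms(2)]]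
  show "halts prg 5 (VPair (es a) (es b))" "res prg 5 (VPair (es a) (es b)) = es (a * b)"
    "tm prg 5 (VPair (es a) (es b)) \<le> U ^ k" using h by auto
qed

lemma implements_simps:
  assumes "implements md es E A k"
  shows "12 \<le> k" "aut_ok A" "\<And>q. q \<in> set (astates A) \<Longrightarrow> pure q" "vsize (vlist (astates A)) \<le> U" "vsize E \<le> U"
    "\<And>q. q \<in> set (astates A) \<Longrightarrow> vsize q \<le> U" "astart A \<in> set (astates A)"
  using assms vsize_mem_vlist[of _ "astates A"] by (auto simp: implements_def aut_ok_def intro: less_imp_le less_le_trans)

lemma implements_states:
  assumes "implements md es E A k" "k \<le> k'"
  shows "halts prg 21 E" "res prg 21 E = vlist (astates A)" "tm prg 21 E \<le> U ^ k'"
    "halts prg 22 E" "res prg 22 E = astart A" "tm prg 22 E \<le> U ^ k'"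
proof -
  have "computes prg U 21 E (vlist (astates A)) k" "computes prg U 22 E (astart A) k"
    using assms by (auto simp: implements_def)
  note h = computesD[OF computes_le[OF U this(1) assms(2)]] computesD[OF computes_le[OF U this(2) assms(2)]]
  show "halts prg 21 E" "res prg 21 E = vlist (astates A)" "tm prg 21 E \<le> U ^ k'"
    "halts prg 22 E" "res prg 22 E = astart A" "tm prg 22 E \<le> U ^ k'" using h by auto
qed

lemma implements_ter:
  assumes "implements md es E A k" "k \<le> k'" "q \<in> set (astates A)"
  shows "halts prg 24 (VPair md (VPair E q))" "res prg 24 (VPair md (VPair E q)) = es (afinal A q)"
    "tm prg 24 (VPair md (VPair E q)) \<le> U ^ k'"
proof -
  have "computes prg U 24 (VPair md (VPair E q)) (es (afinal A q)) k"
    using assms by (auto simp: implements_def)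
  note h = computesD[OF computes_le[OF U this assms(2)]]
  show "halts prg 24 (VPair md (VPair E q))" "res prg 24 (VPair md (VPair E q)) = es (afinal A q)"
    "tm prg 24 (VPair md (VPair E q)) \<le> U ^ k'" using h by auto
qed

lemma implements_tr:
  assumes "implements md es E A k" "k \<le> k'" "q \<in> set (astates A)" "q' \<in> set (astates A)"
    "vsize (enc_letter ps :: ('p, 'k :: {comm_semiring_0, comm_monoid_mult}) val) \<le> U"
  shows "halts prg 27 (VPair (VPair md (enc_letter ps)) (VPair E (VPair q q')) :: ('p, 'k) val)"
    "res prg 27 (VPair (VPair md (enc_letter ps)) (VPair E (VPair q q')) :: ('p, 'k) val) = es (atrans A q (set ps) q')"
    "tm prg 27 (VPair (VPair md (enc_letter ps)) (VPair E (VPair q q')) :: ('p, 'k) val) \<le> U ^ k'"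
proof -
  have "computes prg U 27 (VPair (VPair md (enc_letter ps)) (VPair E (VPair q q')) :: ('p, 'k) val)
      (es (atrans A q (set ps) q')) k"
    using assms unfolding implements_def by blast
  note h = computesD[OF computes_le[OF U this assms(2)]]
  show "halts prg 27 (VPair (VPair md (enc_letter ps)) (VPair E (VPair q q')) :: ('p, 'k) val)"
    "res prg 27 (VPair (VPair md (enc_letter ps)) (VPair E (VPair q q')) :: ('p, 'k) val) = es (atrans A q (set ps) q')"
    "tm prg 27 (VPair (VPair md (enc_letter ps)) (VPair E (VPair q q')) :: ('p, 'k) val) \<le> U ^ k'" using h by auto
qed

lemma implementsI:
  assumes "12 \<le> k" "aut_ok A" "\<And>q. q \<in> set (astates A) \<Longrightarrow> pure q" "vsize (vlist (astates A)) \<le> U" "vsize E \<le> U"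
    "computes prg U 21 E (vlist (astates A)) k" "computes prg U 22 E (astart A) k"
    "\<And>q. q \<in> set (astates A) \<Longrightarrow> vsize q \<le> U \<Longrightarrow>
       computes prg U 24 (VPair md (VPair E q)) (es (afinal A q)) k"
    "\<And>ps q q'. vsize (enc_letter ps :: ('p, 'k :: {comm_semiring_0, comm_monoid_mult}) val) \<le> U \<Longrightarrow>
       q \<in> set (astates A) \<Longrightarrow> q' \<in> set (astates A) \<Longrightarrow> vsize q \<le> U \<Longrightarrow> vsize q' \<le> U \<Longrightarrow>
       computes prg U 27 (VPair (VPair md (enc_letter ps)) (VPair E (VPair q q'))) (es (atrans A q (set ps) q')) k"
  shows "implements md es (E :: ('p, 'k) val) A k"
  unfolding implements_def using assms vsize_mem_vlist[of _ "astates A"]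
  by (meson less_imp_le_nat less_le_trans)

lemma mode_expr [simp]:
  "xv P (mode_zero e) env = (if xv P e env = VNil then VNil else VWt 0)"
  "xv P (mode_one e) env = (if xv P e env = VNil then VNum 1 else VWt 1)"
  "xok P (mode_zero e) env = xok P e env" "xok P (mode_one e) env = xok P e env"
  "xgood P T (mode_zero e) env = xgood P T e env" "xgood P T (mode_one e) env = xgood P T e env"
  "ncalls (mode_zero e) = ncalls e" "ncalls (mode_one e) = ncalls e"
  by (auto simp: mode_zero_def mode_one_def)

lemma implements_const:
  assumes m: "mode_ok md es"
  shows "implements md es (VPair (VNum 0) (es s)) (const_aut s) 12"
  using mode_okD[OF m] U64[OF U]
  by (intro implementsI computesU[OF _ prg_nth(23), where k = 2] computesU[OF _ prg_nth(24), where k = 2]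
      computesU[OF _ prg_nth(26), where k = 2] computesU[OF _ prg_nth(29), where k = 2];
      auto simp: aut_ok_def states_body_def tagged_def start_body_def ter_body_def tr_body_def)

lemma implements_lit:
  assumes "vsize (enc_env env :: ('p, 'k :: {comm_semiring_0, comm_monoid_mult}) val) + vsize (enc_pil \<phi> :: ('p, 'k) val) + 5 \<le> U"
    "snd ` set_pil \<phi> \<subseteq> fst ` set env"
  shows "implements VNil truth (VPair (VNum 1) (VPair (enc_pil \<phi>) (enc_env env)) :: ('p, 'k) val)
    (lit_aut (\<lambda>a. pil_sat a (map_pil (inst (map_of env)) \<phi>))) (12 + 3 * pil_size \<phi>)"
proof -
  let ?k = "9 + 3 * pil_size \<phi>"
  have h: "computes prg U 8 (VPair (VPair (enc_letter ps) (enc_env env)) (enc_pil \<phi> :: ('p, 'k) val))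
      (truth (pil_sat (set ps) (map_pil (inst (map_of env)) \<phi>))) ?k"
    if "vsize (enc_letter ps :: ('p, 'k) val) \<le> U" for ps
    using assms that by (intro comp_psat[OF U]) auto
  show ?thesis
    using U64[OF U] assms
    by (intro implementsI computesU[OF _ prg_nth(23), where k = ?k] computesU[OF _ prg_nth(24), where k = ?k]
      computesU[OF _ prg_nth(26), where k = ?k] computesU[OF _ prg_nth(29), where k = ?k];
      auto simp: aut_ok_def states_body_def tagged_def start_body_def ter_body_def tr_body_def computesD[OF h])
qed

lemma computes_pon:
  assumes "vsize (vlist (map (VPair x) ys @ acc)) \<le> U" "vsize x \<le> U" "vsize (vlist ys) \<le> U" "7 \<le> k"
  shows "halts prg 1 (VPair (VPair x (vlist acc)) (vlist ys))"
    "res prg 1 (VPair (VPair x (vlist acc)) (vlist ys)) = vlist (map (VPair x) ys @ acc)"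
    "tm prg 1 (VPair (VPair x (vlist acc)) (vlist ys)) \<le> U ^ k"
  using computesD[OF computes_le[OF U comp_pon[OF U assms(1-3)] assms(4)]] by auto

lemma computes_pon_Nil:
  assumes "vsize (vlist (map (VPair x) ys)) \<le> U" "vsize x \<le> U" "vsize (vlist ys) \<le> U" "7 \<le> k"
  shows "halts prg 1 (VPair (VPair x VNil) (vlist ys))"
    "res prg 1 (VPair (VPair x VNil) (vlist ys)) = vlist (map (VPair x) ys)"
    "tm prg 1 (VPair (VPair x VNil) (vlist ys)) \<le> U ^ k"
  using computes_pon[of x ys "[]" k] assms by auto

text \<open>One more level of calls, hence 3 more in the exponent; so it is for each operation other
  than determinization.\<close>

lemma implements_wrap:
  assumes m: "mode_ok md es" and A: "implements md es E A k"
    and s: "vsize (vlist (astates (wrap_aut c A))) \<le> U" "vsize E + 5 \<le> U"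
  shows "implements md es (VPair (VNum 3) (VPair (truth c) E)) (wrap_aut c A) (k + 3)"
proof -
  note a = implements_simps[OF A] and st = implements_states[OF A order_refl]
  note ter = implements_ter[OF A order_refl] and tr = implements_tr[OF A order_refl]
  have p: "vsize (vlist (map tagL (astates A))) \<le> U" using s(1) by simp
  have k: "7 \<le> k" "2 \<le> k" "12 \<le> k" using a by auto
  have u: "vsize E + 5 \<le> U" "64 \<le> U" using s U64[OF U] by auto
  have u1: "vsize (VNil :: ('a, 'b) val) \<le> U" using u by simp
  note pon = computes_pon_Nil[OF p u1 a(4) k(1)]
  note [simp] = st ter tr pon mode_okD[OF m] a(2-7) k
  have [simp]: "aut_ok (wrap_aut c A)" using aut_ok_wrap[OF a(2)] .
  show ?thesis
  proof (rule implementsI)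
    show "computes prg U 21 (VPair (VNum 3) (VPair (truth c) E)) (vlist (astates (wrap_aut c A))) (k + 3)"
      using u by (intro computesU[OF _ prg_nth(23), where k = k]) (auto simp: states_body_def tagged_def)
    show "computes prg U 22 (VPair (VNum 3) (VPair (truth c) E)) (astart (wrap_aut c A)) (k + 3)"
      using u by (intro computesU[OF _ prg_nth(24), where k = k]) (auto simp: start_body_def)
  next
    fix q assume q: "q \<in> set (astates (wrap_aut c A))" "vsize q \<le> U"
    with u show "computes prg U 24 (VPair md (VPair (VPair (VNum 3) (VPair (truth c) E)) q)) (es (afinal (wrap_aut c A) q)) (k + 3)"
      by (intro computesU[OF _ prg_nth(26), where k = k]) (auto simp: ter_body_def)
  next
    fix ps q q' assume "vsize (enc_letter ps :: ('a, 'b) val) \<le> U"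
      "q \<in> set (astates (wrap_aut c A))" "q' \<in> set (astates (wrap_aut c A))" "vsize q \<le> U" "vsize q' \<le> U"
    with u show "computes prg U 27 (VPair (VPair md (enc_letter ps)) (VPair (VPair (VNum 3) (VPair (truth c) E)) (VPair q q')))
        (es (atrans (wrap_aut c A) q (set ps) q')) (k + 3)"
      by (intro computesU[OF _ prg_nth(29), where k = k]) (auto simp: tr_body_def)
  next
    show "12 \<le> k + 3" by (rule trans_le_add1[OF a(1)])
  qed (use s in auto)
qed

text \<open>Brings the operands of a binary operation to a common exponent.\<close>

lemma implements_mono: "implements md es E A j \<Longrightarrow> j \<le> k \<Longrightarrow> implements md es E A k"
  unfolding implements_def by (meson computes_le[OF U] le_trans)

lemma implements_plus:
  assumes m: "mode_ok md es" and A: "implements md es E A k"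
    and s: "vsize (vlist (astates (plus_aut A))) \<le> U" "vsize E + 5 \<le> U"
  shows "implements md es (VPair (VNum 4) E) (plus_aut A) (k + 3)"
proof -
  note a = implements_simps[OF A] and st = implements_states[OF A order_refl]
  note ter = implements_ter[OF A order_refl] and tr = implements_tr[OF A order_refl]
  have k: "5 \<le> k" "7 \<le> k" "2 \<le> k" "12 \<le> k" using a by auto
  have u: "vsize E + 5 \<le> U" "64 \<le> U" using s U64[OF U] by auto
  have u1: "vsize (VNil :: ('a, 'b) val) \<le> U" "vsize (VNum 1 :: ('a, 'b) val) \<le> U" using u by simp_all
  have p: "vsize (vlist (map tagL (astates A))) \<le> U" using s(1) by simp
  note [simp] = computes_pon_Nil[OF p u1(1) a(4) k(2)]
  note [simp] = st ter tr mode_okD[OF m] mode_ok_add[OF m k(1)] mode_ok_mul[OF m k(1)] a(2-7) k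
  have [simp]: "aut_ok (plus_aut A)" using aut_ok_plus[OF a(2)] by auto
  show ?thesis
  proof (rule implementsI)
    show "computes prg U 21 (VPair (VNum 4) E) (vlist (astates (plus_aut A))) (k + 3)"
      using u by (intro computesU[OF _ prg_nth(23), where k = k]) (auto simp: states_body_def tagged_def)
    show "computes prg U 22 (VPair (VNum 4) E) (astart (plus_aut A)) (k + 3)"
      using u by (intro computesU[OF _ prg_nth(24), where k = k]) (auto simp: tagged_def start_body_def)
  next
    fix q assume "q \<in> set (astates (plus_aut A))" "vsize q \<le> U"
    with u show "computes prg U 24 (VPair md (VPair (VPair (VNum 4) E) q)) (es (afinal (plus_aut A) q)) (k + 3)"
      by (intro computesU[OF _ prg_nth(26), where k = k]) (auto simp: ter_body_def set_pairl)
  next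
    fix ps q q' assume "vsize (enc_letter ps :: ('a, 'b) val) \<le> U"
      "q \<in> set (astates (plus_aut A))" "q' \<in> set (astates (plus_aut A))" "vsize q \<le> U" "vsize q' \<le> U"
    with u show "computes prg U 27 (VPair (VPair md (enc_letter ps)) (VPair (VPair (VNum 4) E) (VPair q q')))
        (es (atrans (plus_aut A) q (set ps) q')) (k + 3)"
      by (intro computesU[OF _ prg_nth(29), where k = k]) (auto simp: tr_body_def set_pairl)
  next
    show "12 \<le> k + 3" by (rule trans_le_add1[OF a(1)])
  qed (use s in \<open>auto simp: set_pairl\<close>)
qed

lemma implements_add:
  assumes m: "mode_ok md es" and A: "implements md es E A k"
    and B: "implements md es E' B k"
    and s: "vsize (vlist (astates (add_aut A B))) \<le> U" "vsize E + vsize E' + 5 \<le> U"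
  shows "implements md es (VPair (VNum 5) (VPair E E')) (add_aut A B) (k + 3)"
proof -
  note a = implements_simps[OF A] and st = implements_states[OF A order_refl]
  note ter = implements_ter[OF A order_refl] and tr = implements_tr[OF A order_refl]
  note b = implements_simps[OF B] and stB = implements_states[OF B order_refl]
  note terB = implements_ter[OF B order_refl] and trB = implements_tr[OF B order_refl]
  have k: "5 \<le> k" "7 \<le> k" "2 \<le> k" "12 \<le> k" using a by auto
  have u: "vsize E + vsize E' + 5 \<le> U" "64 \<le> U" using s U64[OF U] by auto
  have u1: "vsize (VNil :: ('a, 'b) val) \<le> U" "vsize (VNum 1 :: ('a, 'b) val) \<le> U" using u by simp_all
  have p: "vsize (vlist (map tagL (astates A) @ map tagR (astates B))) \<le> U" using s(1) by simp
  have p': "vsize (vlist (map tagR (astates B))) \<le> U"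
    using p vsize_vlist_suffix[of "map tagR (astates B)" "map tagL (astates A)"] by simp
  note [simp] = computes_pon[OF p u1(1) a(4) k(2)] computes_pon_Nil[OF p' u1(2) b(4) k(2)]
  note [simp] = st ter tr stB terB trB b(2-7) mode_okD[OF m] mode_ok_add[OF m k(1)] mode_ok_mul[OF m k(1)] a(2-7) k
  have [simp]: "aut_ok (add_aut A B)" using aut_ok_bin[OF a(2) b(2)] by auto
  show ?thesis
  proof (rule implementsI)
    show "computes prg U 21 (VPair (VNum 5) (VPair E E')) (vlist (astates (add_aut A B))) (k + 3)"
      using u by (intro computesU[OF _ prg_nth(23), where k = k]) (auto simp: states_body_def tagged_def)
    show "computes prg U 22 (VPair (VNum 5) (VPair E E')) (astart (add_aut A B)) (k + 3)"
      using u by (intro computesU[OF _ prg_nth(24), where k = k]) (auto simp: tagged_def start_body_def)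
  next
    fix q assume "q \<in> set (astates (add_aut A B))" "vsize q \<le> U"
    with u show "computes prg U 24 (VPair md (VPair (VPair (VNum 5) (VPair E E')) q)) (es (afinal (add_aut A B) q)) (k + 3)"
      by (intro computesU[OF _ prg_nth(26), where k = k]) (auto simp: ter_body_def set_pairl)
  next
    fix ps q q' assume "vsize (enc_letter ps :: ('a, 'b) val) \<le> U"
      "q \<in> set (astates (add_aut A B))" "q' \<in> set (astates (add_aut A B))" "vsize q \<le> U" "vsize q' \<le> U"
    with u show "computes prg U 27 (VPair (VPair md (enc_letter ps)) (VPair (VPair (VNum 5) (VPair E E')) (VPair q q')))
        (es (atrans (add_aut A B) q (set ps) q')) (k + 3)"
      by (intro computesU[OF _ prg_nth(29), where k = k]) (auto simp: tr_body_def set_pairl)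
  next
    show "12 \<le> k + 3" by (rule trans_le_add1[OF a(1)])
  qed (use s in \<open>auto simp: set_pairl\<close>)
qed

lemma implements_mul:
  assumes m: "mode_ok md es" and A: "implements md es E A k"
    and B: "implements md es E' B k"
    and s: "vsize (vlist (astates (mul_aut A B))) \<le> U" "vsize E + vsize E' + 5 \<le> U"
  shows "implements md es (VPair (VNum 6) (VPair E E')) (mul_aut A B) (k + 3)"
proof -
  note a = implements_simps[OF A] and st = implements_states[OF A order_refl]
  note ter = implements_ter[OF A order_refl] and tr = implements_tr[OF A order_refl]
  note b = implements_simps[OF B] and stB = implements_states[OF B order_refl]
  note terB = implements_ter[OF B order_refl] and trB = implements_tr[OF B order_refl]
  have k: "5 \<le> k" "7 \<le> k" "2 \<le> k" "12 \<le> k" using a by auto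
  have u: "vsize E + vsize E' + 5 \<le> U" "64 \<le> U" using s U64[OF U] by auto
  have u1: "vsize (VNil :: ('a, 'b) val) \<le> U" "vsize (VNum 1 :: ('a, 'b) val) \<le> U" using u by simp_all
  have p: "vsize (vlist (pairl (astates A) (astates B))) \<le> U" using s(1) by simp
  note [simp] = computesD[OF computes_le[OF U comp_prodl[OF U p a(4) b(4)] k(4)]]
  note [simp] = st ter tr stB terB trB b(2-7) mode_okD[OF m] mode_ok_add[OF m k(1)] mode_ok_mul[OF m k(1)] a(2-7) k
  have [simp]: "aut_ok (mul_aut A B)" using aut_ok_bin[OF a(2) b(2)] by auto
  show ?thesis
  proof (rule implementsI)
    show "computes prg U 21 (VPair (VNum 6) (VPair E E')) (vlist (astates (mul_aut A B))) (k + 3)"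
      using u by (intro computesU[OF _ prg_nth(23), where k = k]) (auto simp: states_body_def tagged_def)
    show "computes prg U 22 (VPair (VNum 6) (VPair E E')) (astart (mul_aut A B)) (k + 3)"
      using u by (intro computesU[OF _ prg_nth(24), where k = k]) (auto simp: tagged_def start_body_def)
  next
    fix q assume "q \<in> set (astates (mul_aut A B))" "vsize q \<le> U"
    with u show "computes prg U 24 (VPair md (VPair (VPair (VNum 6) (VPair E E')) q)) (es (afinal (mul_aut A B) q)) (k + 3)"
      by (intro computesU[OF _ prg_nth(26), where k = k]) (auto simp: ter_body_def set_pairl)
  next
    fix ps q q' assume "vsize (enc_letter ps :: ('a, 'b) val) \<le> U"
      "q \<in> set (astates (mul_aut A B))" "q' \<in> set (astates (mul_aut A B))" "vsize q \<le> U" "vsize q' \<le> U"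
    with u show "computes prg U 27 (VPair (VPair md (enc_letter ps)) (VPair (VPair (VNum 6) (VPair E E')) (VPair q q')))
        (es (atrans (mul_aut A B) q (set ps) q')) (k + 3)"
      by (intro computesU[OF _ prg_nth(29), where k = k]) (auto simp: tr_body_def set_pairl)
  next
    show "12 \<le> k + 3" by (rule trans_le_add1[OF a(1)])
  qed (use s in \<open>auto simp: set_pairl\<close>)
qed

lemma implements_cat:
  assumes m: "mode_ok md es" and A: "implements md es E A k"
    and B: "implements md es E' B k"
    and s: "vsize (vlist (astates (cat_aut A B))) \<le> U" "vsize E + vsize E' + 5 \<le> U"
  shows "implements md es (VPair (VNum 7) (VPair E E')) (cat_aut A B) (k + 3)"
proof -
  note a = implements_simps[OF A] and st = implements_states[OF A order_refl]
  note ter = implements_ter[OF A order_refl] and tr = implements_tr[OF A order_refl]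
  note b = implements_simps[OF B] and stB = implements_states[OF B order_refl]
  note terB = implements_ter[OF B order_refl] and trB = implements_tr[OF B order_refl]
  have k: "5 \<le> k" "7 \<le> k" "2 \<le> k" "12 \<le> k" using a by auto
  have u: "vsize E + vsize E' + 5 \<le> U" "64 \<le> U" using s U64[OF U] by auto
  have u1: "vsize (VNil :: ('a, 'b) val) \<le> U" "vsize (VNum 1 :: ('a, 'b) val) \<le> U" using u by simp_all
  have p: "vsize (vlist (map tagL (astates A) @ map tagR (astates B))) \<le> U" using s(1) by simp
  have p': "vsize (vlist (map tagR (astates B))) \<le> U"
    using p vsize_vlist_suffix[of "map tagR (astates B)" "map tagL (astates A)"] by simp
  note [simp] = computes_pon[OF p u1(1) a(4) k(2)] computes_pon_Nil[OF p' u1(2) b(4) k(2)]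
  note [simp] = st ter tr stB terB trB b(2-7) mode_okD[OF m] mode_ok_add[OF m k(1)] mode_ok_mul[OF m k(1)] a(2-7) k
  have [simp]: "aut_ok (cat_aut A B)" using aut_ok_bin[OF a(2) b(2)] by auto
  show ?thesis
  proof (rule implementsI)
    show "computes prg U 21 (VPair (VNum 7) (VPair E E')) (vlist (astates (cat_aut A B))) (k + 3)"
      using u by (intro computesU[OF _ prg_nth(23), where k = k]) (auto simp: states_body_def tagged_def)
    show "computes prg U 22 (VPair (VNum 7) (VPair E E')) (astart (cat_aut A B)) (k + 3)"
      using u by (intro computesU[OF _ prg_nth(24), where k = k]) (auto simp: tagged_def start_body_def)
  next
    fix q assume "q \<in> set (astates (cat_aut A B))" "vsize q \<le> U"
    with u show "computes prg U 24 (VPair md (VPair (VPair (VNum 7) (VPair E E')) q)) (es (afinal (cat_aut A B) q)) (k + 3)"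
      by (intro computesU[OF _ prg_nth(26), where k = k]) (auto simp: ter_body_def set_pairl)
  next
    fix ps q q' assume "vsize (enc_letter ps :: ('a, 'b) val) \<le> U"
      "q \<in> set (astates (cat_aut A B))" "q' \<in> set (astates (cat_aut A B))" "vsize q \<le> U" "vsize q' \<le> U"
    with u show "computes prg U 27 (VPair (VPair md (enc_letter ps)) (VPair (VPair (VNum 7) (VPair E E')) (VPair q q')))
        (es (atrans (cat_aut A B) q (set ps) q')) (k + 3)"
      by (intro computesU[OF _ prg_nth(29), where k = k]) (auto simp: tr_body_def set_pairl)
  next
    show "12 \<le> k + 3" by (rule trans_le_add1[OF a(1)])
  qed (use s in \<open>auto simp: set_pairl\<close>)
qed

lemma implements_shuf:
  assumes m: "mode_ok md es" and A: "implements md es E A k"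
    and B: "implements md es E' B k"
    and s: "vsize (vlist (astates (shuf_aut A B))) \<le> U" "vsize E + vsize E' + 5 \<le> U"
  shows "implements md es (VPair (VNum 8) (VPair E E')) (shuf_aut A B) (k + 3)"
proof -
  note a = implements_simps[OF A] and st = implements_states[OF A order_refl]
  note ter = implements_ter[OF A order_refl] and tr = implements_tr[OF A order_refl]
  note b = implements_simps[OF B] and stB = implements_states[OF B order_refl]
  note terB = implements_ter[OF B order_refl] and trB = implements_tr[OF B order_refl]
  have k: "5 \<le> k" "7 \<le> k" "2 \<le> k" "12 \<le> k" using a by auto
  have u: "vsize E + vsize E' + 5 \<le> U" "64 \<le> U" using s U64[OF U] by auto
  have u1: "vsize (VNil :: ('a, 'b) val) \<le> U" "vsize (VNum 1 :: ('a, 'b) val) \<le> U" using u by simp_all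
  have p: "vsize (vlist (pairl (astates A) (astates B))) \<le> U" using s(1) by simp
  note [simp] = computesD[OF computes_le[OF U comp_prodl[OF U p a(4) b(4)] k(4)]]
  have k4: "4 \<le> k" using k by simp
  note [simp] = computesD[OF computes_le[OF U comp_teq[OF U] k4]]
  \<comment> \<open>The equations for \<open>es 0\<close> and \<open>es 1\<close> are reversed: a
    move that is ruled out contributes a zero to an addition, and \<open>mode_ok_add\<close> applies
    only to arguments of the form \<open>es a\<close>.\<close>
  note [simp] = st ter tr stB terB trB b(2-7) mode_okD(1,2)[OF m] mode_okD(3,4)[OF m, symmetric] mode_ok_add[OF m k(1)] mode_ok_mul[OF m k(1)] a(2-7) k
  have [simp]: "aut_ok (shuf_aut A B)" using aut_ok_bin[OF a(2) b(2)] by auto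
  show ?thesis
  proof (rule implementsI)
    show "computes prg U 21 (VPair (VNum 8) (VPair E E')) (vlist (astates (shuf_aut A B))) (k + 3)"
      using u by (intro computesU[OF _ prg_nth(23), where k = k]) (auto simp: states_body_def tagged_def)
    show "computes prg U 22 (VPair (VNum 8) (VPair E E')) (astart (shuf_aut A B)) (k + 3)"
      using u by (intro computesU[OF _ prg_nth(24), where k = k]) (auto simp: tagged_def start_body_def)
  next
    fix q assume "q \<in> set (astates (shuf_aut A B))" "vsize q \<le> U"
    with u show "computes prg U 24 (VPair md (VPair (VPair (VNum 8) (VPair E E')) q)) (es (afinal (shuf_aut A B) q)) (k + 3)"
      by (intro computesU[OF _ prg_nth(26), where k = k]) (auto simp: ter_body_def set_pairl)
  next
    fix ps q q' assume "vsize (enc_letter ps :: ('a, 'b) val) \<le> U"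
      "q \<in> set (astates (shuf_aut A B))" "q' \<in> set (astates (shuf_aut A B))" "vsize q \<le> U" "vsize q' \<le> U"
    with u obtain x y x' y' where q: "q = VPair x y" "x \<in> set (astates A)" "y \<in> set (astates B)"
        and q': "q' = VPair x' y'" "x' \<in> set (astates A)" "y' \<in> set (astates B)"
        and l: "vsize (enc_letter ps :: ('a, 'b) val) \<le> U" "vsize q \<le> U" "vsize q' \<le> U"
      by (auto simp: set_pairl)
    show "computes prg U 27 (VPair (VPair md (enc_letter ps)) (VPair (VPair (VNum 8) (VPair E E')) (VPair q q')))
        (es (atrans (shuf_aut A B) q (set ps) q')) (k + 3)"
      using u l q(2,3) q'(2,3) unfolding q(1) q'(1)
      by (intro computesU[OF _ prg_nth(29), where k = k]; cases "x = x'"; cases "y = y'"; simp add: tr_body_def)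
  next
    show "12 \<le> k + 3" by (rule trans_le_add1[OF a(1)])
  qed (use s in \<open>auto simp: set_pairl\<close>)
qed

section \<open>The subset construction as carried out by the program\<close>

lemmas anyter_nth = prg_nth(25)[unfolded anyter_body_def]
lemmas anytr_nth = prg_nth(27)[unfolded anytr_body_def]
lemmas succ_nth = prg_nth(28)[unfolded succ_body_def]

lemma vsize_subset_le:
  assumes "X \<in> set (subseqs xs)"
  shows "set X \<subseteq> set xs" "vsize (vlist X) \<le> vsize (vlist xs)"
proof -
  show "set X \<subseteq> set xs" using assms subseqs_powset[of xs] by (metis PowD image_eqI)
  show "vsize (vlist X) \<le> vsize (vlist xs)" using assms
  proof (induction xs arbitrary: X)
    case (Cons x xs)
    then show ?case by (auto simp: Let_def intro: le_SucI trans_le_add2)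
  qed simp
qed

lemma vsize_filter_le: "vsize (vlist (filter P xs)) \<le> vsize (vlist xs)"
  using vsize_subset_le(2)[OF filter_in_subseqs] .

lemma comp_anyter:
  assumes A: "implements VNil truth E A k" and X: "set X \<subseteq> set (astates A)" "vsize (vlist X) \<le> U"
  shows "computes prg U 23 (VPair E (vlist X)) (truth (\<exists>q\<in>set X. afinal A q)) (k + 5)"
proof -
  note a = implements_simps[OF A]
  have u: "64 \<le> U" using U64[OF U] .
  have "computes prg U 23 (VPair E (vlist (map (\<lambda>q. q) X))) ((\<lambda>X. truth (\<exists>q\<in>set X. afinal A q)) X) (k + 5)"
  proof (rule computes_fold[OF U _ anyter_nth, where k = k])
    show "vsize (VPair E (vlist (map (\<lambda>q. q) X))) \<le> U ^ 2" using a X u by (intro lin_le'[OF U]) simp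
    show "vsize (truth (\<exists>q\<in>set Y. afinal A q)) \<le> U ^ 2" for Y using u by (intro lin_le'[OF U]) simp
    fix q Y assume "\<exists>Z. X = Z @ q # Y"
    then have "q \<in> set (astates A)" using X by auto
    note h = implements_ter[OF A order_refl this]
    show "xok prg (If (Call 24 (MkPair CNil (MkPair foldctx foldelt))) (CNum 1) (Var 0))
        [truth (\<exists>q\<in>set Y. afinal A q), VPair E (VPair q (vlist (map (\<lambda>q. q) Y)))] \<and>
      xv prg (If (Call 24 (MkPair CNil (MkPair foldctx foldelt))) (CNum 1) (Var 0))
        [truth (\<exists>q\<in>set Y. afinal A q), VPair E (VPair q (vlist (map (\<lambda>q. q) Y)))] = truth (\<exists>q\<in>set (q # Y). afinal A q) \<and>
      xc prg (If (Call 24 (MkPair CNil (MkPair foldctx foldelt))) (CNum 1) (Var 0))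
        [truth (\<exists>q\<in>set Y. afinal A q), VPair E (VPair q (vlist (map (\<lambda>q. q) Y)))] \<le> 8 * U ^ k"
      using h by simp
  qed (use a in auto)
  then show ?thesis by simp
qed

lemma comp_anytr:
  assumes A: "implements VNil truth E A k" and X: "set X \<subseteq> set (astates A)" "vsize (vlist X) \<le> U"
    and p: "p \<in> set (astates A)" and l: "vsize (enc_letter ps :: ('p, 'k :: {comm_semiring_0, comm_monoid_mult}) val) \<le> U"
  shows "computes prg U 25 (VPair (VPair (enc_letter ps) (VPair E p)) (vlist X) :: ('p, 'k) val)
    (truth (\<exists>q\<in>set X. atrans A q (set ps) p)) (k + 5)"
proof -
  note a = implements_simps[OF A]
  have u: "64 \<le> U" using U64[OF U] .
  have "computes prg U 25 (VPair (VPair (enc_letter ps) (VPair E p)) (vlist (map (\<lambda>q. q) X)))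
      ((\<lambda>X. truth (\<exists>q\<in>set X. atrans A q (set ps) p)) X) (k + 5)"
  proof (rule computes_fold[OF U _ anytr_nth, where k = k])
    show "vsize (VPair (VPair (enc_letter ps) (VPair E p)) (vlist (map (\<lambda>q. q) X))) \<le> U ^ 2"
      using a(5) a(6)[OF p] X u l by (intro lin_le'[OF U]) simp
    show "vsize (truth (\<exists>q\<in>set Y. atrans A q (set ps) p)) \<le> U ^ 2" for Y
      using u by (intro lin_le'[OF U]) simp
    fix q Y assume "\<exists>Z. X = Z @ q # Y"
    then have "q \<in> set (astates A)" using X by auto
    note h = implements_tr[OF A order_refl this p l]
    show "xok prg (If (Call 27 (MkPair (MkPair CNil (Fst foldctx)) (MkPair (Fst (Snd foldctx)) (MkPair foldelt (Snd (Snd foldctx))))))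
          (CNum 1) (Var 0))
        [truth (\<exists>q\<in>set Y. atrans A q (set ps) p), VPair (VPair (enc_letter ps) (VPair E p)) (VPair q (vlist (map (\<lambda>q. q) Y)))] \<and>
      xv prg (If (Call 27 (MkPair (MkPair CNil (Fst foldctx)) (MkPair (Fst (Snd foldctx)) (MkPair foldelt (Snd (Snd foldctx))))))
          (CNum 1) (Var 0))
        [truth (\<exists>q\<in>set Y. atrans A q (set ps) p), VPair (VPair (enc_letter ps) (VPair E p)) (VPair q (vlist (map (\<lambda>q. q) Y)))] =
        truth (\<exists>q\<in>set (q # Y). atrans A q (set ps) p) \<and>
      xc prg (If (Call 27 (MkPair (MkPair CNil (Fst foldctx)) (MkPair (Fst (Snd foldctx)) (MkPair foldelt (Snd (Snd foldctx))))))
          (CNum 1) (Var 0))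
        [truth (\<exists>q\<in>set Y. atrans A q (set ps) p), VPair (VPair (enc_letter ps) (VPair E p)) (VPair q (vlist (map (\<lambda>q. q) Y)))] \<le> 8 * U ^ k"
      using h by simp
  qed (use a in auto)
  then show ?thesis by simp
qed

lemma comp_succ:
  assumes A: "implements VNil truth E A k" and X: "set X \<subseteq> set (astates A)" "vsize (vlist X) \<le> U"
    and l: "vsize (enc_letter ps :: ('p, 'k :: {comm_semiring_0, comm_monoid_mult}) val) \<le> U"
  shows "computes prg U 26 (VPair (VPair (enc_letter ps) (VPair E (vlist X))) (vlist (astates A)) :: ('p, 'k) val)
    (vlist (filter (\<lambda>p. \<exists>q\<in>set X. atrans A q (set ps) p) (astates A))) (k + 10)"
proof -
  note a = implements_simps[OF A]
  have u: "64 \<le> U" using U64[OF U] .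
  let ?P = "\<lambda>p. \<exists>q\<in>set X. atrans A q (set ps) p"
  have "computes prg U 26 (VPair (VPair (enc_letter ps) (VPair E (vlist X))) (vlist (map (\<lambda>q. q) (astates A))))
      ((\<lambda>S. vlist (filter ?P S)) (astates A)) (k + 10)"
  proof (rule computes_fold[OF U _ succ_nth, where k = "k + 5"])
    show "vsize (VPair (VPair (enc_letter ps) (VPair E (vlist X))) (vlist (map (\<lambda>q. q) (astates A)))) \<le> U ^ 2"
      using a X u l by (intro lin_le'[OF U]) simp
    show "vsize (vlist (filter ?P S)) \<le> U ^ 2" if "\<exists>Z. astates A = Z @ S" for S
    proof -
      from that obtain Z where "astates A = Z @ S" by blast
      then have "vsize (vlist S) \<le> U" using a(4) vsize_vlist_suffix[of S Z] by simp
      then show ?thesis using vsize_filter_le[of ?P S] by (intro lin_le'[OF U]) simp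
    qed
    fix p S assume "\<exists>Z. astates A = Z @ p # S"
    then have "p \<in> set (astates A)" by auto
    note h = computesD[OF comp_anytr[OF A X this l]]
    show "xok prg (If (Call 25 (MkPair (MkPair (Fst foldctx) (MkPair (Fst (Snd foldctx)) foldelt)) (Snd (Snd foldctx))))
          (MkPair foldelt (Var 0)) (Var 0))
        [vlist (filter ?P S), VPair (VPair (enc_letter ps) (VPair E (vlist X))) (VPair p (vlist (map (\<lambda>q. q) S)))] \<and>
      xv prg (If (Call 25 (MkPair (MkPair (Fst foldctx) (MkPair (Fst (Snd foldctx)) foldelt)) (Snd (Snd foldctx))))
          (MkPair foldelt (Var 0)) (Var 0))
        [vlist (filter ?P S), VPair (VPair (enc_letter ps) (VPair E (vlist X))) (VPair p (vlist (map (\<lambda>q. q) S)))] =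
        vlist (filter ?P (p # S)) \<and>
      xc prg (If (Call 25 (MkPair (MkPair (Fst foldctx) (MkPair (Fst (Snd foldctx)) foldelt)) (Snd (Snd foldctx))))
          (MkPair foldelt (Var 0)) (Var 0))
        [vlist (filter ?P S), VPair (VPair (enc_letter ps) (VPair E (vlist X))) (VPair p (vlist (map (\<lambda>q. q) S)))] \<le> 8 * U ^ (k + 5)"
      using h by simp
  qed (use a in auto)
  then show ?thesis by simp
qed

text \<open>The 13 consists of two nested loops for the successor set, 5 each, and 3 for the
  surrounding body.\<close>

lemma implements_det:
  assumes A: "implements VNil truth E A k"
    and s: "vsize (vlist (astates (det_aut A) :: ('p, 'k :: {comm_semiring_0, comm_monoid_mult}) val list)) \<le> U" "vsize E + 5 \<le> U"
  shows "implements (VNum 1) VWt (VPair (VNum 2) E) (det_aut A :: ('p, 'k, ('p \<times> nat) set, 'k) vaut) (k + 13)"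
proof -
  let ?D = "det_aut A :: ('p, 'k, ('p \<times> nat) set, 'k) vaut"
  note a = implements_simps[OF A]
  have k1: "k \<le> k + 10" "12 \<le> k + 10" "4 \<le> k + 10" "k + 5 \<le> k + 10" using a(1) by simp_all
  note [simp] = implements_states[OF A k1(1)] a(2-7)
  have k2: "2 \<le> k" using a(1) by simp
  have p: "vsize (vlist (map vlist (subseqs (astates A)))) \<le> U" using s(1) by simp
  note [simp] = computesD[OF computes_le[OF U comp_subs[OF U p] k1(2)]]
    computesD[OF computes_le[OF U comp_anyter[OF A] k1(4)]]
    computesD[OF comp_succ[OF A]] computesD[OF computes_le[OF U comp_teq[OF U] k1(3)]]
  have [simp]: "aut_ok ?D" using aut_ok_det a by blast
  have X: "set X \<subseteq> set (astates A)" "vsize (vlist X) \<le> U" if "X \<in> set (subseqs (astates A))" for X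
    using vsize_subset_le(1)[OF that] le_trans[OF vsize_subset_le(2)[OF that] a(4)] by auto
  have pu: "\<forall>q\<in>set X. pure q" if "X \<in> set (subseqs (astates A))" for X using X(1)[OF that] by auto
  have u: "vsize E + 5 \<le> U" "64 \<le> U" using s U64[OF U] by auto
  show ?thesis
  proof (rule implementsI)
    show "computes prg U 21 (VPair (VNum 2) E) (vlist (astates ?D)) (k + 13)"
      using u by (intro computesU[OF _ prg_nth(23), where k = "k + 10"]) (auto simp: states_body_def tagged_def)
    show "computes prg U 22 (VPair (VNum 2) E) (astart ?D) (k + 13)"
      using u by (intro computesU[OF _ prg_nth(24), where k = "k + 10"]) (auto simp: start_body_def)
  next
    fix q assume "q \<in> set (astates ?D)" "vsize q \<le> U"
    then obtain X where q: "q = vlist X" "X \<in> set (subseqs (astates A))" by auto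
    show "computes prg U 24 (VPair (VNum 1) (VPair (VPair (VNum 2) E) q)) (VWt (afinal ?D q)) (k + 13)"
      using u X[OF q(2)] by (intro computesU[OF _ prg_nth(26), where k = "k + 10"]) (auto simp: ter_body_def q)
  next
    fix ps q q' assume l: "vsize (enc_letter ps :: ('p, 'k) val) \<le> U"
      and q: "q \<in> set (astates ?D)" "q' \<in> set (astates ?D)"
    then obtain X Y where X': "q = vlist X" "X \<in> set (subseqs (astates A))"
      and Y: "q' = vlist Y" "Y \<in> set (subseqs (astates A))" by auto
    let ?Z = "filter (\<lambda>p. \<exists>q\<in>set X. atrans A q (set ps) p) (astates A)"
    have Z: "?Z \<in> set (subseqs (astates A))" by (rule filter_in_subseqs)
    show "computes prg U 27 (VPair (VPair (VNum 1) (enc_letter ps)) (VPair (VPair (VNum 2) E) (VPair q q')))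
        (VWt (atrans ?D q (set ps) q')) (k + 13)"
      using u l X[OF X'(2)] X[OF Y(2)] X[OF Z] pu[OF Y(2)] pu[OF Z]
      by (intro computesU[OF _ prg_nth(29), where k = "k + 10"]) (auto simp: tr_body_def X'(1) Y(1))
  next
    show "12 \<le> k + 13" using k2 by simp
  qed (use s pu in auto)
qed

end

section \<open>Codes of ground expressions and exponents of their time bounds\<close>

primrec optag :: "bop \<Rightarrow> nat" where
  "optag OAdd = 5" | "optag OMul = 6" | "optag OCat = 7" | "optag OShuf = 8"

primrec enc_g :: "('d \<Rightarrow> ('p, 'k) val) \<Rightarrow> 'd gexp \<Rightarrow> ('p, 'k) val" where
  "enc_g l (GLeaf d) = l d"
| "enc_g l (GWrap c e) = VPair (VNum 3) (VPair (truth c) (enc_g l e))"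
| "enc_g l (GPlus e) = VPair (VNum 4) (enc_g l e)"
| "enc_g l (GBin op e e') = VPair (VNum (optag op)) (VPair (enc_g l e) (enc_g l e'))"

primrec enc_b :: "'p bleaf \<Rightarrow> ('p, 'k) val" where
  "enc_b (BConst b) = VPair (VNum 0) (truth b)"
| "enc_b (BLit \<phi> env) = VPair (VNum 1) (VPair (enc_pil \<phi>) (enc_env env))"

primrec enc_w :: "('p, 'k) wleaf \<Rightarrow> ('p, 'k) val" where
  "enc_w (VConst k) = VPair (VNum 0) (VWt k)"
| "enc_w (VDet e) = VPair (VNum 2) (enc_g enc_b e)"

text \<open>\<open>ghgt\<close> is the exponent of the time bound.\<close>

primrec ghgt :: "('d \<Rightarrow> nat) \<Rightarrow> 'd gexp \<Rightarrow> nat" where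
  "ghgt l (GLeaf d) = l d"
| "ghgt l (GWrap c e) = ghgt l e + 3"
| "ghgt l (GPlus e) = ghgt l e + 3"
| "ghgt l (GBin op e e') = max (ghgt l e) (ghgt l e') + 3"

primrec hgt_b :: "'p bleaf \<Rightarrow> nat" where
  "hgt_b (BConst b) = 12" | "hgt_b (BLit \<phi> env) = 12 + 3 * pil_size \<phi>"

primrec hgt_w :: "('p, 'k) wleaf \<Rightarrow> nat" where
  "hgt_w (VConst k) = 12" | "hgt_w (VDet e) = ghgt hgt_b e + 13"

text \<open>The variables of a stored formula are bound in its environment, so looking up an
  instance succeeds.\<close>

primrec bclosed :: "'p bleaf \<Rightarrow> bool" where
  "bclosed (BConst b) = True" | "bclosed (BLit \<phi> env) = (snd ` set_pil \<phi> \<subseteq> fst ` set env)"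

primrec wclosed :: "('p, 'k) wleaf \<Rightarrow> bool" where
  "wclosed (VConst k) = True" | "wclosed (VDet e) = (\<forall>d\<in>set_gexp e. bclosed d)"

lemma vsize_vlist_map_VPair: "vsize (vlist xs) \<le> vsize (vlist (map (VPair x) xs))"
  by (induction xs) auto

lemma vsize_vlist_map_VPair': "ys \<noteq> [] \<Longrightarrow> vsize (VPair x VNil) \<le> vsize (vlist (map (VPair x) ys))"
  by (cases ys) auto

lemma vsize_pairl:
  assumes "xs \<noteq> []" "ys \<noteq> []"
  shows "vsize (vlist xs) \<le> vsize (vlist (pairl xs ys))" "vsize (vlist ys) \<le> vsize (vlist (pairl xs ys))"
proof -
  show "vsize (vlist xs) \<le> vsize (vlist (pairl xs ys))"
  proof (induction xs)
    case (Cons x xs)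
    have "vsize (VPair x VNil) \<le> vsize (vlist (map (VPair x) ys))"
      by (rule vsize_vlist_map_VPair'[OF assms(2)])
    then show ?case using Cons vsize_vlist_append[of "map (VPair x) ys" "pairl xs ys"]
      by (simp add: pairl_def)
  qed (simp add: pairl_def)
  obtain x xs' where xs: "xs = x # xs'" using assms(1) by (cases xs) auto
  have "vsize (vlist (map (VPair x) ys)) \<le> vsize (vlist (map (VPair x) ys @ pairl xs' ys))"
    using vsize_vlist_append[of "map (VPair x) ys" "pairl xs' ys"] vsize_pos[of "vlist (pairl xs' ys)"] by linarith
  then show "vsize (vlist ys) \<le> vsize (vlist (pairl xs ys))"
    using vsize_vlist_map_VPair[of ys x] by (simp add: xs pairl_def)
qed

lemma vsize_prefix: "vsize (vlist us) \<le> vsize (vlist (us @ vs))"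
  using vsize_vlist_append[of us vs] vsize_pos[of "vlist vs"] by linarith

lemma aut_ok_gaut: "(\<And>d. d \<in> set_gexp e \<Longrightarrow> aut_ok (la d)) \<Longrightarrow> aut_ok (gaut la e)"
  using gaut_correct[of e la "\<lambda>d. series (la d) (astart (la d))"] by blast

text \<open>This is what allows bounding only the final automaton. For pairs of states it relies on
  the other list being nonempty, which holds as it contains the start state.\<close>

lemma states_bin_size:
  fixes A B :: "('p, 'k, 'a, 's :: {comm_semiring_0, comm_monoid_mult}) vaut"
  assumes "aut_ok A" "aut_ok B"
  shows "vsize (vlist (astates A)) \<le> vsize (vlist (astates (bin_aut op A B)))"
    "vsize (vlist (astates B)) \<le> vsize (vlist (astates (bin_aut op A B)))"
proof -
  have ne: "astates A \<noteq> []" "astates B \<noteq> []" using assms by (auto simp: aut_ok_def)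
  have l: "vsize (vlist (astates A)) \<le> vsize (vlist (map tagL (astates A) @ map tagR (astates B)))"
    using vsize_vlist_map_VPair[of "astates A" VNil] vsize_prefix[of "map tagL (astates A)" "map tagR (astates B)"]
    by linarith
  have r: "vsize (vlist (astates B)) \<le> vsize (vlist (map tagL (astates A) @ map tagR (astates B)))"
    using vsize_vlist_map_VPair[of "astates B" "VNum 1"] vsize_vlist_suffix[of "map tagR (astates B)" "map tagL (astates A)"]
    by linarith
  show "vsize (vlist (astates A)) \<le> vsize (vlist (astates (bin_aut op A B)))"
    using l vsize_pairl(1)[OF ne] by (cases op) auto
  show "vsize (vlist (astates B)) \<le> vsize (vlist (astates (bin_aut op A B)))"
    using r vsize_pairl(2)[OF ne] by (cases op) auto
qed

text \<open>The code of a type begins with its number, so the list of types is an association list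
  for function 7.\<close>

lemma comp_look_types:
  fixes B :: "('p, 'k :: {comm_semiring_0, comm_monoid_mult}) pwcomp"
  assumes U: "large prg U" and s: "vsize (vlist (map (enc_type B pl r) is)) \<le> U" and i: "i \<in> set is"
  shows "\<exists>v. computes prg U 7 (VPair (VNum i) (vlist (map (enc_type B pl r) is)))
    (VPair v (VPair (vlist (map VNum [1..<Suc (r i)])) VNil)) 9"
proof -
  let ?v = "\<lambda>i. vlist (map (\<lambda>p. VPair (VPort p) (VWt (weight B i p))) (pl i))"
  let ?w = "\<lambda>i. VPair (?v i) (VPair (vlist (map VNum [1..<Suc (r i)])) VNil)"
  let ?kvs = "map (\<lambda>i. (VNum i :: ('p, 'k) val, ?w i)) is"
  have e: "vlist (map (enc_type B pl r) is) = vlist (map (\<lambda>(a, b). VPair a b) ?kvs)"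
    by (simp add: enc_type_def o_def del: upt_Suc)
  have m: "map_of ?kvs (VNum i) = Some (?w i)" using i by (induction "is") (auto simp del: upt_Suc)
  have "computes prg U 7 (VPair (VNum i) (vlist (map (\<lambda>(a, b). VPair a b) ?kvs)))
     (case map_of ?kvs (VNum i) of None \<Rightarrow> VNil | Some v \<Rightarrow> v) 9"
  proof (rule comp_look[OF U])
    show "vsize (vlist (map (\<lambda>(a, b). VPair a b) ?kvs)) \<le> U" using s unfolding e .
  qed (use U64[OF U] in \<open>auto simp del: upt_Suc\<close>)
  then show ?thesis unfolding m e option.case by blast
qed

definition row_val :: "('p, 'k, ('p \<times> nat) set, 'k :: {comm_semiring_0, comm_monoid_mult}) vaut \<Rightarrow>
    ('p \<times> nat) list \<Rightarrow> ('p, 'k) val \<Rightarrow> ('p, 'k) val" where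
  "row_val A ps q = vlist (map (\<lambda>q'. VWt (atrans A q (set ps) q')) (astates A))"

definition mat_val :: "('p, 'k, ('p \<times> nat) set, 'k :: {comm_semiring_0, comm_monoid_mult}) vaut \<Rightarrow>
    ('p \<times> nat) list \<Rightarrow> ('p, 'k) val" where
  "mat_val A ps = vlist (map (row_val A ps) (astates A))"

definition tab_val :: "('p, 'k, ('p \<times> nat) set, 'k :: {comm_semiring_0, comm_monoid_mult}) vaut \<Rightarrow>
    ('p \<times> nat) list list \<Rightarrow> ('p, 'k) val" where
  "tab_val A ls = vlist (map (\<lambda>ps. VPair (enc_letter ps) (mat_val A ps)) (filter (\<lambda>ps. ps \<noteq> []) ls))"

lemma vsize_vlist_leaves: "(\<And>x. x \<in> set xs \<Longrightarrow> vsize (f x) = 1) \<Longrightarrow> vsize (vlist (map f xs)) = 1 + 2 * length xs"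
  by (induction xs) auto

lemma vsize_row_val: "vsize (row_val A ps q) = 1 + 2 * length (astates A)"
  unfolding row_val_def by (rule vsize_vlist_leaves) simp

lemma vsize_mat_val: "vsize (mat_val A ps) = 1 + length (astates A) * (2 + 2 * length (astates A))"
proof -
  have "vsize (vlist (map (row_val A ps) xs)) = 1 + length xs * (2 + 2 * length (astates A))" for xs
    by (induction xs) (simp_all add: vsize_row_val)
  then show ?thesis by (simp add: mat_val_def add.commute)
qed

lemma length_le_vsize: "2 * length xs + 1 \<le> vsize (vlist xs)"
proof (induction xs)
  case (Cons x xs)
  then show ?case using vsize_pos[of x] by simp
qed simp

context
  fixes U :: nat
  assumes U: "large prg U"
begin

lemma implements_gexp:
  assumes m: "mode_ok U md es" and ok: "\<And>d. d \<in> set_gexp e \<Longrightarrow> aut_ok (la d)"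
    and l: "\<And>d. d \<in> set_gexp e \<Longrightarrow> vsize (vlist (astates (la d))) \<le> U \<Longrightarrow> vsize (ld d) + 5 \<le> U \<Longrightarrow>
      implements U md es (ld d) (la d) (lh d)"
    and s: "vsize (vlist (astates (gaut la e))) \<le> U" "vsize (enc_g ld e) + 5 \<le> U"
  shows "implements U md es (enc_g ld e) (gaut la e) (ghgt lh e)"
  using ok l s
proof (induction e)
  case (GWrap c e)
  have "vsize (vlist (astates (gaut la e))) \<le> U"
    using vsize_vlist_map_VPair[of "astates (gaut la e)" VNil] GWrap.prems(3) by simp
  then have "implements U md es (enc_g ld e) (gaut la e) (ghgt lh e)" using GWrap by simp
  then show ?case using implements_wrap[OF U m, of "enc_g ld e" "gaut la e" "ghgt lh e" c] GWrap.prems by simp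
next
  case (GPlus e)
  have "vsize (vlist (astates (gaut la e))) \<le> U"
    using vsize_vlist_map_VPair[of "astates (gaut la e)" VNil] GPlus.prems(3) by simp
  then have "implements U md es (enc_g ld e) (gaut la e) (ghgt lh e)" using GPlus by simp
  then show ?case using implements_plus[OF U m, of "enc_g ld e" "gaut la e" "ghgt lh e"] GPlus.prems by simp
next
  case (GBin op e e')
  have ok: "aut_ok (gaut la e)" "aut_ok (gaut la e')" using GBin.prems(1) by (auto intro!: aut_ok_gaut)
  have "vsize (vlist (astates (gaut la e))) \<le> U" "vsize (vlist (astates (gaut la e'))) \<le> U"
    using states_bin_size[OF ok, of op] GBin.prems(3) by auto
  then have "implements U md es (enc_g ld e) (gaut la e) (ghgt lh e)"
    "implements U md es (enc_g ld e') (gaut la e') (ghgt lh e')" using GBin by auto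
  then have i: "implements U md es (enc_g ld e) (gaut la e) (max (ghgt lh e) (ghgt lh e'))"
    "implements U md es (enc_g ld e') (gaut la e') (max (ghgt lh e) (ghgt lh e'))"
    using implements_mono[OF U] by (metis max.cobounded1, metis max.cobounded2)
  show ?case using GBin.prems(3,4)
      implements_add[OF U m i] implements_mul[OF U m i] implements_cat[OF U m i] implements_shuf[OF U m i]
    by (cases op) simp_all
qed simp

lemma implements_baut:
  fixes e :: "'p bleaf gexp"
  assumes c: "\<forall>d\<in>set_gexp e. bclosed d"
    and s: "vsize (vlist (astates (baut e :: ('p, 'k :: {comm_semiring_0, comm_monoid_mult}, ('p \<times> nat) set, bool) vaut))) \<le> U"
      "vsize (enc_g enc_b e :: ('p, 'k) val) + 5 \<le> U"
  shows "implements U VNil truth (enc_g enc_b e :: ('p, 'k) val) (baut e) (ghgt hgt_b e)"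
proof (rule implements_gexp[OF mode_ok_truth[OF U] _ _ s])
  fix d assume d: "d \<in> set_gexp e"
  show "aut_ok (bleaf_aut d :: ('p, 'k, ('p \<times> nat) set, bool) vaut)"
    by (cases d) (auto simp: aut_ok_def)
  assume "vsize (enc_b d :: ('p, 'k) val) + 5 \<le> U"
  then show "implements U VNil truth (enc_b d :: ('p, 'k) val) (bleaf_aut d) (hgt_b d)"
  proof (cases d)
    case (BConst b)
    then show ?thesis using implements_const[OF U mode_ok_truth[OF U]] by simp
  next
    case (BLit \<phi> env)
    then have "snd ` set_pil \<phi> \<subseteq> fst ` set env" using c d by force
    then show ?thesis using \<open>vsize (enc_b d :: ('p, 'k) val) + 5 \<le> U\<close> BLit
      by (auto intro!: implements_lit[OF U])
  qed
qed

lemma implements_waut: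
  fixes e :: "('p, 'k :: {comm_semiring_0, comm_monoid_mult}) wleaf gexp"
  assumes c: "\<forall>d\<in>set_gexp e. wclosed d"
    and s: "vsize (vlist (astates (waut e))) \<le> U" "vsize (enc_g enc_w e) + 5 \<le> U"
  shows "implements U (VNum 1) VWt (enc_g enc_w e) (waut e) (ghgt hgt_w e)"
proof (rule implements_gexp[OF mode_ok_VWt[OF U] _ _ s])
  fix d :: "('p, 'k) wleaf" assume d: "d \<in> set_gexp e"
  show "aut_ok (wleaf_aut d)"
    using aut_ok_det baut_correct[of _, where 'k = 'k] by (cases d) (auto simp: aut_ok_def)
  assume sd: "vsize (vlist (astates (wleaf_aut d))) \<le> U" "vsize (enc_w d) + 5 \<le> U"
  show "implements U (VNum 1) VWt (enc_w d) (wleaf_aut d) (hgt_w d)"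
  proof (cases d)
    case (VConst k)
    then show ?thesis using implements_const[OF U mode_ok_VWt[OF U]] by simp
  next
    case (VDet f)
    let ?A = "baut f :: ('p, 'k, ('p \<times> nat) set, bool) vaut"
    have p: "vsize (vlist (map vlist (subseqs (astates ?A)))) \<le> U" using sd(1) VDet by simp
    \<comment> \<open>The state list of the inner automaton is itself a state of the determinized
      one, hence also bounded by \<open>U\<close>.\<close>
    have "astates ?A \<in> set (subseqs (astates ?A))"
      using filter_in_subseqs[of "\<lambda>_. True" "astates ?A"] by simp
    then have "vsize (vlist (astates ?A)) \<le> U"
      using p vsize_mem_vlist[of "vlist (astates ?A)" "map vlist (subseqs (astates ?A))"] by auto
    moreover have "vsize (enc_g enc_b f :: ('p, 'k) val) + 5 \<le> U" using sd(2) VDet by simp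
    moreover have "\<forall>d\<in>set_gexp f. bclosed d" using c d VDet by auto
    ultimately have "implements U VNil truth (enc_g enc_b f :: ('p, 'k) val) ?A (ghgt hgt_b f)"
      by (intro implements_baut) auto
    from implements_det[OF U this] show ?thesis using VDet sd by simp
  qed
qed


section \<open>Writing out the tables\<close>

lemmas irow_nth = prg_nth(30)[unfolded irow_body_def]
lemmas trow_nth = prg_nth(31)[unfolded trow_body_def]
lemmas row_nth = prg_nth(32)[unfolded row_body_def]
lemmas mat_nth = prg_nth(33)[unfolded mat_body_def]
lemmas tab_nth = prg_nth(34)[unfolded tab_body_def]

text \<open>A fold that treats the elements independently; 8 calls per element fit into the constant
  of \<open>computes_fold\<close>.\<close>

lemma comp_map:
  fixes f :: "'x \<Rightarrow> ('p, 'k :: {comm_semiring_0, comm_monoid_mult}) val"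
  assumes m: "m < 33" and nth: "prg ! m = fold_body m CNil (MkPair g (Var 0))"
    and g: "\<And>x ys acc. x \<in> set xs \<Longrightarrow> xgood prg (U ^ k) g [acc, VPair c (VPair (ex x) ys)] \<and>
      xv prg g [acc, VPair c (VPair (ex x) ys)] = f x" "ncalls g \<le> 8"
    and s: "vsize c + vsize (vlist (map ex xs)) \<le> 60 * U" "vsize (vlist (map f xs)) \<le> U ^ 2" and k: "2 \<le> k"
  shows "computes prg U m (VPair c (vlist (map ex xs))) (vlist (map f xs)) (k + 5)"
proof (rule computes_fold[OF U _ nth, where k = k])
  have u: "64 \<le> U" using U64[OF U] .
  show "vsize (VPair c (vlist (map ex xs))) \<le> U ^ 2" using s(1) u by (intro lin_le'[OF U]) simp
  show "vsize (vlist (map f ys)) \<le> U ^ 2" if "\<exists>zs. xs = zs @ ys" for ys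
  proof -
    from that obtain zs where "xs = zs @ ys" by blast
    then show ?thesis using s(2) vsize_vlist_suffix[of "map f ys" "map f zs"] by simp
  qed
  fix x ys assume "\<exists>zs. xs = zs @ x # ys"
  then have x: "x \<in> set xs" by auto
  note g' = g(1)[OF x, of "vlist (map f ys)" "vlist (map ex ys)"]
  have "ncalls g * U ^ k \<le> 8 * U ^ k" using g(2) by simp
  then have ok: "xok prg g [vlist (map f ys), VPair c (VPair (ex x) (vlist (map ex ys)))]"
    "xc prg g [vlist (map f ys), VPair c (VPair (ex x) (vlist (map ex ys)))] \<le> 8 * U ^ k"
    using xgood_xok[OF conjunct1[OF g']] by (blast, meson le_trans)
  then show "xok prg (MkPair g (Var 0)) [vlist (map f ys), VPair c (VPair (ex x) (vlist (map ex ys)))] \<and>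
      xv prg (MkPair g (Var 0)) [vlist (map f ys), VPair c (VPair (ex x) (vlist (map ex ys)))] = vlist (map f (x # ys)) \<and>
      xc prg (MkPair g (Var 0)) [vlist (map f ys), VPair c (VPair (ex x) (vlist (map ex ys)))] \<le> 8 * U ^ k"
    using g' by simp
qed (use m k in auto)

context
  fixes E :: "('p, 'k :: {comm_semiring_0, comm_monoid_mult}) val" and A k
  assumes A: "implements U (VNum 1) VWt E A k"
begin

lemma states_le: "2 * length (astates A) + 1 \<le> U"
  using length_le_vsize[of "astates A"] implements_simps(4)[OF U A] by simp

lemma comp_irow:
  "computes prg U 28 (VPair (astart A) (vlist (astates A)))
    (vlist (map (\<lambda>q. VWt (if astart A = q then 1 else 0)) (astates A))) 9"
proof -
  note a = implements_simps[OF U A]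
  have q: "vsize (astart A) \<le> U" "pure (astart A)" using a by auto
  have "computes prg U 28 (VPair (astart A) (vlist (map (\<lambda>q. q) (astates A))))
    (vlist (map (\<lambda>q. VWt (if astart A = q then 1 else 0)) (astates A))) (4 + 5)"
  proof (rule comp_map[OF _ irow_nth])
    show "vsize (vlist (map (\<lambda>q. VWt (if astart A = q then 1 else 0)) (astates A))) \<le> U ^ 2"
      using states_le U64[OF U] by (subst vsize_vlist_leaves) (auto intro!: lin_le'[OF U])
    show "vsize (astart A) + vsize (vlist (map (\<lambda>q. q) (astates A))) \<le> 60 * U"
      using q(1) a(4) U64[OF U] by simp
  qed (use a q computesD[OF comp_teq[OF U q(2)]] in auto)
  then show ?thesis by simp
qed

lemma comp_trow:
  "computes prg U 29 (VPair E (vlist (astates A))) (vlist (map (\<lambda>q. VWt (afinal A q)) (astates A))) (k + 5)"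
proof -
  note a = implements_simps[OF U A]
  have "computes prg U 29 (VPair E (vlist (map (\<lambda>q. q) (astates A))))
    (vlist (map (\<lambda>q. VWt (afinal A q)) (astates A))) (k + 5)"
  proof (rule comp_map[OF _ trow_nth])
    show "vsize (vlist (map (\<lambda>q. VWt (afinal A q)) (astates A))) \<le> U ^ 2"
      using states_le U64[OF U] by (subst vsize_vlist_leaves) (auto intro!: lin_le'[OF U])
  qed (use a implements_ter[OF U A order_refl] in auto)
  then show ?thesis by simp
qed

lemma comp_row:
  assumes q: "q \<in> set (astates A)" and l: "vsize (enc_letter ps :: ('p, 'k) val) \<le> U"
  shows "computes prg U 30 (VPair (VPair (enc_letter ps) (VPair E q)) (vlist (astates A))) (row_val A ps q) (k + 5)"
proof -
  note a = implements_simps[OF U A]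
  have "computes prg U 30 (VPair (VPair (enc_letter ps) (VPair E q)) (vlist (map (\<lambda>q. q) (astates A))))
    (vlist (map (\<lambda>q'. VWt (atrans A q (set ps) q')) (astates A))) (k + 5)"
  proof (rule comp_map[OF _ row_nth])
    show "vsize (vlist (map (\<lambda>q'. VWt (atrans A q (set ps) q')) (astates A))) \<le> U ^ 2"
      using states_le U64[OF U] by (subst vsize_vlist_leaves) (auto intro!: lin_le'[OF U])
    show "vsize (VPair (enc_letter ps) (VPair E q)) + vsize (vlist (map (\<lambda>q. q) (astates A))) \<le> 60 * U"
      using a(4,5) a(6)[OF q] l U64[OF U] by simp
  qed (use a q implements_tr[OF U A order_refl q _ l] in auto)
  then show ?thesis by (simp add: row_val_def)
qed

text \<open>A matrix is quadratic in the number of states; this is the size that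
  \<open>computes_fold\<close> grants to results of a loop.\<close>

lemma vsize_mat_le: "vsize (mat_val A ps) \<le> U ^ 2"
proof -
  let ?N = "length (astates A)"
  have "vsize (mat_val A ps) = 1 + ?N * (2 * ?N + 1 + 1)" by (simp add: vsize_mat_val)
  also have "\<dots> \<le> 1 + ?N * (U + 1)" using states_le by (intro add_left_mono mult_le_mono2) simp
  also have "\<dots> \<le> (2 * ?N + 1) * U"
  proof -
    have "1 + ?N \<le> U" using states_le by simp
    moreover have "?N * U \<le> ?N * U + ?N * U" by simp
    ultimately show ?thesis by (simp add: algebra_simps)
  qed
  also have "\<dots> \<le> U * U" using states_le by (rule mult_le_mono1)
  finally show ?thesis by (simp add: power2_eq_square)
qed

lemma comp_mat:
  assumes l: "vsize (enc_letter ps :: ('p, 'k) val) \<le> U"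
  shows "computes prg U 31 (VPair (VPair (enc_letter ps) (VPair E (vlist (astates A)))) (vlist (astates A))) (mat_val A ps) (k + 10)"
proof -
  note a = implements_simps[OF U A]
  have "computes prg U 31 (VPair (VPair (enc_letter ps) (VPair E (vlist (astates A)))) (vlist (map (\<lambda>q. q) (astates A))))
    (vlist (map (row_val A ps) (astates A))) ((k + 5) + 5)"
  proof (rule comp_map[OF _ mat_nth])
    show "vsize (vlist (map (row_val A ps) (astates A))) \<le> U ^ 2" using vsize_mat_le[of ps] by (simp add: mat_val_def)
    show "vsize (VPair (enc_letter ps) (VPair E (vlist (astates A)))) + vsize (vlist (map (\<lambda>q. q) (astates A))) \<le> 60 * U"
      using a(4,5) l U64[OF U] by simp
  qed (use a computesD[OF comp_row[OF _ l]] in auto)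
  then show ?thesis by (simp add: mat_val_def add.commute)
qed

text \<open>The list of letters contains the empty set, which is no interaction. Its code
  \<open>VNil\<close> is not a pair, and so it is dropped.\<close>

lemma comp_tab:
  assumes l: "vsize (enc_letters ls :: ('p, 'k) val) \<le> U" and s: "vsize (tab_val A ls) \<le> U"
  shows "computes prg U 32 (VPair (VPair E (vlist (astates A))) (enc_letters ls)) (tab_val A ls) (k + 15)"
  unfolding enc_letters_def
proof (rule computes_fold[OF U _ tab_nth, where k = "k + 10" and G = "tab_val A"])
  note a = implements_simps[OF U A]
  show "vsize (VPair (VPair E (vlist (astates A))) (vlist (map enc_letter ls))) \<le> U ^ 2"
    using a l U64[OF U] by (intro lin_le'[OF U]) (simp add: enc_letters_def)
  show "vsize (tab_val A ls') \<le> U ^ 2" if "\<exists>zs. ls = zs @ ls'" for ls'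
  proof -
    from that obtain zs where "ls = zs @ ls'" by blast
    then have "vsize (tab_val A ls') \<le> U" using s vsize_vlist_suffix unfolding tab_val_def
      by (auto intro: le_trans)
    then show ?thesis by (intro lin_le'[OF U]) simp
  qed
  fix ps ls' assume "\<exists>zs. ls = zs @ ps # ls'"
  then have "enc_letter ps \<in> set (map enc_letter ls :: ('p, 'k) val list)" by auto
  then have lp: "vsize (enc_letter ps :: ('p, 'k) val) \<le> U"
    using vsize_mem_vlist l unfolding enc_letters_def by (metis less_imp_le_nat less_le_trans)
  note h = computesD[OF comp_mat[OF lp]]
  have p: "is_pair (enc_letter ps :: ('p, 'k) val) \<longleftrightarrow> ps \<noteq> []" by (simp add: enc_letter_def)
  show "xok prg (If (IsPair foldelt) (MkPair (MkPair foldelt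
        (Call 31 (MkPair (MkPair foldelt foldctx) (Snd foldctx)))) (Var 0)) (Var 0))
      [tab_val A ls', VPair (VPair E (vlist (astates A))) (VPair (enc_letter ps) (vlist (map enc_letter ls')))] \<and>
    xv prg (If (IsPair foldelt) (MkPair (MkPair foldelt
        (Call 31 (MkPair (MkPair foldelt foldctx) (Snd foldctx)))) (Var 0)) (Var 0))
      [tab_val A ls', VPair (VPair E (vlist (astates A))) (VPair (enc_letter ps) (vlist (map enc_letter ls')))] =
      tab_val A (ps # ls') \<and>
    xc prg (If (IsPair foldelt) (MkPair (MkPair foldelt
        (Call 31 (MkPair (MkPair foldelt foldctx) (Snd foldctx)))) (Var 0)) (Var 0))
      [tab_val A ls', VPair (VPair E (vlist (astates A))) (VPair (enc_letter ps) (vlist (map enc_letter ls')))] \<le> 8 * U ^ (k + 10)"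
    using h by (simp add: p tab_val_def)
qed (use implements_simps(1)[OF U A] in \<open>auto simp: tab_val_def\<close>)

end

end

section \<open>Correctness of the grounding functions\<close>

text \<open>Offsets from the first common tag, which is 2 for EPIL and wFOEIL and 3 for
  FOEIL.\<close>

primrec opnum :: "bop \<Rightarrow> nat" where
  "opnum OAdd = 0" | "opnum OMul = 1" | "opnum OCat = 2" | "opnum OShuf = 3"

primrec knum :: "qk \<Rightarrow> nat" where
  "knum KSum = 5" | "knum KProd = 6" | "knum KSumCat = 7" | "knum KProdCat = 8"
| "knum KSumShuf = 9" | "knum KProdShuf = 10"

primrec encq :: "nat \<Rightarrow> ('d \<Rightarrow> ('p, 'k) val) \<Rightarrow> 'd qexp \<Rightarrow> ('p, 'k) val" where
  "encq b l (QLeaf d) = l d"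
| "encq b l (QBin op a a') = node (b + opnum op) [encq b l a, encq b l a']"
| "encq b l (QPlus a) = node (b + 4) [encq b l a]"
| "encq b l (QQuant k x a) = node (b + knum k) [enc_var x, encq b l a]"

definition encE :: "bool \<times> ('p \<times> var) zeta \<Rightarrow> ('p, 'k) val" where
  "encE d = node (if fst d then 0 else 1) [enc_zeta (snd d)]"

primrec encF :: "'p fleaf \<Rightarrow> ('p, 'k) val" where
  "encF (LEpil \<phi>) = node 0 [enc_epil \<phi>]"
| "encF (LEq b x y) = node (if b then 1 else 2) [enc_var x, enc_var y]"

definition encW :: "'k + 'p foeil \<Rightarrow> ('p, 'k) val" where
  "encW d = (case d of Inl k \<Rightarrow> node 0 [VWt k] | Inr \<psi> \<Rightarrow> node 1 [enc_foeil \<psi>])"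

lemma enc_epil_eq: "enc_epil \<phi> = encq 2 encE (toqE \<phi>)"
  by (induction \<phi>) (simp_all add: encE_def)

lemma enc_foeil_eq: "enc_foeil \<psi> = encq 3 encF (toqF \<psi>)"
  by (induction \<psi>) simp_all

lemma enc_wfoeil_eq: "enc_wfoeil \<psi> = encq 2 encW (toqW \<psi>)"
  by (induction \<psi>) (simp_all add: encW_def)

text \<open>Exponent of the time for grounding. The 12 of a quantifier is 9 for its loop over the
  instances and 3 for the enclosing body.\<close>

primrec qhgt :: "('d \<Rightarrow> nat) \<Rightarrow> 'd qexp \<Rightarrow> nat" where
  "qhgt l (QLeaf d) = l d + 3"
| "qhgt l (QBin op a a') = max (qhgt l a) (qhgt l a') + 3"
| "qhgt l (QPlus a) = qhgt l a + 3"
| "qhgt l (QQuant k x a) = qhgt l a + 12"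

text \<open>Depth of nested quantifiers, which limits how far environments grow.\<close>

primrec qdep :: "('d \<Rightarrow> nat) \<Rightarrow> 'd qexp \<Rightarrow> nat" where
  "qdep l (QLeaf d) = l d"
| "qdep l (QBin op a a') = max (qdep l a) (qdep l a')"
| "qdep l (QPlus a) = qdep l a"
| "qdep l (QQuant k x a) = qdep l a + 1"

text \<open>The sort of a quantified variable has to be a listed type, so that its list of instances
  is found.\<close>

primrec qclosed :: "('d \<Rightarrow> var set \<Rightarrow> bool) \<Rightarrow> nat set \<Rightarrow> 'd qexp \<Rightarrow> var set \<Rightarrow> bool" where
  "qclosed l I (QLeaf d) = l d"
| "qclosed l I (QBin op a a') = (\<lambda>D. qclosed l I a D \<and> qclosed l I a' D)"
| "qclosed l I (QPlus a) = qclosed l I a"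
| "qclosed l I (QQuant k x a) = (\<lambda>D. fst x \<in> I \<and> qclosed l I a (insert x D))"

lemma enc_var_sel [simp]: "vfst (enc_var x) = VNum (fst x)" "is_pair (enc_var x)"
  by (simp_all add: enc_var_def)

lemma enc_env_Cons: "enc_env ((x, j) # env) = VPair (VPair (enc_var x) (VNum j)) (enc_env env)"
  by (simp add: enc_env_def)

lemma quant_suffix_size:
  "vsize (enc_g lg (foldr (\<lambda>j e. GBin op (F j) e) ys b)) \<le> vsize (enc_g lg (foldr (\<lambda>j e. GBin op (F j) e) (zs @ ys) b))"
  by (induction zs) auto

lemma quant_elem_size:
  "j \<in> set js \<Longrightarrow> vsize (enc_g lg (F j)) \<le> vsize (enc_g lg (foldr (\<lambda>j e. GBin op (F j) e) js b))"
  by (induction js) auto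

definition lhE :: "bool \<times> ('p \<times> var) zeta \<Rightarrow> nat" where
  "lhE d = 2 + 3 * zeta_size (snd d)"

primrec lhF :: "'p fleaf \<Rightarrow> nat" where
  "lhF (LEpil \<phi>) = qhgt lhE (toqE \<phi>)" | "lhF (LEq b x y) = 9"

definition lhW :: "'k + 'p foeil \<Rightarrow> nat" where
  "lhW d = (case d of Inl k \<Rightarrow> 2 | Inr \<psi> \<Rightarrow> qhgt lhF (toqF \<psi>))"

primrec ldF :: "'p fleaf \<Rightarrow> nat" where
  "ldF (LEpil \<phi>) = qdep (\<lambda>d. 0) (toqE \<phi>)" | "ldF (LEq b x y) = 0"

definition ldW :: "'k + 'p foeil \<Rightarrow> nat" where
  "ldW d = (case d of Inl k \<Rightarrow> 0 | Inr \<psi> \<Rightarrow> qdep ldF (toqF \<psi>))"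

definition lokE :: "bool \<times> ('p \<times> var) zeta \<Rightarrow> var set \<Rightarrow> bool" where
  "lokE d D \<longleftrightarrow> snd ` set_zeta (snd d) \<subseteq> D"

primrec lokF :: "nat set \<Rightarrow> 'p fleaf \<Rightarrow> var set \<Rightarrow> bool" where
  "lokF I (LEpil \<phi>) = qclosed lokE I (toqE \<phi>)"
| "lokF I (LEq b x y) = (\<lambda>D. x \<in> D \<and> y \<in> D)"

definition lokW :: "nat set \<Rightarrow> 'k + 'p foeil \<Rightarrow> var set \<Rightarrow> bool" where
  "lokW I d D = (case d of Inl k \<Rightarrow> True | Inr \<psi> \<Rightarrow> qclosed (lokF I) I (toqF \<psi>) D)"

context
  fixes U :: nat
  assumes U: "large prg U"
begin

text \<open>One proof for the three pairs of functions 14/15, 16/17 and 18/19. By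
  \<open>t < b\<close> the tag of a leaf fails all tests for connectives. The term
  \<open>8 * qdep ldep a\<close> reserves room for the bindings of the quantifiers still to come,
  each of size 6.\<close>

lemma comp_ground:
  fixes B :: "('p, 'k :: {comm_semiring_0, comm_monoid_mult}) pwcomp" and lf :: "'d \<Rightarrow> ('p, 'k) val"
    and lg :: "'g \<Rightarrow> ('p, 'k) val" and pl r "is"
  defines "tys \<equiv> vlist (map (enc_type B pl r) is)"
  assumes self: "self < 33" "prg ! self = ground_body b zE oneE self loop leafE"
    and loop: "loop < 33" "prg ! loop = quant_body self loop"
    and z: "\<And>T (env :: ('p, 'k) val list). xgood prg T zE env" "\<And>env. xv prg zE env = zv" "ncalls zE = 0" "lg z = VPair (VNum 0) zv"
    and i: "\<And>T (env :: ('p, 'k) val list). xgood prg T oneE env" "\<And>env. xv prg oneE env = iv" "ncalls oneE = 0" "lg i = VPair (VNum 0) iv"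
    and leaf: "\<And>d env. lok d (fst ` set env) \<Longrightarrow> vsize (lf d) \<le> U \<Longrightarrow> vsize (enc_env env :: ('p, 'k) val) + 8 * ldep d \<le> U \<Longrightarrow>
      vsize (enc_g lg (l d env)) \<le> U \<Longrightarrow> \<exists>t q. lf d = VPair (VNum t) q \<and> t < b \<and> 2 \<le> lh d \<and>
        xgood prg (U ^ lh d) leafE [VPair (VPair tys (enc_env env)) (lf d)] \<and>
        xv prg leafE [VPair (VPair tys (enc_env env)) (lf d)] = enc_g lg (l d env)"
    and leafn: "ncalls leafE \<le> 10" and tys: "vsize tys \<le> U"
  shows "qclosed lok (set is) a (fst ` set env) \<Longrightarrow> vsize (encq b lf a) \<le> U \<Longrightarrow>
    vsize (enc_env env :: ('p, 'k) val) + 8 * qdep ldep a \<le> U \<Longrightarrow>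
    vsize (enc_g lg (ground z i l r a env)) \<le> U \<Longrightarrow>
    2 \<le> qhgt lh a \<and> computes prg U self (VPair (VPair tys (enc_env env)) (encq b lf a)) (enc_g lg (ground z i l r a env)) (qhgt lh a)"
proof (induction a arbitrary: env)
  case (QLeaf d)
  have "lok d (fst ` set env)" "vsize (lf d) \<le> U" "vsize (enc_env env :: ('p, 'k) val) + 8 * ldep d \<le> U"
    "vsize (enc_g lg (l d env)) \<le> U" using QLeaf by auto
  from leaf[OF this] obtain t q where t: "lf d = VPair (VNum t) q" "t < b" "2 \<le> lh d"
    "xgood prg (U ^ lh d) leafE [VPair (VPair tys (enc_env env)) (lf d)]"
    "xv prg leafE [VPair (VPair tys (enc_env env)) (lf d)] = enc_g lg (l d env)" by blast
  have [simp]: "t \<noteq> b" "t \<noteq> b + c" for c using t(2) by auto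
  show ?case
    using QLeaf.prems t tys leafn z(3) i(3) U64[OF U] self(1)
    by (intro conjI computesU[OF U _ self(2), where k = "lh d"])
      (auto simp: ground_body_def Let_def ground_bin_def ground_quant_def mk_wrap_def mk_leaf_def mk_bin_def)
next
  case (QBin op a a')
  let ?k = "max (qhgt lh a) (qhgt lh a')"
  have sz: "vsize (encq b lf a) \<le> U" "vsize (encq b lf a') \<le> U"
    "vsize (enc_env env :: ('p, 'k) val) + 8 * qdep ldep a \<le> U" "vsize (enc_env env :: ('p, 'k) val) + 8 * qdep ldep a' \<le> U"
    "vsize (enc_g lg (ground z i l r a env)) \<le> U" "vsize (enc_g lg (ground z i l r a' env)) \<le> U"
    using QBin.prems by (auto simp: node_def)
  have a: "2 \<le> qhgt lh a" "computes prg U self (VPair (VPair tys (enc_env env)) (encq b lf a)) (enc_g lg (ground z i l r a env)) (qhgt lh a)"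
    using QBin.IH(1)[of env] QBin.prems sz by auto
  have a': "computes prg U self (VPair (VPair tys (enc_env env)) (encq b lf a')) (enc_g lg (ground z i l r a' env)) (qhgt lh a')"
    using QBin.IH(2)[of env] QBin.prems sz by auto
  have k: "2 \<le> ?k" using a(1) by simp
  note [simp] = computesD[OF computes_le[OF U a(2) max.cobounded1[of _ "qhgt lh a'"]]]
    computesD[OF computes_le[OF U a' max.cobounded2[of "qhgt lh a'" "qhgt lh a"]]]
  show ?case
    using QBin.prems sz tys leafn z(3) i(3) U64[OF U] self(1) k
    by (intro conjI computesU[OF U _ self(2), where k = ?k]; cases op)
      (auto simp: ground_body_def Let_def ground_bin_def ground_quant_def mk_wrap_def mk_leaf_def mk_bin_def node_def)
next
  case (QPlus a)
  have a: "2 \<le> qhgt lh a" "computes prg U self (VPair (VPair tys (enc_env env)) (encq b lf a)) (enc_g lg (ground z i l r a env)) (qhgt lh a)"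
    using QPlus.IH[of env] QPlus.prems by (auto simp: node_def)
  note [simp] = computesD[OF a(2)]
  show ?case
    using QPlus.prems tys leafn z(3) i(3) U64[OF U] self(1) a(1)
    by (intro conjI computesU[OF U _ self(2), where k = "qhgt lh a"])
      (auto simp: ground_body_def Let_def ground_bin_def ground_quant_def mk_wrap_def mk_leaf_def mk_bin_def node_def)
next
  case (QQuant k x a)
  define js where "js = [1..<Suc (r (fst x))]"
  let ?base = "quant_base z i (kop k)"
  let ?W = "\<lambda>j. GWrap (kflag k) (ground z i l r a ((x, j) # env))"
  let ?F = "\<lambda>j e. GBin (kop k) (?W j) e"
  let ?G = "\<lambda>js. enc_g lg (foldr ?F js ?base)"
  let ?c = "VPair (VPair tys (enc_env env)) (VPair (enc_var x) (VPair (encq b lf a)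
     (VPair (VNum (optag (kop k))) (VPair (truth (kflag k)) (enc_g lg ?base)))))"
  have gr: "ground z i l r (QQuant k x a) env = foldr ?F js ?base" by (simp add: js_def del: upt_Suc)
  have res: "vsize (?G js) \<le> U" using QQuant.prems(4) unfolding gr .
  have base: "vsize (enc_g lg ?base) \<le> U"
    using quant_suffix_size[of lg "kop k" ?W "[]" ?base js] res by simp
  have sz: "vsize (encq b lf a) \<le> U" "vsize (enc_env env :: ('p, 'k) val) + 8 + 8 * qdep ldep a \<le> U"
    using QQuant.prems by (auto simp: node_def)
  have x: "fst x \<in> set is" using QQuant.prems by simp
  have step: "2 \<le> qhgt lh a \<and> computes prg U self (VPair (VPair tys (VPair (VPair (enc_var x) (VNum j)) (enc_env env))) (encq b lf a))
      (enc_g lg (ground z i l r a ((x, j) # env))) (qhgt lh a)" if "j \<in> set js" for j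
  proof -
    have "vsize (enc_g lg (ground z i l r a ((x, j) # env))) \<le> U"
      using quant_elem_size[OF that, of lg ?W "kop k" ?base] res by simp
    moreover have "vsize (enc_env ((x, j) # env) :: ('p, 'k) val) + 8 * qdep ldep a \<le> U"
      using sz(2) by (simp add: enc_env_Cons enc_var_def)
    ultimately show ?thesis using QQuant.IH[of "(x, j) # env"] QQuant.prems(1) sz(1) by (simp add: enc_env_Cons)
  qed
  obtain v where lk: "computes prg U 7 (VPair (VNum (fst x)) tys) (VPair v (VPair (vlist (map VNum js)) VNil)) 9"
    using comp_look_types[OF U, of B pl r "is" "fst x"] tys x unfolding tys_def js_def by blast
  have jss: "vsize (vlist (map VNum js) :: ('p, 'k) val) \<le> U"
  proof -
    obtain B' where "enc_type B pl r (fst x) = VPair (VNum (fst x)) (VPair B' (VPair (vlist (map VNum js)) VNil))"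
      by (simp add: enc_type_def js_def del: upt_Suc)
    then have "vsize (vlist (map VNum js) :: ('p, 'k) val) \<le> vsize (enc_type B pl r (fst x))" by simp
    moreover have "vsize (enc_type B pl r (fst x)) < vsize tys"
      unfolding tys_def using x by (intro vsize_mem_vlist) simp
    ultimately show ?thesis using tys by simp
  qed
  let ?k = "qhgt lh a + 9"
  have lp: "computes prg U loop (VPair ?c (vlist (map VNum js))) (?G js) ?k"
  proof (rule computes_fold[OF U _ loop(2)[unfolded quant_body_def], where k = "qhgt lh a + 2" and G = ?G])
    show "vsize (?G ys) \<le> U ^ 2" if "\<exists>zs. js = zs @ ys" for ys
    proof -
      from that obtain zs where "js = zs @ ys" by blast
      then show ?thesis using quant_suffix_size[of lg "kop k" ?W ys ?base zs] res by (intro lin_le'[OF U]) simp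
    qed
    show "vsize (VPair ?c (vlist (map VNum js))) \<le> U ^ 2"
      using sz tys base jss U64[OF U] by (intro lin_le'[OF U]) simp
    fix j ys assume "\<exists>zs. js = zs @ j # ys"
    then have "j \<in> set js" by auto
    have "computes prg U self (VPair (VPair tys (VPair (VPair (enc_var x) (VNum j)) (enc_env env))) (encq b lf a))
      (enc_g lg (ground z i l r a ((x, j) # env))) (qhgt lh a + 2)"
      by (rule computes_le[OF U conjunct2[OF step[OF \<open>j \<in> set js\<close>]]]) simp
    note h = computesD[OF this]
    show "xok prg (MkPair (Fst (Snd (Snd (Snd foldctx))))
     (MkPair (mk_wrap (Fst (Snd (Snd (Snd (Snd foldctx)))))
        (Call self (MkPair
          (MkPair (Fst (Fst foldctx))
            (MkPair (MkPair (Fst (Snd foldctx)) foldelt) (Snd (Fst foldctx))))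
          (Fst (Snd (Snd foldctx))))))
       (Var 0))) [?G ys, VPair ?c (VPair (VNum j) (vlist (map VNum ys)))] \<and>
     xv prg (MkPair (Fst (Snd (Snd (Snd foldctx))))
     (MkPair (mk_wrap (Fst (Snd (Snd (Snd (Snd foldctx)))))
        (Call self (MkPair
          (MkPair (Fst (Fst foldctx))
            (MkPair (MkPair (Fst (Snd foldctx)) foldelt) (Snd (Fst foldctx))))
          (Fst (Snd (Snd foldctx))))))
       (Var 0))) [?G ys, VPair ?c (VPair (VNum j) (vlist (map VNum ys)))] = ?G (j # ys) \<and>
     xc prg (MkPair (Fst (Snd (Snd (Snd foldctx))))
     (MkPair (mk_wrap (Fst (Snd (Snd (Snd (Snd foldctx)))))
        (Call self (MkPair
          (MkPair (Fst (Fst foldctx))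
            (MkPair (MkPair (Fst (Snd foldctx)) foldelt) (Snd (Fst foldctx))))
          (Fst (Snd (Snd foldctx))))))
       (Var 0))) [?G ys, VPair ?c (VPair (VNum j) (vlist (map VNum ys)))] \<le> 8 * U ^ (qhgt lh a + 2)"
      using h by (simp add: mk_wrap_def)
  qed (use loop in auto)
  have k9: "9 \<le> ?k" by simp
  note [simp] = computesD[OF computes_le[OF U lk k9]]
  have "computes prg U self (VPair (VPair tys (enc_env env)) (encq b lf (QQuant k x a)))
     (enc_g lg (ground z i l r (QQuant k x a) env)) (qhgt lh (QQuant k x a))"
    unfolding gr using QQuant.prems(2) sz tys leafn z(3) i(3) U64[OF U] self(1) computesD[OF lp]
    by (intro computesU[OF U _ self(2), where k = ?k]; cases k)
      (auto simp: ground_body_def Let_def ground_bin_def ground_quant_def mk_wrap_def mk_leaf_def mk_bin_def node_def z i)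
  then show ?case by simp
qed

section \<open>Grounding of the leaves and of the three logics\<close>

lemma comp_gz:
  assumes e: "vsize (enc_env env :: ('p, 'k :: {comm_semiring_0, comm_monoid_mult}) val) \<le> U"
  shows "vsize (enc_zeta \<zeta> :: ('p, 'k) val) \<le> U \<Longrightarrow>
    computes prg U 12 (VPair (enc_env env) (enc_zeta \<zeta>) :: ('p, 'k) val) (enc_g enc_b (gz env \<zeta>)) (2 + 3 * zeta_size \<zeta>)"
proof (induction \<zeta>)
  case (ZPil \<phi>)
  have "1 \<le> pil_size \<phi>" by (cases \<phi>) auto
  then show ?case using ZPil e U64[OF U]
    by (intro computesU[OF U _ prg_nth(14), where k = 2])
      (auto simp: gz_body_def mk_lit_def mk_bin_def node_def)
next
  case (ZCat \<zeta> \<zeta>')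
  define K where "K = 2 + 3 * (zeta_size \<zeta> + zeta_size \<zeta>')"
  have K: "2 \<le> K" "2 + 3 * zeta_size \<zeta> \<le> K" "2 + 3 * zeta_size \<zeta>' \<le> K" "K + 3 \<le> 2 + 3 * zeta_size (ZCat \<zeta> \<zeta>')"
    by (simp_all add: K_def)
  have "computes prg U 12 (VPair (enc_env env) (enc_zeta \<zeta>) :: ('p, 'k) val) (enc_g enc_b (gz env \<zeta>)) K"
    by (rule computes_le[OF U ZCat.IH(1)]) (use ZCat.prems K in \<open>auto simp: node_def\<close>)
  note [simp] = computesD[OF this]
  have "computes prg U 12 (VPair (enc_env env) (enc_zeta \<zeta>') :: ('p, 'k) val) (enc_g enc_b (gz env \<zeta>')) K"
    by (rule computes_le[OF U ZCat.IH(2)]) (use ZCat.prems K in \<open>auto simp: node_def\<close>)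
  note [simp] = computesD[OF this]
  show ?case using ZCat.prems e U64[OF U]
    by (intro computesU[OF U _ prg_nth(14) _ _ _ _ K(1,4)])
      (auto simp: gz_body_def mk_lit_def mk_bin_def node_def)
qed

text \<open>The continuation \<open>c\<close> is a part of the result, so intermediate continuations
  inherit the size bound.\<close>

lemma vsize_gneg: "vsize (enc_g enc_b c :: ('p, 'k) val) \<le> vsize (enc_g enc_b (gneg env \<zeta> c) :: ('p, 'k) val)"
proof (induction \<zeta> arbitrary: c)
  case (ZCat \<zeta> \<zeta>')
  then show ?case using le_trans by fastforce
qed simp

lemma comp_gneg:
  assumes e: "vsize (enc_env env :: ('p, 'k :: {comm_semiring_0, comm_monoid_mult}) val) \<le> U"
  shows "vsize (enc_zeta \<zeta> :: ('p, 'k) val) \<le> U \<Longrightarrow> vsize (enc_g enc_b (gneg env \<zeta> c) :: ('p, 'k) val) \<le> U \<Longrightarrow>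
    computes prg U 13 (VPair (enc_env env) (VPair (enc_zeta \<zeta>) (enc_g enc_b c)) :: ('p, 'k) val)
      (enc_g enc_b (gneg env \<zeta> c)) (2 + 3 * zeta_size \<zeta>)"
proof (induction \<zeta> arbitrary: c)
  case (ZPil \<phi>)
  have "1 \<le> pil_size \<phi>" by (cases \<phi>) auto
  then show ?case using ZPil e U64[OF U]
    by (intro computesU[OF U _ prg_nth(15), where k = 2])
      (auto simp: gneg_body_def mk_lit_def mk_bin_def mk_wrap_def mk_leaf_def node_def)
next
  case (ZCat \<zeta> \<zeta>')
  define K where "K = 2 + 3 * (zeta_size \<zeta> + zeta_size \<zeta>')"
  have K: "2 \<le> K" "2 + 3 * zeta_size \<zeta> \<le> K" "2 + 3 * zeta_size \<zeta>' \<le> K" "K + 3 \<le> 2 + 3 * zeta_size (ZCat \<zeta> \<zeta>')"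
    by (simp_all add: K_def)
  have c: "vsize (enc_g enc_b (gneg env \<zeta>' c) :: ('p, 'k) val) \<le> U"
    using vsize_gneg[of "gneg env \<zeta>' c" env \<zeta>, where 'k = 'k] ZCat.prems(2) by simp
  have c': "vsize (enc_g enc_b c :: ('p, 'k) val) \<le> U"
    using vsize_gneg[of c env \<zeta>', where 'k = 'k] c by linarith
  have "computes prg U 13 (VPair (enc_env env) (VPair (enc_zeta \<zeta>') (enc_g enc_b c)) :: ('p, 'k) val)
      (enc_g enc_b (gneg env \<zeta>' c)) K"
    by (rule computes_le[OF U ZCat.IH(2)]) (use ZCat.prems c K in \<open>auto simp: node_def\<close>)
  note [simp] = computesD[OF this]
  have "computes prg U 13 (VPair (enc_env env) (VPair (enc_zeta \<zeta>) (enc_g enc_b (gneg env \<zeta>' c))) :: ('p, 'k) val)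
      (enc_g enc_b (gneg env \<zeta> (gneg env \<zeta>' c))) K"
    by (rule computes_le[OF U ZCat.IH(1)]) (use ZCat.prems K in \<open>auto simp: node_def\<close>)
  note [simp] = computesD[OF this]
  show ?case using ZCat.prems e c' U64[OF U]
    by (intro computesU[OF U _ prg_nth(15) _ _ _ _ K(1,4)])
      (auto simp: gneg_body_def mk_lit_def mk_bin_def mk_wrap_def mk_leaf_def node_def)
qed

context
  fixes B :: "('p, 'k :: {comm_semiring_0, comm_monoid_mult}) pwcomp" and pl r "is"
  assumes tys: "vsize (vlist (map (enc_type B pl r) is)) \<le> U"
begin

lemma comp_groundE:
  "qclosed lokE (set is) (toqE \<phi>) (fst ` set env) \<Longrightarrow> vsize (enc_epil \<phi> :: ('p, 'k) val) \<le> U \<Longrightarrow>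
    vsize (enc_env env :: ('p, 'k) val) + 8 * qdep (\<lambda>d. 0) (toqE \<phi>) \<le> U \<Longrightarrow>
    vsize (enc_g enc_b (groundE r (toqE \<phi>) env) :: ('p, 'k) val) \<le> U \<Longrightarrow>
    2 \<le> qhgt lhE (toqE \<phi>) \<and> computes prg U 14 (VPair (VPair (vlist (map (enc_type B pl r) is)) (enc_env env)) (enc_epil \<phi>))
      (enc_g enc_b (groundE r (toqE \<phi>) env)) (qhgt lhE (toqE \<phi>))"
  unfolding enc_epil_eq
proof (rule comp_ground[OF _ prg_nth(16) _ prg_nth(17), where zv = VNil and iv = "VNum 1" and lok = lokE])
  fix d :: "bool \<times> ('p \<times> var) zeta" and env
  assume a: "vsize (encE d :: ('p, 'k) val) \<le> U" "vsize (enc_env env :: ('p, 'k) val) + 8 * 0 \<le> U"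
    "vsize (enc_g enc_b (groundE_leaf d env) :: ('p, 'k) val) \<le> U"
  obtain b \<zeta> where d: "d = (b, \<zeta>)" by (cases d)
  have e: "vsize (enc_env env :: ('p, 'k) val) \<le> U" and s: "vsize (enc_zeta \<zeta> :: ('p, 'k) val) \<le> U"
    using a by (auto simp: encE_def d node_def)
  show "\<exists>t q. encE d = VPair (VNum t) q \<and> t < 2 \<and> 2 \<le> lhE d \<and>
        xgood prg (U ^ lhE d) epil_leaf [VPair (VPair (vlist (map (enc_type B pl r) is)) (enc_env env)) (encE d)] \<and>
        xv prg epil_leaf [VPair (VPair (vlist (map (enc_type B pl r) is)) (enc_env env)) (encE d)] = enc_g enc_b (groundE_leaf d env)"
  proof (cases b)
    case True
    then show ?thesis using computesD[OF comp_gz[OF e s]]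
      by (simp add: d encE_def node_def epil_leaf_def groundE_leaf_def lhE_def)
  next
    case False
    have "vsize (enc_g enc_b (gneg env \<zeta> (GWrap False (GLeaf (BConst True)))) :: ('p, 'k) val) \<le> U"
      using a(3) False by (simp add: d groundE_leaf_def)
    from computesD[OF comp_gneg[OF e s this]] show ?thesis using False
      by (simp add: d encE_def node_def epil_leaf_def groundE_leaf_def lhE_def mk_wrap_def mk_leaf_def)
  qed
qed (use tys in \<open>auto simp: epil_leaf_def mk_wrap_def mk_leaf_def\<close>)

lemma comp_groundF:
  "qclosed (lokF (set is)) (set is) (toqF \<psi>) (fst ` set env) \<Longrightarrow> vsize (enc_foeil \<psi> :: ('p, 'k) val) \<le> U \<Longrightarrow>
    vsize (enc_env env :: ('p, 'k) val) + 8 * qdep ldF (toqF \<psi>) \<le> U \<Longrightarrow>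
    vsize (enc_g enc_b (groundF r (toqF \<psi>) env) :: ('p, 'k) val) \<le> U \<Longrightarrow>
    2 \<le> qhgt lhF (toqF \<psi>) \<and> computes prg U 16 (VPair (VPair (vlist (map (enc_type B pl r) is)) (enc_env env)) (enc_foeil \<psi>))
      (enc_g enc_b (groundF r (toqF \<psi>) env)) (qhgt lhF (toqF \<psi>))"
  unfolding enc_foeil_eq
proof (rule comp_ground[OF _ prg_nth(18) _ prg_nth(19), where zv = VNil and iv = "VNum 1" and lok = "lokF (set is)"])
  fix d :: "'p fleaf" and env
  assume c: "lokF (set is) d (fst ` set env)"
    and a: "vsize (encF d :: ('p, 'k) val) \<le> U" "vsize (enc_env env :: ('p, 'k) val) + 8 * ldF d \<le> U"
    "vsize (enc_g enc_b (groundF_leaf r d env) :: ('p, 'k) val) \<le> U"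
  show "\<exists>t q. encF d = VPair (VNum t) q \<and> t < 3 \<and> 2 \<le> lhF d \<and>
        xgood prg (U ^ lhF d) foeil_leaf [VPair (VPair (vlist (map (enc_type B pl r) is)) (enc_env env)) (encF d)] \<and>
        xv prg foeil_leaf [VPair (VPair (vlist (map (enc_type B pl r) is)) (enc_env env)) (encF d)] = enc_g enc_b (groundF_leaf r d env)"
  proof (cases d)
    case (LEpil \<phi>)
    have "2 \<le> qhgt lhE (toqE \<phi>) \<and> computes prg U 14 (VPair (VPair (vlist (map (enc_type B pl r) is)) (enc_env env)) (enc_epil \<phi>))
      (enc_g enc_b (groundE r (toqE \<phi>) env)) (qhgt lhE (toqE \<phi>))"
      using a c LEpil by (intro comp_groundE) (auto simp: node_def)
    note h = computesD[OF conjunct2[OF this]] this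
    show ?thesis using h LEpil by (simp add: node_def foeil_leaf_def)
  next
    case (LEq b x y)
    have e: "vsize (enc_env env :: ('p, 'k) val) \<le> U" using a by simp
    have "x \<in> fst ` set env" "y \<in> fst ` set env" using c LEq by auto
    then obtain i j where m: "map_of env x = Some i" "map_of env y = Some j"
      by (metis map_of_eq_None_iff not_Some_eq)
    have h: "computes prg U 7 (VPair (enc_var x) (enc_env env :: ('p, 'k) val)) (VNum i) 9"
      "computes prg U 7 (VPair (enc_var y) (enc_env env :: ('p, 'k) val)) (VNum j) 9"
      using comp_look_env[OF U e, of x] comp_look_env[OF U e, of y] by (auto simp: m)
    show ?thesis using computesD[OF h(1)] computesD[OF h(2)]
      by (cases b) (auto simp: LEq node_def foeil_leaf_def mk_leaf_def m truth_def)
  qed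
qed (use tys in \<open>auto simp: foeil_leaf_def mk_leaf_def\<close>)

lemma comp_groundW:
  "qclosed (lokW (set is)) (set is) (toqW \<psi>) (fst ` set env) \<Longrightarrow> vsize (enc_wfoeil \<psi> :: ('p, 'k) val) \<le> U \<Longrightarrow>
    vsize (enc_env env :: ('p, 'k) val) + 8 * qdep ldW (toqW \<psi>) \<le> U \<Longrightarrow>
    vsize (enc_g enc_w (groundW r (toqW \<psi>) env)) \<le> U \<Longrightarrow>
    2 \<le> qhgt lhW (toqW \<psi>) \<and> computes prg U 18 (VPair (VPair (vlist (map (enc_type B pl r) is)) (enc_env env)) (enc_wfoeil \<psi>))
      (enc_g enc_w (groundW r (toqW \<psi>) env)) (qhgt lhW (toqW \<psi>))"
  unfolding enc_wfoeil_eq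
proof (rule comp_ground[OF _ prg_nth(20) _ prg_nth(21), where zv = "VWt 0" and iv = "VWt 1" and lok = "lokW (set is)"])
  fix d :: "'k + 'p foeil" and env
  assume c: "lokW (set is) d (fst ` set env)"
    and a: "vsize (encW d) \<le> U" "vsize (enc_env env :: ('p, 'k) val) + 8 * ldW d \<le> U"
    "vsize (enc_g enc_w (groundW_leaf r d env)) \<le> U"
  show "\<exists>t q. encW d = VPair (VNum t) q \<and> t < 2 \<and> 2 \<le> lhW d \<and>
        xgood prg (U ^ lhW d) wfoeil_leaf [VPair (VPair (vlist (map (enc_type B pl r) is)) (enc_env env)) (encW d)] \<and>
        xv prg wfoeil_leaf [VPair (VPair (vlist (map (enc_type B pl r) is)) (enc_env env)) (encW d)] = enc_g enc_w (groundW_leaf r d env)"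
  proof (cases d)
    case (Inl k)
    then show ?thesis by (simp add: encW_def node_def wfoeil_leaf_def groundW_leaf_def mk_leaf_def lhW_def)
  next
    case (Inr \<psi>)
    have "2 \<le> qhgt lhF (toqF \<psi>) \<and> computes prg U 16 (VPair (VPair (vlist (map (enc_type B pl r) is)) (enc_env env)) (enc_foeil \<psi>))
      (enc_g enc_b (groundF r (toqF \<psi>) env)) (qhgt lhF (toqF \<psi>))"
      using a c Inr by (intro comp_groundF) (auto simp: node_def encW_def ldW_def lokW_def groundW_leaf_def)
    note h = computesD[OF conjunct2[OF this]] this
    show ?thesis using h Inr
      by (simp add: encW_def node_def wfoeil_leaf_def groundW_leaf_def mk_leaf_def lhW_def)
  qed
qed (use tys in \<open>auto simp: wfoeil_leaf_def mk_leaf_def\<close>)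

end

end

section \<open>The program on sentences\<close>

lemma qclosed_toqE: "snd ` set_epil \<phi> \<subseteq> D \<Longrightarrow> qclosed lokE I (toqE \<phi>) D"
  by (induction \<phi>) (auto simp: lokE_def)

lemma qclosed_toqF:
  "is_foeil B \<psi> \<Longrightarrow> foeil_free \<psi> \<subseteq> D \<Longrightarrow> qclosed (lokF {1..ntypes B}) {1..ntypes B} (toqF \<psi>) D"
  by (induction \<psi> arbitrary: D) (auto simp: is_var_def Diff_subset_conv intro!: qclosed_toqE)

lemma qclosed_toqW:
  "is_wfoeil B \<psi> \<Longrightarrow> wfoeil_free \<psi> \<subseteq> D \<Longrightarrow> qclosed (lokW {1..ntypes B}) {1..ntypes B} (toqW \<psi>) D"
  by (induction \<psi> arbitrary: D) (auto simp: is_var_def lokW_def Diff_subset_conv intro!: qclosed_toqF)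

lemma set_gexp_ground:
  assumes l: "\<And>d env. lok d (fst ` set env) \<Longrightarrow> set_gexp (l d env) \<subseteq> C" and zi: "z \<in> C" "i \<in> C"
  shows "qclosed lok I a (fst ` set env) \<Longrightarrow> set_gexp (ground z i l r a env) \<subseteq> C"
proof (induction a arbitrary: env)
  case (QQuant k x a)
  have IH: "set_gexp (ground z i l r a ((x, j) # env)) \<subseteq> C" for j
    using QQuant.IH[of "(x, j) # env"] QQuant.prems by simp
  have "set_gexp (foldr (\<lambda>j e. GBin (kop k) (GWrap (kflag k) (ground z i l r a ((x, j) # env))) e) js
      (quant_base z i (kop k))) \<subseteq> C" for js
    using IH zi by (induction js) (simp_all, cases "kop k", auto)
  then show ?case by (simp del: upt_Suc)
qed (use l in auto)

lemma set_gexp_gz: "snd ` set_zeta \<zeta> \<subseteq> fst ` set env \<Longrightarrow> set_gexp (gz env \<zeta>) \<subseteq> Collect bclosed"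
  by (induction \<zeta>) auto

lemma set_gexp_gneg:
  "snd ` set_zeta \<zeta> \<subseteq> fst ` set env \<Longrightarrow> set_gexp c \<subseteq> Collect bclosed \<Longrightarrow>
    set_gexp (gneg env \<zeta> c) \<subseteq> Collect bclosed"
proof (induction \<zeta> arbitrary: c)
  case (ZCat \<zeta> \<zeta>')
  then have "snd ` set_zeta \<zeta> \<subseteq> fst ` set env" "snd ` set_zeta \<zeta>' \<subseteq> fst ` set env"
    by (auto simp: image_Un)
  then show ?case unfolding gneg.simps by (intro ZCat.IH ZCat.prems(2))
qed auto

lemma set_gexp_groundE_leaf: "lokE d (fst ` set env) \<Longrightarrow> set_gexp (groundE_leaf d env) \<subseteq> Collect bclosed"
  by (cases "fst d") (simp_all add: groundE_leaf_def lokE_def set_gexp_gz set_gexp_gneg)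

lemma set_gexp_groundF_leaf:
  assumes "lokF I d (fst ` set env)"
  shows "set_gexp (groundF_leaf r d env) \<subseteq> Collect bclosed"
proof (cases d)
  case (LEpil \<phi>)
  have "set_gexp (groundE r (toqE \<phi>) env) \<subseteq> Collect bclosed"
    by (rule set_gexp_ground[OF set_gexp_groundE_leaf]) (use assms LEpil in simp_all)
  then show ?thesis using LEpil by simp
qed simp

lemma set_gexp_groundW_leaf:
  assumes "lokW I d (fst ` set env)"
  shows "set_gexp (groundW_leaf r d env) \<subseteq> Collect wclosed"
proof (cases d)
  case (Inr \<psi>)
  have "set_gexp (groundF r (toqF \<psi>) env) \<subseteq> Collect bclosed"
    by (rule set_gexp_ground[OF set_gexp_groundF_leaf]) (use assms Inr in \<open>simp_all add: lokW_def\<close>)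
  then show ?thesis using Inr by (auto simp: groundW_leaf_def)
qed (simp add: groundW_leaf_def)

lemma wclosed_groundW:
  assumes "qclosed (lokW I) I (toqW \<psi>) (fst ` set env)"
  shows "\<forall>d\<in>set_gexp (groundW r (toqW \<psi>) env). wclosed d"
proof -
  have "set_gexp (groundW r (toqW \<psi>) env) \<subseteq> Collect wclosed"
    by (rule set_gexp_ground[OF set_gexp_groundW_leaf]) (use assms in simp_all)
  then show ?thesis by auto
qed

definition wfa_val :: "('p, 'k, ('p \<times> nat) set, 'k :: {comm_semiring_0, comm_monoid_mult}) vaut \<Rightarrow>
    ('p \<times> nat) list list \<Rightarrow> ('p, 'k) val" where
  "wfa_val A ls = vlist [vlist (map (\<lambda>q. VWt (if astart A = q then 1 else 0)) (astates A)),
     vlist (map (\<lambda>q. VWt (afinal A q)) (astates A)), tab_val A ls]"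

lemma wfa_code_wfa_val:
  fixes A :: "('p, 'k, ('p \<times> nat) set, 'k :: {comm_semiring_0, comm_monoid_mult}) vaut"
  assumes "distinct (map set ls)" "\<And>l. l \<in> set ls \<Longrightarrow> distinct l" "set ` {l \<in> set ls. l \<noteq> []} = I"
  shows "wfa_code I (wfa_of A) (wfa_val A ls)"
proof -
  let ?N = "length (astates A)" and ?ls = "filter (\<lambda>l. l \<noteq> []) ls"
  have m: "mat_val A ps = vlist (map (\<lambda>q. vlist (map (\<lambda>q'. VWt (trans (wfa_of A) q (set ps) q')) [0..<?N])) [0..<?N])" for ps
    by (auto simp: mat_val_def row_val_def wfa_of_def intro!: nth_equalityI)
  have i: "map (\<lambda>q. VWt (if astart A = q then 1 else 0)) (astates A) = map (\<lambda>q. VWt (initial (wfa_of A) q)) [0..<?N]"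
    and t: "map (\<lambda>q. VWt (afinal A q)) (astates A) = map (\<lambda>q. VWt (terminal (wfa_of A) q)) [0..<?N]"
    by (auto simp: wfa_of_def intro: nth_equalityI)
  have "distinct (map set ?ls)" using assms(1) by (simp add: distinct_map_filter)
  moreover have "set ` set ?ls = I" using assms(3) by (simp add: set_filter)
  ultimately show ?thesis
    unfolding wfa_code_def wfa_val_def tab_val_def i t m using assms(2)
    by (intro exI[of _ ?N] exI[of _ ?ls]) (auto simp: wfa_of_def)
qed

lemma length_tab_val: "Suc (length (filter (\<lambda>l. l \<noteq> []) ls)) \<le> vsize (tab_val A ls)"
  unfolding tab_val_def using length_le_vsize_vlist[of "map (\<lambda>ps. VPair (enc_letter ps) (mat_val A ps)) (filter (\<lambda>ps. ps \<noteq> []) ls)"]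
  by simp

lemma length_le_filter:
  assumes "distinct ls"
  shows "length ls \<le> Suc (length (filter (\<lambda>l. l \<noteq> []) ls))"
proof -
  have "set ls \<subseteq> insert [] (set (filter (\<lambda>l. l \<noteq> []) ls))" by auto
  then have "card (set ls) \<le> card (insert [] (set (filter (\<lambda>l. l \<noteq> []) ls)))" by (rule card_mono[rotated]) simp
  also have "\<dots> \<le> Suc (card (set (filter (\<lambda>l. l \<noteq> []) ls)))" by (simp add: card_insert_if)
  finally show ?thesis using assms by (simp add: distinct_card del: set_filter)
qed

lemma comp_main:
  fixes B :: "('p, 'k :: {comm_semiring_0, comm_monoid_mult}) pwcomp" and pl :: "nat \<Rightarrow> 'p list" and r :: "nat \<Rightarrow> nat" and \<psi> :: "('p, 'k) wfoeil"
  defines "is \<equiv> [1..<Suc (ntypes B)]"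
  defines "tys \<equiv> vlist (map (enc_type B pl r) is)" and "e \<equiv> groundW r (toqW \<psi>) []" and "ls \<equiv> all_letters pl r is"
  assumes U: "large prg U" and sent: "is_sentence B \<psi>"
    and s: "vsize tys \<le> U" "vsize (enc_wfoeil \<psi>) \<le> U" "1 + 8 * qdep ldW (toqW \<psi>) \<le> U"
      "vsize (enc_g enc_w e) + 5 \<le> U" "vsize (vlist (astates (waut e))) \<le> U"
      "vsize (enc_letters ls :: ('p, 'k) val) \<le> U" "vsize (tab_val (waut e) ls) \<le> U"
    and k: "qhgt lhW (toqW \<psi>) \<le> k" "ghgt hgt_w e + 15 \<le> k" "22 \<le> k"
  shows "computes prg U 0 (enc_input B pl r \<psi>) (wfa_val (waut e) ls) (k + 3)"
proof -
  have set_is: "set is = {1..ntypes B}" by (auto simp: is_def simp del: upt_Suc)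
  have c: "qclosed (lokW (set is)) (set is) (toqW \<psi>) (fst ` set [])"
    unfolding set_is using sent by (intro qclosed_toqW) (auto simp: is_sentence_def)
  have g: "computes prg U 18 (VPair (VPair tys VNil) (enc_wfoeil \<psi>)) (enc_g enc_w e) k"
  proof -
    have "2 \<le> qhgt lhW (toqW \<psi>) \<and> computes prg U 18 (VPair (VPair tys (enc_env [])) (enc_wfoeil \<psi>)) (enc_g enc_w e) (qhgt lhW (toqW \<psi>))"
      unfolding e_def tys_def
      by (rule comp_groundW[OF U s(1)[unfolded tys_def] c s(2)]) (use s(3,4) in \<open>simp_all add: enc_env_def e_def\<close>)
    from computes_le[OF U conjunct2[OF this] k(1)] show ?thesis by (simp add: enc_env_def)
  qed
  have i: "implements U (VNum 1) VWt (enc_g enc_w e) (waut e) (ghgt hgt_w e)"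
    using wclosed_groundW[OF c] s by (intro implements_waut[OF U]) (auto simp: e_def)
  have kk: "ghgt hgt_w e \<le> k" "ghgt hgt_w e + 5 \<le> k" "9 \<le> k" "2 \<le> k" using k by auto
  note [simp] = computesD[OF g] implements_states[OF U i kk(1)]
    computesD[OF computes_le[OF U comp_irow[OF U i] kk(3)]]
    computesD[OF computes_le[OF U comp_trow[OF U i] kk(2)]]
    computesD[OF computes_le[OF U comp_tab[OF U i s(6,7)] k(2)]]
    computesD[OF computes_le[OF U comp_ltype[OF U s(6)[unfolded ls_def] s(1)[unfolded tys_def]] k(3), folded tys_def ls_def]]
  have input: "enc_input B pl r \<psi> = VPair tys (enc_wfoeil \<psi>)" by (simp add: enc_input_def tys_def is_def)
  show ?thesis unfolding input using s U64[OF U] kk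
    by (intro computesU[OF U _ prg_nth(1), where k = k]) (auto simp: main_body_def wfa_val_def)
qed

text \<open>Reading the input and the outer call fit into a second copy of
  \<open>U ^ k\<close>.\<close>

lemma computes_runs:
  assumes "computes prg U 0 x y k" "vsize x + 1 \<le> U ^ k"
  shows "\<exists>t. runs prg x y t \<and> t \<le> 2 * U ^ k"
proof -
  note h = computesD[OF assms(1)]
  have v: "eval prg [x] (Var 0) x (vsize x)" using eval.intros(1)[of 0 "[x]" prg] by simp
  have "eval prg [x] (prg ! 0) y (tm prg 0 x)" using halts_eval[OF h(1)] h(2) by simp
  from eval.intros(16)[OF v _ this] have "runs prg x y (vsize x + tm prg 0 x + 1)" by (simp add: runs_def)
  then show ?thesis using h(3) assms(2) by (intro exI[of _ "vsize x + tm prg 0 x + 1"]) simp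
qed

lemma sentence_sem_eq_behavior:
  fixes \<psi> :: "('p, 'k :: {comm_semiring_0, comm_monoid_mult}) wfoeil"
  assumes "w \<noteq> []"
  shows "sentence_sem r \<psi> w = behavior (wfa_of (waut (groundW r (toqW \<psi>) []))) w"
  using groundW_correct[OF assms, of r \<psi> "[]"] waut_correct[of "groundW r (toqW \<psi>) []"]
  by (simp add: sentence_sem_def behavior_wfa_of)

section \<open>Size bounds\<close>

text \<open>The factor 9 is the size of an encoded port. Each further logic adds 4 for the node
  around its leaves, which leads to 13, 17, 21 and 25 below.\<close>

lemma vsize_enc_pil: "vsize (enc_pil \<phi> :: ('p, 'k) val) \<le> 9 * pil_size \<phi>"
  by (induction \<phi>) (simp_all add: node_def)

lemma vsize_enc_zeta: "vsize (enc_zeta \<zeta> :: ('p, 'k) val) \<le> 13 * zeta_size \<zeta>"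
proof (induction \<zeta>)
  case (ZPil \<phi>)
  have "1 \<le> pil_size \<phi>" by (cases \<phi>) auto
  then show ?case using vsize_enc_pil[of \<phi>, where 'k = 'k] by (simp add: node_def)
qed (simp_all add: node_def)

lemma zeta_size_pos: "1 \<le> zeta_size \<zeta>"
proof (cases \<zeta>)
  case (ZPil \<phi>)
  have "1 \<le> pil_size \<phi>" by (cases \<phi>) auto
  then show ?thesis using ZPil by simp
qed simp

lemma epil_size_pos: "1 \<le> epil_size \<phi>"
  using zeta_size_pos by (cases \<phi>) auto

lemma foeil_size_pos: "1 \<le> foeil_size r \<psi>"
  using epil_size_pos by (cases \<psi>) auto

lemma wfoeil_size_pos: "1 \<le> wfoeil_size r \<psi>"
  using foeil_size_pos by (cases \<psi>) auto

lemma vsize_enc_epil: "vsize (enc_epil \<phi> :: ('p, 'k) val) \<le> 17 * epil_size \<phi>"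
proof (induction \<phi>)
  case (EPos \<zeta>)
  show ?case using vsize_enc_zeta[of \<zeta>, where 'k = 'k] zeta_size_pos[of \<zeta>] by (simp add: node_def)
next
  case (ENeg \<zeta>)
  show ?case using vsize_enc_zeta[of \<zeta>, where 'k = 'k] by (simp add: node_def)
qed (simp_all add: node_def)

lemma le_copies: "v \<le> C * m \<Longrightarrow> v \<le> C * (copies r x * m)"
proof -
  have "1 * m \<le> copies r x * m" by (intro mult_le_mono1) (simp add: copies_def)
  then have "C * m \<le> C * (copies r x * m)" using mult_le_mono2 by simp
  then show "v \<le> C * m \<Longrightarrow> v \<le> C * (copies r x * m)" by (rule le_trans[rotated])
qed

lemma vsize_enc_foeil: "vsize (enc_foeil \<psi> :: ('p, 'k) val) \<le> 21 * foeil_size r \<psi>"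
proof (induction \<psi>)
  case (FEpil \<phi>)
  show ?case using vsize_enc_epil[of \<phi>, where 'k = 'k] epil_size_pos[of \<phi>] by (simp add: node_def)
qed (auto simp: node_def intro: trans_le_add2 le_copies)

lemma vsize_enc_wfoeil: "vsize (enc_wfoeil \<psi>) \<le> 25 * wfoeil_size r \<psi>"
proof (induction \<psi>)
  case (WBool \<psi>)
  show ?case using vsize_enc_foeil[of \<psi> r, where 'k = 'b] foeil_size_pos[of r \<psi>] by (simp add: node_def)
qed (auto simp: node_def intro: trans_le_add2 le_copies)

section \<open>Depth and ground expression measured in the size of the instance\<close>

primrec qsize :: "('d \<Rightarrow> nat) \<Rightarrow> (nat \<Rightarrow> nat) \<Rightarrow> 'd qexp \<Rightarrow> nat" where
  "qsize l r (QLeaf d) = l d"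
| "qsize l r (QBin op a a') = 1 + qsize l r a + qsize l r a'"
| "qsize l r (QPlus a) = 1 + qsize l r a"
| "qsize l r (QQuant k x a) = 1 + copies r x * qsize l r a"

definition lsE :: "bool \<times> ('p \<times> var) zeta \<Rightarrow> nat" where
  "lsE d = (if fst d then 0 else 1) + zeta_size (snd d)"

primrec lsF :: "'p fleaf \<Rightarrow> nat" where
  "lsF (LEpil \<phi>) = epil_size \<phi>" | "lsF (LEq b x y) = 1"

definition lsW :: "(nat \<Rightarrow> nat) \<Rightarrow> 'k + 'p foeil \<Rightarrow> nat" where
  "lsW r d = (case d of Inl k \<Rightarrow> 1 | Inr \<psi> \<Rightarrow> foeil_size r \<psi>)"

lemma epil_size_eq: "epil_size \<phi> = qsize lsE r (toqE \<phi>)"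
  by (induction \<phi>) (simp_all add: lsE_def)

lemma foeil_size_eq: "foeil_size r \<psi> = qsize lsF r (toqF \<psi>)"
  by (induction \<psi>) simp_all

lemma wfoeil_size_eq: "wfoeil_size r \<psi> = qsize (lsW r) r (toqW \<psi>)"
  by (induction \<psi>) (simp_all add: lsW_def)

lemma qdep_le_qsize: "(\<And>d. ld d \<le> ls d) \<Longrightarrow> qdep ld a \<le> qsize ls r a"
proof (induction a)
  case (QQuant k x a)
  then have "qdep ld a \<le> 1 * (copies r x * qsize ls r a)" by (intro le_copies) simp
  then show ?case by simp
qed (simp_all add: le_SucI)

lemma qhgt_le_qsize: "(\<And>d. lh d + 3 \<le> C * ls d) \<Longrightarrow> 12 \<le> C \<Longrightarrow> qhgt lh a \<le> C * qsize ls r a"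
proof (induction a)
  case (QQuant k x a)
  then have "qhgt lh a \<le> C * (copies r x * qsize ls r a)" by (intro le_copies) simp
  then show ?case using QQuant.prems(2) by (simp add: algebra_simps)
qed (auto simp: algebra_simps intro: le_trans add_mono)

lemma qdep_toqW:
  fixes \<psi> :: "('a, 'b) wfoeil"
  shows "qdep ldW (toqW \<psi>) \<le> wfoeil_size r \<psi>"
proof -
  have E: "qdep (\<lambda>d. 0) (toqE \<phi>) \<le> epil_size \<phi>" for \<phi> :: "('a \<times> var) epil"
    unfolding epil_size_eq[of \<phi> r] by (rule qdep_le_qsize) simp
  have F: "ldF d \<le> lsF d" for d :: "'a fleaf" using E by (cases d) auto
  have "qdep ldF (toqF \<psi>) \<le> foeil_size r \<psi>" for \<psi> :: "'a foeil"
    unfolding foeil_size_eq by (rule qdep_le_qsize[OF F])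
  then have W: "ldW d \<le> lsW r d" for d :: "'b + 'a foeil" by (cases d) (auto simp: ldW_def lsW_def)
  show ?thesis unfolding wfoeil_size_eq by (rule qdep_le_qsize[OF W])
qed

text \<open>The factor 12 of a quantifier rises by 3 at each passage to the leaves of the next
  logic: 12, 15, 18.\<close>

lemma qhgt_toqW:
  fixes \<psi> :: "('a, 'b) wfoeil"
  shows "qhgt lhW (toqW \<psi>) \<le> 18 * wfoeil_size r \<psi>"
proof -
  have "lhE d + 3 \<le> 12 * lsE d" for d :: "bool \<times> ('a \<times> var) zeta"
    using zeta_size_pos[of "snd d"] by (simp add: lhE_def lsE_def)
  then have E: "qhgt lhE (toqE \<phi>) \<le> 12 * epil_size \<phi>" for \<phi> :: "('a \<times> var) epil"
    unfolding epil_size_eq[of \<phi> r] by (rule qhgt_le_qsize) simp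
  have F: "lhF d + 3 \<le> 15 * lsF d" for d :: "'a fleaf"
  proof (cases d)
    case (LEpil \<phi>)
    then show ?thesis using E[of \<phi>] epil_size_pos[of \<phi>] by simp
  qed simp
  have F': "qhgt lhF (toqF \<psi>) \<le> 15 * foeil_size r \<psi>" for \<psi> :: "'a foeil"
    unfolding foeil_size_eq by (rule qhgt_le_qsize[OF F]) simp
  have W: "lhW d + 3 \<le> 18 * lsW r d" for d :: "'b + 'a foeil"
  proof (cases d)
    case (Inr \<psi>)
    then show ?thesis using F'[of \<psi>] foeil_size_pos[of r \<psi>] by (simp add: lhW_def lsW_def)
  qed (simp add: lhW_def lsW_def)
  show ?thesis unfolding wfoeil_size_eq by (rule qhgt_le_qsize[OF W]) simp
qed

text \<open>Linear, because \<open>qsize\<close> already counts the copies of a quantified body. A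
  copy adds 7 for its operation and wrap, which the slack \<open>s\<close> absorbs; the neutral
  element has size at most 7 as well.\<close>

lemma vsize_ground:
  fixes lg :: "'g \<Rightarrow> ('p, 'k) val"
  assumes l: "\<And>d env. vsize (enc_env env :: ('p, 'k) val) + 8 * ldep d \<le> E \<Longrightarrow> vsize (enc_g lg (l d env)) + s \<le> L * ls d"
    and zi: "vsize (lg z) \<le> 3" "vsize (lg i) \<le> 3" and s: "7 \<le> s" "s + 7 \<le> L"
  shows "vsize (enc_env env :: ('p, 'k) val) + 8 * qdep ldep a \<le> E \<Longrightarrow>
    vsize (enc_g lg (ground z i l r a env)) + s \<le> L * qsize ls r a"
proof (induction a arbitrary: env)
  case (QLeaf d)
  then show ?case using l by simp
next
  case (QBin op a a')
  have "vsize (enc_g lg (ground z i l r a env)) + s \<le> L * qsize ls r a"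
    "vsize (enc_g lg (ground z i l r a' env)) + s \<le> L * qsize ls r a'" using QBin by auto
  then show ?case using s by (simp add:  distrib_left)
next
  case (QPlus a)
  have "vsize (enc_g lg (ground z i l r a env)) + s \<le> L * qsize ls r a" using QPlus by auto
  then show ?case using s by (simp add: distrib_left)
next
  case (QQuant k x a)
  have IH: "vsize (enc_g lg (ground z i l r a ((x, j) # env))) + s \<le> L * qsize ls r a" for j
    using QQuant.IH[of "(x, j) # env"] QQuant.prems by (simp add: enc_env_Cons)
  have "vsize (enc_g lg (foldr (\<lambda>j e. GBin (kop k) (GWrap (kflag k) (ground z i l r a ((x, j) # env))) e) js
      (quant_base z i (kop k)))) \<le> 7 + length js * (L * qsize ls r a)" for js
  proof (induction js)
    case Nil
    then show ?case using zi by (cases k) auto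
  next
    case (Cons j js)
    then show ?case using IH[of j] s by simp
  qed
  from this[of "[1..<Suc (r (fst x))]"]
  have "vsize (enc_g lg (ground z i l r (QQuant k x a) env)) \<le> 7 + r (fst x) * (L * qsize ls r a)"
    by (simp del: upt_Suc)
  moreover have "r (fst x) * (L * qsize ls r a) \<le> L * (copies r x * qsize ls r a)"
    by (simp add: copies_def)
  ultimately show ?case using s unfolding qsize.simps distrib_left mult_1_right by linarith
qed

text \<open>The \<open>E\<close> in the factor is the copy of the environment in each leaf; a
  negated letter formula yields two such leaves, hence \<open>2 * E\<close> in
  \<open>vsize_gneg_le\<close>.\<close>

lemma vsize_gz:
  assumes "vsize (enc_env env :: ('p, 'k) val) \<le> E"
  shows "vsize (enc_g enc_b (gz env \<zeta>) :: ('p, 'k) val) + 9 \<le> (E + 40) * zeta_size \<zeta>"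
proof (induction \<zeta>)
  case (ZPil \<phi>)
  have p: "1 \<le> pil_size \<phi>" by (cases \<phi>) auto
  have "vsize (enc_g enc_b (gz env (ZPil \<phi>)) :: ('p, 'k) val) + 9 \<le> 12 + 9 * pil_size \<phi> + E"
    using assms vsize_enc_pil[of \<phi>, where 'k = 'k] by simp
  also have "\<dots> \<le> (E + 40) * pil_size \<phi>"
    unfolding distrib_right using p mult_le_mono2[OF p, of E] by linarith
  finally show ?case by simp
qed (simp add: distrib_left)

lemma vsize_gneg_le:
  assumes "vsize (enc_env env :: ('p, 'k) val) \<le> E"
  shows "vsize (enc_g enc_b (gneg env \<zeta> c) :: ('p, 'k) val) \<le> vsize (enc_g enc_b c :: ('p, 'k) val) + (2 * E + 40) * zeta_size \<zeta>"
proof (induction \<zeta> arbitrary: c)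
  case (ZPil \<phi>)
  have p: "1 \<le> pil_size \<phi>" by (cases \<phi>) auto
  have "vsize (enc_g enc_b (gneg env (ZPil \<phi>) c) :: ('p, 'k) val) \<le> 31 + 9 * pil_size \<phi> + 2 * E + vsize (enc_g enc_b c :: ('p, 'k) val)"
    using assms vsize_enc_pil[of \<phi>, where 'k = 'k] by (simp add:  node_def)
  also have "31 + 9 * pil_size \<phi> + 2 * E \<le> (2 * E + 40) * pil_size \<phi>"
    unfolding distrib_right using p mult_le_mono2[OF p, of "2 * E"] by linarith
  finally show ?case by simp
next
  case (ZCat \<zeta> \<zeta>')
  show ?case using ZCat.IH(1)[of "gneg env \<zeta>' c"] ZCat.IH(2)[of c] by (simp add: distrib_left)
qed

lemma vsize_groundF:
  assumes "vsize (enc_env env :: ('p, 'k) val) + 8 * qdep ldF (toqF \<psi>) \<le> E"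
  shows "vsize (enc_g enc_b (groundF r (toqF \<psi>) env) :: ('p, 'k) val) + 9 \<le> (2 * E + 40) * foeil_size r \<psi>"
proof -
  have E: "vsize (enc_g enc_b (groundE_leaf d env) :: ('p, 'k) val) + 9 \<le> (2 * E + 40) * lsE d"
    if "vsize (enc_env env :: ('p, 'k) val) + 8 * 0 \<le> E" for d :: "bool \<times> ('p \<times> var) zeta" and env
  proof (cases "fst d")
    case True
    have "(E + 40) * zeta_size (snd d) \<le> (2 * E + 40) * zeta_size (snd d)" by (rule mult_le_mono1) simp
    from le_trans[OF vsize_gz this] show ?thesis using that True by (simp add: groundE_leaf_def lsE_def)
  next
    case False
    then show ?thesis
      using vsize_gneg_le[of env E "snd d" "GWrap False (GLeaf (BConst True))", where 'k = 'k] that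
      by (simp add: groundE_leaf_def lsE_def  distrib_left)
  qed
  have F: "vsize (enc_g enc_b (groundF_leaf r d env) :: ('p, 'k) val) + 9 \<le> (2 * E + 40) * lsF d"
    if "vsize (enc_env env :: ('p, 'k) val) + 8 * ldF d \<le> E" for d :: "'p fleaf" and env
  proof (cases d)
    case (LEpil \<phi>)
    have "vsize (enc_g enc_b (groundE r (toqE \<phi>) env) :: ('p, 'k) val) + 9 \<le> (2 * E + 40) * qsize lsE r (toqE \<phi>)"
      by (rule vsize_ground[OF E]) (use that LEpil in auto)
    then show ?thesis using LEpil by (simp add: epil_size_eq[of \<phi> r])
  qed simp
  show ?thesis unfolding foeil_size_eq
    by (rule vsize_ground[OF F _ _ _ _ assms]) auto
qed

lemma vsize_groundW:
  fixes \<psi> :: "('p, 'k :: {comm_semiring_0, comm_monoid_mult}) wfoeil"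
  assumes "vsize (enc_env env :: ('p, 'k) val) + 8 * qdep ldW (toqW \<psi>) \<le> E"
  shows "vsize (enc_g enc_w (groundW r (toqW \<psi>) env)) + 7 \<le> (2 * E + 40) * wfoeil_size r \<psi>"
proof -
  have W: "vsize (enc_g enc_w (groundW_leaf r d env :: ('p, 'k) wleaf gexp)) + 7 \<le> (2 * E + 40) * lsW r d"
    if "vsize (enc_env env :: ('p, 'k) val) + 8 * ldW d \<le> E" for d :: "'k + 'p foeil" and env
  proof (cases d)
    case (Inr \<psi>)
    then show ?thesis using vsize_groundF[of env \<psi> E r, where 'k = 'k] that
      by (simp add: groundW_leaf_def ldW_def lsW_def)
  qed (simp add: groundW_leaf_def lsW_def)
  show ?thesis unfolding wfoeil_size_eq
    by (rule vsize_ground[OF W _ _ _ _ assms]) auto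
qed

text \<open>A crude estimate of height by size; the exponent of the running time may be polynomial
  in the input.\<close>

lemma ghgt_le_vsize:
  assumes "\<And>d. d \<in> set_gexp e \<Longrightarrow> lh d \<le> C * vsize (lg d)" "3 \<le> C"
  shows "ghgt lh e \<le> C * vsize (enc_g lg e)"
  using assms by (induction e) (auto simp: algebra_simps max_def intro: le_trans add_mono)

lemma pil_size_le: "pil_size \<phi> \<le> vsize (enc_pil \<phi> :: ('p, 'k) val)"
  by (induction \<phi>) (auto simp: node_def)

lemma ghgt_hgt_w: "ghgt hgt_w e \<le> 7 * vsize (enc_g enc_w e :: ('p, 'k) val)"
proof (rule ghgt_le_vsize)
  have b: "ghgt hgt_b e \<le> 4 * vsize (enc_g enc_b e :: ('p, 'k) val)" for e :: "'p bleaf gexp"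
  proof (rule ghgt_le_vsize)
    fix d :: "'p bleaf"
    show "hgt_b d \<le> 4 * vsize (enc_b d :: ('p, 'k) val)"
    proof (cases d)
      case (BLit \<phi> env)
      then show ?thesis using pil_size_le[of \<phi>, where 'k = 'k] by simp
    qed simp
  qed simp
  fix d :: "('p, 'k) wleaf"
  show "hgt_w d \<le> 7 * vsize (enc_w d)"
  proof (cases d)
    case (VDet f)
    then show ?thesis using b[of f] by simp
  qed simp
qed simp

section \<open>Sizes of the state lists\<close>

lemma vsize_vlist_map_VPair_eq: "vsize x = 1 \<Longrightarrow> vsize (vlist (map (VPair x) xs)) = vsize (vlist xs) + 2 * length xs"
  by (induction xs) auto

lemma vsize_append: "vsize (vlist (us @ vs)) + 1 = vsize (vlist us) + vsize (vlist vs)"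
  by (induction us) auto

lemma vsize_pairl_le: "vsize (vlist (pairl xs ys)) \<le> vsize (vlist xs) * vsize (vlist ys)"
proof (induction xs)
  case Nil
  show ?case using vsize_pos[of "vlist ys"] by (simp add: pairl_def)
next
  case (Cons x xs)
  have "vsize (vlist (map (VPair x) ys)) \<le> (1 + vsize x) * vsize (vlist ys)"
  proof (induction ys)
    case (Cons y ys)
    have "vsize x * 1 \<le> vsize x * vsize y" using vsize_pos[of y] by (intro mult_le_mono2) simp
    moreover have "(1 + vsize x) * vsize (vlist (y # ys)) =
        (1 + vsize x) * vsize (vlist ys) + 1 + vsize y + vsize x + vsize x * vsize y"
      by (simp add: algebra_simps)
    moreover have "vsize (vlist (map (VPair x) (y # ys))) = 2 + vsize x + vsize y + vsize (vlist (map (VPair x) ys))"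
      by simp
    ultimately show ?case using Cons vsize_pos[of x] by linarith
  qed simp
  then show ?case using Cons vsize_append[of "map (VPair x) ys" "pairl xs ys"]
    by (simp add: pairl_def distrib_right)
qed

lemma states_ge3: "aut_ok A \<Longrightarrow> 3 \<le> vsize (vlist (astates A))"
  using length_le_vsize[of "astates A"] by (cases "astates A") (auto simp: aut_ok_def)

lemma states_bin_le:
  assumes "aut_ok A" "aut_ok A'"
  shows "vsize (vlist (astates (bin_aut op A A'))) \<le> 2 * (vsize (vlist (astates A)) * vsize (vlist (astates A')))"
proof -
  let ?a = "vsize (vlist (astates A))" and ?b = "vsize (vlist (astates A'))"
  have ab: "3 \<le> ?a" "3 \<le> ?b" using assms by (auto intro: states_ge3)
  have "3 * ?b \<le> ?a * ?b" "?a * 3 \<le> ?a * ?b" using ab by (auto intro: mult_le_mono)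
  then have sum: "2 * ?a + 2 * ?b \<le> 2 * (?a * ?b)" by linarith
  have p: "vsize (vlist (pairl (astates A) (astates A'))) \<le> 2 * (?a * ?b)"
    using vsize_pairl_le[of "astates A" "astates A'"] by simp
  have u: "vsize (vlist (map tagL (astates A) @ map tagR (astates A'))) + 3 \<le> 2 * ?a + 2 * ?b"
    using vsize_append[of "map tagL (astates A)" "map tagR (astates A')"]
      length_le_vsize[of "astates A"] length_le_vsize[of "astates A'"]
    by (simp add: vsize_vlist_map_VPair_eq)
  show ?thesis using sum p u by (cases op) auto
qed

lemma states_unary_le:
  assumes "aut_ok A"
  shows "vsize (vlist (VNil # map tagL (astates A))) \<le> 4 * vsize (vlist (astates A))"
  using states_ge3[OF assms] length_le_vsize[of "astates A"] by (simp add: vsize_vlist_map_VPair_eq)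

text \<open>An operation multiplies the sizes up to a constant factor, and the constants are paid by
  the symbols it adds to the code. Without determinization one exponential suffices.\<close>

lemma states_baut_le:
  "vsize (vlist (astates (baut e :: ('p, 'k :: {comm_semiring_0, comm_monoid_mult}, ('p \<times> nat) set, bool) vaut)))
    \<le> 2 ^ vsize (enc_g enc_b e :: ('p, 'k) val)"
proof (induction e)
  case (GLeaf d)
  have "2 ^ 3 \<le> (2 :: nat) ^ vsize (enc_b d :: ('p, 'k) val)"
    by (rule power_increasing) (cases d, auto)
  then show ?case by (cases d) auto
next
  case (GWrap c e)
  have "aut_ok (baut e :: ('p, 'k, ('p \<times> nat) set, bool) vaut)" using baut_correct by blast
  from states_unary_le[OF this] GWrap show ?case by (simp add: power_add)
next
  case (GPlus e)
  have "aut_ok (baut e :: ('p, 'k, ('p \<times> nat) set, bool) vaut)" using baut_correct by blast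
  from states_unary_le[OF this] GPlus show ?case by (simp add: power_add)
next
  case (GBin op e e')
  let ?a = "vsize (vlist (astates (baut e :: ('p, 'k, ('p \<times> nat) set, bool) vaut)))"
    and ?b = "vsize (vlist (astates (baut e' :: ('p, 'k, ('p \<times> nat) set, bool) vaut)))"
  have ok: "aut_ok (baut e :: ('p, 'k, ('p \<times> nat) set, bool) vaut)"
    "aut_ok (baut e' :: ('p, 'k, ('p \<times> nat) set, bool) vaut)" using baut_correct by blast+
  have "?a * ?b \<le> 2 ^ vsize (enc_g enc_b e :: ('p, 'k) val) * 2 ^ vsize (enc_g enc_b e' :: ('p, 'k) val)"
    using GBin by (intro mult_le_mono)
  then show ?case using states_bin_le[OF ok, of op] by (simp add: power_add)
qed

lemma vsize_vlist_le:
  "(\<And>x. x \<in> set xs \<Longrightarrow> vsize x \<le> m) \<Longrightarrow> vsize (vlist xs) \<le> 1 + length xs * (1 + m)"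
  by (induction xs) (fastforce simp: algebra_simps)+

lemma states_det_le:
  fixes A :: "('p, 'k, 'a, bool) vaut"
  assumes "vsize (vlist (astates A)) \<le> m"
  shows "vsize (vlist (astates (det_aut A :: ('p, 'k, 'a, 's :: {comm_semiring_0, comm_monoid_mult}) vaut))) \<le> 2 ^ (2 * m)"
proof -
  have sub: "vsize (vlist ys) \<le> vsize (vlist xs)" if "ys \<in> set (subseqs xs)" for xs ys :: "('p, 'k) val list"
    using that
  proof (induction xs arbitrary: ys)
    case (Cons x xs)
    then consider "ys \<in> set (subseqs xs)" | zs where "ys = x # zs" "zs \<in> set (subseqs xs)"
      by (auto simp: Let_def)
    then show ?case
    proof cases
      case 1
      then show ?thesis using Cons.IH[of ys] by simp
    next
      case 2
      then show ?thesis using Cons.IH[of zs] by simp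
    qed
  qed simp
  have "vsize x \<le> m" if "x \<in> set (map vlist (subseqs (astates A)))" for x :: "('p, 'k) val"
    using that sub assms by (auto intro: le_trans)
  from vsize_vlist_le[of "map vlist (subseqs (astates A))", OF this]
  have "vsize (vlist (astates (det_aut A :: ('p, 'k, 'a, 's :: {comm_semiring_0, comm_monoid_mult}) vaut))) \<le> 1 + 2 ^ length (astates A) * (1 + m)"
    by (simp add: length_subseqs)
  also have "\<dots> \<le> 2 ^ length (astates A) * (2 + m)"
    by (simp add: algebra_simps)
  \<comment> \<open>There are fewer than \<open>m\<close> states, and the factor 2 gained this way
    makes the exponent exactly \<open>2 * m\<close>.\<close>
  also have "\<dots> \<le> 2 ^ (m - 1) * (2 * 2 ^ m)"
  proof (intro mult_le_mono power_increasing)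
    show "length (astates A) \<le> m - 1" using length_le_vsize[of "astates A"] assms by simp
    have "m < 2 ^ m" "1 \<le> (2 :: nat) ^ m" by (rule less_exp) simp
    then show "2 + m \<le> 2 * 2 ^ m" by linarith
  qed simp
  also have "\<dots> = 2 ^ (2 * m)"
  proof -
    have "1 \<le> m" using assms vsize_pos[of "vlist (astates A)"] by linarith
    then have "2 * m = (m - 1) + (1 + m)" by simp
    then show ?thesis by (simp only: power_add) simp
  qed
  finally show ?thesis .
qed

lemma two_plus_le: "2 + 2 ^ a \<le> (2 :: nat) ^ (a + 2)"
proof -
  have "1 \<le> (2 :: nat) ^ a" by simp
  then have "2 + 2 ^ a \<le> 4 * (2 :: nat) ^ a" by linarith
  then show ?thesis by (simp add: power_add)
qed

text \<open>Determinized leaves cause the second exponential. Above them the inner powers of 2 are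
  added, and their sum stays below one power of 2 with the code sizes added.\<close>

lemma states_waut_le:
  fixes e :: "('p, 'k :: {comm_semiring_0, comm_monoid_mult}) wleaf gexp"
  shows "vsize (vlist (astates (waut e))) \<le> 2 ^ (2 ^ vsize (enc_g enc_w e))"
proof (induction e)
  case (GLeaf d)
  show ?case
  proof (cases d)
    case (VConst k)
    have "2 ^ 2 \<le> (2 :: nat) ^ (2 ^ vsize (enc_w d))" by (intro power_increasing) (simp_all add: VConst)
    then show ?thesis by (simp add: VConst)
  next
    case (VDet f)
    have "2 * 2 ^ vsize (enc_g enc_b f :: ('p, 'k) val) \<le> (2 :: nat) ^ vsize (enc_w d)"
      by (simp add: VDet power_add)
    then have "(2 :: nat) ^ (2 * 2 ^ vsize (enc_g enc_b f :: ('p, 'k) val)) \<le> 2 ^ (2 ^ vsize (enc_w d))"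
      by (intro power_increasing) simp_all
    then show ?thesis
      using states_det_le[OF states_baut_le[of f], where 's = 'k] VDet by (auto intro: le_trans)
  qed
next
  case (GWrap c e)
  let ?s = "vsize (enc_g enc_w e)"
  have "aut_ok (waut e)" using waut_correct by blast
  from states_unary_le[OF this] GWrap have "vsize (vlist (astates (waut (GWrap c e)))) \<le> 2 ^ 2 * 2 ^ (2 ^ ?s)" by simp
  also have "\<dots> = 2 ^ (2 + 2 ^ ?s)" by (rule power_add[symmetric])
  also have "\<dots> \<le> 2 ^ (2 ^ vsize (enc_g enc_w (GWrap c e)))"
    by (intro power_increasing order_trans[OF two_plus_le]) simp_all
  finally show ?case .
next
  case (GPlus e)
  let ?s = "vsize (enc_g enc_w e)"
  have "aut_ok (waut e)" using waut_correct by blast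
  from states_unary_le[OF this] GPlus have "vsize (vlist (astates (waut (GPlus e)))) \<le> 2 ^ 2 * 2 ^ (2 ^ ?s)" by simp
  also have "\<dots> = 2 ^ (2 + 2 ^ ?s)" by (rule power_add[symmetric])
  also have "\<dots> \<le> 2 ^ (2 ^ vsize (enc_g enc_w (GPlus e)))"
    by (intro power_increasing order_trans[OF two_plus_le]) simp_all
  finally show ?case .
next
  case (GBin op e e')
  let ?s = "vsize (enc_g enc_w e)" and ?s' = "vsize (enc_g enc_w e')"
  have ok: "aut_ok (waut e)" "aut_ok (waut e')" using waut_correct by blast+
  have "vsize (vlist (astates (waut e))) * vsize (vlist (astates (waut e'))) \<le> 2 ^ (2 ^ ?s) * 2 ^ (2 ^ ?s')"
    using GBin by (intro mult_le_mono)
  with states_bin_le[OF ok, of op]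
  have "vsize (vlist (astates (waut (GBin op e e')))) \<le> 2 * (2 ^ (2 ^ ?s) * 2 ^ (2 ^ ?s'))" by simp
  also have "\<dots> = 2 ^ (1 + (2 ^ ?s + 2 ^ ?s'))" by (simp add: power_add)
  also have "\<dots> \<le> 2 ^ (2 ^ vsize (enc_g enc_w (GBin op e e')))"
  proof (intro power_increasing)
    have "(2 :: nat) ^ ?s \<le> 2 ^ ?s * 2 ^ ?s'" "(2 :: nat) ^ ?s' \<le> 2 ^ ?s * 2 ^ ?s'" "1 \<le> (2 :: nat) ^ (?s + ?s')" by simp_all
    then have "1 + (2 ^ ?s + 2 ^ ?s') \<le> 8 * (2 :: nat) ^ (?s + ?s')" unfolding power_add by linarith
    then show "1 + (2 ^ ?s + 2 ^ ?s') \<le> (2 :: nat) ^ vsize (enc_g enc_w (GBin op e e'))"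
      by (simp add: power_add)
  qed simp
  finally show ?case .
qed

section \<open>Sizes of component types, alphabet and tables\<close>

lemma vsize_types:
  fixes B :: "('p, 'k :: {comm_semiring_0, comm_monoid_mult}) pwcomp"
  assumes pl: "lists_ports B pl"
  shows "vsize (vlist (map (enc_type B pl r) [1..<Suc (ntypes B)])) \<le> 1 + 8 * comp_size B r"
proof -
  have p: "length (pl i) = card (ports B i)" if "i \<in> {1..ntypes B}" for i
    using pl that by (metis distinct_card lists_ports_def)
  have v: "vsize (vlist (map (\<lambda>p. VPair (VPort p) (VWt (f p))) ps) :: ('p, 'k) val) = 1 + 4 * length ps" for f ps
    by (induction ps) auto
  have "1 + vsize (enc_type B pl r i) \<le> 8 * ((1 + card (ports B i)) * (1 + r i))" if "i \<in> {1..ntypes B}" for i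
    using vsize_vlist_leaves[of "[1..<Suc (r i)]" "VNum :: nat \<Rightarrow> ('p, 'k) val"]
    by (simp add: enc_type_def v p[OF that] algebra_simps del: upt_Suc)
  then have "(\<Sum>i = 1..ntypes B. 1 + vsize (enc_type B pl r i)) \<le> 8 * comp_size B r"
    unfolding comp_size_def sum_distrib_left by (intro sum_mono) blast
  moreover have "(\<Sum>i\<leftarrow>[1..<Suc (ntypes B)]. 1 + vsize (enc_type B pl r i)) = (\<Sum>i = 1..ntypes B. 1 + vsize (enc_type B pl r i))"
    by (simp only: interv_sum_list_conv_sum_set_nat) (auto intro!: sum.cong)
  ultimately show ?thesis by (simp add: vsize_vlist o_def del: upt_Suc)
qed

lemma prod_letters_le: "(\<Prod>i = 1..ntypes B. (card (ports B i) + 1) ^ r i) \<le> 2 ^ comp_size B r"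
proof -
  have "(card (ports B i) + 1) ^ r i \<le> 2 ^ ((1 + card (ports B i)) * (1 + r i))" for i
  proof -
    have "card (ports B i) + 1 \<le> 2 ^ card (ports B i)" using less_exp[of "card (ports B i)"] by linarith
    then have "(card (ports B i) + 1) ^ r i \<le> (2 ^ card (ports B i)) ^ r i" by (rule power_mono) simp
    also have "\<dots> = 2 ^ (card (ports B i) * r i)" by (simp add: power_mult)
    also have "\<dots> \<le> 2 ^ ((1 + card (ports B i)) * (1 + r i))" by (intro power_increasing mult_le_mono) auto
    finally show ?thesis .
  qed
  then show ?thesis unfolding comp_size_def power_sum by (intro prod_mono) auto
qed

lemma length_slots_le: "length (slots pl r [1..<Suc (ntypes B)]) \<le> comp_size B r"
proof -
  have "length (slots pl r [1..<Suc (ntypes B)]) = (\<Sum>i = 1..ntypes B. r i)"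
    by (simp only: slots_def length_concat map_map o_def length_map length_upt diff_Suc_1
        interv_sum_list_conv_sum_set_nat) (auto intro!: sum.cong)
  also have "\<dots> \<le> comp_size B r" unfolding comp_size_def by (intro sum_mono) (simp add: distrib_left distrib_right)
  finally show ?thesis .
qed

lemma vsize_letters:
  assumes B: "is_pwcomp B" and pl: "lists_ports B pl" and n: "comp_size B r \<le> n"
  shows "vsize (enc_letters (all_letters pl r [1..<Suc (ntypes B)]) :: ('p, 'k) val) \<le> 2 ^ (2 * n + 3)"
proof -
  let ?ls = "all_letters pl r [1..<Suc (ntypes B)]"
  have v: "vsize (enc_letter l :: ('p, 'k) val) = 1 + 4 * length l" for l
    unfolding enc_letter_def by (induction l) auto
  have "vsize x \<le> 1 + 4 * n" if x: "x \<in> set (map enc_letter ?ls :: ('p, 'k) val list)" for x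
  proof -
    from x obtain l where l: "l \<in> set ?ls" "x = enc_letter l" by auto
    have "length l \<le> length (slots pl r [1..<Suc (ntypes B)])"
      using slot_letters_props(1)[OF slots_ok_slots[OF B pl, of r]] l(1) unfolding all_letters_eq by blast
    then show ?thesis using length_slots_le[of pl r B] n by (simp add: l(2) v)
  qed
  from vsize_vlist_le[of "map enc_letter ?ls", OF this]
  have "vsize (enc_letters ?ls :: ('p, 'k) val) \<le> 1 + length ?ls * (2 + 4 * n)"
    by (simp add: enc_letters_def)
  also have "1 + length ?ls * (2 + 4 * n) \<le> 1 + 2 ^ n * (2 + 4 * n)"
  proof (intro add_mono mult_le_mono1 order_refl)
    show "length ?ls \<le> 2 ^ n"
      unfolding length_all_letters[OF pl] using prod_letters_le[of B r] power_increasing[OF n, of "2 :: nat"] by linarith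
  qed
  also have "1 + 2 ^ n * (2 + 4 * n) \<le> 2 ^ n * (3 + 4 * n)" by (simp add: algebra_simps)
  also have "\<dots> \<le> 2 ^ n * (8 * 2 ^ n)"
  proof (rule mult_le_mono2)
    have "n < 2 ^ n" "1 \<le> (2 :: nat) ^ n" by (rule less_exp) simp
    then show "3 + 4 * n \<le> 8 * 2 ^ n" by linarith
  qed
  also have "\<dots> = 2 ^ (n + (3 + n))" by (simp only: power_add) simp
  also have "n + (3 + n) = 2 * n + 3" by simp
  finally show ?thesis .
qed

lemma vsize_tab:
  fixes A :: "('p, 'k, ('p \<times> nat) set, 'k :: {comm_semiring_0, comm_monoid_mult}) vaut"
  assumes M: "vsize (vlist (astates A)) \<le> M"
  shows "vsize (tab_val A ls) \<le> vsize (enc_letters ls :: ('p, 'k) val) * (2 + M * M)"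
proof -
  have mat: "vsize (mat_val A ps) \<le> M * M" for ps
  proof -
    let ?N = "length (astates A)"
    have "2 * ?N + 1 \<le> M" using length_le_vsize[of "astates A"] M by linarith
    then have "(2 * ?N + 1) * (2 * ?N + 1) \<le> M * M" by (rule mult_le_mono) (use \<open>2 * ?N + 1 \<le> M\<close> in simp)
    then show ?thesis by (simp add: vsize_mat_val algebra_simps)
  qed
  show ?thesis
  proof (induction ls)
    case Nil
    then show ?case by (simp add: tab_val_def enc_letters_def)
  next
    case (Cons l ls)
    let ?l = "vsize (enc_letter l :: ('p, 'k) val)"
    have "vsize (tab_val A (l # ls)) \<le> 2 + ?l + vsize (mat_val A l) + vsize (tab_val A ls)"
      by (simp add: tab_val_def)
    also have "\<dots> \<le> (2 + ?l + M * M) + vsize (enc_letters ls :: ('p, 'k) val) * (2 + M * M)"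
      using Cons mat[of l] by linarith
    also have "2 + ?l + M * M \<le> (1 + ?l) * (2 + M * M)" by (simp add: algebra_simps)
    finally show ?case by (simp add: enc_letters_def distrib_right)
  qed
qed

section \<open>Total running time\<close>

lemma add_le_power2:
  assumes "x \<le> 2 ^ a" "y \<le> 2 ^ b" "1 \<le> a" "1 \<le> b"
  shows "x + y \<le> (2 :: nat) ^ (a + b)"
proof -
  have "2 ^ 1 \<le> (2 :: nat) ^ a" "2 ^ 1 \<le> (2 :: nat) ^ b" using assms by (intro power_increasing; simp)+
  then have "2 \<le> (2 :: nat) ^ a" "2 \<le> (2 :: nat) ^ b" by simp_all
  then have "2 * 2 ^ b \<le> 2 ^ a * (2 :: nat) ^ b" "2 ^ a * 2 \<le> 2 ^ a * (2 :: nat) ^ b"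
    by (intro mult_le_mono; simp)+
  then show ?thesis using assms(1,2) unfolding power_add by linarith
qed

lemma input_size_ge2:
  assumes "is_pwcomp B"
  shows "2 \<le> input_size B r \<psi>"
proof -
  have "{1..ntypes B} \<noteq> {}" using assms by (auto simp: is_pwcomp_def)
  moreover have "1 \<le> (1 + card (ports B i)) * (1 + r i)" for i by (simp add: algebra_simps)
  ultimately have "1 \<le> comp_size B r"
    unfolding comp_size_def using sum_mono[of "{1..ntypes B}" "\<lambda>i. 1" "\<lambda>i. (1 + card (ports B i)) * (1 + r i)"]
    by fastforce
  then show ?thesis using wfoeil_size_pos[of r \<psi>] by (simp add: input_size_def)
qed

text \<open>In the exponent, the first factor bounds the logarithm of \<open>U\<close> and the
  second the power of \<open>U\<close>. Only \<open>m\<close> depends on the size of the state list;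
  it is a double-exponential bound in general and a constant for letter formulas that this parameter
  has to cover.\<close>

lemma run_bounds:
  fixes B :: "('p, 'k :: {comm_semiring_0, comm_monoid_mult}) pwcomp" and pl :: "nat \<Rightarrow> 'p list" and r :: "nat \<Rightarrow> nat"
    and \<psi> :: "('p, 'k) wfoeil"
  defines "e \<equiv> groundW r (toqW \<psi>) []" and "n \<equiv> input_size B r \<psi>"
  assumes B: "is_pwcomp B" and pl: "lists_ports B pl" and sent: "is_sentence B \<psi>"
    and m: "vsize (vlist (astates (waut e))) \<le> 2 ^ m" "1 \<le> m"
  shows "\<exists>y t. runs prg (enc_input B pl r \<psi>) y t \<and> wfa_code (interactions B r) (wfa_of (waut e)) y \<and>
    t \<le> 2 ^ ((kappa prg + 182 * n ^ 2 + 3 * m) * (465 * n ^ 2)) \<and>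
    (\<Prod>i = 1..ntypes B. (card (ports B i) + 1) ^ r i) \<le> t"
proof -
  let ?is = "[1..<Suc (ntypes B)]"
  define tys where "tys = vlist (map (enc_type B pl r) ?is)"
  define ls where "ls = all_letters pl r ?is"
  define X where "X = 64 + kappa prg + vsize tys + vsize (enc_wfoeil \<psi>) + (1 + 8 * qdep ldW (toqW \<psi>)) + (vsize (enc_g enc_w e) + 5)"
  define V where "V = vsize (enc_letters ls :: ('p, 'k) val)"
  \<comment> \<open>Each size that has to lie below \<open>U\<close> is a summand of it.\<close>
  define U where "U = X + (2 ^ m + (V + vsize (tab_val (waut e) ls)))"
  define k where "k = qhgt lhW (toqW \<psi>) + ghgt hgt_w e + 37"
  have n: "comp_size B r \<le> n" "wfoeil_size r \<psi> \<le> n" "2 \<le> n"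
    using input_size_ge2[OF B] by (auto simp: n_def input_size_def)
  have nn: "n \<le> n ^ 2" "4 \<le> n ^ 2" using n(3) mult_le_mono[OF n(3) n(3)] by (auto simp: power2_eq_square)
  \<comment> \<open>Environments have size at most \<open>1 + 8 * n\<close> and are copied into the
    leaves, so the ground expression is quadratic in the size of the instance.\<close>
  have S: "vsize (enc_g enc_w e) + 7 \<le> 16 * n ^ 2 + 42 * n"
  proof -
    have "vsize (enc_env [] :: ('p, 'k) val) + 8 * qdep ldW (toqW \<psi>) \<le> 1 + 8 * n"
      using qdep_toqW[of \<psi> r] n(2) by (simp add: enc_env_def)
    from vsize_groundW[OF this, of r]
    have "vsize (enc_g enc_w e) + 7 \<le> (2 * (1 + 8 * n) + 40) * n"
      unfolding e_def by (rule le_trans) (use n(2) in simp)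
    also have "\<dots> = 16 * n ^ 2 + 42 * n" by (simp add: algebra_simps power2_eq_square)
    finally show ?thesis .
  qed
  have tys: "vsize tys \<le> 1 + 8 * n" unfolding tys_def using vsize_types[OF pl, of r] n(1) by linarith
  have X: "X \<le> kappa prg + 160 * n ^ 2"
    unfolding X_def using S tys vsize_enc_wfoeil[of \<psi> r] qdep_toqW[of \<psi> r] n nn by linarith
  have k: "k + 4 \<le> 465 * n ^ 2"
    unfolding k_def using qhgt_toqW[of \<psi> r] ghgt_hgt_w[of e] S n nn by linarith
  have V: "V \<le> 2 ^ (2 * n + 3)" unfolding V_def ls_def by (rule vsize_letters[OF B pl n(1)])
  have T: "vsize (tab_val (waut e) ls) \<le> 2 ^ ((2 * n + 3) + (2 * m + 2))"
  proof -
    have "2 + 2 ^ m * 2 ^ m \<le> (2 :: nat) ^ (2 * m + 2)"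
      using two_plus_le[of "2 * m"] by (simp add: mult_2 power_add)
    then have "V * (2 + 2 ^ m * 2 ^ m) \<le> 2 ^ (2 * n + 3) * 2 ^ (2 * m + 2)" by (intro mult_le_mono V)
    then show ?thesis using vsize_tab[OF m(1), of ls] unfolding V_def power_add by linarith
  qed
  have U: "U \<le> 2 ^ (X + (m + ((2 * n + 3) + ((2 * n + 3) + (2 * m + 2)))))"
    unfolding U_def
  proof (intro add_le_power2 T V)
    show "X \<le> 2 ^ X" using less_exp[of X] by simp
  qed (use m in \<open>auto simp: X_def\<close>)
  have large: "large prg U" unfolding large_def U_def X_def by simp
  have "computes prg U 0 (enc_input B pl r \<psi>) (wfa_val (waut e) ls) (k + 3)"
    by (rule comp_main[OF large sent, of pl r, folded tys_def ls_def e_def])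
      (use m in \<open>simp_all add: U_def X_def V_def k_def\<close>)
  moreover have "vsize (enc_input B pl r \<psi>) + 1 \<le> U ^ (k + 3)"
  proof -
    have "vsize (enc_input B pl r \<psi>) + 1 \<le> U"
      unfolding U_def X_def enc_input_def tys_def by (simp del: upt_Suc)
    also have "U ^ 1 \<le> U ^ (k + 3)" using large by (intro power_increasing) (auto simp: large_def)
    finally show ?thesis by simp
  qed
  ultimately obtain t where t: "runs prg (enc_input B pl r \<psi>) (wfa_val (waut e) ls) t" "t \<le> 2 * U ^ (k + 3)"
    using computes_runs by blast
  have "2 * U ^ (k + 3) \<le> U * U ^ (k + 3)" using large by (intro mult_le_mono1) (simp add: large_def)
  also have "\<dots> = U ^ (k + 4)" by (simp add: add.commute flip: power_Suc)
  also have "\<dots> \<le> (2 ^ (X + (m + ((2 * n + 3) + ((2 * n + 3) + (2 * m + 2)))))) ^ (k + 4)"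
    using U by (rule power_mono) simp
  also have "\<dots> = 2 ^ ((X + (m + ((2 * n + 3) + ((2 * n + 3) + (2 * m + 2))))) * (k + 4))"
    by (rule power_mult[symmetric])
  also have "\<dots> \<le> 2 ^ ((kappa prg + 182 * n ^ 2 + 3 * m) * (465 * n ^ 2))"
  proof (intro power_increasing mult_le_mono k)
    show "X + (m + ((2 * n + 3) + ((2 * n + 3) + (2 * m + 2)))) \<le> kappa prg + 182 * n ^ 2 + 3 * m"
      using X nn by linarith
  qed simp
  finally have time: "t \<le> 2 ^ ((kappa prg + 182 * n ^ 2 + 3 * m) * (465 * n ^ 2))" using t(2) by linarith
  note props = slot_letters_props[OF slots_ok_slots[OF B pl, of r], folded all_letters_eq, folded ls_def]
  have code: "wfa_code (interactions B r) (wfa_of (waut e)) (wfa_val (waut e) ls)"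
    using props interactions_eq[OF B pl, of r] unfolding ls_def[symmetric]
    by (intro wfa_code_wfa_val) auto
  \<comment> \<open>Time is at least the size of the output, which lists all nonempty letters; the
    empty one is made up for by the surplus of 1 in the size of a list.\<close>
  have "(\<Prod>i = 1..ntypes B. (card (ports B i) + 1) ^ r i) = length ls"
    unfolding ls_def by (rule length_all_letters[OF pl, symmetric])
  also have "\<dots> \<le> vsize (tab_val (waut e) ls)"
    using length_le_filter[of ls] length_tab_val[of ls "waut e"] conjunct1[OF props(3)[unfolded distinct_map]] by linarith
  also have "\<dots> \<le> vsize (wfa_val (waut e) ls)" by (simp add: wfa_val_def)
  also have "\<dots> \<le> t" using t(1) unfolding runs_def by (rule vsize_le_time)
  finally show ?thesis using t(1) code time by blast
qed

text \<open>Provides best-case sentences of every size, by iterated negation of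
  \<open>PTrue\<close>.\<close>

lemma ex_pil_size: "\<exists>\<phi> :: 'v pil. pil_size \<phi> = Suc s \<and> set_pil \<phi> = {}"
proof (induction s)
  case 0
  show ?case by (rule exI[of _ PTrue]) simp
next
  case (Suc s)
  then obtain \<phi> :: "'v pil" where "pil_size \<phi> = Suc s" "set_pil \<phi> = {}" by blast
  then show ?case by (intro exI[of _ "PNot \<phi>"]) simp
qed

theorem theorem7p15:
  shows "\<exists>(prg :: program) (c :: nat) (d :: nat).
    \<forall>(B :: ('p, 'k :: {comm_semiring_0, comm_monoid_mult}) pwcomp) (pl :: nat \<Rightarrow> 'p list)
      (r :: nat \<Rightarrow> nat).
      is_pwcomp B \<and> lists_ports B pl \<longrightarrow>
        (\<forall>\<psi> :: ('p, 'k) wfoeil. is_sentence B \<psi> \<longrightarrow>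
          (\<exists>(A :: (nat, ('p \<times> nat) set, 'k) wfa) y t.
             runs prg (enc_input B pl r \<psi>) y t \<and>
             wfa_code (interactions B r) A y \<and>
             (\<forall>w \<in> nonempty_words (interactions B r). sentence_sem r \<psi> w = behavior A w) \<and>
             t \<le> 2 ^ (2 ^ (c * input_size B r \<psi> ^ d)) \<and>
             (\<Prod>i = 1..ntypes B. (card (ports B i) + 1) ^ r i) \<le> t)) \<and>
        (\<forall>s \<ge> 1. \<exists>(\<psi> :: ('p, 'k) wfoeil) y t.
             is_sentence B \<psi> \<and> wfoeil_size r \<psi> = s \<and>
             runs prg (enc_input B pl r \<psi>) y t \<and>
             t \<le> 2 ^ (c * input_size B r \<psi> ^ d))"
proof (rule exI[of _ prg], rule exI[of _ "465 * (kappa prg + 707)"], rule exI[of _ 4],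
    (intro allI impI conjI; elim conjE))
  fix B :: "('p, 'k) pwcomp" and pl :: "nat \<Rightarrow> 'p list" and r :: "nat \<Rightarrow> nat" and \<psi> :: "('p, 'k) wfoeil"
  assume B: "is_pwcomp B" and pl: "lists_ports B pl" and sent: "is_sentence B \<psi>"
  define e where "e = groundW r (toqW \<psi>) []"
  define n where "n = input_size B r \<psi>"
  define K where "K = kappa prg"
  have n: "2 \<le> n" using input_size_ge2[OF B] by (simp add: n_def)
  then have nn: "n \<le> n ^ 2" "1 \<le> n ^ 2" using mult_le_mono[OF n n] by (auto simp: power2_eq_square)
  \<comment> \<open>The constant is \<open>58 = 16 + 42\<close>, from the quadratic and the linear
    term.\<close>
  have S: "vsize (enc_g enc_w e) \<le> 58 * n ^ 2"
  proof -
    have w: "wfoeil_size r \<psi> \<le> n" by (simp add: n_def input_size_def)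
    have "vsize (enc_env [] :: ('p, 'k) val) + 8 * qdep ldW (toqW \<psi>) \<le> 1 + 8 * n"
      using qdep_toqW[of \<psi> r] w by (simp add: enc_env_def)
    from vsize_groundW[OF this, of r]
    have "vsize (enc_g enc_w e) + 7 \<le> (2 * (1 + 8 * n) + 40) * n"
      unfolding e_def by (rule le_trans) (use w in simp)
    also have "\<dots> = 16 * n ^ 2 + 42 * n" by (simp add: algebra_simps power2_eq_square)
    finally show ?thesis using nn by linarith
  qed
  have "vsize (vlist (astates (waut e))) \<le> 2 ^ (2 ^ vsize (enc_g enc_w e))" by (rule states_waut_le)
  also have "\<dots> \<le> 2 ^ (2 ^ (58 * n ^ 2))" using S by (intro power_increasing) auto
  finally have m: "vsize (vlist (astates (waut (groundW r (toqW \<psi>) [])))) \<le> 2 ^ (2 ^ (58 * n ^ 2))"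
    by (simp add: e_def)
  obtain y t where y: "runs prg (enc_input B pl r \<psi>) y t" "wfa_code (interactions B r) (wfa_of (waut e)) y"
    "t \<le> 2 ^ ((K + 182 * n ^ 2 + 3 * 2 ^ (58 * n ^ 2)) * (465 * n ^ 2))"
    "(\<Prod>i = 1..ntypes B. (card (ports B i) + 1) ^ r i) \<le> t"
    using run_bounds[OF B pl sent m] unfolding e_def n_def K_def by auto
  \<comment> \<open>By \<open>x \<le> 2 ^ x\<close> the polynomial factors become powers of 2, so
    that all exponents add up on the second level.\<close>
  have "(K + 182 * n ^ 2 + 3 * 2 ^ (58 * n ^ 2)) * (465 * n ^ 2) \<le>
      2 ^ ((K + 182 * n ^ 2) + (58 * n ^ 2 + 2)) * 2 ^ (465 * n ^ 2)"
  proof (intro mult_le_mono less_imp_le[OF less_exp])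
    have "3 * 2 ^ (58 * n ^ 2) \<le> (2 :: nat) ^ (58 * n ^ 2 + 2)" by (simp add: power_add)
    then show "K + 182 * n ^ 2 + 3 * 2 ^ (58 * n ^ 2) \<le> 2 ^ ((K + 182 * n ^ 2) + (58 * n ^ 2 + 2))"
      by (rule add_le_power2[OF less_imp_le[OF less_exp]]) (use nn in simp_all)
  qed
  also have "\<dots> = 2 ^ ((K + 182 * n ^ 2) + (58 * n ^ 2 + 2) + 465 * n ^ 2)" by (simp only: power_add)
  \<comment> \<open>\<open>707 = 182 + 58 + 2 + 465\<close> sums up the exponents. The factor 465
    and the degree 4 come from the best case, where two quadratic bounds are multiplied.\<close>
  also have "\<dots> \<le> 2 ^ (465 * (K + 707) * n ^ 4)"
  proof (intro power_increasing)
    have "(K + 182 * n ^ 2) + (58 * n ^ 2 + 2) + 465 * n ^ 2 \<le> K * n ^ 2 + 707 * n ^ 2"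
      using nn mult_le_mono2[OF nn(2), of K] by linarith
    also have "\<dots> = (K + 707) * n ^ 2" by (rule distrib_right[symmetric])
    also have "\<dots> \<le> (465 * (K + 707)) * n ^ 4" using n by (intro mult_le_mono power_increasing) auto
    finally show "(K + 182 * n ^ 2) + (58 * n ^ 2 + 2) + 465 * n ^ 2 \<le> 465 * (K + 707) * n ^ 4" .
  qed simp
  finally have "(2 :: nat) ^ ((K + 182 * n ^ 2 + 3 * 2 ^ (58 * n ^ 2)) * (465 * n ^ 2)) \<le> 2 ^ (2 ^ (465 * (K + 707) * n ^ 4))"
    by (intro power_increasing) auto
  then have "t \<le> 2 ^ (2 ^ (465 * (kappa prg + 707) * input_size B r \<psi> ^ 4))"
    using y(3) unfolding n_def K_def by linarith
  moreover have "sentence_sem r \<psi> w = behavior (wfa_of (waut e)) w" if "w \<in> nonempty_words (interactions B r)" for w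
    unfolding e_def using that by (intro sentence_sem_eq_behavior) (simp add: nonempty_words_def)
  ultimately show "\<exists>A y t. runs prg (enc_input B pl r \<psi>) y t \<and> wfa_code (interactions B r) A y \<and>
      (\<forall>w \<in> nonempty_words (interactions B r). sentence_sem r \<psi> w = behavior A w) \<and>
      t \<le> 2 ^ (2 ^ (465 * (kappa prg + 707) * input_size B r \<psi> ^ 4)) \<and>
      (\<Prod>i = 1..ntypes B. (card (ports B i) + 1) ^ r i) \<le> t"
    using y by (intro exI[of _ "wfa_of (waut e)"] exI[of _ y] exI[of _ t]) auto
next
  fix B :: "('p, 'k) pwcomp" and pl :: "nat \<Rightarrow> 'p list" and r :: "nat \<Rightarrow> nat" and s :: nat
  assume B: "is_pwcomp B" and pl: "lists_ports B pl" and s: "1 \<le> s"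
  from s obtain s' where s': "s = Suc s'" by (cases s) auto
  obtain \<phi> :: "('p \<times> var) pil" where \<phi>: "pil_size \<phi> = s" "set_pil \<phi> = {}"
    unfolding s' using ex_pil_size[of s'] by (elim exE conjE)
  define \<psi> :: "('p, 'k) wfoeil" where "\<psi> = WBool (FEpil (EPos (ZPil \<phi>)))"
  define n where "n = input_size B r \<psi>"
  define K where "K = kappa prg"
  have sent: "is_sentence B \<psi>" by (simp add: \<psi>_def is_sentence_def \<phi>)
  \<comment> \<open>The automaton of a letter formula has two states whatever the size of the
    formula. Its state list has size 5, which gives \<open>m = 10\<close> after
    determinization.\<close>
  have "vsize (vlist (astates (lit_aut P :: ('p, 'k, ('p \<times> nat) set, bool) vaut))) \<le> 5" for P by simp
  from states_det_le[OF this]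
  have m: "vsize (vlist (astates (waut (groundW r (toqW \<psi>) [])))) \<le> 2 ^ 10"
    by (simp add: \<psi>_def groundW_leaf_def groundE_leaf_def del: lit_aut_simps det_aut_simps)
  obtain y t where y: "runs prg (enc_input B pl r \<psi>) y t" "t \<le> 2 ^ ((K + 182 * n ^ 2 + 3 * 10) * (465 * n ^ 2))"
    using run_bounds[OF B pl sent m] unfolding n_def K_def by auto
  have n: "1 \<le> n ^ 2" using input_size_ge2[OF B, of r \<psi>] by (simp add: n_def)
  have "(K + 182 * n ^ 2 + 3 * 10) * (465 * n ^ 2) \<le> ((K + 707) * n ^ 2) * (465 * n ^ 2)"
  proof (intro mult_le_mono1)
    show "K + 182 * n ^ 2 + 3 * 10 \<le> (K + 707) * n ^ 2"
      unfolding distrib_right using n mult_le_mono2[OF n, of K] by linarith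
  qed
  also have "\<dots> = 465 * (K + 707) * n ^ 4" by (simp add: power2_eq_square power4_eq_xxxx)
  finally have "(2 :: nat) ^ ((K + 182 * n ^ 2 + 3 * 10) * (465 * n ^ 2)) \<le> 2 ^ (465 * (K + 707) * n ^ 4)"
    by (intro power_increasing) auto
  then have "t \<le> 2 ^ (465 * (kappa prg + 707) * input_size B r \<psi> ^ 4)" using y(2) unfolding n_def K_def by linarith
  moreover have "wfoeil_size r \<psi> = s" by (simp add: \<psi>_def \<phi>)
  ultimately show "\<exists>(\<psi> :: ('p, 'k) wfoeil) y t. is_sentence B \<psi> \<and> wfoeil_size r \<psi> = s \<and>
      runs prg (enc_input B pl r \<psi>) y t \<and> t \<le> 2 ^ (465 * (kappa prg + 707) * input_size B r \<psi> ^ 4)"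
    using sent y(1) by blast
qed

end
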